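(* Let $Q=[-1,1]^2$, $P=\{x\in Q:\frac12\le x_1<1\}$, $\Omega=Q\setminus P$, let $I_w(\sigma)=\int_Q|\nabla u_\sigma|^2\,dx$ and let $$\mathcal{A}_w=\{\sigma\in W^{1,2}(Q;\mathbb{R}):\ u_\sigma=u_{\sigma_0}\text{ on }\partial Q,\ \det\nabla u_\sigma\ge0\text{ a.e. in }Q\},$$ where $$\sigma_0(x_1,x_2)=\begin{cases}0&\text{if }-1<x_1\le0,\\-2x_1x_2&\text{if }0<x_1<\frac12,\\-x_2&\text{if }\frac12\le x_1<1.\end{cases}$$ Let $\Sigma$ be the unique harmonic function on $\Omega$ agreeing with $\sigma_0$ on $\partial\Omega$. Then $$\sigma(x)=\begin{cases}\Sigma(x)&\text{if }x\in\Omega,\\-x_2&\text{if }x\in P\end{cases}$$ is the unique global minimizer of $I_w$ in $\mathcal{A}_w$, and $\det\nabla u_\sigma>0$ everywhere in $\Omega$. It also holds that $\partial_{x_1}\sigma$ cannot vanish $\mathcal{H}^1$-a.e. along the set $K=\{y\in Q:y_1=1/2\}$. In particular, the global minimizer does not belong to the class $C^1(Q)$.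
   Context: For a scalar function $\sigma$ on $Q$, the shear map $u_\sigma:Q\to\mathbb{R}^2$ is $u_\sigma(x)=x+\sigma(x)e_2$ with $e_2=(0,1)$; thus $\det\nabla u_\sigma=1+\partial_{x_2}\sigma$. Boundary conditions are in the sense of trace, and $\sigma_0$ is extended continuously to $\partial Q$. As a domain for harmonic functions (and for the pointwise statement $\det\nabla u_\sigma>0$), $\Omega$ is the open rectangle $(-1,\frac12)\times(-1,1)$. Along $K$, $\partial_{x_1}\sigma$ is understood as the trace of $\partial_{x_1}\sigma|_\Omega$, i.e. taken from the $\Omega$ side. $\mathcal{H}^1$ is one-dimensional Hausdorff measure. *)

theory Defs
  imports "HOL-Analysis.Analysis"
begin

section \<open>Smooth, harmonic and continuously differentiable functions\<close>

definition partial :: "2 \<Rightarrow> (real^2 \<Rightarrow> real) \<Rightarrow> real^2 \<Rightarrow> real" where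
  "partial i f x = frechet_derivative f (at x) (axis i 1)"

text \<open>The set \<open>U\<close> is meant to be open, so that \<^const>\<open>partial\<close> at points of \<open>U\<close>
  only depends on the restriction to \<open>U\<close>.\<close>

fun Ck_on :: "nat \<Rightarrow> (real^2) set \<Rightarrow> (real^2 \<Rightarrow> real) \<Rightarrow> bool" where
  "Ck_on 0 U f \<longleftrightarrow> continuous_on U f"
| "Ck_on (Suc k) U f \<longleftrightarrow> (\<forall>x\<in>U. f differentiable (at x)) \<and> (\<forall>i. Ck_on k U (partial i f))"

definition test_function :: "(real^2) set \<Rightarrow> (real^2 \<Rightarrow> real) \<Rightarrow> bool" where
  "test_function U \<phi> \<longleftrightarrow>
     (\<forall>k. Ck_on k UNIV \<phi>) \<and> (\<exists>C. compact C \<and> C \<subseteq> U \<and> (\<forall>x. x \<notin> C \<longrightarrow> \<phi> x = 0))"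

definition harmonic_on :: "(real^2) set \<Rightarrow> (real^2 \<Rightarrow> real) \<Rightarrow> bool" where
  "harmonic_on U f \<longleftrightarrow> Ck_on 2 U f \<and> (\<forall>x\<in>U. (\<Sum>i\<in>UNIV. partial i (partial i f) x) = 0)"

text \<open>The class $C^1$ on a closed set with dense interior: the function is differentiable
  relative to the set, with a gradient that is continuous up to the boundary.\<close>

definition C1_closed :: "(real^2) set \<Rightarrow> (real^2 \<Rightarrow> real) \<Rightarrow> bool" where
  "C1_closed S f \<longleftrightarrow>
     (\<exists>G. continuous_on S G \<and> (\<forall>x\<in>S. (f has_derivative (\<lambda>h. G x \<bullet> h)) (at x within S)))"

section \<open>The Sobolev space $W^{1,2}$ of an open set\<close>

definition L2_on :: "(real^2) set \<Rightarrow> (real^2 \<Rightarrow> 'b::euclidean_space) \<Rightarrow> bool" where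
  "L2_on U f \<longleftrightarrow> f \<in> borel_measurable (lebesgue_on U) \<and> integrable (lebesgue_on U) (\<lambda>x. (norm (f x))\<^sup>2)"

definition L2_tendsto ::
  "(real^2) set \<Rightarrow> (nat \<Rightarrow> real^2 \<Rightarrow> 'b::euclidean_space) \<Rightarrow> (real^2 \<Rightarrow> 'b) \<Rightarrow> bool" where
  "L2_tendsto U F f \<longleftrightarrow>
     (\<lambda>n. \<integral>\<^sup>+x. ennreal ((norm (F n x - f x))\<^sup>2) \<partial>lebesgue_on U) \<longlonglongrightarrow> 0"

definition has_weak_gradient :: "(real^2) set \<Rightarrow> (real^2 \<Rightarrow> real) \<Rightarrow> (real^2 \<Rightarrow> real^2) \<Rightarrow> bool" where
  "has_weak_gradient U f G \<longleftrightarrow>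
     (\<forall>C. compact C \<and> C \<subseteq> U \<longrightarrow> f absolutely_integrable_on C \<and> G absolutely_integrable_on C) \<and>
     (\<forall>\<phi> i. test_function U \<phi> \<longrightarrow>
        (LINT x:U|lebesgue. f x * partial i \<phi> x) = - (LINT x:U|lebesgue. G x $ i * \<phi> x))"

text \<open>The weak gradient is determined almost everywhere on \<open>U\<close>; some representative is chosen.\<close>

definition weak_gradient :: "(real^2) set \<Rightarrow> (real^2 \<Rightarrow> real) \<Rightarrow> real^2 \<Rightarrow> real^2" where
  "weak_gradient U f = (SOME G. has_weak_gradient U f G)"

definition W12 :: "(real^2) set \<Rightarrow> (real^2 \<Rightarrow> real) set" where
  "W12 U = {f. L2_on U f \<and> (\<exists>G. has_weak_gradient U f G \<and> L2_on U G)}"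

definition W12_tendsto :: "(real^2) set \<Rightarrow> (nat \<Rightarrow> real^2 \<Rightarrow> real) \<Rightarrow> (real^2 \<Rightarrow> real) \<Rightarrow> bool" where
  "W12_tendsto U F f \<longleftrightarrow>
     L2_tendsto U F f \<and> L2_tendsto U (\<lambda>n. weak_gradient U (F n)) (weak_gradient U f)"

text \<open>Row \<open>i\<close> of the weak Jacobian matrix is the weak gradient of the \<open>i\<close>-th component.\<close>

definition weak_jacobian :: "(real^2) set \<Rightarrow> (real^2 \<Rightarrow> real^2) \<Rightarrow> real^2 \<Rightarrow> real^2^2" where
  "weak_jacobian U u x = (\<chi> i. weak_gradient U (\<lambda>y. u y $ i) x)"

section \<open>Traces\<close>

text \<open>The trace on a finite union of boundary segments, each given by its end points. The trace
  operator is the unique bounded linear map from $W^{1,2}(U)$ to $L^2$ of the segments that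
  restricts functions in $W^{1,2}(U) \cap C(\overline{U})$; hence \<open>g\<close> is the trace of \<open>f\<close> iff
  it is the $L^2$ limit of the restrictions of such functions converging to \<open>f\<close> in $W^{1,2}(U)$.
  The segments are parametrised with constant speed by \<^const>\<open>linepath\<close>; the speed is only a
  constant factor in the integrals and does not affect convergence to zero.\<close>

definition has_trace ::
  "(real^2) set \<Rightarrow> ((real^2) \<times> (real^2)) set \<Rightarrow> (real^2 \<Rightarrow> real) \<Rightarrow> (real^2 \<Rightarrow> real) \<Rightarrow> bool" where
  "has_trace U B f g \<longleftrightarrow>
     f \<in> W12 U \<and>
     (\<forall>(p, q)\<in>B. (\<lambda>t. g (linepath p q t)) \<in> borel_measurable (lebesgue_on {0..1})) \<and>
     (\<exists>F. (\<forall>n. F n \<in> W12 U \<and> continuous_on (closure U) (F n)) \<and>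
          W12_tendsto U F f \<and>
          (\<forall>(p, q)\<in>B.
             (\<lambda>n. \<integral>\<^sup>+t. ennreal ((F n (linepath p q t) - g (linepath p q t))\<^sup>2) \<partial>lebesgue_on {0..1})
               \<longlonglongrightarrow> 0))"

definition rect_sides :: "real^2 \<Rightarrow> real^2 \<Rightarrow> ((real^2) \<times> (real^2)) set" where
  "rect_sides a b =
     {(vector [a$1, a$2], vector [b$1, a$2]), (vector [b$1, a$2], vector [b$1, b$2]),
      (vector [b$1, b$2], vector [a$1, b$2]), (vector [a$1, b$2], vector [a$1, a$2])}"

section \<open>One-dimensional Hausdorff measure\<close>

text \<open>As an outer measure, defined for all sets. Boundedness is required because
  \<^const>\<open>diameter\<close> is only meaningful for bounded sets.\<close>

definition hausdorff1 :: "'a::metric_space set \<Rightarrow> ennreal" where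
  "hausdorff1 A =
     (SUP \<delta>\<in>{0<..}.
        INF C\<in>{C :: nat \<Rightarrow> 'a set. A \<subseteq> (\<Union>n. C n) \<and> (\<forall>n. bounded (C n) \<and> diameter (C n) \<le> \<delta>)}.
          (\<Sum>n. ennreal (diameter (C n))))"

section \<open>The variational problem\<close>

definition square_Q :: "(real^2) set" where
  "square_Q = cbox (vector [-1, -1]) (vector [1, 1])"

definition strip_P :: "(real^2) set" where
  "strip_P = {x \<in> square_Q. 1/2 \<le> x$1 \<and> x$1 < 1}"

text \<open>The complement of the strip in the square, taken as an open rectangle; the two differ only
  by a set of measure zero.\<close>

definition Omega :: "(real^2) set" where
  "Omega = box (vector [-1, -1]) (vector [1/2, 1])"

definition seg_K :: "(real^2) set" where
  "seg_K = {y \<in> square_Q. y$1 = 1/2}"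

definition sides_Q :: "((real^2) \<times> (real^2)) set" where
  "sides_Q = rect_sides (vector [-1, -1]) (vector [1, 1])"

definition sides_Omega :: "((real^2) \<times> (real^2)) set" where
  "sides_Omega = rect_sides (vector [-1, -1]) (vector [1/2, 1])"

text \<open>The formula includes the continuous extension to the boundary of the square.\<close>

definition sigma0 :: "real^2 \<Rightarrow> real" where
  "sigma0 x = (if x$1 \<le> 0 then 0 else if x$1 < 1/2 then - 2 * x$1 * x$2 else - x$2)"

definition shear :: "(real^2 \<Rightarrow> real) \<Rightarrow> real^2 \<Rightarrow> real^2" where
  "shear \<sigma> x = x + \<sigma> x *\<^sub>R axis 2 1"

text \<open>The norm on \<^typ>\<open>real^2^2\<close> is the Frobenius norm.\<close>

definition energy :: "(real^2 \<Rightarrow> real) \<Rightarrow> real" where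
  "energy \<sigma> = (LINT x:square_Q|lebesgue. (norm (weak_jacobian (interior square_Q) (shear \<sigma>) x))\<^sup>2)"

definition admissible :: "(real^2 \<Rightarrow> real) set" where
  "admissible = {\<sigma> \<in> W12 (interior square_Q).
     (\<forall>i. has_trace (interior square_Q) sides_Q (\<lambda>x. shear \<sigma> x $ i) (\<lambda>x. shear sigma0 x $ i)) \<and>
     (AE x in lebesgue. x \<in> square_Q \<longrightarrow> 0 \<le> det (weak_jacobian (interior square_Q) (shear \<sigma>) x))}"

definition global_minimizer :: "(real^2 \<Rightarrow> real) \<Rightarrow> bool" where
  "global_minimizer \<sigma> \<longleftrightarrow> \<sigma> \<in> admissible \<and> (\<forall>v\<in>admissible. energy \<sigma> \<le> energy v)"

definition harmonic_extension :: "(real^2 \<Rightarrow> real) \<Rightarrow> bool" where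
  "harmonic_extension S \<longleftrightarrow> harmonic_on Omega S \<and> has_trace Omega sides_Omega S sigma0"

text \<open>The last case only concerns a null set of the square, where the boundary values are used.\<close>

definition glued :: "(real^2 \<Rightarrow> real) \<Rightarrow> real^2 \<Rightarrow> real" where
  "glued S x = (if x \<in> Omega then S x else if x \<in> strip_P then - x$2 else sigma0 x)"

text \<open>The function \<open>h\<close> is the trace on the segment, from the side of \<^const>\<open>Omega\<close>, of the first
  partial derivative of \<open>\<sigma>\<close>. Traces are local, so the derivative need only be of class $W^{1,2}$
  in a one-sided neighbourhood of the segment. The whole of \<^const>\<open>Omega\<close> would be too much to
  ask: the boundary values \<^const>\<open>sigma0\<close> have a kink at the points $(0, \pm 1)$, near which the
  second derivatives of the harmonic extension are not square integrable.\<close>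

definition trace_d1_on_K :: "(real^2 \<Rightarrow> real) \<Rightarrow> (real^2 \<Rightarrow> real) \<Rightarrow> bool" where
  "trace_d1_on_K \<sigma> h \<longleftrightarrow>
     (\<exists>a. -1 \<le> a \<and> a < 1/2 \<and>
        has_trace (box (vector [a, -1]) (vector [1/2, 1]))
          {(vector [1/2, -1], vector [1/2, 1])} (partial 1 \<sigma>) h)"

end

theory Submission
  imports Defs "HOL-Complex_Analysis.Complex_Analysis"
begin

text \<open>
  On \<open>\<Omega>\<close> the minimizer is \<open>\<Sigma> = Re H\<close> with
  \<open>H(z) = (\<i>/3) (z+1)\<^sup>2 + \<i> \<Sum> c\<^sub>n cos(\<mu>\<^sub>n (z+1)) / sinh \<mu>\<^sub>n\<close>; the boundary values reduce to the
  Fourier series of a tent function. The derivative is \<open>H' = \<i> (2/3 (z+1) - 4/\<pi> T)\<close> with a sine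
  series \<open>T\<close>. Expanding \<open>cosh / sinh\<close> into exponentials writes \<open>Re T\<close> as a sum of nonnegative
  logarithmic kernels, so that \<open>\<partial>\<^sub>2(x\<^sub>2 + \<Sigma>) \<ge> 1 - 2/3 (x\<^sub>1 + 1) > 0\<close> on \<open>\<Omega>\<close>; the bound
  \<open>|H'| \<le> C (1 - |x\<^sub>2|) powr (-1/4)\<close> puts \<open>\<Sigma>\<close> into \<open>W\<^sup>1\<^sup>2\<close>.

  For a competitor \<open>v\<close>, the derivative \<open>\<partial>\<^sub>2(x\<^sub>2 + v) \<ge> 0\<close> has mean zero on the vertical lines of the
  strip, which forces \<open>v = - x\<^sub>2\<close> there. So the gradient of \<open>v - \<sigma>\<close> is supported in \<open>\<Omega>\<close>, where
  it is orthogonal to every mode of the series, hence to the gradient of \<open>x\<^sub>2 + \<Sigma>\<close>, and the energies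
  differ by the Dirichlet integral of \<open>v - \<sigma>\<close>.

  On \<open>K\<close> one has \<open>Im H' = 1\<close>. If \<open>\<partial>\<^sub>1 \<sigma> = Re H'\<close> vanished there too, then \<open>H'\<close> would be constantly
  \<open>\<i>\<close>, which contradicts \<open>\<partial>\<^sub>2(x\<^sub>2 + \<Sigma>) > 0\<close>. The trace exists because \<open>T\<close> is, up to a rapidly convergent
  series, a combination of logarithms that are holomorphic near \<open>K\<close>.\<close>

text \<open>A trace is given only through an approximating sequence, so boundary values are used
  exclusively via integration by parts: Green's formula is proved for functions that are continuous
  on a closed rectangle and then passed to the limit, which yields identities for two functions with
  the same trace. As all sides are parallel to the axes, products \<open>p (x$1) * q (x$2)\<close>
  suffice as test functions, and the calculus reduces to one variable.

  The boundary values have kinks at (0, 1) and (0, -1), where the derivative of H has logarithmic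
  singularities. Hence the gradient is unbounded on \<open>Omega\<close>, and all estimates carry a
  weight in the distance to the horizontal sides; the exponent -1/4 is a compromise between summable
  coefficients and a square integrable weight.

  Uniqueness of the harmonic extension has to be shown for boundary values in the L2 sense, so no
  pointwise maximum principle is used: the difference of two extensions is orthogonal to all
  products of sines that vanish on the boundary, and these are shown to be complete.\<close>

no_notation fps_nth (infixl "$" 75)

subsection \<open>Smooth functions of one variable and cut-offs\<close>

text \<open>The derivative is an existential witness rather than \<open>deriv\<close>, so each
  closure property only has to name a derivative of the right form; \<open>smooth_deriv\<close>
  later identifies it with \<open>deriv\<close>.\<close>

fun C1k :: "nat \<Rightarrow> (real \<Rightarrow> real) \<Rightarrow> bool" where
  "C1k 0 f \<longleftrightarrow> continuous_on UNIV f"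
| "C1k (Suc k) f \<longleftrightarrow> (\<exists>f'. (\<forall>x. (f has_real_derivative f' x) (at x)) \<and> C1k k f')"

definition smooth :: "(real \<Rightarrow> real) \<Rightarrow> bool" where
  "smooth f \<longleftrightarrow> (\<forall>k. C1k k f)"

lemma C1k_SucD: "C1k (Suc k) f \<Longrightarrow> C1k k f"
proof (induction k arbitrary: f)
  case 0
  then show ?case
    by (auto intro!: DERIV_isCont simp: continuous_on_eq_continuous_at)
next
  case (Suc k)
  then show ?case by (metis C1k.simps(2))
qed

lemma C1k_lincomb: "C1k k f \<Longrightarrow> C1k k g \<Longrightarrow> C1k k (\<lambda>x. a * f x + b * g x)"
proof (induction k arbitrary: f g)
  case 0
  then show ?case by (auto intro!: continuous_intros)
next
  case (Suc k)
  then obtain f' g' where "\<forall>x. (f has_real_derivative f' x) (at x)" "C1k k f'"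
    "\<forall>x. (g has_real_derivative g' x) (at x)" "C1k k g'" by auto
  then show ?case using Suc.IH[of f' g']
    by (auto intro!: exI[of _ "\<lambda>x. a * f' x + b * g' x"] derivative_eq_intros)
qed

lemma C1k_mult: "C1k k f \<Longrightarrow> C1k k g \<Longrightarrow> C1k k (\<lambda>x. f x * g x)"
proof (induction k arbitrary: f g)
  case 0
  then show ?case by (auto intro!: continuous_intros)
next
  case (Suc k)
  then obtain f' g' where *: "\<forall>x. (f has_real_derivative f' x) (at x)" "C1k k f'"
    "\<forall>x. (g has_real_derivative g' x) (at x)" "C1k k g'" by auto
  have "C1k k f" "C1k k g" using Suc.prems C1k_SucD by blast+
  then have "C1k k (\<lambda>x. 1 * (f' x * g x) + 1 * (f x * g' x))"
    using * Suc.IH by (intro C1k_lincomb) auto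
  then show ?case using *
    by (auto intro!: exI[of _ "\<lambda>x. f' x * g x + f x * g' x"] derivative_eq_intros)
qed

lemma C1k_affine: "C1k k f \<Longrightarrow> C1k k (\<lambda>x. f (a * x + b))"
proof (induction k arbitrary: f)
  case 0
  then show ?case
    using continuous_on_compose2[of UNIV f UNIV "\<lambda>x. a * x + b"] by (simp add: continuous_intros)
next
  case (Suc k)
  then obtain f' where *: "\<forall>x. (f has_real_derivative f' x) (at x)" "C1k k f'" by auto
  have "((\<lambda>x. f (a * x + b)) has_real_derivative f' (a * x + b) * a) (at x)" for x
    by (rule DERIV_chain2[of f]) (use * in \<open>auto intro!: derivative_eq_intros\<close>)
  moreover have "C1k k (\<lambda>x. f' (a * x + b) * a)"
    using C1k_lincomb[OF Suc.IH[OF *(2)] Suc.IH[OF *(2)], of a 0] by (simp add: mult.commute)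
  ultimately show ?case by (auto intro!: exI[of _ "\<lambda>x. f' (a * x + b) * a"])
qed

lemma C1k_const: "C1k k (\<lambda>x. c)"
  by (induction k arbitrary: c) (auto intro!: exI[of _ "\<lambda>x. 0"])

lemma C1k_id: "C1k k (\<lambda>x. x)"
  by (cases k) (auto intro!: exI[of _ "\<lambda>x. 1"] C1k_const)

text \<open>Differentiation maps the span of sine and cosine to itself, so generalising over both
  coefficients lets the induction on the order close. The hyperbolic version works alike.\<close>

lemma C1k_trig: "C1k k (\<lambda>x. a * sin x + b * cos x)"
proof (induction k arbitrary: a b)
  case 0
  then show ?case by (auto intro!: continuous_intros)
next
  case (Suc k)
  show ?case using Suc.IH[of "-b" a]
    by (auto intro!: exI[of _ "\<lambda>x. (-b) * sin x + a * cos x"] derivative_eq_intros)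
qed

lemma C1k_hyp: "C1k k (\<lambda>x. a * sinh x + b * cosh x :: real)"
proof (induction k arbitrary: a b)
  case 0
  then show ?case by (auto intro!: continuous_intros)
next
  case (Suc k)
  show ?case using Suc.IH[of b a]
    by (auto intro!: exI[of _ "\<lambda>x. b * sinh x + a * cosh x"] derivative_eq_intros)
qed

lemma smooth_lincomb: "smooth f \<Longrightarrow> smooth g \<Longrightarrow> smooth (\<lambda>x. a * f x + b * g x)"
  and smooth_mult [intro]: "smooth f \<Longrightarrow> smooth g \<Longrightarrow> smooth (\<lambda>x. f x * g x)"
  and smooth_affine: "smooth f \<Longrightarrow> smooth (\<lambda>x. f (a * x + b))"
  and smooth_const [simp, intro]: "smooth (\<lambda>x. c)"
  and smooth_id [simp, intro]: "smooth (\<lambda>x. x)"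
  by (auto simp: smooth_def C1k_lincomb C1k_mult C1k_affine C1k_const C1k_id)

lemma smooth_add [intro]: "smooth f \<Longrightarrow> smooth g \<Longrightarrow> smooth (\<lambda>x. f x + g x)"
  using smooth_lincomb[of f g 1 1] by simp

lemma smooth_sin: "smooth (\<lambda>x. sin (a * x + b))"
  using smooth_affine[of "\<lambda>x. 1 * sin x + 0 * cos x"] C1k_trig[of _ 1 0] by (simp add: smooth_def)

lemma smooth_sinh: "smooth (\<lambda>x. sinh (a * x + b))"
  using smooth_affine[of "\<lambda>x. 1 * sinh x + 0 * cosh x"] C1k_hyp[of _ 1 0] by (simp add: smooth_def)

lemma smooth_DERIV: "smooth f \<Longrightarrow> (f has_real_derivative deriv f x) (at x)"
  by (metis C1k.simps(2) DERIV_imp_deriv smooth_def)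

lemma smooth_deriv [intro]: assumes "smooth f" shows "smooth (deriv f)"
proof -
  have "C1k k (deriv f)" for k
proof -
  obtain f' where f': "\<forall>x. (f has_real_derivative f' x) (at x)" "C1k k f'"
    using assms C1k.simps(2)[of k f] unfolding smooth_def by blast
  moreover have "deriv f = f'" using f' by (auto intro!: DERIV_imp_deriv)
  ultimately show "C1k k (deriv f)" by simp
qed
  then show ?thesis by (simp add: smooth_def)
qed

lemma smooth_continuous: "smooth f \<Longrightarrow> continuous_on A f"
  by (metis C1k.simps(1) continuous_on_subset smooth_def subset_UNIV)

section \<open>A smooth step function\<close>

definition flat_exp :: "nat \<Rightarrow> real \<Rightarrow> real" where
  "flat_exp n x = (if x > 0 then exp (- inverse x) * inverse x ^ n else 0)"

lemma flat_exp_limit: "((\<lambda>x. exp (- inverse x) * inverse x ^ n) \<longlongrightarrow> 0) (at_right (0::real))"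
proof -
  have "((\<lambda>x. inverse x ^ n / exp (inverse x)) \<longlongrightarrow> 0) (at_right (0::real))"
    by (rule filterlim_compose[OF tendsto_power_div_exp_0 filterlim_inverse_at_top_right])
  then show ?thesis by (simp add: exp_minus divide_simps mult.commute)
qed

text \<open>The family is closed under differentiation up to linear combinations, which gives
  smoothness of all its members by one induction. For \<open>n\<close> = 0 it is the standard
  function that is flat at the origin.\<close>

lemma flat_exp_DERIV:
  "(flat_exp n has_real_derivative flat_exp (n+2) x - real n * flat_exp (n+1) x) (at x)"
proof -
  consider "x > 0" | "x < 0" | "x = 0" by linarith
  then show ?thesis
  proof cases
    case 1
    have "((\<lambda>x. exp (- inverse x) * inverse x ^ n) has_real_derivative
       flat_exp (n+2) x - real n * flat_exp (n+1) x) (at x)"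
    proof (cases n)
      case 0
      then show ?thesis using 1
        by (auto intro!: derivative_eq_intros simp: flat_exp_def power2_eq_square)
    next
      case (Suc j)
      then show ?thesis using 1
        by (auto intro!: derivative_eq_intros simp: flat_exp_def) (cases j; simp add: algebra_simps)
    qed
    moreover have "eventually (\<lambda>y. y > 0) (nhds x)"
      using 1 eventually_nhds_in_open[of "{0<..}" x] by auto
    ultimately show ?thesis
      by (subst DERIV_cong_ev[OF refl _ refl]) (auto simp: flat_exp_def elim!: eventually_mono)
  next
    case 2
    have "eventually (\<lambda>y. y < 0) (nhds x)"
      using 2 eventually_nhds_in_open[of "{..<0}" x] by auto
    moreover have "((\<lambda>x. 0) has_real_derivative flat_exp (n+2) x - real n * flat_exp (n+1) x) (at x)"
      using 2 by (auto simp: flat_exp_def)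
    ultimately show ?thesis
      by (subst DERIV_cong_ev[OF refl _ refl]) (auto simp: flat_exp_def elim!: eventually_mono)
  next
    case 3
    \<comment> \<open>For h > 0 the difference quotient is the same formula with exponent
      \<open>Suc n\<close>, so the limit lemma applies to it.\<close>
    have "((\<lambda>h. (flat_exp n (0 + h) - flat_exp n 0) / h) \<longlongrightarrow> 0) (at_right 0)"
      using flat_exp_limit[of "Suc n"]
      by (rule Lim_transform_eventually) (auto simp: eventually_at_right_less flat_exp_def field_simps
          intro: eventually_mono[OF eventually_at_right_less])
    moreover have "((\<lambda>h. (flat_exp n (0 + h) - flat_exp n 0) / h) \<longlongrightarrow> 0) (at_left 0)"
      by (rule Lim_transform_eventually[OF tendsto_const])
         (auto simp: flat_exp_def eventually_at_left_field intro!: exI[of _ "-1"])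
    ultimately have "((\<lambda>h. (flat_exp n (0 + h) - flat_exp n 0) / h) \<longlongrightarrow> 0) (at 0)"
      using filterlim_at_split by blast
    then show ?thesis using 3 by (simp add: DERIV_def flat_exp_def)
  qed
qed

lemma smooth_flat_exp: "smooth (flat_exp n)"
  unfolding smooth_def
proof
  fix k show "C1k k (flat_exp n)"
  proof (induction k arbitrary: n)
    case 0
    then show ?case
      using flat_exp_DERIV by (auto intro!: DERIV_isCont simp: continuous_on_eq_continuous_at)
  next
    case (Suc k)
    have "C1k k (\<lambda>x. flat_exp (n+2) x - real n * flat_exp (n+1) x)"
      using C1k_lincomb[OF Suc.IH[of "n+2"] Suc.IH[of "n+1"], of 1 "- real n"] by simp
    then show ?case unfolding C1k.simps
      by (intro exI[of _ "\<lambda>x. flat_exp (n+2) x - real n * flat_exp (n+1) x"]) (simp only: flat_exp_DERIV simp_thms)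
  qed
qed

text \<open>A normalised antiderivative of a bump on (1, 2). The sign of the derivative is recorded
  because the derivative later serves as a probability density on [1, 2].\<close>

lemma smooth_step_exists:
  "\<exists>s. smooth s \<and> (\<forall>x\<le>1. s x = 0) \<and> (\<forall>x\<ge>2. s x = 1) \<and> (\<forall>x. 0 \<le> deriv s x)"
proof -
  define \<psi> where "\<psi> x = flat_exp 0 (1 * x + -1) * flat_exp 0 ((-1) * x + 2)" for x
  have sm: "smooth \<psi>" unfolding \<psi>_def by (intro smooth_mult smooth_affine smooth_flat_exp)
  have nn: "\<psi> x \<ge> 0" for x by (simp add: \<psi>_def flat_exp_def)
  have cont: "continuous_on A \<psi>" for A using sm smooth_continuous by blast
  have int: "\<psi> integrable_on {a..b}" for a b by (rule integrable_continuous_interval[OF cont])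
  define I where "I x = integral {0..x} \<psi>" for x
  have z: "\<psi> x = 0" if "x \<le> 1 \<or> x \<ge> 2" for x using that by (auto simp: \<psi>_def flat_exp_def)
  have I0: "I x = 0" if "x \<le> 1" for x
    unfolding I_def by (rule integral_unique[OF has_integral_is_0]) (use that in \<open>auto simp: z\<close>)
  have I2: "I x = I 2" if "x \<ge> 2" for x
  proof -
    have "integral {0..2} \<psi> + integral {2..x} \<psi> = integral {0..x} \<psi>"
      by (rule Henstock_Kurzweil_Integration.integral_combine) (use that int in auto)
    moreover have "integral {2..x} \<psi> = 0" by (rule integral_unique[OF has_integral_is_0]) (auto simp: z)
    ultimately show ?thesis by (simp add: I_def)
  qed
  have D: "(I has_real_derivative \<psi> x) (at x)" for x
  proof (cases "x < 1")
    case True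
    have "eventually (\<lambda>y. y < 1) (nhds x)"
      using True eventually_nhds_in_open[of "{..<1}" x] by auto
    then show ?thesis using True
      by (subst DERIV_cong_ev[OF refl _ refl, of _ "\<lambda>x. 0"]) (auto simp: z I0 elim!: eventually_mono)
  next
    case False
    have "(I has_real_derivative \<psi> x) (at x within {0..x+1})"
      unfolding I_def using integral_has_real_derivative[OF cont, of x 0 "x+1"] False by auto
    moreover have "at x within {0..x+1} = at x" using False by (intro at_within_interior) auto
    ultimately show ?thesis by simp
  qed
  have pos: "I 2 > 0"
  proof -
    have "I 2 \<ge> 0" unfolding I_def by (intro integral_nonneg int nn)
    moreover have "I 2 \<noteq> 0"
    proof
      assume "I 2 = 0"
      then have "\<forall>x\<in>{0..2}. \<psi> x = 0" unfolding I_def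
        using integral_eq_0_iff[OF cont, of 0 2] nn by auto
      then have "\<psi> (3/2) = 0" by auto
      then show False by (auto simp: \<psi>_def flat_exp_def)
    qed
    ultimately show ?thesis by simp
  qed
  define s where "s x = I x / I 2" for x
  have Ds: "(s has_real_derivative \<psi> x / I 2) (at x)" for x
    unfolding s_def by (intro DERIV_cdivide D)
  have "C1k k s" for k
  proof (cases k)
    case 0
    then show ?thesis
      using Ds by (auto intro!: DERIV_isCont simp: continuous_on_eq_continuous_at)
  next
    case (Suc j)
    have "C1k j (\<lambda>x. (1 / I 2) * \<psi> x + 0 * \<psi> x)"
      using sm by (intro C1k_lincomb) (auto simp: smooth_def)
    then have "C1k j (\<lambda>x. \<psi> x / I 2)" by simp
    then show ?thesis using Suc Ds by (auto intro!: exI[of _ "\<lambda>x. \<psi> x / I 2"])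
  qed
  moreover have "deriv s x = \<psi> x / I 2" for x by (rule DERIV_imp_deriv[OF Ds])
  moreover have "s x = 0" if "x \<le> 1" for x using I0[OF that] by (simp add: s_def)
  moreover have "s x = 1" if "x \<ge> 2" for x using I2[OF that] pos by (simp only: s_def) simp
  moreover have "0 \<le> \<psi> x / I 2" for x using nn[of x] pos by simp
  ultimately show ?thesis
    by (intro exI[of _ s]) (simp add: smooth_def)
qed

definition step :: "real \<Rightarrow> real" where
  "step = (SOME s. smooth s \<and> (\<forall>x\<le>1. s x = 0) \<and> (\<forall>x\<ge>2. s x = 1) \<and> (\<forall>x. 0 \<le> deriv s x))"

lemma smooth_step: "smooth step"
  and step_0: "x \<le> 1 \<Longrightarrow> step x = 0"
  and step_1: "x \<ge> 2 \<Longrightarrow> step x = 1"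
  and deriv_step_nonneg: "0 \<le> deriv step x"
  using someI_ex[OF smooth_step_exists] unfolding step_def[symmetric] by auto

lemma step_mono: "x \<le> y \<Longrightarrow> step x \<le> step y"
  by (rule DERIV_nonneg_imp_nondecreasing[of x y step])
     (use smooth_DERIV[OF smooth_step] deriv_step_nonneg in blast)+

lemma step_bounds: "0 \<le> step x" "step x \<le> 1"
  using step_mono[of "min x 1" x] step_mono[of x "max x 2"] step_0[of "min x 1"] step_1[of "max x 2"]
  by auto

lemma deriv_step_0: assumes "x \<le> 1 \<or> x \<ge> 2" shows "deriv step x = 0"
proof -
  have D: "(step has_real_derivative deriv step x) (at x)" by (rule smooth_DERIV[OF smooth_step])
  show ?thesis
  proof (cases "x \<le> 1")
    case True
    show ?thesis by (rule DERIV_local_min[OF D, of 1]) (use True step_bounds step_0 in auto)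
  next
    case False
    show ?thesis by (rule DERIV_local_max[OF D, of 1]) (use False assms step_bounds step_1 in auto)
  qed
qed

lemma deriv_step_bounded: "\<exists>M>0. \<forall>x. \<bar>deriv step x\<bar> \<le> M"
proof -
  have "compact (deriv step ` {1..2})"
    by (intro compact_continuous_image smooth_continuous smooth_deriv smooth_step) auto
  then obtain M where M: "M > 0" "\<forall>y\<in>deriv step ` {1..2}. norm y \<le> M"
    using compact_imp_bounded bounded_pos by metis
  have "\<bar>deriv step x\<bar> \<le> M" for x
    using M deriv_step_0[of x] by (cases "1 \<le> x \<and> x \<le> 2") auto
  then show ?thesis using M by auto
qed

text \<open>Rises from 0 to 1 between a + 1/k and a + 2/k and falls again in the mirrored layer at
  \<open>b\<close>, provided that 4 <= k (b - a), so that the two layers do not overlap. It is a sum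
  rather than a product, so that the derivative splits into one contribution per end point.\<close>

definition cutoff :: "real \<Rightarrow> real \<Rightarrow> nat \<Rightarrow> real \<Rightarrow> real" where
  "cutoff a b k x = step (real k * x + - (real k * a)) + step (- real k * x + real k * b) + -1"

lemma smooth_cutoff: "smooth (cutoff a b k)"
proof -
  have "smooth (\<lambda>x. step (real k * x + - (real k * a)))" "smooth (\<lambda>x. step (- real k * x + real k * b))"
    by (rule smooth_affine[OF smooth_step])+
  then show ?thesis unfolding cutoff_def[abs_def] by (intro smooth_add smooth_const)
qed

lemma cutoff_DERIV: "(cutoff a b k has_real_derivative
   real k * deriv step (real k * (x - a)) - real k * deriv step (real k * (b - x))) (at x)"
proof -
  have "(cutoff a b k has_real_derivative
     deriv step (real k * x + - (real k * a)) * real k + deriv step (- real k * x + real k * b) * (- real k)) (at x)"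
    unfolding cutoff_def
    by (auto intro!: derivative_eq_intros DERIV_chain2[OF smooth_DERIV[OF smooth_step]])
  then show ?thesis by (simp add: algebra_simps)
qed

lemma deriv_cutoff: "deriv (cutoff a b k) x =
   real k * deriv step (real k * (x - a)) - real k * deriv step (real k * (b - x))"
  by (rule DERIV_imp_deriv[OF cutoff_DERIV])

lemma cutoff_0:
  assumes "4 \<le> real k * (b - a)" "x \<le> a + 1 / k \<or> x \<ge> b - 1 / k"
  shows "cutoff a b k x = 0"
proof -
  have k: "real k > 0" using assms(1) by (cases k) auto
  show ?thesis
  proof (cases "x \<le> a + 1/k")
    case True
    then have "real k * x \<le> real k * a + 1" using k by (simp add: field_simps)
    then show ?thesis using assms(1) unfolding cutoff_def by (simp add: step_0 step_1 algebra_simps)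
  next
    case False
    then have "real k * x \<ge> real k * b - 1" using k assms by (simp add: field_simps)
    then show ?thesis using assms(1) unfolding cutoff_def by (simp add: step_0 step_1 algebra_simps)
  qed
qed

lemma cutoff_bounds:
  assumes "4 \<le> real k * (b - a)"
  shows "0 \<le> cutoff a b k x" "cutoff a b k x \<le> 1"
proof -
  show "cutoff a b k x \<le> 1" unfolding cutoff_def
    using step_bounds[of "real k * x + - (real k * a)"] step_bounds[of "- real k * x + real k * b"] by simp
  show "0 \<le> cutoff a b k x"
  proof (cases "- real k * x + real k * b \<ge> 2")
    case True
    then show ?thesis unfolding cutoff_def using step_1 step_bounds by simp
  next
    case False
    show ?thesis
    proof (cases "real k * x + - (real k * a) \<ge> 2")
      case True
      then show ?thesis unfolding cutoff_def using step_1 step_bounds by simp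
    next
      case F2: False
      then show ?thesis using assms False by (simp add: algebra_simps)
    qed
  qed
qed

lemma eventually_ge_mult: "c > 0 \<Longrightarrow> eventually (\<lambda>k. B \<le> real k * c) sequentially"
  by real_asymp

lemma cutoff_eventually:
  assumes "a < x" "x < b"
  shows "eventually (\<lambda>k. cutoff a b k x = 1 \<and> deriv (cutoff a b k) x = 0) sequentially"
proof -
  have "eventually (\<lambda>k. 2 \<le> real k * (x - a)) sequentially" "eventually (\<lambda>k. 2 \<le> real k * (b - x)) sequentially"
    using assms by (auto intro!: eventually_ge_mult)
  then show ?thesis
  proof eventually_elim
    case (elim k)
    then show ?case
      by (auto simp: cutoff_def deriv_cutoff algebra_simps step_1 deriv_step_0)
  qed
qed

lemma cutoff_tendsto:
  assumes "a < b" shows "(\<lambda>k. cutoff a b k x) \<longlonglongrightarrow> indicator {a<..<b} x"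
proof (cases "a < x \<and> x < b")
  case True
  then show ?thesis
    by (intro tendsto_eventually eventually_mono[OF cutoff_eventually]) auto
next
  case False
  have "eventually (\<lambda>k. 4 \<le> real k * (b - a)) sequentially" using assms by (intro eventually_ge_mult) auto
  then have "eventually (\<lambda>k. cutoff a b k x = 0) sequentially"
  proof eventually_elim
    case (elim k)
    show ?case by (rule cutoff_0[OF elim]) (use False in \<open>auto intro: add_increasing2 simp: not_less\<close>, 
        smt (verit) divide_nonneg_nonneg of_nat_0_le_iff)
  qed
  then show ?thesis using False by (intro tendsto_eventually) (auto simp: indicator_def elim!: eventually_mono)
qed

section \<open>Product test functions on rectangles\<close>

definition tensor :: "(real \<Rightarrow> real) \<Rightarrow> (real \<Rightarrow> real) \<Rightarrow> real^2 \<Rightarrow> real" where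
  "tensor p q x = p (x$1) * q (x$2)"

lemma tensor_has_derivative:
  assumes "smooth p" "smooth q"
  shows "(tensor p q has_derivative (\<lambda>h. deriv p (x$1) * h$1 * q (x$2) + p (x$1) * (deriv q (x$2) * h$2))) (at x)"
proof -
  have "((\<lambda>x. p (x$1)) has_derivative (\<lambda>h. deriv p (x$1) * h$1)) (at x)"
       "((\<lambda>x. q (x$2)) has_derivative (\<lambda>h. deriv q (x$2) * h$2)) (at x)"
    using has_derivative_compose[OF bounded_linear_imp_has_derivative[OF bounded_linear_vec_nth[of 1]]
        smooth_DERIV[OF assms(1), of "x$1", unfolded has_field_derivative_def]]
      has_derivative_compose[OF bounded_linear_imp_has_derivative[OF bounded_linear_vec_nth[of 2]]
        smooth_DERIV[OF assms(2), of "x$2", unfolded has_field_derivative_def]] by simp_all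
  from has_derivative_mult[OF this] show ?thesis
    by (simp add: tensor_def[abs_def] algebra_simps)
qed

lemma partial_tensor:
  assumes "smooth p" "smooth q"
  shows "partial 1 (tensor p q) = tensor (deriv p) q" "partial 2 (tensor p q) = tensor p (deriv q)"
  unfolding partial_def frechet_derivative_at[OF tensor_has_derivative[OF assms], symmetric]
  by (auto simp: tensor_def axis_def)

lemma Ck_on_tensor: "smooth p \<Longrightarrow> smooth q \<Longrightarrow> Ck_on k U (tensor p q)"
proof (induction k arbitrary: p q)
  case 0
  show ?case
    using has_derivative_continuous[OF tensor_has_derivative[OF 0]]
    by (auto intro!: continuous_at_imp_continuous_on)
next
  case (Suc k)
  have "Ck_on k U (tensor (deriv p) q)" "Ck_on k U (tensor p (deriv q))"
    using Suc by (auto intro: smooth_deriv)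
  then show ?case using tensor_has_derivative[OF Suc.prems] partial_tensor[OF Suc.prems]
    by (auto simp: forall_2 differentiable_def)
qed

lemma continuous_tensor: "smooth p \<Longrightarrow> smooth q \<Longrightarrow> continuous_on A (tensor p q)"
  using Ck_on_tensor[of p q 0 A] by simp

lemma mem_box2: 
  "x \<in> box a b \<longleftrightarrow> a$1 < x$1 \<and> x$1 < b$1 \<and> a$2 < x$2 \<and> x$2 < (b::real^2)$2"
  "x \<in> cbox a b \<longleftrightarrow> a$1 \<le> x$1 \<and> x$1 \<le> b$1 \<and> a$2 \<le> x$2 \<and> x$2 \<le> (b::real^2)$2"
  by (auto simp: mem_box_cart forall_2)

lemma test_function_tensor:
  fixes c d :: "real^2"
  assumes "smooth p" "smooth q" "\<And>s. s < c$1 \<or> s > d$1 \<Longrightarrow> p s = 0"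
    "\<And>s. s < c$2 \<or> s > d$2 \<Longrightarrow> q s = 0" "cbox c d \<subseteq> U"
  shows "test_function U (tensor p q)"
  unfolding test_function_def using assms
  by (auto intro!: Ck_on_tensor exI[of _ "cbox c d"] simp: tensor_def mem_box2 not_le)

text \<open>Turns an arbitrary smooth product into a test function on the box; letting
  \<open>k\<close> grow then shows what the factors contribute at the boundary.\<close>

definition cut2 :: "real^2 \<Rightarrow> real^2 \<Rightarrow> nat \<Rightarrow> (real \<Rightarrow> real) \<Rightarrow> (real \<Rightarrow> real) \<Rightarrow> real^2 \<Rightarrow> real" where
  "cut2 a b k p q = tensor (\<lambda>s. cutoff (a$1) (b$1) k s * p s) (\<lambda>s. cutoff (a$2) (b$2) k s * q s)"

lemma test_function_cut2:
  fixes a b :: "real^2"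
  assumes "smooth p" "smooth q" "4 \<le> real k * (b$1 - a$1)" "4 \<le> real k * (b$2 - a$2)"
  shows "test_function (box a b) (cut2 a b k p q)"
  unfolding cut2_def
proof (rule test_function_tensor[where c = "vector [a$1 + 1/k, a$2 + 1/k]" and d = "vector [b$1 - 1/k, b$2 - 1/k]"])
  have k: "1 / real k > 0" using assms(3) by (cases k) auto
  show "cbox (vector [a$1 + 1/k, a$2 + 1/k]) (vector [b$1 - 1/k, b$2 - 1/k]) \<subseteq> box a b"
  proof
    fix x :: "real^2"
    assume "x \<in> cbox (vector [a$1 + 1/k, a$2 + 1/k]) (vector [b$1 - 1/k, b$2 - 1/k])"
    then show "x \<in> box a b" using k unfolding mem_box2 vector_2 by linarith
  qed
qed (use assms in \<open>auto intro!: smooth_mult smooth_cutoff simp: cutoff_0\<close>)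

lemma deriv_smooth_mult:
  "smooth f \<Longrightarrow> smooth g \<Longrightarrow> deriv (\<lambda>s. f s * g s) = (\<lambda>s. deriv f s * g s + f s * deriv g s)"
  by (rule ext, rule DERIV_imp_deriv, rule DERIV_cong[OF DERIV_mult[OF smooth_DERIV smooth_DERIV]]) auto

lemma partial_cut2:
  assumes "smooth p" "smooth q"
  shows "partial 1 (cut2 a b k p q) x = (deriv (cutoff (a$1) (b$1) k) (x$1) * p (x$1)
       + cutoff (a$1) (b$1) k (x$1) * deriv p (x$1)) * (cutoff (a$2) (b$2) k (x$2) * q (x$2))"
    "partial 2 (cut2 a b k p q) x = cutoff (a$1) (b$1) k (x$1) * p (x$1) * 
       (deriv (cutoff (a$2) (b$2) k) (x$2) * q (x$2) + cutoff (a$2) (b$2) k (x$2) * deriv q (x$2))"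
  unfolding cut2_def partial_tensor[OF smooth_mult[OF smooth_cutoff assms(1)] smooth_mult[OF smooth_cutoff assms(2)]] 
       deriv_smooth_mult[OF smooth_cutoff assms(1)] deriv_smooth_mult[OF smooth_cutoff assms(2)] tensor_def by auto

subsection \<open>Iterated integrals and the fundamental lemma of the calculus of variations\<close>

abbreviation pt :: "real \<Rightarrow> real \<Rightarrow> real^2" where "pt x y \<equiv> vector [x, y]"

lemma pt_eq: "pt x y = x *\<^sub>R axis 1 1 + y *\<^sub>R axis 2 1"
  by (simp add: vec_eq_iff forall_2 axis_def)

lemma continuous_on_pt [continuous_intros]:
  "continuous_on A f \<Longrightarrow> continuous_on A g \<Longrightarrow> continuous_on A (\<lambda>z. pt (f z) (g z))"
  unfolding pt_eq by (intro continuous_intros)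

lemma measurable_pt [measurable]: "(\<lambda>z. pt (fst z) (snd z)) \<in> borel \<Otimes>\<^sub>M borel \<rightarrow>\<^sub>M borel"
  unfolding borel_prod by (intro borel_measurable_continuous_onI continuous_intros)

lemma Basis_vec2: "(Basis :: (real^2) set) = {axis 1 1, axis 2 1}"
  by (auto simp: Basis_vec_def UNIV_2)

text \<open>Identifying the measure of the plane with an image of a product measure makes Fubini
  applicable to functions on \<open>real^2\<close>. It suffices to compare the values on
  boxes.\<close>

lemma distr_lborel_pt:
  "distr (lborel \<Otimes>\<^sub>M lborel) borel (\<lambda>z. pt (fst z) (snd z)) = (lborel :: (real^2) measure)"
proof (rule lborel_eqI[symmetric])
  fix l u :: "real^2" assume lu: "\<And>b. b \<in> Basis \<Longrightarrow> l \<bullet> b \<le> u \<bullet> b"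
  have le: "l$1 \<le> u$1" "l$2 \<le> u$2"
    using lu[of "axis 1 1"] lu[of "axis 2 1"] by (auto simp: Basis_vec2 inner_axis)
  have "emeasure (distr (lborel \<Otimes>\<^sub>M lborel) borel (\<lambda>z. pt (fst z) (snd z))) (box l u)
     = emeasure (lborel \<Otimes>\<^sub>M lborel) ({l$1<..<u$1} \<times> {l$2<..<u$2})"
    by (subst emeasure_distr) (auto simp: space_pair_measure mem_box2 intro!: arg_cong[where f="emeasure _"])
  also have "\<dots> = ennreal (u$1 - l$1) * ennreal (u$2 - l$2)"
    by (subst lborel.emeasure_pair_measure_Times) (use le in auto)
  also have "\<dots> = (\<Prod>b\<in>Basis. (u - l) \<bullet> b)"
    using le by (simp add: Basis_vec2 axis_eq_axis inner_axis ennreal_mult'[symmetric])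
  finally show "emeasure (distr (lborel \<Otimes>\<^sub>M lborel) borel (\<lambda>z. pt (fst z) (snd z))) (box l u) = \<dots>" .
qed simp

lemma integrable_lborel_pt:
  fixes k :: "real^2 \<Rightarrow> real"
  assumes "integrable lborel k"
  shows "integrable (lborel \<Otimes>\<^sub>M lborel) (\<lambda>(x, y). k (pt x y))"
proof -
  have "integrable (distr (lborel \<Otimes>\<^sub>M lborel) borel (\<lambda>z. pt (fst z) (snd z))) k"
    unfolding distr_lborel_pt by fact
  from integrable_distr[OF _ this] show ?thesis by (simp add: case_prod_unfold)
qed

lemma lborel_integral_pt:
  fixes k :: "real^2 \<Rightarrow> real"
  assumes "integrable lborel k"
  shows "(\<integral>x. k x \<partial>lborel) = (\<integral>y. \<integral>x. k (pt x y) \<partial>lborel \<partial>lborel)"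
    "(\<integral>x. k x \<partial>lborel) = (\<integral>x. \<integral>y. k (pt x y) \<partial>lborel \<partial>lborel)"
    "AE y in lborel. integrable lborel (\<lambda>x. k (pt x y))"
    "AE x in lborel. integrable lborel (\<lambda>y. k (pt x y))"
    "integrable lborel (\<lambda>y. \<integral>x. k (pt x y) \<partial>lborel)" 
    "integrable lborel (\<lambda>x. \<integral>y. k (pt x y) \<partial>lborel)"
proof -
  have [measurable]: "k \<in> borel_measurable borel" using assms by simp
  have *: "(\<integral>x. k x \<partial>lborel) = (\<integral>z. (case z of (x, y) \<Rightarrow> k (pt x y)) \<partial>(lborel \<Otimes>\<^sub>M lborel))"
    unfolding distr_lborel_pt[symmetric] by (subst integral_distr) (auto simp: case_prod_unfold)
  show "(\<integral>x. k x \<partial>lborel) = (\<integral>y. \<integral>x. k (pt x y) \<partial>lborel \<partial>lborel)"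
    unfolding * by (rule lborel_pair.integral_snd[OF integrable_lborel_pt[OF assms], symmetric])
  show "(\<integral>x. k x \<partial>lborel) = (\<integral>x. \<integral>y. k (pt x y) \<partial>lborel \<partial>lborel)"
    unfolding * by (rule lborel_pair.integral_fst[OF integrable_lborel_pt[OF assms], symmetric])
  show "AE y in lborel. integrable lborel (\<lambda>x. k (pt x y))"
    by (rule lborel_pair.AE_integrable_snd[OF integrable_lborel_pt[OF assms]])
  show "AE x in lborel. integrable lborel (\<lambda>y. k (pt x y))"
    by (rule lborel_pair.AE_integrable_fst[OF integrable_lborel_pt[OF assms]])
  show "integrable lborel (\<lambda>y. \<integral>x. k (pt x y) \<partial>lborel)"
    by (rule lborel_pair.integrable_snd[OF integrable_lborel_pt[OF assms]])
  show "integrable lborel (\<lambda>x. \<integral>y. k (pt x y) \<partial>lborel)"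
    by (rule lborel_pair.integrable_fst[OF integrable_lborel_pt[OF assms]])
qed

text \<open>After passing to a Borel representative, the Borel sets with vanishing integral are
  closed under complements and disjoint unions and contain the boxes, which are stable under
  intersection and generate the Borel sets.\<close>

lemma integrable_set_integral_box_0:
  fixes g :: "real^2 \<Rightarrow> real"
  assumes g: "integrable lebesgue g" and zero: "\<And>c d. (LINT x:box c d|lebesgue. g x) = 0"
  shows "AE x in lebesgue. g x = 0"
proof -
  obtain f where f[measurable]: "f \<in> borel_measurable lborel" and gf: "AE x in lborel. g x = f x"
    using completion_ex_borel_measurable_real[OF borel_measurable_integrable[OF g]] by auto
  have gf': "AE x in lebesgue. g x = f x" by (rule AE_completion[OF gf])
  have [measurable]: "g \<in> borel_measurable lebesgue" using g by simp
  have fm: "f \<in> borel_measurable lebesgue" by (rule measurable_completion) simp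
  have "integrable lebesgue f"
    using g integrable_cong_AE[OF _ fm gf'] by simp
  then have fi: "integrable lborel f" using integrable_completion[OF f] by simp
  have fz: "(LINT x:box c d|lborel. f x) = 0" for c d
  proof -
    have "(LINT x:box c d|lborel. f x) = (LINT x:box c d|lebesgue. f x)"
      unfolding set_lebesgue_integral_def by (rule integral_completion[symmetric]) simp
    also have "\<dots> = (LINT x:box c d|lebesgue. g x)"
      unfolding set_lebesgue_integral_def
    proof (intro integral_cong_AE)
      have [measurable]: "box c d \<in> sets lebesgue" by simp
      note fm[measurable]
      show "(\<lambda>x. indicator (box c d) x *\<^sub>R f x) \<in> borel_measurable lebesgue"
        "(\<lambda>x. indicator (box c d) x *\<^sub>R g x) \<in> borel_measurable lebesgue" by measurable
    qed (use gf' in \<open>auto elim: eventually_mono\<close>)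
    finally show ?thesis using zero by simp
  qed
  have si: "set_integrable lborel A f" if "A \<in> sets borel" for A
    using fi that unfolding set_integrable_def by (intro integrable_mult_indicator) auto
  \<comment> \<open>Needed for the complement step of the induction: the plane is exhausted by
    growing cubes, on which the integral vanishes.\<close>
  have tot: "(\<integral>x. f x \<partial>lborel) = 0"
  proof (rule LIMSEQ_unique)
    let ?A = "\<lambda>n::nat. box (- (real n *\<^sub>R One)) (real n *\<^sub>R One) :: (real^2) set"
    show "(\<lambda>n. LINT x:?A n|lborel. f x) \<longlonglongrightarrow> (\<integral>x. f x \<partial>lborel)"
      unfolding set_lebesgue_integral_def
    proof (rule integral_dominated_convergence[where w="\<lambda>x. norm (f x)"])
      show "AE x in lborel. (\<lambda>n. indicator (?A n) x *\<^sub>R f x) \<longlonglongrightarrow> f x"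
      proof (intro AE_I2 tendsto_eventually)
        fix x :: "real^2"
        obtain n where n: "x \<in> ?A n" using UN_box_eq_UNIV by blast
        have "x \<in> ?A m" if "m \<ge> n" for m
          using n that by (auto simp: mem_box intro: less_le_trans le_less_trans)
        then show "eventually (\<lambda>n. indicator (?A n) x *\<^sub>R f x = f x) sequentially"
          by (auto simp: eventually_at_top_linorder intro!: exI[of _ n])
      qed
    qed (use fi in \<open>auto simp: indicator_def\<close>)
    show "(\<lambda>n. LINT x:?A n|lborel. f x) \<longlonglongrightarrow> 0" by (simp add: fz)
  qed
  have "(LINT x:A|lborel. f x) = 0" if "A \<in> sets borel" for A
  proof -
    let ?E = "range (\<lambda>(a, b). box a b) :: (real^2) set set"
    have A: "A \<in> sigma_sets UNIV ?E" using that by (simp add: borel_eq_box)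
    have St: "Int_stable ?E" by (auto simp: Int_stable_def box_Int_box)
    have sub: "?E \<subseteq> Pow UNIV" by auto
    show ?thesis
      using St sub A
    proof (induction rule: sigma_sets_induct_disjoint)
      case (basic A)
      then show ?case using fz by auto
    next
      case empty
      show ?case by (simp add: set_lebesgue_integral_def)
    next
      case (compl A)
      then have "A \<in> sets borel" by (simp add: borel_eq_box)
      then have "(LINT x:A \<union> (UNIV - A)|lborel. f x) = (LINT x:A|lborel. f x) + (LINT x:UNIV - A|lborel. f x)"
        by (intro set_integral_Un si) auto
      then show ?case using compl.IH tot by (simp add: set_lebesgue_integral_def)
    next
      case (union A)
      then have [measurable]: "A i \<in> sets borel" for i by (auto simp: borel_eq_box)
      have "(LINT x:(\<Union>i. A i)|lborel. f x) = (\<Sum>i. LINT x:A i|lborel. f x)"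
        by (intro lebesgue_integral_countable_add si)
           (use union.hyps(1) in \<open>auto simp: disjoint_family_on_def\<close>)
      then show ?case using union.IH by simp
    qed
  qed
  then have "AE x in lborel. f x = 0"
    using fi by (intro sigma_finite_measure.density_zero[OF sigma_finite_lborel]) auto
  then have "AE x in lebesgue. f x = 0" by (rule AE_completion)
  with gf' show ?thesis by eventually_elim simp
qed

lemma lborel_set_integral_eq_lebesgue:
  fixes f :: "real^2 \<Rightarrow> real"
  shows "(\<lambda>x. indicator A x *\<^sub>R f x) \<in> borel_measurable borel \<Longrightarrow>
    (LINT x:A|lebesgue. f x) = (\<integral>x. indicator A x *\<^sub>R f x \<partial>lborel)"
  unfolding set_lebesgue_integral_def by (rule integral_completion) simp

lemma eventually_box_large:
  fixes a b :: "real^2"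
  assumes "a$1 < b$1" "a$2 < b$2"
  shows "eventually (\<lambda>k. 4 \<le> real k * (b$1 - a$1) \<and> 4 \<le> real k * (b$2 - a$2)) sequentially"
  using assms by (intro eventually_conj eventually_ge_mult) auto

lemma cutoff_integral_tendsto:
  fixes f :: "real^2 \<Rightarrow> real"
  assumes f: "set_integrable lebesgue (box a b) f" and ab: "a$1 < b$1" "a$2 < b$2"
  shows "(\<lambda>k. LINT x:box a b|lebesgue. f x * (cutoff (a$1) (b$1) k (x$1) * cutoff (a$2) (b$2) k (x$2)))
     \<longlonglongrightarrow> (LINT x:box a b|lebesgue. f x)"
  unfolding set_lebesgue_integral_def
proof -
  let ?c = "\<lambda>k (x::real^2). cutoff (a$1) (b$1) k (x$1) * cutoff (a$2) (b$2) k (x$2)"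
  let ?f = "\<lambda>x. indicator (box a b) x *\<^sub>R f x"
  \<comment> \<open>Starting the sequence at \<open>K\<close> makes the bounds 0 and 1 for the
    cut-offs valid for all indices, as dominated convergence requires.\<close>
  obtain K where K: "\<And>k. k \<ge> K \<Longrightarrow> 4 \<le> real k * (b$1 - a$1)" "\<And>k. k \<ge> K \<Longrightarrow> 4 \<le> real k * (b$2 - a$2)"
    using eventually_box_large[OF ab]
    unfolding eventually_at_top_linorder by auto
  have fi: "integrable lebesgue ?f" using f unfolding set_integrable_def .
  have [measurable]: "(\<lambda>x::real^2. ?c k x) \<in> borel_measurable lebesgue" for k
  proof -
    have "continuous_on UNIV (\<lambda>x::real^2. ?c k x)"
      by (intro continuous_intros continuous_on_compose2[OF smooth_continuous[OF smooth_cutoff, of UNIV]]) auto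
    then show ?thesis by (intro measurable_completion) (simp add: borel_measurable_continuous_onI)
  qed
  have "(\<lambda>k. \<integral>x. ?f x * ?c (k + K) x \<partial>lebesgue) \<longlonglongrightarrow> (\<integral>x. ?f x \<partial>lebesgue)"
  proof (rule integral_dominated_convergence[where w="\<lambda>x. norm (?f x)"])
    show "AE x in lebesgue. (\<lambda>k. ?f x * ?c (k + K) x) \<longlonglongrightarrow> ?f x"
    proof (rule AE_I2)
      fix x
      show "(\<lambda>k. ?f x * ?c (k + K) x) \<longlonglongrightarrow> ?f x"
      proof (cases "x \<in> box a b")
        case True
        have "(\<lambda>k. ?c (k + K) x) \<longlonglongrightarrow> indicator {a$1<..<b$1} (x$1) * indicator {a$2<..<b$2} (x$2)"
          by (intro tendsto_mult LIMSEQ_ignore_initial_segment cutoff_tendsto ab)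
        then have "(\<lambda>k. ?c (k + K) x) \<longlonglongrightarrow> 1" using True by (simp add: mem_box2)
        from tendsto_mult[OF tendsto_const this, of "?f x"] show ?thesis by simp
      qed simp
    qed
    show "AE x in lebesgue. norm (?f x * ?c (k + K) x) \<le> norm (?f x)" for k
    proof (rule AE_I2)
      fix x
      have "norm (?c (k + K) x) \<le> 1"
        using cutoff_bounds[OF K(1), of "k+K" "x$1"] cutoff_bounds[OF K(2), of "k+K" "x$2"]
        by (auto simp: abs_mult intro!: mult_le_one)
      then show "norm (?f x * ?c (k + K) x) \<le> norm (?f x)"
        unfolding norm_mult by (rule mult_left_le) simp
    qed
  qed (use fi in auto)
  then have "(\<lambda>k. \<integral>x. ?f x * ?c k x \<partial>lebesgue) \<longlonglongrightarrow> (\<integral>x. ?f x \<partial>lebesgue)"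
    by (rule LIMSEQ_offset)
  then show "(\<lambda>k. \<integral>x. indicator (box a b) x *\<^sub>R (f x * ?c k x) \<partial>lebesgue) \<longlonglongrightarrow> (\<integral>x. ?f x \<partial>lebesgue)"
    by (simp add: mult.assoc)
qed

lemma test_function_mono: "test_function U \<phi> \<Longrightarrow> U \<subseteq> V \<Longrightarrow> test_function V \<phi>"
  unfolding test_function_def by blast

lemma cut2_1: "cut2 a b k (\<lambda>s. 1) (\<lambda>s. 1) x = cutoff (a$1) (b$1) k (x$1) * cutoff (a$2) (b$2) k (x$2)"
  by (simp add: cut2_def tensor_def)

lemma cut2_outside:
  assumes "4 \<le> real k * (b$1 - a$1)" "4 \<le> real k * (b$2 - a$2)" "x \<notin> box a b"
  shows "cut2 a b k p q x = 0"
proof -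
  have "1 / real k \<ge> 0" by simp
  then have "x$1 \<le> a$1 + 1/k \<or> x$1 \<ge> b$1 - 1/k \<or> x$2 \<le> a$2 + 1/k \<or> x$2 \<ge> b$2 - 1/k"
    using assms(3) unfolding mem_box2 by argo
  then show ?thesis using cutoff_0[OF assms(1)] cutoff_0[OF assms(2)]
    by (auto simp: cut2_def tensor_def)
qed

text \<open>Only products are tested, since all later applications supply products. The cut-offs of
  a closed box in \<open>U\<close> converge to its indicator, which gives vanishing integrals over
  boxes; a countable cover of \<open>U\<close> by boxes concludes.\<close>

lemma fundamental_lemma:
  fixes g :: "real^2 \<Rightarrow> real"
  assumes g: "\<And>C. compact C \<Longrightarrow> C \<subseteq> U \<Longrightarrow> set_integrable lebesgue C g" and U: "open U"
    and zero: "\<And>p q. smooth p \<Longrightarrow> smooth q \<Longrightarrow> test_function U (tensor p q) \<Longrightarrow>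
       (LINT x:U|lebesgue. g x * tensor p q x) = 0"
  shows "AE x in lebesgue. x \<in> U \<longrightarrow> g x = 0"
proof -
  have bz: "(LINT x:box c d|lebesgue. g x) = 0" if cd: "cbox c d \<subseteq> U" for c d
  proof (cases "c$1 < d$1 \<and> c$2 < d$2")
    case False
    then have "box c d = {}" by (auto simp: set_eq_iff mem_box2)
    then show ?thesis by (simp add: set_lebesgue_integral_def)
  next
    case True
    have "set_integrable lebesgue (box c d) g"
      by (rule set_integrable_subset[OF g[of "cbox c d"]]) (use cd box_subset_cbox in auto)
    from cutoff_integral_tendsto[OF this] True
    have lim: "(\<lambda>k. LINT x:box c d|lebesgue. g x * cut2 c d k (\<lambda>s. 1) (\<lambda>s. 1) x) \<longlonglongrightarrow> (LINT x:box c d|lebesgue. g x)"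
      by (simp add: cut2_1)
    have "eventually (\<lambda>k. (LINT x:box c d|lebesgue. g x * cut2 c d k (\<lambda>s. 1) (\<lambda>s. 1) x) = 0) sequentially"
      using eventually_box_large[OF conjunct1[OF True] conjunct2[OF True]]
    proof (rule eventually_mono)
      fix k assume "4 \<le> real k * (d$1 - c$1) \<and> 4 \<le> real k * (d$2 - c$2)"
      then have k: "4 \<le> real k * (d$1 - c$1)" "4 \<le> real k * (d$2 - c$2)" by auto
      let ?\<phi> = "cut2 c d k (\<lambda>s. 1) (\<lambda>s. 1)"
      have "test_function U ?\<phi>"
        by (rule test_function_mono[OF test_function_cut2[OF _ _ k]]) (use cd box_subset_cbox in auto)
      then have "(LINT x:U|lebesgue. g x * ?\<phi> x) = 0"
        unfolding cut2_def by (rule zero[rotated 2]) (auto intro!: smooth_mult smooth_cutoff)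
      moreover have *: "indicator U x *\<^sub>R (g x * ?\<phi> x) = indicator (box c d) x *\<^sub>R (g x * ?\<phi> x)" for x
        using cut2_outside[OF k, of x] cd box_subset_cbox[of c d] by (auto simp: indicator_def)
      ultimately show "(LINT x:box c d|lebesgue. g x * ?\<phi> x) = 0"
        unfolding set_lebesgue_integral_def by (simp only: *)
    qed
    then have "(\<lambda>k. LINT x:box c d|lebesgue. g x * cut2 c d k (\<lambda>s. 1) (\<lambda>s. 1) x) \<longlonglongrightarrow> 0"
      by (rule tendsto_eventually)
    with lim show ?thesis by (rule LIMSEQ_unique)
  qed
  have loc: "AE x in lebesgue. x \<in> box e f \<longrightarrow> g x = 0" if ef: "cbox e f \<subseteq> U" for e f
  proof -
    have "set_integrable lebesgue (box e f) g"
      by (rule set_integrable_subset[OF g[of "cbox e f"]]) (use ef box_subset_cbox in auto)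
    then have "AE x in lebesgue. indicator (box e f) x *\<^sub>R g x = 0"
      unfolding set_integrable_def
    proof (rule integrable_set_integral_box_0)
      fix c d
      \<comment> \<open>Restricting \<open>g\<close> to \<open>box e f\<close> turns the local
        hypothesis into a global one: the intersection with any box is again a box, to which
        \<open>bz\<close> applies.\<close>
      let ?c = "\<chi> i. max (c$i) (e$i)" and ?d = "\<chi> i. min (d$i) (f$i)"
      have "cbox ?c ?d \<subseteq> cbox e f" by (auto simp: mem_box2)
      then have "cbox ?c ?d \<subseteq> U" using ef by blast
      from bz[OF this] have "(LINT x:box ?c ?d|lebesgue. g x) = 0" .
      moreover have *: "indicator (box c d) x *\<^sub>R (indicator (box e f) x *\<^sub>R g x) = indicator (box ?c ?d) x *\<^sub>R g x" for x
        by (auto simp: indicator_def mem_box2)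
      ultimately show "(LINT x:box c d|lebesgue. indicator (box e f) x *\<^sub>R g x) = 0"
        unfolding set_lebesgue_integral_def by (simp only: *)
    qed
    then show ?thesis by eventually_elim (auto simp: indicator_def)
  qed
  obtain D where D: "countable D" "D \<subseteq> Pow U" "\<And>X. X \<in> D \<Longrightarrow> \<exists>a b. X = cbox a b" "\<Union>D = U"
    using open_countable_Union_open_cbox[OF U] by metis
  have "AE x in lebesgue. x \<in> X \<longrightarrow> g x = 0" if X: "X \<in> D" for X
  proof -
    obtain e f where ef: "X = cbox e f" using D(3)[OF X] by auto
    have "cbox e f \<subseteq> U" using D(2) X ef by auto
    from loc[OF this] have "AE x in lebesgue. x \<in> box e f \<longrightarrow> g x = 0" .
    moreover have "AE x in lebesgue. x \<notin> cbox e f - box e f"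
      using negligible_frontier_interval[of e f] negligible_iff_null_sets AE_not_in by blast
    ultimately show ?thesis unfolding ef by eventually_elim auto
  qed
  then have "AE x in lebesgue. \<forall>X\<in>D. x \<in> X \<longrightarrow> g x = 0"
    using D(1) by (intro AE_ball_countable[THEN iffD2]) auto
  then show ?thesis by eventually_elim (use D(4) in blast)
qed

subsection \<open>Green's formula on rectangles\<close>

lemma integrable_indicator_continuous:
  fixes f :: "'a::euclidean_space \<Rightarrow> real"
  assumes "compact S" "continuous_on S f"
  shows "integrable lborel (\<lambda>x. indicator S x * f x)"
  using borel_integrable_compact[OF assms] by simp

lemma integral_deriv_step: "integrable lborel (\<lambda>x. deriv step x)" "(\<integral>x. deriv step x \<partial>lborel) = 1"
proof -
  have c: "continuous_on UNIV (deriv step)" by (intro smooth_continuous smooth_deriv smooth_step)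
  have eq: "deriv step = (\<lambda>x. deriv step x * indicator {1..2} x)"
  proof
    fix x show "deriv step x = deriv step x * indicator {1..2} x"
      using deriv_step_0[of x] by (cases "x \<in> {1..2}") auto
  qed
  have "integrable lborel (\<lambda>x. indicator {1..2} x *\<^sub>R deriv step x)"
    by (intro borel_integrable_compact smooth_continuous smooth_deriv smooth_step) auto
  then show "integrable lborel (\<lambda>x. deriv step x)" by (subst eq) (simp add: mult.commute)
  have "(\<integral>x. deriv step x * indicator {1..2} x \<partial>lborel) = step 2 - step 1"
    using c by (intro integral_FTC_Icc_real smooth_DERIV smooth_step) (auto simp: continuous_on_eq_continuous_at)
  then show "(\<integral>x. deriv step x \<partial>lborel) = 1" by (subst eq) (simp add: step_0 step_1)
qed

text \<open>The scaled derivatives of \<open>step\<close> are nonnegative with integral 1 and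
  concentrate at 0 from the right; substituting s = x / k moves the scale into the argument of
  \<open>u\<close>. The second claim supplies the bound for later dominated convergence.\<close>

lemma delta_sequence:
  fixes u :: "real \<Rightarrow> real"
  assumes L: "L > 0" and u: "continuous_on {0..L} u"
  shows "(\<lambda>k. \<integral>s. indicator {0..L} s * (real k * deriv step (real k * s)) * u s \<partial>lborel) \<longlonglongrightarrow> u 0"
    and "(\<And>s. s \<in> {0..L} \<Longrightarrow> \<bar>u s\<bar> \<le> B) \<Longrightarrow>
      \<bar>\<integral>s. indicator {0..L} s * (real k * deriv step (real k * s)) * u s \<partial>lborel\<bar> \<le> B"
proof -
  define v where "v s = indicator {0..L} s *\<^sub>R u s" for s
  have vm[measurable]: "v \<in> borel_measurable borel"
    unfolding v_def using u by (intro borel_measurable_continuous_on_indicator) auto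
  have dm[measurable]: "deriv step \<in> borel_measurable borel" using integral_deriv_step(1) by auto
  have "compact (u ` {0..L})" by (intro compact_continuous_image u) auto
  then obtain B0 where B0: "\<And>s. s \<in> {0..L} \<Longrightarrow> \<bar>u s\<bar> \<le> B0"
    using compact_imp_bounded[of "u ` {0..L}"] unfolding bounded_iff by fastforce
  have B0p: "B0 \<ge> 0" using B0[of 0] L by auto
  have eq: "(\<integral>s. indicator {0..L} s * (real k * deriv step (real k * s)) * u s \<partial>lborel)
      = (\<integral>x. deriv step x * v (x / real k) \<partial>lborel)" if "k > 0" for k
  proof -
    have "(\<integral>s. indicator {0..L} s * (real k * deriv step (real k * s)) * u s \<partial>lborel)
      = \<bar>1 / real k\<bar> *\<^sub>R (\<integral>x. indicator {0..L} (0 + 1/real k * x) * (real k * deriv step (real k * (0 + 1/real k * x))) * u (0 + 1/real k * x) \<partial>lborel)"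
      using that by (intro lborel_integral_real_affine) auto
    also have "\<dots> = (\<integral>x. \<bar>1 / real k\<bar> *\<^sub>R (indicator {0..L} (0 + 1/real k * x) * (real k * deriv step (real k * (0 + 1/real k * x))) * u (0 + 1/real k * x)) \<partial>lborel)"
      unfolding real_scaleR_def by (rule Bochner_Integration.integral_mult_right_zero[symmetric])
    also have "\<dots> = (\<integral>x. deriv step x * v (x / real k) \<partial>lborel)"
      using that by (intro Bochner_Integration.integral_cong refl) (simp add: v_def)
    finally show ?thesis .
  qed
  have vB: "\<bar>deriv step x * v y\<bar> \<le> B * deriv step x" if "\<And>s. s \<in> {0..L} \<Longrightarrow> \<bar>u s\<bar> \<le> B" for x y B
  proof -
    have "B \<ge> 0" using that[of 0] L by auto
    then have "\<bar>v y\<bar> \<le> B" using that by (auto simp: v_def indicator_def)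
    then show ?thesis using mult_right_mono[of "\<bar>v y\<bar>" B "deriv step x"] deriv_step_nonneg[of x]
      by (simp add: abs_mult mult.commute)
  qed
  show "\<bar>\<integral>s. indicator {0..L} s * (real k * deriv step (real k * s)) * u s \<partial>lborel\<bar> \<le> B"
    if B: "\<And>s. s \<in> {0..L} \<Longrightarrow> \<bar>u s\<bar> \<le> B"
  proof (cases "k > 0")
    case True
    have "norm (\<integral>x. deriv step x * v (x / real k) \<partial>lborel) \<le> (\<integral>x. B * deriv step x \<partial>lborel)"
    proof (rule order_trans[OF Bochner_Integration.integral_norm_bound integral_mono])
      show i: "integrable lborel (\<lambda>x. B * deriv step x)" using integral_deriv_step(1) by simp
      show "integrable lborel (\<lambda>x. norm (deriv step x * v (x / real k)))"
        by (rule Bochner_Integration.integrable_bound[OF i]) (use vB[OF B] in \<open>auto intro: order_trans[OF _ abs_ge_self]\<close>)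
    qed (use vB[OF B] in auto)
    then show ?thesis using eq[OF True] integral_deriv_step(2) by simp
  next
    case False
    then show ?thesis using B[of 0] L by auto
  qed
  have "(\<lambda>k. \<integral>x. deriv step x * v (x / real k) \<partial>lborel) \<longlonglongrightarrow> (\<integral>x. deriv step x * u 0 \<partial>lborel)"
  proof (rule integral_dominated_convergence[where w="\<lambda>x. B0 * deriv step x"])
    show "AE x in lborel. (\<lambda>k. deriv step x * v (x / real k)) \<longlonglongrightarrow> deriv step x * u 0"
    proof (rule AE_I2)
      fix x
      show "(\<lambda>k. deriv step x * v (x / real k)) \<longlonglongrightarrow> deriv step x * u 0"
      proof (cases "x \<ge> 1")
        case True
        have ev: "eventually (\<lambda>k. x / real k \<in> {0..L}) sequentially"
          using eventually_ge_mult[OF L, of x] eventually_gt_at_top[of 0]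
          by eventually_elim (use True in \<open>auto simp: field_simps\<close>)
        have "(\<lambda>k. x / real k) \<longlonglongrightarrow> 0" by real_asymp
        then have "(\<lambda>k. u (x / real k)) \<longlonglongrightarrow> u 0"
          using u L ev by (intro continuous_on_tendsto_compose[OF u]) auto
        moreover have "eventually (\<lambda>k. v (x / real k) = u (x / real k)) sequentially"
          using ev by eventually_elim (auto simp: v_def)
        ultimately have "(\<lambda>k. v (x / real k)) \<longlonglongrightarrow> u 0"
          using tendsto_cong by fastforce
        then show ?thesis by (intro tendsto_mult tendsto_const)
      next
        case False
        then show ?thesis by (simp add: deriv_step_0)
      qed
    qed
    show "AE x in lborel. norm (deriv step x * v (x / real k)) \<le> B0 * deriv step x" for k
      using vB[OF B0] by auto
  qed (use integral_deriv_step(1) in auto)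
  moreover have "eventually (\<lambda>k. (\<integral>x. deriv step x * v (x / real k) \<partial>lborel) =
     (\<integral>s. indicator {0..L} s * (real k * deriv step (real k * s)) * u s \<partial>lborel)) sequentially"
    using eventually_gt_at_top[of 0] by eventually_elim (simp add: eq)
  ultimately show "(\<lambda>k. \<integral>s. indicator {0..L} s * (real k * deriv step (real k * s)) * u s \<partial>lborel) \<longlonglongrightarrow> u 0"
    using integral_deriv_step(2) by (simp add: tendsto_cong)
qed

text \<open>The derivative of the cut-off tends to a unit mass at \<open>a\<close> minus a unit mass
  at \<open>b\<close>; translating one layer and reflecting the other reduces both to
  \<open>delta_sequence\<close>.\<close>

lemma cutoff_deriv_integral:
  fixes u :: "real \<Rightarrow> real"
  assumes ab: "a < b" and u: "continuous_on {a..b} u"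
  shows "(\<lambda>k. \<integral>s. indicator {a..b} s * deriv (cutoff a b k) s * u s \<partial>lborel) \<longlonglongrightarrow> u a - u b"
    and "(\<And>s. s \<in> {a..b} \<Longrightarrow> \<bar>u s\<bar> \<le> B) \<Longrightarrow>
      \<bar>\<integral>s. indicator {a..b} s * deriv (cutoff a b k) s * u s \<partial>lborel\<bar> \<le> 2 * B"
proof -
  let ?I = "\<lambda>k u. \<integral>s. indicator {0..b-a} s * (real k * deriv step (real k * s)) * u s \<partial>lborel"
  have c1: "continuous_on {0..b-a} (\<lambda>s. u (a + s))" and c2: "continuous_on {0..b-a} (\<lambda>s. u (b - s))"
    by (auto intro!: continuous_intros continuous_on_compose2[OF u])
  have eq: "(\<integral>s. indicator {a..b} s * deriv (cutoff a b k) s * u s \<partial>lborel) = ?I k (\<lambda>s. u (a + s)) - ?I k (\<lambda>s. u (b - s))" for k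
  proof -
    let ?f = "\<lambda>s. indicator {a..b} s * (real k * deriv step (real k * (s - a))) * u s"
    let ?g = "\<lambda>s. indicator {a..b} s * (real k * deriv step (real k * (b - s))) * u s"
    have cs: "continuous_on A (\<lambda>s. deriv step (real k * f s))" if "continuous_on A f" for A and f :: "real \<Rightarrow> real"
      by (rule continuous_on_compose2[OF smooth_continuous[OF smooth_deriv[OF smooth_step], of UNIV]])
         (use that in \<open>auto intro!: continuous_intros\<close>)
    have i1: "integrable lborel ?f" "integrable lborel ?g"
      unfolding mult.assoc[of "indicator {a..b} _" "_ * _" "u _"]
      by (intro integrable_indicator_continuous continuous_intros cs u compact_Icc)+
    have "(\<integral>s. indicator {a..b} s * deriv (cutoff a b k) s * u s \<partial>lborel) = (\<integral>s. ?f s - ?g s \<partial>lborel)"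
      by (intro Bochner_Integration.integral_cong refl) (simp add: deriv_cutoff algebra_simps)
    also have "\<dots> = (\<integral>s. ?f s \<partial>lborel) - (\<integral>s. ?g s \<partial>lborel)"
      using i1 by simp
    also have "(\<integral>s. ?f s \<partial>lborel) = ?I k (\<lambda>s. u (a + s))"
      by (subst lborel_integral_real_affine[of 1 _ a], simp, simp, intro Bochner_Integration.integral_cong refl)
         (auto simp: indicator_def algebra_simps)
    also have "(\<integral>s. ?g s \<partial>lborel) = ?I k (\<lambda>s. u (b - s))"
      by (subst lborel_integral_real_affine[of "-1" _ b], simp, simp, intro Bochner_Integration.integral_cong refl)
         (auto simp: indicator_def algebra_simps)
    finally show ?thesis .
  qed
  show "(\<lambda>k. \<integral>s. indicator {a..b} s * deriv (cutoff a b k) s * u s \<partial>lborel) \<longlonglongrightarrow> u a - u b"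
    unfolding eq using tendsto_diff[OF delta_sequence(1)[OF _ c1] delta_sequence(1)[OF _ c2]] ab by simp
  show "\<bar>\<integral>s. indicator {a..b} s * deriv (cutoff a b k) s * u s \<partial>lborel\<bar> \<le> 2 * B"
    if B: "\<And>s. s \<in> {a..b} \<Longrightarrow> \<bar>u s\<bar> \<le> B"
  proof -
    have "\<bar>?I k (\<lambda>s. u (a + s))\<bar> \<le> B" "\<bar>?I k (\<lambda>s. u (b - s))\<bar> \<le> B"
      using ab by (auto intro!: delta_sequence(2) c1 c2 B)
    then show ?thesis unfolding eq by linarith
  qed
qed

lemma continuous_cutoff: 
  "continuous_on A f \<Longrightarrow> continuous_on A (\<lambda>x. cutoff a b k (f x))"
  "continuous_on A f \<Longrightarrow> continuous_on A (\<lambda>x. deriv (cutoff a b k) (f x))"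
  by (rule continuous_on_compose2[OF smooth_continuous[of _ UNIV]]; auto intro: smooth_cutoff smooth_deriv)+

text \<open>By Fubini, the slice across the layer produces the difference of the values on opposite
  sides, while the cut-off along the side tends to 1. The uniform bound \<open>2 * B\<close> for the
  slices allows dominated convergence in the remaining variable.\<close>

lemma boundary_layer:
  fixes H :: "real^2 \<Rightarrow> real"
  assumes ab: "a$1 < b$1" "a$2 < b$2" and H: "continuous_on (cbox a b) H"
  shows boundary_layer_1: "(\<lambda>k. \<integral>x. indicator (cbox a b) x * (deriv (cutoff (a$1) (b$1) k) (x$1) * cutoff (a$2) (b$2) k (x$2) * H x) \<partial>lborel)
      \<longlonglongrightarrow> (\<integral>y. indicator {a$2..b$2} y * (H (pt (a$1) y) - H (pt (b$1) y)) \<partial>lborel)"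
    and boundary_layer_2: "(\<lambda>k. \<integral>x. indicator (cbox a b) x * (cutoff (a$1) (b$1) k (x$1) * deriv (cutoff (a$2) (b$2) k) (x$2) * H x) \<partial>lborel)
      \<longlonglongrightarrow> (\<integral>y. indicator {a$1..b$1} y * (H (pt y (a$2)) - H (pt y (b$2))) \<partial>lborel)"
proof -
  obtain B where B: "\<And>x. x \<in> cbox a b \<Longrightarrow> \<bar>H x\<bar> \<le> B"
    using compact_imp_bounded[OF compact_continuous_image[OF H compact_cbox]] unfolding bounded_iff by fastforce
  have "a \<in> cbox a b" using ab by (auto simp: mem_box2)
  from B[OF this] have B0: "B \<ge> 0" by auto
  obtain K where K: "\<And>k. k \<ge> K \<Longrightarrow> 4 \<le> real k * (b$1 - a$1)" "\<And>k. k \<ge> K \<Longrightarrow> 4 \<le> real k * (b$2 - a$2)"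
    using eventually_box_large[OF ab] unfolding eventually_at_top_linorder by auto
  \<comment> \<open>At the two ends of a side the tangential cut-off does not tend to 1, so these
    points are excluded as a null set.\<close>
  have ae: "AE y in lborel. y \<noteq> (c::real) \<and> y \<noteq> d" for c d
    using AE_lborel_singleton[of c] AE_lborel_singleton[of d] by eventually_elim auto
  have cH: "continuous_on A (\<lambda>s. H (pt (f s) (g s)))"
    if "continuous_on A f" "continuous_on A g" "\<And>s. s \<in> A \<Longrightarrow> a$1 \<le> f s \<and> f s \<le> b$1 \<and> a$2 \<le> g s \<and> g s \<le> b$2" for A f and g :: "real \<Rightarrow> real"
    by (rule continuous_on_compose2[OF H]) (use that in \<open>auto intro!: continuous_intros simp: mem_box2\<close>)
  {
    define J where "J k y = (\<integral>s. indicator {a$1..b$1} s * deriv (cutoff (a$1) (b$1) k) s * H (pt s y) \<partial>lborel)" for k y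
    let ?F = "\<lambda>k x. indicator (cbox a b) x * (deriv (cutoff (a$1) (b$1) k) (x$1) * cutoff (a$2) (b$2) k (x$2) * H x)"
    have int: "integrable lborel (?F k)" for k
      by (intro integrable_indicator_continuous continuous_intros continuous_cutoff H compact_cbox)
    have sl: "(\<integral>x. ?F k (pt x y) \<partial>lborel) = indicator {a$2..b$2} y * cutoff (a$2) (b$2) k y * J k y" for k y
      unfolding J_def Bochner_Integration.integral_mult_right_zero[symmetric]
      by (intro Bochner_Integration.integral_cong refl) (auto simp: indicator_def mem_box2)
    have m: "(\<lambda>y. indicator {a$2..b$2} y * cutoff (a$2) (b$2) k y * J k y) \<in> borel_measurable lborel" for k
      using lborel_integral_pt(5)[OF int[of k]] unfolding sl by (rule borel_measurable_integrable)
    have "(\<lambda>k. \<integral>y. indicator {a$2..b$2} y * cutoff (a$2) (b$2) (k+K) y * J (k+K) y \<partial>lborel) \<longlonglongrightarrow>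
       (\<integral>y. indicator {a$2..b$2} y * (H (pt (a$1) y) - H (pt (b$1) y)) \<partial>lborel)"
    proof (rule integral_dominated_convergence[where w="\<lambda>y. indicator {a$2..b$2} y * (2 * B)"])
      show "(\<lambda>y. indicator {a$2..b$2} y * (H (pt (a$1) y) - H (pt (b$1) y))) \<in> borel_measurable lborel"
        by (intro borel_measurable_integrable integrable_indicator_continuous continuous_intros cH compact_Icc)
           (use ab in auto)
      show "integrable lborel (\<lambda>y. indicator {a$2..b$2} y * (2 * B))"
        using borel_integrable_compact[of "{a$2..b$2}" "\<lambda>y. 2 * B"] by auto
      show "AE y in lborel. (\<lambda>k. indicator {a$2..b$2} y * cutoff (a$2) (b$2) (k+K) y * J (k+K) y)
          \<longlonglongrightarrow> indicator {a$2..b$2} y * (H (pt (a$1) y) - H (pt (b$1) y))"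
        using ae[of "a$2" "b$2"]
      proof eventually_elim
        case (elim y)
        show ?case
        proof (cases "a$2 < y \<and> y < b$2")
          case True
          have "(\<lambda>k. cutoff (a$2) (b$2) (k+K) y) \<longlonglongrightarrow> indicator {a$2<..<b$2} y"
            by (intro LIMSEQ_ignore_initial_segment cutoff_tendsto ab)
          moreover have "(\<lambda>k. J (k+K) y) \<longlonglongrightarrow> H (pt (a$1) y) - H (pt (b$1) y)"
            unfolding J_def
            by (intro LIMSEQ_ignore_initial_segment cutoff_deriv_integral(1) ab cH) (use True in \<open>auto intro!: continuous_intros\<close>)
          ultimately have "(\<lambda>k. indicator {a$2..b$2} y * cutoff (a$2) (b$2) (k+K) y * J (k+K) y)
            \<longlonglongrightarrow> indicator {a$2..b$2} y * indicator {a$2<..<b$2} y * (H (pt (a$1) y) - H (pt (b$1) y))"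
            by (intro tendsto_mult tendsto_const)
          then show ?thesis using True by simp
        qed (use elim in \<open>auto simp: indicator_def\<close>)
      qed
      show "AE y in lborel. norm (indicator {a$2..b$2} y * cutoff (a$2) (b$2) (k+K) y * J (k+K) y) \<le> indicator {a$2..b$2} y * (2 * B)" for k
      proof (rule AE_I2)
        fix y
        show "norm (indicator {a$2..b$2} y * cutoff (a$2) (b$2) (k+K) y * J (k+K) y) \<le> indicator {a$2..b$2} y * (2 * B)"
        proof (cases "y \<in> {a$2..b$2}")
          case True
          have "\<bar>J (k+K) y\<bar> \<le> 2 * B" unfolding J_def
            by (intro cutoff_deriv_integral(2) ab cH B) (use True in \<open>auto intro!: continuous_intros simp: mem_box2\<close>)
          moreover have "0 \<le> cutoff (a$2) (b$2) (k+K) y" "cutoff (a$2) (b$2) (k+K) y \<le> 1"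
            by (intro cutoff_bounds K; simp)+
          ultimately show ?thesis
            using mult_mono[of "cutoff (a$2) (b$2) (k+K) y" 1 "\<bar>J (k+K) y\<bar>" "2 * B"] True by (simp add: abs_mult)
        qed simp
      qed
    qed (use m in auto)
    then have "(\<lambda>k. \<integral>y. \<integral>x. ?F k (pt x y) \<partial>lborel \<partial>lborel) \<longlonglongrightarrow>
       (\<integral>y. indicator {a$2..b$2} y * (H (pt (a$1) y) - H (pt (b$1) y)) \<partial>lborel)"
      unfolding sl by (rule LIMSEQ_offset)
    then show "(\<lambda>k. \<integral>x. ?F k x \<partial>lborel) \<longlonglongrightarrow> (\<integral>y. indicator {a$2..b$2} y * (H (pt (a$1) y) - H (pt (b$1) y)) \<partial>lborel)"
      using lborel_integral_pt(1)[OF int] by simp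
  }
  {
    define J where "J k y = (\<integral>s. indicator {a$2..b$2} s * deriv (cutoff (a$2) (b$2) k) s * H (pt y s) \<partial>lborel)" for k y
    let ?F = "\<lambda>k x. indicator (cbox a b) x * (cutoff (a$1) (b$1) k (x$1) * deriv (cutoff (a$2) (b$2) k) (x$2) * H x)"
    have int: "integrable lborel (?F k)" for k
      by (intro integrable_indicator_continuous continuous_intros continuous_cutoff H compact_cbox)
    have sl: "(\<integral>x. ?F k (pt y x) \<partial>lborel) = indicator {a$1..b$1} y * cutoff (a$1) (b$1) k y * J k y" for k y
      unfolding J_def Bochner_Integration.integral_mult_right_zero[symmetric]
      by (intro Bochner_Integration.integral_cong refl) (auto simp: indicator_def mem_box2)
    have m: "(\<lambda>y. indicator {a$1..b$1} y * cutoff (a$1) (b$1) k y * J k y) \<in> borel_measurable lborel" for k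
      using lborel_integral_pt(6)[OF int[of k]] unfolding sl by (rule borel_measurable_integrable)
    have "(\<lambda>k. \<integral>y. indicator {a$1..b$1} y * cutoff (a$1) (b$1) (k+K) y * J (k+K) y \<partial>lborel) \<longlonglongrightarrow>
       (\<integral>y. indicator {a$1..b$1} y * (H (pt y (a$2)) - H (pt y (b$2))) \<partial>lborel)"
    proof (rule integral_dominated_convergence[where w="\<lambda>y. indicator {a$1..b$1} y * (2 * B)"])
      show "(\<lambda>y. indicator {a$1..b$1} y * (H (pt y (a$2)) - H (pt y (b$2)))) \<in> borel_measurable lborel"
        by (intro borel_measurable_integrable integrable_indicator_continuous continuous_intros cH compact_Icc)
           (use ab in auto)
      show "integrable lborel (\<lambda>y. indicator {a$1..b$1} y * (2 * B))"
        using borel_integrable_compact[of "{a$1..b$1}" "\<lambda>y. 2 * B"] by auto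
      show "AE y in lborel. (\<lambda>k. indicator {a$1..b$1} y * cutoff (a$1) (b$1) (k+K) y * J (k+K) y)
          \<longlonglongrightarrow> indicator {a$1..b$1} y * (H (pt y (a$2)) - H (pt y (b$2)))"
        using ae[of "a$1" "b$1"]
      proof eventually_elim
        case (elim y)
        show ?case
        proof (cases "a$1 < y \<and> y < b$1")
          case True
          have "(\<lambda>k. cutoff (a$1) (b$1) (k+K) y) \<longlonglongrightarrow> indicator {a$1<..<b$1} y"
            by (intro LIMSEQ_ignore_initial_segment cutoff_tendsto ab)
          moreover have "(\<lambda>k. J (k+K) y) \<longlonglongrightarrow> H (pt y (a$2)) - H (pt y (b$2))"
            unfolding J_def
            by (intro LIMSEQ_ignore_initial_segment cutoff_deriv_integral(1) ab cH) (use True in \<open>auto intro!: continuous_intros\<close>)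
          ultimately have "(\<lambda>k. indicator {a$1..b$1} y * cutoff (a$1) (b$1) (k+K) y * J (k+K) y)
            \<longlonglongrightarrow> indicator {a$1..b$1} y * indicator {a$1<..<b$1} y * (H (pt y (a$2)) - H (pt y (b$2)))"
            by (intro tendsto_mult tendsto_const)
          then show ?thesis using True by simp
        qed (use elim in \<open>auto simp: indicator_def\<close>)
      qed
      show "AE y in lborel. norm (indicator {a$1..b$1} y * cutoff (a$1) (b$1) (k+K) y * J (k+K) y) \<le> indicator {a$1..b$1} y * (2 * B)" for k
      proof (rule AE_I2)
        fix y
        show "norm (indicator {a$1..b$1} y * cutoff (a$1) (b$1) (k+K) y * J (k+K) y) \<le> indicator {a$1..b$1} y * (2 * B)"
        proof (cases "y \<in> {a$1..b$1}")
          case True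
          have "\<bar>J (k+K) y\<bar> \<le> 2 * B" unfolding J_def
            by (intro cutoff_deriv_integral(2) ab cH B) (use True in \<open>auto intro!: continuous_intros simp: mem_box2\<close>)
          moreover have "0 \<le> cutoff (a$1) (b$1) (k+K) y" "cutoff (a$1) (b$1) (k+K) y \<le> 1"
            by (intro cutoff_bounds K; simp)+
          ultimately show ?thesis
            using mult_mono[of "cutoff (a$1) (b$1) (k+K) y" 1 "\<bar>J (k+K) y\<bar>" "2 * B"] True by (simp add: abs_mult)
        qed simp
      qed
    qed (use m in auto)
    then have "(\<lambda>k. \<integral>y. \<integral>x. ?F k (pt y x) \<partial>lborel \<partial>lborel) \<longlonglongrightarrow>
       (\<integral>y. indicator {a$1..b$1} y * (H (pt y (a$2)) - H (pt y (b$2))) \<partial>lborel)"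
      unfolding sl by (rule LIMSEQ_offset)
    then show "(\<lambda>k. \<integral>x. ?F k x \<partial>lborel) \<longlonglongrightarrow> (\<integral>y. indicator {a$1..b$1} y * (H (pt y (a$2)) - H (pt y (b$2))) \<partial>lborel)"
      using lborel_integral_pt(2)[OF int] by simp
  }
qed

lemma AE_frontier_box: "AE x in lborel. x \<notin> cbox a b - box a (b :: 'a::euclidean_space)"
proof -
  have "AE x in lebesgue. x \<notin> cbox a b - box a b"
    using negligible_frontier_interval[of a b] negligible_iff_null_sets AE_not_in by blast
  then show ?thesis by (simp add: AE_completion_iff)
qed

lemma set_integrable_mult_continuous:
  fixes g V :: "real^2 \<Rightarrow> real"
  assumes g: "set_integrable lebesgue (box a b) g" and V: "continuous_on (cbox a b) V"
  shows "set_integrable lebesgue (box a b) (\<lambda>x. g x * V x)"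
proof -
  obtain B where B: "\<And>x. x \<in> cbox a b \<Longrightarrow> \<bar>V x\<bar> \<le> B"
    using compact_imp_bounded[OF compact_continuous_image[OF V compact_cbox]] unfolding bounded_iff by fastforce
  have gi: "integrable lebesgue (\<lambda>x. indicator (box a b) x *\<^sub>R g x)" using g unfolding set_integrable_def .
  have m: "(\<lambda>x. indicator (cbox a b) x *\<^sub>R V x) \<in> borel_measurable lebesgue"
    by (intro measurable_completion) (simp add: borel_measurable_continuous_on_indicator V del: real_scaleR_def)
  have "integrable lebesgue (\<lambda>x. (indicator (box a b) x *\<^sub>R g x) * (indicator (cbox a b) x *\<^sub>R V x))"
  proof (rule Bochner_Integration.integrable_bound[OF integrable_mult_left[OF integrable_norm[OF gi], of B]])
    show "(\<lambda>x. (indicator (box a b) x *\<^sub>R g x) * (indicator (cbox a b) x *\<^sub>R V x)) \<in> borel_measurable lebesgue"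
      using borel_measurable_integrable[OF gi] m by (rule borel_measurable_times)
    have "norm ((indicator (box a b) x *\<^sub>R g x) * (indicator (cbox a b) x *\<^sub>R V x)) \<le> norm (norm (indicator (box a b) x *\<^sub>R g x) * B)" for x
    proof (cases "x \<in> box a b")
      case True
      then have "x \<in> cbox a b" using box_subset_cbox by auto
      then show ?thesis using B[of x] True by (auto simp: abs_mult intro!: mult_left_mono)
    qed simp
    then show "AE x in lebesgue. norm ((indicator (box a b) x *\<^sub>R g x) * (indicator (cbox a b) x *\<^sub>R V x)) \<le> norm (norm (indicator (box a b) x *\<^sub>R g x) * B)"
      by blast
  qed
  moreover have *: "(indicator (box a b) x *\<^sub>R g x) * (indicator (cbox a b) x *\<^sub>R V x) = indicator (box a b) x *\<^sub>R (g x * V x)" for x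
    using box_subset_cbox[of a b] by (auto simp: indicator_def)
  ultimately show ?thesis unfolding set_integrable_def by (simp only: *)
qed

lemma set_integrable_continuous_box:
  fixes f :: "real^2 \<Rightarrow> 'b::euclidean_space"
  shows "continuous_on (cbox a b) f \<Longrightarrow> set_integrable lebesgue (box a b) f"
  by (rule set_integrable_subset[OF absolutely_integrable_continuous[of a b f]]) (auto simp: box_subset_cbox)

lemma set_integrable_nth:
  fixes G :: "real^2 \<Rightarrow> real^2"
  shows "set_integrable lebesgue A G \<Longrightarrow> set_integrable lebesgue A (\<lambda>x. G x $ i)"
  unfolding set_integrable_def
  by (drule integrable_bounded_linear[OF bounded_linear_vec_nth[of i]]) simp

lemma set_integral_box_eq_cbox:
  fixes f :: "real^2 \<Rightarrow> real"
  assumes "continuous_on (cbox a b) f"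
  shows "(LINT x:box a b|lebesgue. f x) = (\<integral>x. indicator (cbox a b) x * f x \<partial>lborel)"
proof -
  have i: "integrable lborel (\<lambda>x. indicator (cbox a b) x * f x)"
    by (intro integrable_indicator_continuous assms compact_cbox)
  have eq: "indicator (box a b) x *\<^sub>R f x = indicator (box a b) x * (indicator (cbox a b) x * f x)" for x
    using box_subset_cbox[of a b] by (auto simp: indicator_def)
  have m: "(\<lambda>x. indicator (box a b) x *\<^sub>R f x) \<in> borel_measurable borel"
    unfolding eq by (rule borel_measurable_times[OF _ borel_measurable_integrable[OF i, simplified]]) simp
  show ?thesis
    unfolding lborel_set_integral_eq_lebesgue[OF m]
    by (rule integral_cong_AE)
       (use m i AE_frontier_box[of a b] box_subset_cbox[of a b] in \<open>auto simp: indicator_def elim!: eventually_mono\<close>)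
qed

text \<open>Testing the weak gradient with \<open>cut2\<close> and letting the cut-off tend to 1
  leaves, by the product rule, the term with the differentiated cut-off;
  \<open>boundary_layer\<close> turns it into the boundary integral. Continuity on the closed
  rectangle gives the boundary values their meaning.\<close>

lemma green:
  fixes a b :: "real^2"
  assumes ab: "a$1 < b$1" "a$2 < b$2" and wg: "has_weak_gradient (box a b) F G"
    and G: "set_integrable lebesgue (box a b) G" and F: "continuous_on (cbox a b) F"
    and pq: "smooth p" "smooth q"
  shows green_1: "(LINT x:box a b|lebesgue. F x * (deriv p (x$1) * q (x$2)) + G x $ 1 * (p (x$1) * q (x$2)))
     = (\<integral>y. indicator {a$2..b$2} y * (q y * (p (b$1) * F (pt (b$1) y) - p (a$1) * F (pt (a$1) y))) \<partial>lborel)" (is ?g1)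
    and green_2: "(LINT x:box a b|lebesgue. F x * (p (x$1) * deriv q (x$2)) + G x $ 2 * (p (x$1) * q (x$2)))
     = (\<integral>y. indicator {a$1..b$1} y * (p y * (q (b$2) * F (pt y (b$2)) - q (a$2) * F (pt y (a$2)))) \<partial>lborel)" (is ?g2)
proof -
  have cp: "continuous_on A (\<lambda>x. p (f x))" "continuous_on A (\<lambda>x. deriv p (f x))"
    "continuous_on A (\<lambda>x. q (f x))" "continuous_on A (\<lambda>x. deriv q (f x))" if "continuous_on A f" for A and f :: "real^2 \<Rightarrow> real"
    using continuous_on_compose2[OF smooth_continuous[OF pq(1), of UNIV] that]
      continuous_on_compose2[OF smooth_continuous[OF smooth_deriv[OF pq(1)], of UNIV] that]
      continuous_on_compose2[OF smooth_continuous[OF pq(2), of UNIV] that]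
      continuous_on_compose2[OF smooth_continuous[OF smooth_deriv[OF pq(2)], of UNIV] that] by auto
  have iF: "set_integrable lebesgue (box a b) F" by (rule set_integrable_continuous_box[OF F])
  have weak: "(LINT x:box a b|lebesgue. F x * partial i (cut2 a b k p q) x) = - (LINT x:box a b|lebesgue. G x $ i * cut2 a b k p q x)"
    if "4 \<le> real k * (b$1 - a$1)" "4 \<le> real k * (b$2 - a$2)" for i k
    using wg test_function_cut2[OF pq that] unfolding has_weak_gradient_def by blast
  let ?c = "\<lambda>k x. cutoff (a$1) (b$1) k (x$1) * cutoff (a$2) (b$2) k (x$2)"
  have ic: "set_integrable lebesgue (box a b) (\<lambda>x. f x * ?c k x)" if "set_integrable lebesgue (box a b) f" for f k
    by (rule set_integrable_mult_continuous[OF that]) (intro continuous_intros continuous_cutoff)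
  {
    let ?f = "\<lambda>x. F x * (deriv p (x$1) * q (x$2)) + G x $ 1 * (p (x$1) * q (x$2))"
    let ?H = "\<lambda>x. F x * (p (x$1) * q (x$2))"
    let ?d = "\<lambda>k x. deriv (cutoff (a$1) (b$1) k) (x$1) * cutoff (a$2) (b$2) k (x$2)"
    have if1: "set_integrable lebesgue (box a b) (\<lambda>x. F x * (deriv p (x$1) * q (x$2)))"
      by (intro set_integrable_mult_continuous iF continuous_intros cp)
    have if2: "set_integrable lebesgue (box a b) (\<lambda>x. G x $ 1 * (p (x$1) * q (x$2)))"
      by (intro set_integrable_mult_continuous set_integrable_nth G continuous_intros cp)
    have if3: "set_integrable lebesgue (box a b) ?H"
      by (intro set_integrable_mult_continuous iF continuous_intros cp)
    have "(\<lambda>k. - (LINT x:box a b|lebesgue. ?f x * ?c k x)) \<longlonglongrightarrow> - (LINT x:box a b|lebesgue. ?f x)"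
      by (intro tendsto_minus cutoff_integral_tendsto ab set_integral_add if1 if2)
    moreover have "eventually (\<lambda>k. - (LINT x:box a b|lebesgue. ?f x * ?c k x) = (\<integral>x. indicator (cbox a b) x * (?d k x * ?H x) \<partial>lborel)) sequentially"
      using eventually_box_large[OF ab]
    proof eventually_elim
      case (elim k)
      have i0: "set_integrable lebesgue (box a b) (\<lambda>x. ?H x * ?d k x)"
        by (rule set_integrable_mult_continuous[OF if3]) (intro continuous_intros continuous_cutoff)
      have "(LINT x:box a b|lebesgue. ?H x * ?d k x) + (LINT x:box a b|lebesgue. (F x * (deriv p (x$1) * q (x$2))) * ?c k x)
        = (LINT x:box a b|lebesgue. F x * partial 1 (cut2 a b k p q) x)"
        by (subst set_integral_add(2)[symmetric, OF i0 ic[OF if1]])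
           (auto intro!: set_lebesgue_integral_cong simp: partial_cut2[OF pq] algebra_simps)
      also have "\<dots> = - (LINT x:box a b|lebesgue. (G x $ 1 * (p (x$1) * q (x$2))) * ?c k x)"
        using weak[of k 1] elim by (simp add: cut2_def tensor_def mult_ac)
      finally have "(LINT x:box a b|lebesgue. ?H x * ?d k x) = - ((LINT x:box a b|lebesgue. (F x * (deriv p (x$1) * q (x$2))) * ?c k x)
         + (LINT x:box a b|lebesgue. (G x $ 1 * (p (x$1) * q (x$2))) * ?c k x))" by simp
      also have "\<dots> = - (LINT x:box a b|lebesgue. ?f x * ?c k x)"
        by (subst set_integral_add(2)[symmetric, OF ic[OF if1] ic[OF if2]])
           (simp add: algebra_simps)
      finally have "- (LINT x:box a b|lebesgue. ?f x * ?c k x) = (LINT x:box a b|lebesgue. ?d k x * ?H x)"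
        by (simp add: mult.commute)
      also have "\<dots> = (\<integral>x. indicator (cbox a b) x * (?d k x * ?H x) \<partial>lborel)"
        by (rule set_integral_box_eq_cbox) (intro continuous_intros continuous_cutoff cp F)
      finally show ?case .
    qed
    ultimately have "(\<lambda>k. \<integral>x. indicator (cbox a b) x * (?d k x * ?H x) \<partial>lborel) \<longlonglongrightarrow> - (LINT x:box a b|lebesgue. ?f x)"
      by (rule Lim_transform_eventually)
    moreover have "(\<lambda>k. \<integral>x. indicator (cbox a b) x * (?d k x * ?H x) \<partial>lborel)
      \<longlonglongrightarrow> (\<integral>y. indicator {a$2..b$2} y * (?H (pt (a$1) y) - ?H (pt (b$1) y)) \<partial>lborel)"
      by (rule boundary_layer_1[OF ab]) (intro continuous_intros cp F)
    ultimately have "(LINT x:box a b|lebesgue. ?f x) = - (\<integral>y. indicator {a$2..b$2} y * (?H (pt (a$1) y) - ?H (pt (b$1) y)) \<partial>lborel)"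
      using LIMSEQ_unique by fastforce
    also have "\<dots> = (\<integral>y. - (indicator {a$2..b$2} y * (?H (pt (a$1) y) - ?H (pt (b$1) y))) \<partial>lborel)"
      by simp
    finally show ?g1 by (simp add: algebra_simps)
  }
  {
    let ?f = "\<lambda>x. F x * (p (x$1) * deriv q (x$2)) + G x $ 2 * (p (x$1) * q (x$2))"
    let ?H = "\<lambda>x. F x * (p (x$1) * q (x$2))"
    let ?d = "\<lambda>k x. cutoff (a$1) (b$1) k (x$1) * deriv (cutoff (a$2) (b$2) k) (x$2)"
    have if1: "set_integrable lebesgue (box a b) (\<lambda>x. F x * (p (x$1) * deriv q (x$2)))"
      by (intro set_integrable_mult_continuous iF continuous_intros cp)
    have if2: "set_integrable lebesgue (box a b) (\<lambda>x. G x $ 2 * (p (x$1) * q (x$2)))"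
      by (intro set_integrable_mult_continuous set_integrable_nth G continuous_intros cp)
    have if3: "set_integrable lebesgue (box a b) ?H"
      by (intro set_integrable_mult_continuous iF continuous_intros cp)
    have "(\<lambda>k. - (LINT x:box a b|lebesgue. ?f x * ?c k x)) \<longlonglongrightarrow> - (LINT x:box a b|lebesgue. ?f x)"
      by (intro tendsto_minus cutoff_integral_tendsto ab set_integral_add if1 if2)
    moreover have "eventually (\<lambda>k. - (LINT x:box a b|lebesgue. ?f x * ?c k x) = (\<integral>x. indicator (cbox a b) x * (?d k x * ?H x) \<partial>lborel)) sequentially"
      using eventually_box_large[OF ab]
    proof eventually_elim
      case (elim k)
      have i0: "set_integrable lebesgue (box a b) (\<lambda>x. ?H x * ?d k x)"
        by (rule set_integrable_mult_continuous[OF if3]) (intro continuous_intros continuous_cutoff)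
      have "(LINT x:box a b|lebesgue. ?H x * ?d k x) + (LINT x:box a b|lebesgue. (F x * (p (x$1) * deriv q (x$2))) * ?c k x)
        = (LINT x:box a b|lebesgue. F x * partial 2 (cut2 a b k p q) x)"
        by (subst set_integral_add(2)[symmetric, OF i0 ic[OF if1]])
           (auto intro!: set_lebesgue_integral_cong simp: partial_cut2[OF pq] algebra_simps)
      also have "\<dots> = - (LINT x:box a b|lebesgue. (G x $ 2 * (p (x$1) * q (x$2))) * ?c k x)"
        using weak[of k 2] elim by (simp add: cut2_def tensor_def mult_ac)
      finally have "(LINT x:box a b|lebesgue. ?H x * ?d k x) = - ((LINT x:box a b|lebesgue. (F x * (p (x$1) * deriv q (x$2))) * ?c k x)
         + (LINT x:box a b|lebesgue. (G x $ 2 * (p (x$1) * q (x$2))) * ?c k x))" by simp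
      also have "\<dots> = - (LINT x:box a b|lebesgue. ?f x * ?c k x)"
        by (subst set_integral_add(2)[symmetric, OF ic[OF if1] ic[OF if2]])
           (simp add: algebra_simps)
      finally have "- (LINT x:box a b|lebesgue. ?f x * ?c k x) = (LINT x:box a b|lebesgue. ?d k x * ?H x)"
        by (simp add: mult.commute)
      also have "\<dots> = (\<integral>x. indicator (cbox a b) x * (?d k x * ?H x) \<partial>lborel)"
        by (rule set_integral_box_eq_cbox) (intro continuous_intros continuous_cutoff cp F)
      finally show ?case .
    qed
    ultimately have "(\<lambda>k. \<integral>x. indicator (cbox a b) x * (?d k x * ?H x) \<partial>lborel) \<longlonglongrightarrow> - (LINT x:box a b|lebesgue. ?f x)"
      by (rule Lim_transform_eventually)
    moreover have "(\<lambda>k. \<integral>x. indicator (cbox a b) x * (?d k x * ?H x) \<partial>lborel)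
      \<longlonglongrightarrow> (\<integral>y. indicator {a$1..b$1} y * (?H (pt y (a$2)) - ?H (pt y (b$2))) \<partial>lborel)"
      by (rule boundary_layer_2[OF ab]) (intro continuous_intros cp F)
    ultimately have "(LINT x:box a b|lebesgue. ?f x) = - (\<integral>y. indicator {a$1..b$1} y * (?H (pt y (a$2)) - ?H (pt y (b$2))) \<partial>lborel)"
      using LIMSEQ_unique by fastforce
    also have "\<dots> = (\<integral>y. - (indicator {a$1..b$1} y * (?H (pt y (a$2)) - ?H (pt y (b$2)))) \<partial>lborel)"
      by simp
    finally show ?g2 by (simp add: algebra_simps)
  }
qed

subsection \<open>Square integrable functions and weak gradients\<close>

text \<open>Cauchy-Schwarz against the constant 1, whose norm is finite here. Extended nonnegative
  integrals are used throughout, so no integrability has to be known beforehand.\<close>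

lemma L2_conv_imp_L1_conv:
  fixes d :: "nat \<Rightarrow> 'a \<Rightarrow> real"
  assumes fin: "finite_measure M" and m[measurable]: "\<And>n. d n \<in> borel_measurable M"
    and lim: "(\<lambda>n. \<integral>\<^sup>+x. ennreal ((d n x)\<^sup>2) \<partial>M) \<longlonglongrightarrow> 0"
  shows "(\<lambda>n. \<integral>\<^sup>+x. ennreal \<bar>d n x\<bar> \<partial>M) \<longlonglongrightarrow> 0"
proof (rule tendsto_zero_ennreal)
  fix r :: real assume r: "0 < r"
  interpret finite_measure M by fact
  have "(\<lambda>n. emeasure M (space M) * (\<integral>\<^sup>+x. ennreal ((d n x)\<^sup>2) \<partial>M)) \<longlonglongrightarrow> emeasure M (space M) * 0"
    by (intro ennreal_tendsto_cmult lim) (simp add: less_top[symmetric])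
  then have "eventually (\<lambda>n. emeasure M (space M) * (\<integral>\<^sup>+x. ennreal ((d n x)\<^sup>2) \<partial>M) < ennreal (r\<^sup>2)) sequentially"
    using r by (intro order_tendstoD(2)) auto
  then show "eventually (\<lambda>n. (\<integral>\<^sup>+x. ennreal \<bar>d n x\<bar> \<partial>M) < ennreal r) sequentially"
  proof eventually_elim
    case (elim n)
    have "(\<integral>\<^sup>+x. ennreal \<bar>d n x\<bar> * 1 \<partial>M)\<^sup>2 \<le> (\<integral>\<^sup>+x. (ennreal \<bar>d n x\<bar>)\<^sup>2 \<partial>M) * (\<integral>\<^sup>+x. 1\<^sup>2 \<partial>M)"
      by (rule Cauchy_Schwarz_nn_integral) auto
    also have "\<dots> = emeasure M (space M) * (\<integral>\<^sup>+x. ennreal ((d n x)\<^sup>2) \<partial>M)"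
      by (simp add: ennreal_power mult.commute)
    also have "\<dots> < (ennreal r)\<^sup>2" using elim r by (simp add: ennreal_power)
    finally have "(\<integral>\<^sup>+x. ennreal \<bar>d n x\<bar> \<partial>M)\<^sup>2 < (ennreal r)\<^sup>2" by simp
    then show ?case using power_mono[of "ennreal r" "\<integral>\<^sup>+x. ennreal \<bar>d n x\<bar> \<partial>M" 2] by (force simp: not_less[symmetric])
  qed
qed

lemma L2_conv_integral:
  fixes d :: "nat \<Rightarrow> 'a \<Rightarrow> real"
  assumes fin: "finite_measure M" and m[measurable]: "\<And>n. d n \<in> borel_measurable M"
    and lim: "(\<lambda>n. \<integral>\<^sup>+x. ennreal ((d n x)\<^sup>2) \<partial>M) \<longlonglongrightarrow> 0"
    and w[measurable]: "w \<in> borel_measurable M" and B: "\<And>x. x \<in> space M \<Longrightarrow> \<bar>w x\<bar> \<le> B"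
  shows "(\<lambda>n. \<integral>x. d n x * w x \<partial>M) \<longlonglongrightarrow> 0"
proof -
  have lim1: "(\<lambda>n. ennreal \<bar>B\<bar> * (\<integral>\<^sup>+x. ennreal \<bar>d n x\<bar> \<partial>M)) \<longlonglongrightarrow> ennreal \<bar>B\<bar> * 0"
    by (intro ennreal_tendsto_cmult L2_conv_imp_L1_conv[OF fin m lim]) simp
  have bound: "ennreal \<bar>\<integral>x. d n x * w x \<partial>M\<bar> \<le> ennreal \<bar>B\<bar> * (\<integral>\<^sup>+x. ennreal \<bar>d n x\<bar> \<partial>M)" for n
  proof (cases "integrable M (\<lambda>x. d n x * w x)")
    case True
    have "ennreal \<bar>\<integral>x. d n x * w x \<partial>M\<bar> \<le> (\<integral>\<^sup>+x. ennreal (norm (d n x * w x)) \<partial>M)"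
      using integral_norm_bound_ennreal[OF True] by simp
    also have "\<dots> \<le> (\<integral>\<^sup>+x. ennreal \<bar>B\<bar> * ennreal \<bar>d n x\<bar> \<partial>M)"
    proof (rule nn_integral_mono)
      fix x assume "x \<in> space M"
      from B[OF this] have "\<bar>d n x * w x\<bar> \<le> \<bar>B\<bar> * \<bar>d n x\<bar>"
        by (simp add: abs_mult mult.commute mult_right_mono)
      then show "ennreal (norm (d n x * w x)) \<le> ennreal \<bar>B\<bar> * ennreal \<bar>d n x\<bar>"
        by (simp add: ennreal_mult[symmetric] ennreal_leI)
    qed
    also have "\<dots> = ennreal \<bar>B\<bar> * (\<integral>\<^sup>+x. ennreal \<bar>d n x\<bar> \<partial>M)" by (rule nn_integral_cmult) auto
    finally show ?thesis .
  \<comment> \<open>Without integrability the integral has the default value 0, and the bound is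
    trivial.\<close>
  qed (simp add: not_integrable_integral_eq)
  have "(\<lambda>n. ennreal \<bar>\<integral>x. d n x * w x \<partial>M\<bar>) \<longlonglongrightarrow> 0"
    by (rule tendsto_sandwich[OF _ _ tendsto_const lim1[simplified]]) (use bound in auto)
  then have "(\<lambda>n. ennreal \<bar>\<integral>x. d n x * w x \<partial>M\<bar>) \<longlonglongrightarrow> ennreal 0" by simp
  then have "(\<lambda>n. \<bar>\<integral>x. d n x * w x \<partial>M\<bar>) \<longlonglongrightarrow> 0"
    by (subst (asm) tendsto_ennreal_iff) (rule always_eventually, simp_all)
  then show ?thesis by (simp add: tendsto_rabs_zero_iff)
qed

lemma set_integrable_mult_bounded:
  fixes g V :: "real^2 \<Rightarrow> real"
  assumes g: "set_integrable lebesgue A g" and V: "V \<in> borel_measurable lebesgue"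
    and B: "\<And>x. x \<in> A \<Longrightarrow> \<bar>V x\<bar> \<le> B"
  shows "set_integrable lebesgue A (\<lambda>x. g x * V x)"
proof -
  have gi: "integrable lebesgue (\<lambda>x. indicator A x *\<^sub>R g x)" using g unfolding set_integrable_def .
  have "integrable lebesgue (\<lambda>x. (indicator A x *\<^sub>R g x) * V x)"
  proof (rule Bochner_Integration.integrable_bound[OF integrable_mult_left[OF integrable_norm[OF gi], of B]])
    show "(\<lambda>x. (indicator A x *\<^sub>R g x) * V x) \<in> borel_measurable lebesgue"
      using borel_measurable_integrable[OF gi] V by (rule borel_measurable_times)
    have "norm ((indicator A x *\<^sub>R g x) * V x) \<le> norm (norm (indicator A x *\<^sub>R g x) * B)" for x
      using B[of x] by (cases "x \<in> A") (auto simp: abs_mult intro!: mult_left_mono)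
    then show "AE x in lebesgue. norm ((indicator A x *\<^sub>R g x) * V x) \<le> norm (norm (indicator A x *\<^sub>R g x) * B)"
      by blast
  qed
  then show ?thesis unfolding set_integrable_def by (simp add: mult.assoc)
qed

lemma borel_measurable_lebesgue_continuous: 
  "continuous_on UNIV f \<Longrightarrow> f \<in> borel_measurable (lebesgue :: 'a::euclidean_space measure)"
  by (intro measurable_completion) (simp add: borel_measurable_continuous_onI)

lemma test_function_continuous:
  assumes "test_function U \<phi>"
  shows "continuous_on UNIV \<phi>" "continuous_on UNIV (partial i \<phi>)" "\<phi> differentiable (at x)"
proof -
  have "Ck_on (Suc 0) UNIV \<phi>" "Ck_on 0 UNIV \<phi>" using assms unfolding test_function_def by blast+
  then show "continuous_on UNIV \<phi>" "continuous_on UNIV (partial i \<phi>)" "\<phi> differentiable (at x)" by auto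
qed

lemma partial_has_derivative:
  fixes f :: "real^2 \<Rightarrow> real"
  assumes "(f has_derivative (\<lambda>h. v \<bullet> h)) (at x)"
  shows "partial i f x = v $ i"
  unfolding partial_def frechet_derivative_at[OF assms, symmetric] by (simp add: inner_axis)

lemma partial_eq_0_outside:
  fixes f :: "real^2 \<Rightarrow> real"
  assumes "closed C" "\<And>x. x \<notin> C \<Longrightarrow> f x = 0" "x \<notin> C"
  shows "(f has_derivative (\<lambda>h. 0)) (at x)" "partial i f x = 0"
proof -
  show *: "(f has_derivative (\<lambda>h. 0)) (at x)"
    by (rule has_derivative_transform_within_open[of "\<lambda>x. 0" _ x UNIV "- C"])
       (use assms in \<open>auto simp: open_Compl\<close>)
  show "partial i f x = 0"
    unfolding partial_def frechet_derivative_at[OF *, symmetric] by simp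
qed

lemma set_integrable_test:
  fixes g :: "real^2 \<Rightarrow> real"
  assumes g: "\<And>C. compact C \<Longrightarrow> C \<subseteq> U \<Longrightarrow> set_integrable lebesgue C g"
    and C: "compact C" "C \<subseteq> U" "\<And>x. x \<notin> C \<Longrightarrow> \<psi> x = 0" and \<psi>: "continuous_on UNIV \<psi>"
  shows "set_integrable lebesgue U (\<lambda>x. g x * \<psi> x)"
proof -
  have "bounded (\<psi> ` C)"
    using C(1) \<psi> by (intro compact_imp_bounded compact_continuous_image) (auto intro: continuous_on_subset)
  then obtain B where "\<And>x. x \<in> C \<Longrightarrow> \<bar>\<psi> x\<bar> \<le> B" unfolding bounded_iff by fastforce
  then have "set_integrable lebesgue C (\<lambda>x. g x * \<psi> x)"
    using \<psi> by (intro set_integrable_mult_bounded g C borel_measurable_lebesgue_continuous) auto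
  moreover have *: "indicator C x *\<^sub>R (g x * \<psi> x) = indicator U x *\<^sub>R (g x * \<psi> x)" for x
    using C by (auto simp: indicator_def)
  ultimately show ?thesis unfolding set_integrable_def by (simp only: *)
qed

lemma test_function_support:
  assumes "test_function U \<phi>"
  obtains C where "compact C" "C \<subseteq> U" "\<And>x. x \<notin> C \<Longrightarrow> \<phi> x = 0" "\<And>x i. x \<notin> C \<Longrightarrow> partial i \<phi> x = 0"
proof -
  obtain C where C: "compact C" "C \<subseteq> U" "\<And>x. x \<notin> C \<Longrightarrow> \<phi> x = 0"
    using assms unfolding test_function_def by blast
  then show thesis using that[OF C partial_eq_0_outside(2)[OF compact_imp_closed[OF C(1)] C(3)]] by blast
qed

lemma vec_AE_iff: "(AE x in M. P x \<longrightarrow> G x = (H x :: real^2)) \<longleftrightarrow> (\<forall>i. AE x in M. P x \<longrightarrow> G x $ i = H x $ i)"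
  by (simp add: vec_eq_iff forall_2 imp_conjR AE_conj_iff)

text \<open>Makes the choice inside \<open>weak_gradient\<close> harmless: almost everywhere it may
  be replaced by any weak gradient that is known explicitly.\<close>

lemma has_weak_gradient_unique:
  assumes U: "open U" and G: "has_weak_gradient U f G" and H: "has_weak_gradient U f H"
  shows "AE x in lebesgue. x \<in> U \<longrightarrow> G x = H x"
  unfolding vec_AE_iff
proof
  fix i
  have iG: "set_integrable lebesgue C (\<lambda>x. G x $ i)" and iH: "set_integrable lebesgue C (\<lambda>x. H x $ i)"
    if "compact C" "C \<subseteq> U" for C
    using G H that unfolding has_weak_gradient_def by (auto intro!: set_integrable_nth)
  have "AE x in lebesgue. x \<in> U \<longrightarrow> G x $ i - H x $ i = 0"
  proof (rule fundamental_lemma[OF _ U])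
    fix C assume "compact C" "C \<subseteq> U"
    then show "set_integrable lebesgue C (\<lambda>x. G x $ i - H x $ i)"
      by (intro set_integral_diff iG iH)
  next
    fix p q assume t: "test_function U (tensor p q)"
    obtain C where C: "compact C" "C \<subseteq> U" "\<And>x. x \<notin> C \<Longrightarrow> tensor p q x = 0"
      using t unfolding test_function_def by blast
    note i = set_integrable_test[OF iG C test_function_continuous(1)[OF t]]
      set_integrable_test[OF iH C test_function_continuous(1)[OF t]]
    have "(LINT x:U|lebesgue. (G x $ i - H x $ i) * tensor p q x) = (LINT x:U|lebesgue. G x $ i * tensor p q x) - (LINT x:U|lebesgue. H x $ i * tensor p q x)"
      unfolding left_diff_distrib by (rule set_integral_diff(2)[OF i])
    also have "\<dots> = 0"
    proof -
      have "(LINT x:U|lebesgue. f x * partial i (tensor p q) x) = - (LINT x:U|lebesgue. G x $ i * tensor p q x)"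
        using G t unfolding has_weak_gradient_def by blast
      moreover have "(LINT x:U|lebesgue. f x * partial i (tensor p q) x) = - (LINT x:U|lebesgue. H x $ i * tensor p q x)"
        using H t unfolding has_weak_gradient_def by blast
      ultimately show ?thesis by simp
    qed
    finally show "(LINT x:U|lebesgue. (G x $ i - H x $ i) * tensor p q x) = 0" .
  qed
  then show "AE x in lebesgue. x \<in> U \<longrightarrow> G x $ i = H x $ i" by simp
qed

lemma has_weak_gradient_weak_gradient: "has_weak_gradient U f G \<Longrightarrow> has_weak_gradient U f (weak_gradient U f)"
  unfolding weak_gradient_def by (rule someI[of "has_weak_gradient U f"])

lemma weak_gradient_AE_eq:
  "open U \<Longrightarrow> has_weak_gradient U f G \<Longrightarrow> AE x in lebesgue. x \<in> U \<longrightarrow> weak_gradient U f x = G x"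
  by (rule has_weak_gradient_unique[OF _ has_weak_gradient_weak_gradient])

lemma L2_on_iff:
  fixes f :: "real^2 \<Rightarrow> 'b::euclidean_space"
  assumes "U \<in> sets lebesgue"
  shows "L2_on U f \<longleftrightarrow> (\<lambda>x. indicator U x *\<^sub>R f x) \<in> borel_measurable lebesgue \<and>
     integrable lebesgue (\<lambda>x. indicator U x *\<^sub>R (norm (f x))\<^sup>2)"
  unfolding L2_on_def using assms by (simp add: borel_measurable_restrict_space_iff integrable_restrict_space)

lemma L2_on_AE_cong:
  fixes f g :: "real^2 \<Rightarrow> 'b::euclidean_space"
  assumes U: "U \<in> sets lebesgue" and f: "L2_on U f" and ae: "AE x in lebesgue. x \<in> U \<longrightarrow> f x = g x"
  shows "L2_on U g"
proof -
  have m: "(\<lambda>x. indicator U x *\<^sub>R f x) \<in> borel_measurable lebesgue"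
    and i: "integrable lebesgue (\<lambda>x. indicator U x *\<^sub>R (norm (f x))\<^sup>2)"
    using f L2_on_iff[OF U] by auto
  have m': "(\<lambda>x. indicator U x *\<^sub>R g x) \<in> borel_measurable lebesgue"
    by (rule borel_measurable_AE[OF m]) (use ae in \<open>auto elim!: eventually_mono simp: indicator_def\<close>)
  have e: "AE x in lebesgue. indicator U x *\<^sub>R (norm (f x))\<^sup>2 = indicator U x *\<^sub>R (norm (g x))\<^sup>2"
    using ae by (auto elim!: eventually_mono simp: indicator_def)
  have "integrable lebesgue (\<lambda>x. indicator U x *\<^sub>R (norm (g x))\<^sup>2)"
    using integrable_cong_AE[OF borel_measurable_integrable[OF i] borel_measurable_AE[OF borel_measurable_integrable[OF i] e] e] i by simp
  with m' show ?thesis using L2_on_iff[OF U] by auto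
qed

lemma W12_weak_gradient:
  assumes "open U" "f \<in> W12 U"
  shows "L2_on U f" "has_weak_gradient U f (weak_gradient U f)" "L2_on U (weak_gradient U f)"
proof -
  obtain G where G: "L2_on U f" "has_weak_gradient U f G" "L2_on U G" using assms(2) unfolding W12_def by blast
  show "L2_on U f" by fact
  show w: "has_weak_gradient U f (weak_gradient U f)" by (rule has_weak_gradient_weak_gradient[OF G(2)])
  have "AE x in lebesgue. x \<in> U \<longrightarrow> G x = weak_gradient U f x"
    by (rule has_weak_gradient_unique[OF assms(1) G(2) w])
  then show "L2_on U (weak_gradient U f)" by (rule L2_on_AE_cong[rotated 2]) (use assms G in auto)
qed

lemma L2_on_integrable_product:
  fixes f g :: "real^2 \<Rightarrow> 'b::euclidean_space"
  assumes U: "U \<in> sets lebesgue" and f: "L2_on U f" and g: "L2_on U g"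
  shows "set_integrable lebesgue U (\<lambda>x. f x \<bullet> g x)"
proof -
  note F = f[unfolded L2_on_iff[OF U]] and G = g[unfolded L2_on_iff[OF U]]
  have "integrable lebesgue (\<lambda>x. indicator U x *\<^sub>R (norm (f x))\<^sup>2 + indicator U x *\<^sub>R (norm (g x))\<^sup>2)"
    using F G by (intro Bochner_Integration.integrable_add) auto
  then have "integrable lebesgue (\<lambda>x. (indicator U x *\<^sub>R f x) \<bullet> (indicator U x *\<^sub>R g x))"
  proof (rule Bochner_Integration.integrable_bound)
    show "(\<lambda>x. (indicator U x *\<^sub>R f x) \<bullet> (indicator U x *\<^sub>R g x)) \<in> borel_measurable lebesgue"
      using F G by (intro borel_measurable_inner) auto
    have "\<bar>f x \<bullet> g x\<bar> \<le> (norm (f x))\<^sup>2 + (norm (g x))\<^sup>2" for x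
    proof -
      have "\<bar>f x \<bullet> g x\<bar> \<le> norm (f x) * norm (g x)" by (rule Cauchy_Schwarz_ineq2)
      moreover have "2 * (norm (f x) * norm (g x)) \<le> (norm (f x))\<^sup>2 + (norm (g x))\<^sup>2"
        using sum_squares_bound[of "norm (f x)" "norm (g x)"] by simp
      moreover have "0 \<le> norm (f x) * norm (g x)" by simp
      ultimately show ?thesis by linarith
    qed
    then show "AE x in lebesgue. norm ((indicator U x *\<^sub>R f x) \<bullet> (indicator U x *\<^sub>R g x)) \<le>
       norm (indicator U x *\<^sub>R (norm (f x))\<^sup>2 + indicator U x *\<^sub>R (norm (g x))\<^sup>2)"
      by (intro AE_I2) (auto simp: indicator_def)
  qed
  moreover have *: "(indicator U x *\<^sub>R f x) \<bullet> (indicator U x *\<^sub>R g x) = indicator U x *\<^sub>R (f x \<bullet> g x)" for x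
    by (auto simp: indicator_def)
  ultimately show ?thesis unfolding set_integrable_def by (simp only: *)
qed

lemma L2_on_bounded:
  fixes f :: "real^2 \<Rightarrow> 'b::euclidean_space"
  assumes U: "U \<in> lmeasurable" and m: "(\<lambda>x. indicator U x *\<^sub>R f x) \<in> borel_measurable lebesgue"
    and B: "\<And>x. x \<in> U \<Longrightarrow> norm (f x) \<le> B"
  shows "L2_on U f"
proof -
  have Us: "U \<in> sets lebesgue" using U by blast
  have "set_integrable lebesgue U (\<lambda>x. B\<^sup>2)"
    using U unfolding set_integrable_def by (simp add: lmeasurable_iff_integrable)
  then have i: "integrable lebesgue (\<lambda>x. indicator U x *\<^sub>R B\<^sup>2)" unfolding set_integrable_def .
  have "integrable lebesgue (\<lambda>x. indicator U x *\<^sub>R (norm (f x))\<^sup>2)"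
  proof (rule Bochner_Integration.integrable_bound[OF i])
    have "(\<lambda>x. (norm (indicator U x *\<^sub>R f x))\<^sup>2) \<in> borel_measurable lebesgue" using m by measurable
    moreover have *: "(norm (indicator U x *\<^sub>R f x))\<^sup>2 = indicator U x *\<^sub>R (norm (f x))\<^sup>2" for x by (auto simp: indicator_def)
    ultimately show "(\<lambda>x. indicator U x *\<^sub>R (norm (f x))\<^sup>2) \<in> borel_measurable lebesgue" by (simp only: *)
    show "AE x in lebesgue. norm (indicator U x *\<^sub>R (norm (f x))\<^sup>2) \<le> norm (indicator U x *\<^sub>R B\<^sup>2)"
      using B by (intro AE_I2) (auto simp: indicator_def intro!: power_mono)
  qed
  with m show ?thesis using L2_on_iff[OF Us] by auto
qed

lemma L2_on_integrable:
  fixes f :: "real^2 \<Rightarrow> 'b::euclidean_space"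
  assumes U: "U \<in> lmeasurable" and f: "L2_on U f"
  shows "set_integrable lebesgue U f"
proof -
  have Us: "U \<in> sets lebesgue" using U by blast
  note F = f[unfolded L2_on_iff[OF Us]]
  have "integrable lebesgue (\<lambda>x. indicator U x *\<^sub>R (1::real))"
    using U by (simp add: lmeasurable_iff_integrable)
  then have "integrable lebesgue (\<lambda>x. indicator U x *\<^sub>R (1::real) + indicator U x *\<^sub>R (norm (f x))\<^sup>2)"
    using F by (intro Bochner_Integration.integrable_add) auto
  then show ?thesis unfolding set_integrable_def
  proof (rule Bochner_Integration.integrable_bound)
    have "norm (f x) \<le> 1 + (norm (f x))\<^sup>2" for x
    proof -
      have "0 \<le> (norm (f x) - 1)\<^sup>2" by simp
      then have "2 * norm (f x) \<le> 1 + (norm (f x))\<^sup>2" by (simp add: power2_eq_square algebra_simps)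
      moreover have "0 \<le> norm (f x)" by simp
      ultimately show ?thesis by linarith
    qed
    then show "AE x in lebesgue. norm (indicator U x *\<^sub>R f x) \<le>
       norm (indicator U x *\<^sub>R (1::real) + indicator U x *\<^sub>R (norm (f x))\<^sup>2)"
      by (intro AE_I2) (auto simp: indicator_def)
  qed (use F in auto)
qed

lemma L2_on_nth: "U \<in> sets lebesgue \<Longrightarrow> L2_on U G \<Longrightarrow> L2_on U (\<lambda>x. (G x :: real^2) $ i)"
proof -
  assume U: "U \<in> sets lebesgue" and G: "L2_on U G"
  note G' = G[unfolded L2_on_iff[OF U]]
  have "(\<lambda>x. (indicator U x *\<^sub>R G x) $ i) \<in> borel_measurable lebesgue"
    using measurable_compose[OF conjunct1[OF G'] borel_measurable_continuous_onI[of "\<lambda>x::real^2. x $ i"]]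
    by (simp add: continuous_intros)
  then have m: "(\<lambda>x. indicator U x *\<^sub>R G x $ i) \<in> borel_measurable lebesgue" by simp
  have "integrable lebesgue (\<lambda>x. indicator U x *\<^sub>R (norm (G x $ i))\<^sup>2)"
  proof (rule Bochner_Integration.integrable_bound[of lebesgue "\<lambda>x. indicator U x *\<^sub>R (norm (G x))\<^sup>2"])
    have "(\<lambda>x. (norm (indicator U x *\<^sub>R G x $ i))\<^sup>2) \<in> borel_measurable lebesgue" using m by measurable
    moreover have *: "(norm (indicator U x *\<^sub>R G x $ i))\<^sup>2 = indicator U x *\<^sub>R (norm (G x $ i))\<^sup>2" for x by (auto simp: indicator_def)
    ultimately show "(\<lambda>x. indicator U x *\<^sub>R (norm (G x $ i))\<^sup>2) \<in> borel_measurable lebesgue" by (simp only: *)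
    show "AE x in lebesgue. norm (indicator U x *\<^sub>R (norm (G x $ i))\<^sup>2) \<le> norm (indicator U x *\<^sub>R (norm (G x))\<^sup>2)"
      by (intro AE_I2) (auto simp: indicator_def abs_le_square_iff[symmetric] component_le_norm_cart)
  qed (use G' in auto)
  with m show ?thesis unfolding L2_on_iff[OF U] by blast
qed

text \<open>Fubini reduces the claim to the fundamental theorem of calculus on lines. On a
  horizontal line finitely many exceptional points do no harm to a continuous function, and the
  exceptional vertical lines form a null set.\<close>

lemma integral_compact_support_gradient:
  fixes \<Phi> :: "real^2 \<Rightarrow> real" and K :: "real^2 \<Rightarrow> real^2"
  assumes N: "finite N" and C: "compact C" "\<And>x. x \<notin> C \<Longrightarrow> \<Phi> x = 0" "\<And>x. x \<notin> C \<Longrightarrow> K x = 0"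
    and cont: "continuous_on UNIV \<Phi>"
    and D: "\<And>x. x$1 \<notin> N \<Longrightarrow> (\<Phi> has_derivative (\<lambda>h. K x \<bullet> h)) (at x)"
    and int: "integrable lborel (\<lambda>x. K x $ i)"
  shows "(\<integral>x. K x $ i \<partial>lborel) = 0"
proof -
  obtain R where R: "\<And>x. x \<in> C \<Longrightarrow> norm x < R" "R > 0"
    using compact_imp_bounded[OF C(1)] unfolding bounded_pos_less by blast
  have out: "\<Phi> (pt s y) = 0 \<and> K (pt s y) = 0" if "\<bar>s\<bar> \<ge> R \<or> \<bar>y\<bar> \<ge> R" for s y
    using component_le_norm_cart[of "pt s y" 1] component_le_norm_cart[of "pt s y" 2] R(1)[of "pt s y"] C(2,3)[of "pt s y"] that
    by fastforce
  have cl: "continuous_on A (\<lambda>s. \<Phi> (pt (f s) (g s)))" if "continuous_on A f" "continuous_on A g" for A and f g :: "real \<Rightarrow> real"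
    by (rule continuous_on_compose2[OF cont]) (use that in \<open>auto intro!: continuous_intros\<close>)
  have z1: "(\<integral>s. K (pt s y) $ 1 \<partial>lborel) = 0" if i: "integrable lborel (\<lambda>s. K (pt s y) $ 1)" for y
  proof -
    have "((\<lambda>s. K (pt s y) $ 1) has_integral (\<Phi> (pt R y) - \<Phi> (pt (-R) y))) {-R..R}"
    proof (rule fundamental_theorem_of_calculus_interior_strong[OF N])
      show "continuous_on {-R..R} (\<lambda>s. \<Phi> (pt s y))" by (intro cl continuous_intros)
      fix s assume "s \<in> {-R<..<R} - N"
      then have D': "(\<Phi> has_derivative (\<lambda>h. K (pt s y) \<bullet> h)) (at (pt s y))" by (intro D) auto
      have "((\<lambda>s. pt s y) has_derivative (\<lambda>h. h *\<^sub>R axis 1 1)) (at s)"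
        unfolding pt_eq by (auto intro!: derivative_eq_intros)
      from has_derivative_compose[OF this D']
      show "((\<lambda>s. \<Phi> (pt s y)) has_vector_derivative K (pt s y) $ 1) (at s)"
        unfolding has_vector_derivative_def by (simp add: inner_axis)
    qed (use R in auto)
    then have "((\<lambda>s. K (pt s y) $ 1) has_integral 0) {-R..R}" using out[of R y] out[of "-R" y] R(2) by simp
    then have "((\<lambda>s. K (pt s y) $ 1) has_integral 0) UNIV"
      by (rule has_integral_on_superset) (use out[of _ y] in fastforce)+
    then show ?thesis using has_integral_integral_lborel[OF i] has_integral_unique by blast
  qed
  have z2: "(\<integral>s. K (pt y s) $ 2 \<partial>lborel) = 0" if i: "integrable lborel (\<lambda>s. K (pt y s) $ 2)" and y: "y \<notin> N" for y
  proof -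
    have "((\<lambda>s. K (pt y s) $ 2) has_integral (\<Phi> (pt y R) - \<Phi> (pt y (-R)))) {-R..R}"
    proof (rule fundamental_theorem_of_calculus_interior_strong[of "{}"])
      show "continuous_on {-R..R} (\<lambda>s. \<Phi> (pt y s))" by (intro cl continuous_intros)
      fix s
      have D': "(\<Phi> has_derivative (\<lambda>h. K (pt y s) \<bullet> h)) (at (pt y s))" using y by (intro D) auto
      have "((\<lambda>s. pt y s) has_derivative (\<lambda>h. h *\<^sub>R axis 2 1)) (at s)"
        unfolding pt_eq by (auto intro!: derivative_eq_intros)
      from has_derivative_compose[OF this D']
      show "((\<lambda>s. \<Phi> (pt y s)) has_vector_derivative K (pt y s) $ 2) (at s)"
        unfolding has_vector_derivative_def by (simp add: inner_axis)
    qed (use R in auto)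
    then have "((\<lambda>s. K (pt y s) $ 2) has_integral 0) {-R..R}" using out[of y R] out[of y "-R"] R(2) by simp
    then have "((\<lambda>s. K (pt y s) $ 2) has_integral 0) UNIV"
      by (rule has_integral_on_superset) (use out[of y] in fastforce)+
    then show ?thesis using has_integral_integral_lborel[OF i] has_integral_unique by blast
  qed
  have "i = 1 \<or> i = 2" using exhaust_2[of i] by auto
  then show ?thesis
  proof
    assume i: "i = 1"
    have "(\<integral>y. \<integral>x. K (pt x y) $ 1 \<partial>lborel \<partial>lborel) = 0"
      by (rule integral_eq_zero_AE) (use lborel_integral_pt(3)[OF int] z1 i in \<open>auto elim!: eventually_mono\<close>)
    then show ?thesis using lborel_integral_pt(1)[OF int] i by simp
  next
    assume i: "i = 2"
    have "AE x in lborel. x \<notin> N"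
      using N by (intro AE_not_in finite_imp_null_set_lborel)
    then have "AE x in lborel. (\<integral>y. K (pt x y) $ 2 \<partial>lborel) = 0"
      using lborel_integral_pt(4)[OF int] unfolding i by eventually_elim (auto intro!: z2)
    then have "(\<integral>x. \<integral>y. K (pt x y) $ 2 \<partial>lborel \<partial>lborel) = 0" by (rule integral_eq_zero_AE)
    then show ?thesis using lborel_integral_pt(2)[OF int] i by simp
  qed
qed

lemma AE_line: "finite N \<Longrightarrow> AE x in lebesgue. (x::real^2) $ 1 \<notin> N"
proof -
  assume N: "finite N"
  have "negligible {x::real^2. x $ 1 = c}" for c
    using negligible_standard_hyperplane[of "axis 1 1 :: real^2" c] by (simp add: Basis_vec2 inner_axis)
  then have "{x::real^2. x $ 1 = c} \<in> null_sets lebesgue" for c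
    by (simp only: negligible_iff_null_sets)
  from AE_not_in[OF this] have "AE x in lebesgue. (x::real^2) $ 1 \<noteq> c" for c by simp
  then have "AE x in lebesgue. \<forall>c\<in>N. (x::real^2) $ 1 \<noteq> c"
    using N by (intro AE_ball_countable[THEN iffD2]) (auto simp: countable_finite)
  then show ?thesis by eventually_elim auto
qed

text \<open>The exceptional vertical lines admit functions that are glued continuously along a line,
  such as the candidate across x1 = 1/2, where its gradient may jump. The proof integrates the
  gradient of \<open>f\<close> times a test function.\<close>

lemma classical_weak_gradient:
  fixes f :: "real^2 \<Rightarrow> real" and G :: "real^2 \<Rightarrow> real^2"
  assumes U: "open U" and N: "finite N" and f: "continuous_on U f"
    and D: "\<And>x. x \<in> U \<Longrightarrow> x$1 \<notin> N \<Longrightarrow> (f has_derivative (\<lambda>h. G x \<bullet> h)) (at x)"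
    and G: "continuous_on (U \<inter> {x. x$1 \<notin> N}) G"
    and int: "\<And>C. compact C \<Longrightarrow> C \<subseteq> U \<Longrightarrow> set_integrable lebesgue C G"
  shows "has_weak_gradient U f G"
  unfolding has_weak_gradient_def
proof (intro conjI allI impI)
  fix C :: "(real^2) set" assume "compact C \<and> C \<subseteq> U"
  then have C: "compact C" "C \<subseteq> U" by auto
  show "set_integrable lebesgue C G" by (rule int[OF C])
  have "integrable lborel (\<lambda>x. indicator C x *\<^sub>R f x)"
    by (rule borel_integrable_compact[OF C(1)]) (use f C continuous_on_subset in blast)
  then show "set_integrable lebesgue C f" unfolding set_integrable_def
    by (subst integrable_completion) auto
next
  fix \<phi> i assume t: "test_function U \<phi>"
  obtain C where C: "compact C" "C \<subseteq> U" "\<And>x. x \<notin> C \<Longrightarrow> \<phi> x = 0" "\<And>x i. x \<notin> C \<Longrightarrow> partial i \<phi> x = 0"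
    using test_function_support[OF t] by metis
  note cphi = test_function_continuous[OF t]
  have fi: "set_integrable lebesgue C f" if "compact C" "C \<subseteq> U" for C
  proof -
    have "integrable lborel (\<lambda>x. indicator C x *\<^sub>R f x)"
      by (rule borel_integrable_compact[OF that(1)]) (use f that continuous_on_subset in blast)
    then show ?thesis unfolding set_integrable_def by (subst integrable_completion) auto
  qed
  have Gi: "set_integrable lebesgue C (\<lambda>x. G x $ i)" if "compact C" "C \<subseteq> U" for C
    by (intro set_integrable_nth int that)
  have i1: "set_integrable lebesgue U (\<lambda>x. f x * partial i \<phi> x)"
    by (rule set_integrable_test[OF fi C(1,2,4) cphi(2)])
  have i2: "set_integrable lebesgue U (\<lambda>x. G x $ i * \<phi> x)"
    by (rule set_integrable_test[OF Gi C(1,2,3) cphi(1)])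
  define V where "V = U \<inter> {x. x$1 \<notin> N}"
  have openV: "open V"
  proof -
    have "closed N" using N by (simp add: finite_imp_closed)
    then have "closed ((\<lambda>x::real^2. x$1) -` N)" by (intro closed_vimage) (auto intro!: continuous_intros)
    then show ?thesis unfolding V_def by (intro open_Int U) (auto simp: closed_def vimage_def Compl_eq)
  qed
  \<comment> \<open>The product vanishes off the compact support of the test function, so its
    extension by zero stays continuous; \<open>K\<close> below is its gradient off the exceptional
    lines.\<close>
  define \<Phi> where "\<Phi> x = (if x \<in> U then f x * \<phi> x else 0)" for x
  define K where "K x = (\<chi> j. indicator V x *\<^sub>R (f x * partial j \<phi> x + G x $ j * \<phi> x))" for x
  have K0: "K x = 0" "\<Phi> x = 0" if "x \<notin> C" for x using C that by (auto simp: K_def \<Phi>_def vec_eq_iff)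
  have "AE x in lebesgue. indicator U x *\<^sub>R (f x * partial i \<phi> x) + indicator U x *\<^sub>R (G x $ i * \<phi> x) = K x $ i"
    using AE_line[OF N] by eventually_elim (auto simp: K_def V_def indicator_def)
  note ae = this
  have Km: "(\<lambda>x. K x $ i) \<in> borel_measurable borel"
    unfolding K_def vec_lambda_beta
    by (intro borel_measurable_continuous_on_indicator continuous_intros borel_open openV)
       (use f G cphi in \<open>auto simp: V_def intro: continuous_on_subset\<close>)
  have Ki: "integrable lebesgue (\<lambda>x. K x $ i)"
    by (rule integrable_cong_AE_imp[OF Bochner_Integration.integrable_add[OF i1[unfolded set_integrable_def] i2[unfolded set_integrable_def]]])
       (use Km ae in \<open>auto intro: measurable_completion elim: eventually_mono\<close>)
  have "continuous_on (U \<union> - C) \<Phi>"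
  proof (rule continuous_on_open_Un[OF U])
    show "open (- C)" using C(1) by (simp add: compact_imp_closed open_Compl)
    have "continuous_on U (\<lambda>x. f x * \<phi> x)" by (intro continuous_intros f continuous_on_subset[OF cphi(1)]) auto
    then show "continuous_on U \<Phi>" by (rule continuous_on_eq) (auto simp: \<Phi>_def)
    show "continuous_on (- C) \<Phi>" by (rule continuous_on_eq[of _ "\<lambda>x. 0"]) (use K0 in auto)
  qed
  moreover have "U \<union> - C = UNIV" using C(2) by blast
  ultimately have c\<Phi>: "continuous_on UNIV \<Phi>" by simp
  have "(\<integral>x. K x $ i \<partial>lborel) = 0"
  proof (rule integral_compact_support_gradient[OF N C(1) K0(2) K0(1) c\<Phi>])
    show "integrable lborel (\<lambda>x. K x $ i)" using Ki Km by (simp add: integrable_completion)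
    fix x :: "real^2" assume x: "x$1 \<notin> N"
    show "(\<Phi> has_derivative (\<lambda>h. K x \<bullet> h)) (at x)"
    proof (cases "x \<in> U")
      case True
      have "(\<phi> has_derivative frechet_derivative \<phi> (at x)) (at x)"
        using cphi(3) frechet_derivative_works by blast
      then have d\<phi>: "(\<phi> has_derivative (\<lambda>h. (\<chi> j. partial j \<phi> x) \<bullet> h)) (at x)"
      proof (rule has_derivative_eq_rhs)
        have lin: "linear (frechet_derivative \<phi> (at x))"
          using cphi(3)[of x] linear_frechet_derivative by blast
        show "frechet_derivative \<phi> (at x) = (\<lambda>h. (\<chi> j. partial j \<phi> x) \<bullet> h)"
        proof
          fix h :: "real^2"
          have "h = h$1 *\<^sub>R axis 1 1 + h$2 *\<^sub>R axis 2 1" by (simp add: vec_eq_iff forall_2 axis_def)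
          then have "frechet_derivative \<phi> (at x) h = frechet_derivative \<phi> (at x) (h$1 *\<^sub>R axis 1 1 + h$2 *\<^sub>R axis 2 1)" by simp
          also have "\<dots> = h$1 * partial 1 \<phi> x + h$2 * partial 2 \<phi> x"
            by (simp add: linear_add[OF lin] linear_scale[OF lin] partial_def)
          finally show "frechet_derivative \<phi> (at x) h = (\<chi> j. partial j \<phi> x) \<bullet> h"
            by (simp add: inner_vec_def sum_2 mult.commute)
        qed
      qed
      have "((\<lambda>x. f x * \<phi> x) has_derivative (\<lambda>h. K x \<bullet> h)) (at x)"
        by (rule has_derivative_eq_rhs[OF has_derivative_mult[OF D[OF True x] d\<phi>]])
           (use True x in \<open>auto simp: K_def V_def inner_vec_def sum_2 algebra_simps\<close>)
      then show ?thesis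
        by (rule has_derivative_transform_within_open[OF _ U True]) (auto simp: \<Phi>_def)
    next
      case False
      then have "x \<notin> C" using C(2) by auto
      have "((\<lambda>x. 0) has_derivative (\<lambda>h. K x \<bullet> h)) (at x)" using K0(1)[OF \<open>x \<notin> C\<close>] by simp
      then show ?thesis
        by (rule has_derivative_transform_within_open[of _ _ _ _ "- C"]) (use \<open>x \<notin> C\<close> C(1) K0 in \<open>auto simp: compact_imp_closed open_Compl\<close>)
    qed
  qed
  then have "0 = (\<integral>x. K x $ i \<partial>lebesgue)" using Km by (simp add: integral_completion)
  also have "\<dots> = (\<integral>x. indicator U x *\<^sub>R (f x * partial i \<phi> x) + indicator U x *\<^sub>R (G x $ i * \<phi> x) \<partial>lebesgue)"
    using i1 i2 Ki ae unfolding set_integrable_def by (intro integral_cong_AE) (auto elim: eventually_mono)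
  also have "\<dots> = (LINT x:U|lebesgue. f x * partial i \<phi> x) + (LINT x:U|lebesgue. G x $ i * \<phi> x)"
    using i1 i2 unfolding set_integrable_def set_lebesgue_integral_def by (rule Bochner_Integration.integral_add)
  finally show "(LINT x:U|lebesgue. f x * partial i \<phi> x) = - (LINT x:U|lebesgue. G x $ i * \<phi> x)" by simp
qed

lemma continuous_compact_integrable:
  fixes f :: "real^2 \<Rightarrow> 'b::euclidean_space"
  assumes "continuous_on U f" "compact C" "C \<subseteq> U"
  shows "set_integrable lebesgue C f"
proof -
  have "integrable lborel (\<lambda>x. indicator C x *\<^sub>R f x)"
    by (rule borel_integrable_compact[OF assms(2)]) (use assms continuous_on_subset in blast)
  then show ?thesis unfolding set_integrable_def by (subst integrable_completion) auto
qed

section \<open>Line integrals over the sides of a rectangle\<close>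

definition seg_null :: "(nat \<Rightarrow> real^2 \<Rightarrow> real) \<Rightarrow> real^2 \<Rightarrow> real^2 \<Rightarrow> bool" where
  "seg_null E P R \<longleftrightarrow> (\<lambda>n. \<integral>\<^sup>+t. ennreal ((E n (linepath P R t))\<^sup>2) \<partial>lebesgue_on {0..1}) \<longlonglongrightarrow> 0"

lemma lebesgue_on_Icc_integral:
  fixes f :: "real \<Rightarrow> real"
  assumes "continuous_on {0..1} f"
  shows "(\<integral>t. f t \<partial>lebesgue_on {0..1}) = (\<integral>t. indicator {0..1} t * f t \<partial>lborel)"
proof -
  have m: "(\<lambda>t. indicator {0..1} t *\<^sub>R f t) \<in> borel_measurable borel"
    by (intro borel_measurable_continuous_on_indicator assms) auto
  have "(\<integral>t. f t \<partial>lebesgue_on {0..1}) = (\<integral>t. indicator {0..1} t *\<^sub>R f t \<partial>lebesgue)"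
    by (rule integral_restrict_space) simp
  also have "\<dots> = (\<integral>t. indicator {0..1} t *\<^sub>R f t \<partial>lborel)" using m by (intro integral_completion) simp
  finally show ?thesis by simp
qed

text \<open>Substituting the parametrisation turns convergence in the square mean over [0, 1] into
  convergence of weighted line integrals. Hypothesis \<open>S\<close> admits negative
  \<open>l\<close>, hence both orientations of a side.\<close>

lemma segment_term:
  fixes e :: "nat \<Rightarrow> real \<Rightarrow> real"
  assumes l: "l \<noteq> 0" and S: "\<And>t. c + l * t \<in> {lo..hi} \<longleftrightarrow> t \<in> {0..1}"
    and e: "\<And>n. continuous_on {lo..hi} (e n)" and r: "continuous_on UNIV r"
    and lim: "(\<lambda>n. \<integral>\<^sup>+t. ennreal ((e n (c + l * t))\<^sup>2) \<partial>lebesgue_on {0..1}) \<longlonglongrightarrow> 0"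
  shows "(\<lambda>n. \<integral>y. indicator {lo..hi} y * (r y * e n y) \<partial>lborel) \<longlonglongrightarrow> 0"
proof -
  have fm: "finite_measure (lebesgue_on {0..1::real})" by (rule finite_measure_lebesgue_on) auto
  have ce: "continuous_on {0..1} (\<lambda>t. e n (c + l * t))" for n
    by (rule continuous_on_compose2[OF e]) (use S in \<open>auto intro!: continuous_intros\<close>)
  have cr: "continuous_on {0..1} (\<lambda>t. r (c + l * t))"
    by (rule continuous_on_compose2[OF r]) (auto intro!: continuous_intros)
  have "bounded ((\<lambda>t. r (c + l * t)) ` {0..1})"
    by (intro compact_imp_bounded compact_continuous_image cr) auto
  then obtain B where B: "\<And>t. t \<in> {0..1} \<Longrightarrow> \<bar>r (c + l * t)\<bar> \<le> B"
    unfolding bounded_iff by fastforce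
  have "(\<lambda>n. \<integral>t. e n (c + l * t) * r (c + l * t) \<partial>lebesgue_on {0..1}) \<longlonglongrightarrow> 0"
    by (rule L2_conv_integral[OF fm _ lim, of _ B])
       (use B in \<open>auto intro!: continuous_imp_measurable_on_sets_lebesgue ce cr\<close>)
  then have "(\<lambda>n. \<bar>l\<bar> * (\<integral>t. e n (c + l * t) * r (c + l * t) \<partial>lebesgue_on {0..1})) \<longlonglongrightarrow> \<bar>l\<bar> * 0"
    by (intro tendsto_mult tendsto_const)
  moreover have "(\<integral>y. indicator {lo..hi} y * (r y * e n y) \<partial>lborel) = \<bar>l\<bar> * (\<integral>t. e n (c + l * t) * r (c + l * t) \<partial>lebesgue_on {0..1})" for n
  proof -
    have "(\<integral>y. indicator {lo..hi} y * (r y * e n y) \<partial>lborel)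
      = \<bar>l\<bar> *\<^sub>R (\<integral>t. indicator {lo..hi} (c + l * t) * (r (c + l * t) * e n (c + l * t)) \<partial>lborel)"
      by (rule lborel_integral_real_affine[OF l])
    also have "(\<lambda>t. indicator {lo..hi} (c + l * t) * (r (c + l * t) * e n (c + l * t))) = (\<lambda>t. indicator {0..1} t * (e n (c + l * t) * r (c + l * t)))"
      using S by (auto simp: indicator_def fun_eq_iff)
    finally show ?thesis
      by (subst lebesgue_on_Icc_integral) (auto intro!: continuous_intros ce cr)
  qed
  ultimately show ?thesis by simp
qed

lemma linepath_pt:
  "linepath (pt c lo) (pt c hi) t = pt c (lo + (hi - lo) * t)"
  "linepath (pt lo c) (pt hi c) t = pt (lo + (hi - lo) * t) c"
  by (auto simp: linepath_def vec_eq_iff forall_2 algebra_simps)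

lemma interval_param: 
  assumes "lo < (hi::real)"
  shows "lo + (hi - lo) * t \<in> {lo..hi} \<longleftrightarrow> t \<in> {0..1}" "hi + (lo - hi) * t \<in> {lo..hi} \<longleftrightarrow> t \<in> {0..1}"
proof -
  have *: "(hi - lo) * t \<le> hi - lo \<longleftrightarrow> t \<le> 1" "0 \<le> (hi - lo) * t \<longleftrightarrow> 0 \<le> t"
    using assms mult_le_cancel_left_pos[of "hi - lo" t 1] zero_le_mult_iff[of "hi - lo" t] by auto
  then show "lo + (hi - lo) * t \<in> {lo..hi} \<longleftrightarrow> t \<in> {0..1}" "hi + (lo - hi) * t \<in> {lo..hi} \<longleftrightarrow> t \<in> {0..1}"
    by (auto simp: algebra_simps)
qed

text \<open>The disjunctions cover both directions, because \<open>rect_sides\<close> runs around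
  the rectangle and so traverses opposite sides in opposite directions.\<close>

lemma side_null:
  fixes E :: "nat \<Rightarrow> real^2 \<Rightarrow> real"
  assumes E: "\<And>n. continuous_on (cbox a b) (E n)" and ab: "a$1 < b$1" "a$2 < b$2" and r: "continuous_on UNIV r"
  shows side_null_1: "c \<in> {a$1..b$1} \<Longrightarrow> seg_null E (pt c (a$2)) (pt c (b$2)) \<or> seg_null E (pt c (b$2)) (pt c (a$2)) \<Longrightarrow>
       (\<lambda>n. \<integral>y. indicator {a$2..b$2} y * (r y * E n (pt c y)) \<partial>lborel) \<longlonglongrightarrow> 0"
    and side_null_2: "c \<in> {a$2..b$2} \<Longrightarrow> seg_null E (pt (a$1) c) (pt (b$1) c) \<or> seg_null E (pt (b$1) c) (pt (a$1) c) \<Longrightarrow>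
       (\<lambda>n. \<integral>y. indicator {a$1..b$1} y * (r y * E n (pt y c)) \<partial>lborel) \<longlonglongrightarrow> 0"
proof -
  assume c: "c \<in> {a$1..b$1}" and s: "seg_null E (pt c (a$2)) (pt c (b$2)) \<or> seg_null E (pt c (b$2)) (pt c (a$2))"
  have ce: "continuous_on {a$2..b$2} (\<lambda>y. E n (pt c y))" for n
    by (rule continuous_on_compose2[OF E]) (use c in \<open>auto intro!: continuous_intros simp: mem_box2\<close>)
  from s show "(\<lambda>n. \<integral>y. indicator {a$2..b$2} y * (r y * E n (pt c y)) \<partial>lborel) \<longlonglongrightarrow> 0"
    unfolding seg_null_def linepath_pt
    using segment_term[OF _ interval_param(1)[OF ab(2)] ce r] segment_term[OF _ interval_param(2)[OF ab(2)] ce r] ab by auto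
next
  assume c: "c \<in> {a$2..b$2}" and s: "seg_null E (pt (a$1) c) (pt (b$1) c) \<or> seg_null E (pt (b$1) c) (pt (a$1) c)"
  have ce: "continuous_on {a$1..b$1} (\<lambda>y. E n (pt y c))" for n
    by (rule continuous_on_compose2[OF E]) (use c in \<open>auto intro!: continuous_intros simp: mem_box2\<close>)
  from s show "(\<lambda>n. \<integral>y. indicator {a$1..b$1} y * (r y * E n (pt y c)) \<partial>lborel) \<longlonglongrightarrow> 0"
    unfolding seg_null_def linepath_pt
    using segment_term[OF _ interval_param(1)[OF ab(1)] ce r] segment_term[OF _ interval_param(2)[OF ab(1)] ce r] ab by auto
qed

subsection \<open>Functions with equal traces\<close>

lemma L2_tendsto_set_integral:
  fixes F :: "nat \<Rightarrow> real^2 \<Rightarrow> real"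
  assumes U: "U \<in> lmeasurable" and F: "\<And>n. L2_on U (F n)" "L2_on U f" and lim: "L2_tendsto U F f"
    and V: "continuous_on U V" "\<And>x. x \<in> U \<Longrightarrow> \<bar>V x\<bar> \<le> B"
  shows "(\<lambda>n. LINT x:U|lebesgue. (F n x - f x) * V x) \<longlonglongrightarrow> 0"
proof -
  have Us: "U \<in> sets lebesgue" using U by blast
  have "(\<lambda>n. \<integral>x. (F n x - f x) * V x \<partial>lebesgue_on U) \<longlonglongrightarrow> 0"
  proof (rule L2_conv_integral[OF finite_measure_lebesgue_on[OF U]])
    show "(\<lambda>n. \<integral>\<^sup>+x. ennreal ((F n x - f x)\<^sup>2) \<partial>lebesgue_on U) \<longlonglongrightarrow> 0"
      using lim unfolding L2_tendsto_def by simp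
    show "V \<in> borel_measurable (lebesgue_on U)" by (rule continuous_imp_measurable_on_sets_lebesgue[OF V(1) Us])
    show "(\<lambda>x. F n x - f x) \<in> borel_measurable (lebesgue_on U)" for n
      using F unfolding L2_on_def by (intro borel_measurable_diff) auto
  qed (use V in auto)
  then show ?thesis using Us by (simp add: integral_restrict_space set_lebesgue_integral_def)
qed

lemma L2_tendsto_nth:
  fixes G :: "nat \<Rightarrow> real^2 \<Rightarrow> real^2"
  assumes "L2_tendsto U G H"
  shows "L2_tendsto U (\<lambda>n x. G n x $ i) (\<lambda>x. H x $ i)"
  unfolding L2_tendsto_def
proof (rule tendsto_sandwich[OF _ _ tendsto_const assms[unfolded L2_tendsto_def]])
  have "(norm (G n x $ i - H x $ i))\<^sup>2 \<le> (norm (G n x - H x))\<^sup>2" for n x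
    using component_le_norm_cart[of "G n x - H x" i] by (simp add: abs_le_square_iff[symmetric])
  then show "eventually (\<lambda>n. (\<integral>\<^sup>+x. ennreal ((norm (G n x $ i - H x $ i))\<^sup>2) \<partial>lebesgue_on U)
      \<le> (\<integral>\<^sup>+x. ennreal ((norm (G n x - H x))\<^sup>2) \<partial>lebesgue_on U)) sequentially"
    by (intro always_eventually allI nn_integral_mono ennreal_leI)
qed auto

lemma set_integrable_mult_continuous_L2:
  fixes f V :: "real^2 \<Rightarrow> real"
  shows "L2_on (box a b) f \<Longrightarrow> continuous_on (cbox a b) V \<Longrightarrow> set_integrable lebesgue (box a b) (\<lambda>x. f x * V x)"
  by (intro set_integrable_mult_continuous L2_on_integrable) auto

text \<open>The volume side of Green's formula is continuous under convergence in W12, so it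
  survives the passage from approximating functions to a function that only has a trace.\<close>

lemma W12_tendsto_green_limit:
  assumes F: "\<And>n. F n \<in> W12 (box a b)" "f \<in> W12 (box a b)" and lim: "W12_tendsto (box a b) F f"
    and VW: "continuous_on (cbox a b) V" "continuous_on (cbox a b) W"
  shows "(\<lambda>n. LINT x:box a b|lebesgue. F n x * W x + weak_gradient (box a b) (F n) x $ i * V x)
    \<longlonglongrightarrow> (LINT x:box a b|lebesgue. f x * W x + weak_gradient (box a b) f x $ i * V x)"
proof -
  let ?U = "box a b" and ?g = "\<lambda>f x. weak_gradient (box a b) f x $ i"
  have U: "?U \<in> lmeasurable" by simp
  have L: "L2_on ?U f" "L2_on ?U (?g f)" if "f \<in> W12 ?U" for f
    using W12_weak_gradient[OF open_box that] by (auto intro: L2_on_nth)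
  have bd: "\<exists>B. \<forall>x\<in>?U. \<bar>Z x\<bar> \<le> B" if "continuous_on (cbox a b) Z" for Z :: "real^2 \<Rightarrow> real"
    using compact_imp_bounded[OF compact_continuous_image[OF that compact_cbox]] box_subset_cbox[of a b]
    unfolding bounded_iff by fastforce
  have c: "continuous_on ?U V" "continuous_on ?U W"
    using VW box_subset_cbox[of a b] by (auto intro: continuous_on_subset)
  obtain B C where B: "\<forall>x\<in>?U. \<bar>V x\<bar> \<le> B" and C: "\<forall>x\<in>?U. \<bar>W x\<bar> \<le> C" using bd VW by metis
  have t1: "(\<lambda>n. LINT x:?U|lebesgue. (F n x - f x) * W x) \<longlonglongrightarrow> 0"
    by (rule L2_tendsto_set_integral[OF U _ _ _ c(2)]) (use L F lim C in \<open>auto simp: W12_tendsto_def\<close>)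
  have t2: "(\<lambda>n. LINT x:?U|lebesgue. (?g (F n) x - ?g f x) * V x) \<longlonglongrightarrow> 0"
    by (rule L2_tendsto_set_integral[OF U _ _ L2_tendsto_nth c(1)]) (use L F lim B in \<open>auto simp: W12_tendsto_def\<close>)
  let ?T = "\<lambda>f. LINT x:?U|lebesgue. f x * W x + ?g f x * V x"
  have i: "set_integrable lebesgue ?U (\<lambda>x. f x * W x)" "set_integrable lebesgue ?U (\<lambda>x. ?g f x * V x)" if "f \<in> W12 ?U" for f
    by (intro set_integrable_mult_continuous_L2 L VW that)+
  have eq: "?T (F n) - ?T f = (LINT x:?U|lebesgue. (F n x - f x) * W x) + (LINT x:?U|lebesgue. (?g (F n) x - ?g f x) * V x)" for n
    unfolding left_diff_distrib
    using i[OF F(1)[of n]] i[OF F(2)] by (simp add: set_integral_add set_integral_diff)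
  have "(\<lambda>n. ?T (F n) - ?T f) \<longlonglongrightarrow> 0 + 0" unfolding eq by (intro tendsto_add t1 t2)
  then show ?thesis using LIM_zero_iff by fastforce
qed

lemma seg_null_diff:
  assumes "\<And>n. continuous_on {0..1} (\<lambda>t. F n (linepath P R t))" "\<And>n. continuous_on {0..1} (\<lambda>t. F' n (linepath P R t))"
    and g: "(\<lambda>t. g (linepath P R t)) \<in> borel_measurable (lebesgue_on {0..1})"
    and lim: "(\<lambda>n. \<integral>\<^sup>+t. ennreal ((F n (linepath P R t) - g (linepath P R t))\<^sup>2) \<partial>lebesgue_on {0..1}) \<longlonglongrightarrow> 0"
      "(\<lambda>n. \<integral>\<^sup>+t. ennreal ((F' n (linepath P R t) - g (linepath P R t))\<^sup>2) \<partial>lebesgue_on {0..1}) \<longlonglongrightarrow> 0"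
  shows "seg_null (\<lambda>n x. F n x - F' n x) P R"
  unfolding seg_null_def
proof (rule tendsto_sandwich[OF _ _ tendsto_const])
  let ?l = "linepath P R"
  let ?M = "lebesgue_on {0..1::real}"
  have m[measurable]: "(\<lambda>t. F n (?l t)) \<in> borel_measurable ?M" "(\<lambda>t. F' n (?l t)) \<in> borel_measurable ?M" for n
    by (intro continuous_imp_measurable_on_sets_lebesgue assms; simp)+
  note g[measurable]
  let ?R = "\<lambda>n. 2 * (\<integral>\<^sup>+t. ennreal ((F n (?l t) - g (?l t))\<^sup>2) \<partial>?M) + 2 * (\<integral>\<^sup>+t. ennreal ((F' n (?l t) - g (?l t))\<^sup>2) \<partial>?M)"
  have "?R \<longlonglongrightarrow> 2 * 0 + 2 * 0" by (intro tendsto_add ennreal_tendsto_cmult lim) auto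
  then show "?R \<longlonglongrightarrow> 0" by simp
  have "(\<integral>\<^sup>+t. ennreal ((F n (?l t) - F' n (?l t))\<^sup>2) \<partial>?M) \<le> ?R n" for n
  proof -
    have "(x - y)\<^sup>2 \<le> 2 * (x - z)\<^sup>2 + 2 * (y - z)\<^sup>2" for x y z :: real
      using zero_le_power2[of "(x - z) + (y - z)"] by (simp add: power2_eq_square algebra_simps)
    then have "(\<integral>\<^sup>+t. ennreal ((F n (?l t) - F' n (?l t))\<^sup>2) \<partial>?M) \<le> (\<integral>\<^sup>+t. 2 * ennreal ((F n (?l t) - g (?l t))\<^sup>2) + 2 * ennreal ((F' n (?l t) - g (?l t))\<^sup>2) \<partial>?M)"
    proof (intro nn_integral_mono)
      fix t
      assume le: "\<And>x y z :: real. (x - y)\<^sup>2 \<le> 2 * (x - z)\<^sup>2 + 2 * (y - z)\<^sup>2"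
      have "ennreal ((F n (?l t) - F' n (?l t))\<^sup>2) \<le> ennreal (2 * (F n (?l t) - g (?l t))\<^sup>2 + 2 * (F' n (?l t) - g (?l t))\<^sup>2)"
        by (intro ennreal_leI le)
      then show "ennreal ((F n (?l t) - F' n (?l t))\<^sup>2) \<le> 2 * ennreal ((F n (?l t) - g (?l t))\<^sup>2) + 2 * ennreal ((F' n (?l t) - g (?l t))\<^sup>2)"
        by (simp add: ennreal_plus ennreal_mult)
    qed
    also have "\<dots> = ?R n" by (simp add: nn_integral_add nn_integral_cmult)
    finally show ?thesis .
  qed
  then show "eventually (\<lambda>n. (\<integral>\<^sup>+t. ennreal ((F n (?l t) - F' n (?l t))\<^sup>2) \<partial>?M) \<le> ?R n) sequentially" by simp
qed auto

lemma continuous_on_linepath: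
  fixes F :: "real^2 \<Rightarrow> real"
  assumes "continuous_on S F" "closed_segment P R \<subseteq> S"
  shows "continuous_on {0..1} (\<lambda>t. F (linepath P R t))"
  by (rule continuous_on_compose2[OF assms(1)])
     (use assms(2) linepath_in_path[of _ P R] in \<open>auto intro!: continuous_intros\<close>)

lemma has_traceE:
  assumes "has_trace U B f g"
  obtains F where "\<And>n. F n \<in> W12 U" "\<And>n. continuous_on (closure U) (F n)" "W12_tendsto U F f"
    "\<And>P R. (P, R) \<in> B \<Longrightarrow> (\<lambda>n. \<integral>\<^sup>+t. ennreal ((F n (linepath P R t) - g (linepath P R t))\<^sup>2) \<partial>lebesgue_on {0..1}) \<longlonglongrightarrow> 0"
proof -
  obtain F where F: "\<forall>n. F n \<in> W12 U \<and> continuous_on (closure U) (F n)" "W12_tendsto U F f"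
    "\<forall>(P, R)\<in>B. (\<lambda>n. \<integral>\<^sup>+t. ennreal ((F n (linepath P R t) - g (linepath P R t))\<^sup>2) \<partial>lebesgue_on {0..1}) \<longlonglongrightarrow> 0"
    using assms unfolding has_trace_def by (elim conjE exE)
  show thesis by (rule that[of F]) (use F in auto)
qed

text \<open>Apply \<open>green\<close> to both approximating sequences: the boundary terms contain
  only their difference on the sides, which tends to 0 because both sequences approach the same
  \<open>g\<close>. The factors \<open>p\<close> and \<open>q\<close> may therefore be nonzero on
  the boundary.\<close>

lemma trace_green:
  fixes a b :: "real^2"
  assumes ab: "a$1 < b$1" "a$2 < b$2"
    and f: "has_trace (box a b) (rect_sides a b) f g" and f': "has_trace (box a b) (rect_sides a b) f' g"
    and pq: "smooth p" "smooth q"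
  defines "D \<equiv> \<lambda>i x. weak_gradient (box a b) f x $ i - weak_gradient (box a b) f' x $ i"
  shows "(LINT x:box a b|lebesgue. (f x - f' x) * (deriv p (x$1) * q (x$2)) + D 1 x * (p (x$1) * q (x$2))) = 0" (is ?g1)
    and "(LINT x:box a b|lebesgue. (f x - f' x) * (p (x$1) * deriv q (x$2)) + D 2 x * (p (x$1) * q (x$2))) = 0" (is ?g2)
proof -
  let ?U = "box a b"
  have cl: "closure ?U = cbox a b" by (rule closure_box) (use ab in \<open>auto simp: box_ne_empty Basis_vec2 inner_axis\<close>)
  obtain F where F: "\<And>n. F n \<in> W12 ?U" "\<And>n. continuous_on (cbox a b) (F n)" "W12_tendsto ?U F f"
    "\<And>P R. (P, R) \<in> rect_sides a b \<Longrightarrow> (\<lambda>n. \<integral>\<^sup>+t. ennreal ((F n (linepath P R t) - g (linepath P R t))\<^sup>2) \<partial>lebesgue_on {0..1}) \<longlonglongrightarrow> 0"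
    by (rule has_traceE[OF f, unfolded cl]) (rule that; assumption)
  obtain F' where F': "\<And>n. F' n \<in> W12 ?U" "\<And>n. continuous_on (cbox a b) (F' n)" "W12_tendsto ?U F' f'"
    "\<And>P R. (P, R) \<in> rect_sides a b \<Longrightarrow> (\<lambda>n. \<integral>\<^sup>+t. ennreal ((F' n (linepath P R t) - g (linepath P R t))\<^sup>2) \<partial>lebesgue_on {0..1}) \<longlonglongrightarrow> 0"
    by (rule has_traceE[OF f', unfolded cl]) (rule that; assumption)
  have gm: "(\<lambda>t. g (linepath P R t)) \<in> borel_measurable (lebesgue_on {0..1})" if "(P, R) \<in> rect_sides a b" for P R
    using f that unfolding has_trace_def by auto
  have W: "f \<in> W12 ?U" "f' \<in> W12 ?U" using f f' unfolding has_trace_def by auto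
  let ?E = "\<lambda>n x. F n x - F' n x"
  have cE: "continuous_on (cbox a b) (?E n)" for n by (intro continuous_intros F F')
  have sub: "closed_segment P R \<subseteq> cbox a b" if "(P, R) \<in> rect_sides a b" for P R
    using that ab by (intro closed_segment_subset) (auto simp: rect_sides_def mem_box2 convex_box)
  have E0: "seg_null ?E P R" if PR: "(P, R) \<in> rect_sides a b" for P R
    by (intro seg_null_diff[OF _ _ gm[OF PR] F(4)[OF PR] F'(4)[OF PR]] continuous_on_linepath[OF _ sub[OF PR]] F F')
  have sides: "seg_null ?E (pt (a$1) (a$2)) (pt (b$1) (a$2))" "seg_null ?E (pt (b$1) (a$2)) (pt (b$1) (b$2))"
    "seg_null ?E (pt (b$1) (b$2)) (pt (a$1) (b$2))" "seg_null ?E (pt (a$1) (b$2)) (pt (a$1) (a$2))"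
    by (rule E0, simp add: rect_sides_def)+
  have cp: "continuous_on A (\<lambda>x. p (x$1))" "continuous_on A (\<lambda>x. deriv p (x$1))"
    "continuous_on A (\<lambda>x. q (x$2))" "continuous_on A (\<lambda>x. deriv q (x$2))" for A :: "(real^2) set"
    using continuous_on_compose2[OF smooth_continuous[OF pq(1), of UNIV], of A "\<lambda>x. x$1"]
      continuous_on_compose2[OF smooth_continuous[OF smooth_deriv[OF pq(1)], of UNIV], of A "\<lambda>x. x$1"]
      continuous_on_compose2[OF smooth_continuous[OF pq(2), of UNIV], of A "\<lambda>x. x$2"]
      continuous_on_compose2[OF smooth_continuous[OF smooth_deriv[OF pq(2)], of UNIV], of A "\<lambda>x. x$2"]
    by (auto simp: continuous_intros)
  have L: "L2_on ?U f" "L2_on ?U (\<lambda>x. weak_gradient ?U f x $ i)" if "f \<in> W12 ?U" for f i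
    using W12_weak_gradient[OF open_box that] by (auto intro: L2_on_nth)
  have wG: "has_weak_gradient ?U f (weak_gradient ?U f)" "set_integrable lebesgue ?U (weak_gradient ?U f)" if "f \<in> W12 ?U" for f
    using W12_weak_gradient[OF open_box that] by (auto intro!: L2_on_integrable)
  have split: "(LINT x:?U|lebesgue. (f x - h x) * w x + (weak_gradient ?U f x $ i - weak_gradient ?U h x $ i) * v x)
      = (LINT x:?U|lebesgue. f x * w x + weak_gradient ?U f x $ i * v x) - (LINT x:?U|lebesgue. h x * w x + weak_gradient ?U h x $ i * v x)"
    if "f \<in> W12 ?U" "h \<in> W12 ?U" "continuous_on (cbox a b) v" "continuous_on (cbox a b) w" for f h v w i
  proof -
    have s: "set_integrable lebesgue ?U (\<lambda>x. k x * w x + weak_gradient ?U k x $ i * v x)" if k: "k \<in> W12 ?U" for k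
      using set_integral_add(1)[OF set_integrable_mult_continuous_L2[OF L(1)[OF k] \<open>continuous_on (cbox a b) w\<close>]
        set_integrable_mult_continuous_L2[OF L(2)[OF k] \<open>continuous_on (cbox a b) v\<close>]] .
    have e: "(f x - h x) * w x + (weak_gradient ?U f x $ i - weak_gradient ?U h x $ i) * v x =
       (f x * w x + weak_gradient ?U f x $ i * v x) - (h x * w x + weak_gradient ?U h x $ i * v x)" for x
      by (simp add: algebra_simps)
    show ?thesis unfolding set_integral_diff(2)[OF s[OF that(1)] s[OF that(2)], symmetric] e ..
  qed
  {
    let ?V = "\<lambda>x::real^2. p (x$1) * q (x$2)" and ?W = "\<lambda>x::real^2. deriv p (x$1) * q (x$2)"
    let ?T = "\<lambda>f. LINT x:?U|lebesgue. f x * ?W x + weak_gradient ?U f x $ 1 * ?V x"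
    have c: "continuous_on (cbox a b) ?V" "continuous_on (cbox a b) ?W" by (intro continuous_intros cp)+
    have "(\<lambda>n. ?T (F n) - ?T (F' n)) \<longlonglongrightarrow> ?T f - ?T f'"
      by (intro tendsto_diff W12_tendsto_green_limit F F' W c)
    moreover have "?T (F n) - ?T (F' n) =
       (\<integral>y. indicator {a$2..b$2} y * ((q y * p (b$1)) * ?E n (pt (b$1) y)) \<partial>lborel) - (\<integral>y. indicator {a$2..b$2} y * ((q y * p (a$1)) * ?E n (pt (a$1) y)) \<partial>lborel)" for n
    proof -
      have i: "integrable lborel (\<lambda>y. indicator {a$2..b$2} y * (q y * (p c * H (pt c y))))"
        if "continuous_on (cbox a b) H" "c \<in> {a$1..b$1}" for c H
        by (intro integrable_indicator_continuous continuous_intros smooth_continuous pq continuous_on_compose2[OF that(1)])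
           (use that in \<open>auto intro!: continuous_intros simp: mem_box2\<close>)
      have d: "(\<integral>y. indicator {a$2..b$2} y * (q y * (p (b$1) * H (pt (b$1) y) - p (a$1) * H (pt (a$1) y))) \<partial>lborel)
        = (\<integral>y. indicator {a$2..b$2} y * (q y * (p (b$1) * H (pt (b$1) y))) \<partial>lborel) - (\<integral>y. indicator {a$2..b$2} y * (q y * (p (a$1) * H (pt (a$1) y))) \<partial>lborel)"
        if "continuous_on (cbox a b) H" for H
        by (subst Bochner_Integration.integral_diff[symmetric, OF i[OF that] i[OF that]])
           (use ab in \<open>auto simp: right_diff_distrib\<close>)
      have e: "(\<integral>y. indicator {a$2..b$2} y * ((q y * p c) * (F n (pt c y) - F' n (pt c y))) \<partial>lborel)
        = (\<integral>y. indicator {a$2..b$2} y * (q y * (p c * F n (pt c y))) \<partial>lborel) - (\<integral>y. indicator {a$2..b$2} y * (q y * (p c * F' n (pt c y))) \<partial>lborel)"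
        if "c \<in> {a$1..b$1}" for c
        by (subst Bochner_Integration.integral_diff[symmetric, OF i[OF F(2) that] i[OF F'(2) that]])
           (simp add: right_diff_distrib mult.assoc)
      have mem: "a$1 \<in> {a$1..b$1}" "b$1 \<in> {a$1..b$1}" using ab by auto
      show ?thesis
        unfolding green_1[OF ab wG(1)[OF F(1)] wG(2)[OF F(1)] F(2) pq] green_1[OF ab wG(1)[OF F'(1)] wG(2)[OF F'(1)] F'(2) pq]
        unfolding d[OF F(2)] d[OF F'(2)] e[OF mem(1)] e[OF mem(2)] by simp
    qed
    moreover have "(\<lambda>n. (\<integral>y. indicator {a$2..b$2} y * ((q y * p (b$1)) * ?E n (pt (b$1) y)) \<partial>lborel) - (\<integral>y. indicator {a$2..b$2} y * ((q y * p (a$1)) * ?E n (pt (a$1) y)) \<partial>lborel)) \<longlonglongrightarrow> 0 - 0"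
      by (intro tendsto_diff side_null_1[OF cE ab] continuous_intros smooth_continuous pq) (use ab sides in auto)
    ultimately have "?T f - ?T f' = 0" using LIMSEQ_unique by fastforce
    then show ?g1 unfolding D_def split[OF W c] by simp
  }
  {
    let ?V = "\<lambda>x::real^2. p (x$1) * q (x$2)" and ?W = "\<lambda>x::real^2. p (x$1) * deriv q (x$2)"
    let ?T = "\<lambda>f. LINT x:?U|lebesgue. f x * ?W x + weak_gradient ?U f x $ 2 * ?V x"
    have c: "continuous_on (cbox a b) ?V" "continuous_on (cbox a b) ?W" by (intro continuous_intros cp)+
    have "(\<lambda>n. ?T (F n) - ?T (F' n)) \<longlonglongrightarrow> ?T f - ?T f'"
      by (intro tendsto_diff W12_tendsto_green_limit F F' W c)
    moreover have "?T (F n) - ?T (F' n) =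
       (\<integral>y. indicator {a$1..b$1} y * ((p y * q (b$2)) * ?E n (pt y (b$2))) \<partial>lborel) - (\<integral>y. indicator {a$1..b$1} y * ((p y * q (a$2)) * ?E n (pt y (a$2))) \<partial>lborel)" for n
    proof -
      have i: "integrable lborel (\<lambda>y. indicator {a$1..b$1} y * (p y * (q c * H (pt y c))))"
        if "continuous_on (cbox a b) H" "c \<in> {a$2..b$2}" for c H
        by (intro integrable_indicator_continuous continuous_intros smooth_continuous pq continuous_on_compose2[OF that(1)])
           (use that in \<open>auto intro!: continuous_intros simp: mem_box2\<close>)
      have d: "(\<integral>y. indicator {a$1..b$1} y * (p y * (q (b$2) * H (pt y (b$2)) - q (a$2) * H (pt y (a$2)))) \<partial>lborel)
        = (\<integral>y. indicator {a$1..b$1} y * (p y * (q (b$2) * H (pt y (b$2)))) \<partial>lborel) - (\<integral>y. indicator {a$1..b$1} y * (p y * (q (a$2) * H (pt y (a$2)))) \<partial>lborel)"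
        if "continuous_on (cbox a b) H" for H
        by (subst Bochner_Integration.integral_diff[symmetric, OF i[OF that] i[OF that]])
           (use ab in \<open>auto simp: right_diff_distrib\<close>)
      have e: "(\<integral>y. indicator {a$1..b$1} y * ((p y * q c) * (F n (pt y c) - F' n (pt y c))) \<partial>lborel)
        = (\<integral>y. indicator {a$1..b$1} y * (p y * (q c * F n (pt y c))) \<partial>lborel) - (\<integral>y. indicator {a$1..b$1} y * (p y * (q c * F' n (pt y c))) \<partial>lborel)"
        if "c \<in> {a$2..b$2}" for c
        by (subst Bochner_Integration.integral_diff[symmetric, OF i[OF F(2) that] i[OF F'(2) that]])
           (simp add: right_diff_distrib mult.assoc)
      have mem: "a$2 \<in> {a$2..b$2}" "b$2 \<in> {a$2..b$2}" using ab by auto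
      show ?thesis
        unfolding green_2[OF ab wG(1)[OF F(1)] wG(2)[OF F(1)] F(2) pq] green_2[OF ab wG(1)[OF F'(1)] wG(2)[OF F'(1)] F'(2) pq]
        unfolding d[OF F(2)] d[OF F'(2)] e[OF mem(1)] e[OF mem(2)] by simp
    qed
    moreover have "(\<lambda>n. (\<integral>y. indicator {a$1..b$1} y * ((p y * q (b$2)) * ?E n (pt y (b$2))) \<partial>lborel) - (\<integral>y. indicator {a$1..b$1} y * ((p y * q (a$2)) * ?E n (pt y (a$2))) \<partial>lborel)) \<longlonglongrightarrow> 0 - 0"
      by (intro tendsto_diff side_null_2[OF cE ab] continuous_intros smooth_continuous pq) (use ab sides in auto)
    ultimately have "?T f - ?T f' = 0" using LIMSEQ_unique by fastforce
    then show ?g2 unfolding D_def split[OF W c] by simp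
  }
qed

lemma has_weak_gradient_lincomb:
  assumes f: "has_weak_gradient U f G" and g: "has_weak_gradient U g H"
  shows "has_weak_gradient U (\<lambda>x. c * f x + d * g x) (\<lambda>x. c *\<^sub>R G x + d *\<^sub>R H x)"
  unfolding has_weak_gradient_def
proof (intro conjI allI impI)
  have i: "set_integrable lebesgue C f" "set_integrable lebesgue C G" "set_integrable lebesgue C g" "set_integrable lebesgue C H"
    if "compact C" "C \<subseteq> U" for C
    using f g that unfolding has_weak_gradient_def by auto
  fix C :: "(real^2) set" assume "compact C \<and> C \<subseteq> U"
  then show "set_integrable lebesgue C (\<lambda>x. c * f x + d * g x)" "set_integrable lebesgue C (\<lambda>x. c *\<^sub>R G x + d *\<^sub>R H x)"
    using i[of C] by (auto intro!: set_integral_add simp: set_integrable_scaleR_right)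
next
  fix \<phi> i assume t: "test_function U \<phi>"
  obtain C where C: "compact C" "C \<subseteq> U" "\<And>x. x \<notin> C \<Longrightarrow> \<phi> x = 0" "\<And>x i. x \<notin> C \<Longrightarrow> partial i \<phi> x = 0"
    using test_function_support[OF t] by metis
  note cphi = test_function_continuous[OF t]
  have i: "set_integrable lebesgue C f" "set_integrable lebesgue C g" "set_integrable lebesgue C (\<lambda>x. G x $ i)" "set_integrable lebesgue C (\<lambda>x. H x $ i)"
    if "compact C" "C \<subseteq> U" for C
    using f g that unfolding has_weak_gradient_def by (auto intro!: set_integrable_nth)
  note I = set_integrable_test[OF i(1) C(1,2,4) cphi(2)] set_integrable_test[OF i(2) C(1,2,4) cphi(2)]
    set_integrable_test[OF i(3) C(1,2,3) cphi(1)] set_integrable_test[OF i(4) C(1,2,3) cphi(1)]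
  have lin: "(LINT x:U|lebesgue. (c * u x + d * v x) * w x) = c * (LINT x:U|lebesgue. u x * w x) + d * (LINT x:U|lebesgue. v x * w x)"
    if "set_integrable lebesgue U (\<lambda>x. u x * w x)" "set_integrable lebesgue U (\<lambda>x. v x * w x)" for u v w :: "real^2 \<Rightarrow> real"
  proof -
    have "(LINT x:U|lebesgue. (c * u x + d * v x) * w x) = (LINT x:U|lebesgue. c * (u x * w x) + d * (v x * w x))"
      by (simp only: distrib_right mult.assoc)
    also have "\<dots> = (LINT x:U|lebesgue. c * (u x * w x)) + (LINT x:U|lebesgue. d * (v x * w x))"
      by (rule set_integral_add(2)) (use that in auto)
    finally show ?thesis by simp
  qed
  have "(LINT x:U|lebesgue. f x * partial i \<phi> x) = - (LINT x:U|lebesgue. G x $ i * \<phi> x)"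
    "(LINT x:U|lebesgue. g x * partial i \<phi> x) = - (LINT x:U|lebesgue. H x $ i * \<phi> x)"
    using f g t unfolding has_weak_gradient_def by blast+
  then show "(LINT x:U|lebesgue. (c * f x + d * g x) * partial i \<phi> x) = - (LINT x:U|lebesgue. (c *\<^sub>R G x + d *\<^sub>R H x) $ i * \<phi> x)"
    using lin[OF I(1,2)] lin[OF I(3,4)] by simp
qed

lemma L2_on_lincomb:
  fixes f g :: "real^2 \<Rightarrow> 'b::euclidean_space"
  assumes U: "U \<in> sets lebesgue" and f: "L2_on U f" and g: "L2_on U g"
  shows "L2_on U (\<lambda>x. c *\<^sub>R f x + d *\<^sub>R g x)"
proof -
  note F = f[unfolded L2_on_iff[OF U]] and G = g[unfolded L2_on_iff[OF U]]
  have "(\<lambda>x. c *\<^sub>R (indicator U x *\<^sub>R f x) + d *\<^sub>R (indicator U x *\<^sub>R g x)) \<in> borel_measurable lebesgue"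
    by (intro borel_measurable_add borel_measurable_scaleR[OF borel_measurable_const] conjunct1[OF F] conjunct1[OF G])
  then have m: "(\<lambda>x. indicator U x *\<^sub>R (c *\<^sub>R f x + d *\<^sub>R g x)) \<in> borel_measurable lebesgue"
    by (simp add: algebra_simps)
  have i: "integrable lebesgue (\<lambda>x. (2 * c\<^sup>2) * (indicator U x *\<^sub>R (norm (f x))\<^sup>2) + (2 * d\<^sup>2) * (indicator U x *\<^sub>R (norm (g x))\<^sup>2))"
    using F G by (intro Bochner_Integration.integrable_add integrable_mult_right) auto
  have "integrable lebesgue (\<lambda>x. indicator U x *\<^sub>R (norm (c *\<^sub>R f x + d *\<^sub>R g x))\<^sup>2)"
  proof (rule Bochner_Integration.integrable_bound[OF i])
    have "(\<lambda>x. (norm (indicator U x *\<^sub>R (c *\<^sub>R f x + d *\<^sub>R g x)))\<^sup>2) \<in> borel_measurable lebesgue" using m by measurable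
    moreover have *: "(norm (indicator U x *\<^sub>R (c *\<^sub>R f x + d *\<^sub>R g x)))\<^sup>2 = indicator U x *\<^sub>R (norm (c *\<^sub>R f x + d *\<^sub>R g x))\<^sup>2" for x
      by (auto simp: indicator_def)
    ultimately show "(\<lambda>x. indicator U x *\<^sub>R (norm (c *\<^sub>R f x + d *\<^sub>R g x))\<^sup>2) \<in> borel_measurable lebesgue" by (simp only: *)
    have "(norm (c *\<^sub>R f x + d *\<^sub>R g x))\<^sup>2 \<le> 2 * c\<^sup>2 * (norm (f x))\<^sup>2 + 2 * d\<^sup>2 * (norm (g x))\<^sup>2" for x
    proof -
      have "norm (c *\<^sub>R f x + d *\<^sub>R g x) \<le> \<bar>c\<bar> * norm (f x) + \<bar>d\<bar> * norm (g x)"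
        using norm_triangle_ineq[of "c *\<^sub>R f x" "d *\<^sub>R g x"] by simp
      then have "(norm (c *\<^sub>R f x + d *\<^sub>R g x))\<^sup>2 \<le> (\<bar>c\<bar> * norm (f x) + \<bar>d\<bar> * norm (g x))\<^sup>2" by (intro power_mono) auto
      also have "\<dots> \<le> 2 * (\<bar>c\<bar> * norm (f x))\<^sup>2 + 2 * (\<bar>d\<bar> * norm (g x))\<^sup>2"
        using zero_le_power2[of "\<bar>c\<bar> * norm (f x) - \<bar>d\<bar> * norm (g x)"] by (simp add: power2_sum power2_diff)
      finally show ?thesis by (simp add: power_mult_distrib)
    qed
    then show "AE x in lebesgue. norm (indicator U x *\<^sub>R (norm (c *\<^sub>R f x + d *\<^sub>R g x))\<^sup>2) \<le>
      norm ((2 * c\<^sup>2) * (indicator U x *\<^sub>R (norm (f x))\<^sup>2) + (2 * d\<^sup>2) * (indicator U x *\<^sub>R (norm (g x))\<^sup>2))"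
      by (intro AE_I2) (auto simp: indicator_def mult.assoc)
  qed
  with m show ?thesis unfolding L2_on_iff[OF U] by blast
qed

lemma has_weak_gradient_cong:
  assumes "has_weak_gradient U f G" "\<And>x. x \<in> U \<Longrightarrow> f x = f' x" "\<And>x. x \<in> U \<Longrightarrow> G x = G' x"
  shows "has_weak_gradient U f' G'"
proof -
  have 1: "set_integrable lebesgue C f' = set_integrable lebesgue C f" "set_integrable lebesgue C G' = set_integrable lebesgue C G" if "C \<subseteq> U" for C
  proof -
    have "f' x = f x" "G' x = G x" if "x \<in> C" for x using assms(2,3) \<open>C \<subseteq> U\<close> that by auto
    then have "(\<lambda>x. indicator C x *\<^sub>R f' x) = (\<lambda>x. indicator C x *\<^sub>R f x)" "(\<lambda>x. indicator C x *\<^sub>R G' x) = (\<lambda>x. indicator C x *\<^sub>R G x)"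
      by (auto simp: indicator_def fun_eq_iff)
    then show "set_integrable lebesgue C f' = set_integrable lebesgue C f" "set_integrable lebesgue C G' = set_integrable lebesgue C G"
      unfolding set_integrable_def by simp_all
  qed
  have 2: "(LINT x:U|lebesgue. f' x * h x) = (LINT x:U|lebesgue. f x * h x)" "(LINT x:U|lebesgue. G' x $ i * h x) = (LINT x:U|lebesgue. G x $ i * h x)" for h i
    unfolding set_lebesgue_integral_def using assms(2,3)
    by (auto intro!: Bochner_Integration.integral_cong simp: indicator_def)
  show ?thesis using assms(1) unfolding has_weak_gradient_def 2 by (auto simp: 1)
qed

subsection \<open>The Fourier series of a tent function\<close>

lemma summable_inverse_Suc_square: "summable (\<lambda>n. 1 / (real (Suc n))\<^sup>2)"
  using inverse_squares_sums sums_summable by (auto simp: add.commute)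

lemma summable_powr_Suc: "a < -1 \<Longrightarrow> summable (\<lambda>n. real (Suc n) powr a)"
  using summable_Suc_iff[of "\<lambda>n. real n powr a"] by (simp add: summable_real_powr_iff)

lemma continuous_on_suminf_bounded:
  fixes f :: "nat \<Rightarrow> 'a::topological_space \<Rightarrow> 'b::banach"
  assumes "\<And>n. continuous_on A (f n)" "\<And>n x. x \<in> A \<Longrightarrow> norm (f n x) \<le> M n" "summable M"
  shows "continuous_on A (\<lambda>x. \<Sum>n. f n x)"
  by (rule uniform_limit_theorem[OF _ Weierstrass_m_test[OF assms(2,3)]])
     (auto intro!: always_eventually continuous_intros assms)

lemma suminf_has_field_derivative:
  fixes f :: "nat \<Rightarrow> 'a::{real_normed_field,banach} \<Rightarrow> 'a"
  assumes "convex S" "open S" and D: "\<And>n x. x \<in> S \<Longrightarrow> (f n has_field_derivative f' n x) (at x)"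
    and "\<And>n x. x \<in> S \<Longrightarrow> norm (f' n x) \<le> M n" "summable M" "x0 \<in> S" "summable (\<lambda>n. f n x0)" "x \<in> S"
  shows "((\<lambda>x. \<Sum>n. f n x) has_field_derivative (\<Sum>n. f' n x)) (at x)"
proof (rule has_field_derivative_series'(2)[where f = f and f' = f' and S = S, OF assms(1) _ _ assms(6,7)])
  show "uniformly_convergent_on S (\<lambda>n x. \<Sum>i<n. f' i x)" by (rule Weierstrass_m_test'[OF assms(4,5)])
  show "x \<in> interior S" using assms(2,8) by (simp add: interior_open)
qed (rule has_field_derivative_at_within[OF D])

text \<open>The real part of the dilogarithm on the unit circle, a quadratic polynomial on
  [0, 2 pi]. In a suitable difference of two values the squares cancel, which leaves a piecewise
  linear tent.\<close>

definition cosser :: "real \<Rightarrow> real" where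
  "cosser t = (\<Sum>n. cos (real (Suc n) * t) / (real (Suc n))\<^sup>2)"

text \<open>Polar form: 1 - cis s has modulus 2 sin (s/2) and argument (s - pi)/2. The argument is
  the expected derivative of \<open>cosser\<close>.\<close>

lemma Im_Ln_one_minus_cis:
  assumes "0 < s" "s < 2 * pi"
  shows "Im (Ln (1 - cis s)) = (s - pi) / 2" "1 - cis s \<noteq> 0" "cis s \<noteq> 1"
proof -
  have sp: "sin (s/2) > 0" using assms by (intro sin_gt_zero) auto
  have "1 - cis s = complex_of_real (2 * sin (s/2)) * cis ((s - pi)/2)"
  proof -
    have 1: "cos s = 1 - 2 * (sin (s/2))\<^sup>2" using cos_double_sin[of "s/2"] by simp
    have 2: "sin s = 2 * sin (s/2) * cos (s/2)" using sin_double[of "s/2"] by simp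
    have 3: "cos ((s - pi)/2) = sin (s/2)" "sin ((s - pi)/2) = - cos (s/2)"
      by (simp_all add: diff_divide_distrib cos_diff sin_diff)
    show ?thesis using 1 2 3 by (simp add: complex_eq_iff power2_eq_square)
  qed
  also have "\<dots> = exp (Complex (ln (2 * sin (s/2))) ((s - pi)/2))"
    unfolding exp_eq_polar using sp by simp
  finally have e: "1 - cis s = exp (Complex (ln (2 * sin (s/2))) ((s - pi)/2))" .
  then have "Ln (1 - cis s) = Complex (ln (2 * sin (s/2))) ((s - pi)/2)"
    using assms by (intro Ln_unique) auto
  then show "Im (Ln (1 - cis s)) = (s - pi) / 2" by simp
  show "1 - cis s \<noteq> 0" unfolding e by simp
  then show "cis s \<noteq> 1" by auto
qed

lemma Ln_one_minus_sums: "norm z < 1 \<Longrightarrow> (\<lambda>n. z ^ Suc n / of_nat (Suc n)) sums (- Ln (1 - z))"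
proof -
  assume z: "norm (z::complex) < 1"
  have "(\<lambda>n. - (z ^ n) / of_nat n) sums Ln (1 - z)" using Ln_series'[of "- z"] z by simp
  then have "(\<lambda>n. z ^ n / of_nat n) sums (- Ln (1 - z))" using sums_minus by fastforce
  then show ?thesis using sums_Suc_iff[of "\<lambda>n. z ^ n / of_nat n"] by simp
qed

text \<open>Abel regularisation: the termwise derivative of \<open>cosser\<close> converges only
  conditionally, whereas for r < 1 it converges geometrically and sums to the imaginary part of a
  logarithm.\<close>

definition cosser_abel :: "real \<Rightarrow> real \<Rightarrow> real" where
  "cosser_abel r t = (\<Sum>n. r ^ Suc n * cos (real (Suc n) * t) / (real (Suc n))\<^sup>2)"

lemma cosser_abel_DERIV:
  assumes "0 \<le> r" "r < 1"
  shows "(cosser_abel r has_real_derivative Im (Ln (1 - of_real r * cis t))) (at t)"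
proof -
  let ?f = "\<lambda>n t. r ^ Suc n * cos (real (Suc n) * t) / (real (Suc n))\<^sup>2"
  let ?f' = "\<lambda>n t. - (r ^ Suc n * sin (real (Suc n) * t) / real (Suc n))"
  have sm: "summable (\<lambda>n. r ^ Suc n)"
    using assms summable_Suc_iff[of "\<lambda>n. r ^ n"] by (simp add: summable_geometric del: power_Suc)
  have "((\<lambda>t. \<Sum>n. ?f n t) has_real_derivative (\<Sum>n. ?f' n t)) (at t)"
  proof (rule suminf_has_field_derivative[of UNIV])
    fix n x
    show "(?f n has_real_derivative ?f' n x) (at x)"
      by (auto intro!: derivative_eq_intros simp: power2_eq_square field_simps simp del: of_nat_Suc)
    have "norm (?f' n x) = r ^ Suc n * \<bar>sin (real (Suc n) * x)\<bar> / real (Suc n)"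
      using assms by (simp add: abs_mult)
    also have "\<dots> \<le> r ^ Suc n * 1 / 1"
      using assms by (intro frac_le mult_left_mono) auto
    finally show "norm (?f' n x) \<le> r ^ Suc n" by simp
  next
    have "norm (?f n 0) \<le> r ^ Suc n" for n
    proof -
      have "r ^ Suc n / (real (Suc n))\<^sup>2 \<le> r ^ Suc n / 1"
        using assms by (intro frac_le) (auto simp: one_le_power simp del: power_Suc)
      then show ?thesis using assms by (simp add: abs_mult)
    qed
    then show "summable (\<lambda>n. ?f n 0)" by (rule summable_comparison_test'[OF sm, of 0])
  qed (use sm in auto)
  moreover have "(\<Sum>n. ?f' n t) = Im (Ln (1 - of_real r * cis t))"
  proof -
    have "norm (of_real r * cis t) < 1" using assms by (simp add: norm_mult)
    from sums_Im[OF sums_minus[OF Ln_one_minus_sums[OF this]]]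
    have "(\<lambda>n. Im (- ((of_real r * cis t) ^ Suc n / of_nat (Suc n)))) sums Im (Ln (1 - of_real r * cis t))" by simp
    moreover have "Im (- ((of_real r * cis t) ^ Suc n / of_nat (Suc n))) = ?f' n t" for n
      unfolding power_mult_distrib Complex.DeMoivre of_real_power[symmetric]
      by (simp del: of_real_power of_nat_Suc power_Suc)
    ultimately have "(\<lambda>n. ?f' n t) sums Im (Ln (1 - of_real r * cis t))" by simp
    then show ?thesis by (rule sums_unique[symmetric])
  qed
  ultimately show ?thesis unfolding cosser_abel_def by simp
qed

lemma cosser_abel_tendsto: "(\<lambda>k. cosser_abel (1 - 1 / real (k + 2)) t) \<longlonglongrightarrow> cosser t"
proof -
  have "continuous_on {0..1} (\<lambda>r. cosser_abel r t)"
    unfolding cosser_abel_def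
  proof (rule continuous_on_suminf_bounded[OF _ _ summable_inverse_Suc_square])
    fix n and r :: real assume "r \<in> {0..1}"
    then have "\<bar>r ^ Suc n\<bar> \<le> 1" by (simp add: power_abs power_le_one del: power_Suc)
    then have "\<bar>r ^ Suc n * cos (real (Suc n) * t)\<bar> \<le> 1"
      unfolding abs_mult by (intro mult_le_one abs_cos_le_one abs_ge_zero)
    then show "norm (r ^ Suc n * cos (real (Suc n) * t) / (real (Suc n))\<^sup>2) \<le> 1 / (real (Suc n))\<^sup>2"
      by (simp add: divide_right_mono del: power_Suc of_nat_Suc)
  qed (auto intro!: continuous_intros simp del: of_nat_Suc power_Suc)
  moreover have "(\<lambda>k. 1 - 1 / real (k + 2)) \<longlonglongrightarrow> 1" by real_asymp
  moreover have "eventually (\<lambda>k. 1 - 1 / real (k + 2) \<in> {0..1}) sequentially" by (intro always_eventually) auto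
  ultimately have "(\<lambda>k. cosser_abel (1 - 1 / real (k + 2)) t) \<longlonglongrightarrow> cosser_abel 1 t"
    by (intro continuous_on_tendsto_compose[of "{0..1}" "\<lambda>r. cosser_abel r t"]) auto
  then show ?thesis by (simp add: cosser_abel_def cosser_def)
qed

text \<open>Integrates the derivative of the regularised series and lets r tend to 1. The imaginary
  part of \<open>Ln\<close> is bounded by pi, so the convergence is dominated.\<close>

lemma cosser_diff:
  assumes "0 < a" "a \<le> b" "b < 2 * pi"
  shows "cosser b - cosser a = (b - pi)\<^sup>2 / 4 - (a - pi)\<^sup>2 / 4"
proof -
  let ?r = "\<lambda>k. 1 - 1 / real (k + 2)"
  let ?g = "\<lambda>k s. Im (Ln (1 - of_real (?r k) * cis s))"
  have I: "(?g k has_integral (cosser_abel (?r k) b - cosser_abel (?r k) a)) {a..b}" for k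
  proof (rule fundamental_theorem_of_calculus[OF assms(2)])
    fix x
    have "(cosser_abel (?r k) has_real_derivative ?g k x) (at x)" by (rule cosser_abel_DERIV) auto
    then show "(cosser_abel (?r k) has_vector_derivative ?g k x) (at x within {a..b})"
      unfolding has_real_derivative_iff_has_vector_derivative by (rule has_vector_derivative_at_within)
  qed
  have lim: "(\<lambda>k. integral {a..b} (?g k)) \<longlonglongrightarrow> integral {a..b} (\<lambda>s. (s - pi) / 2)"
  proof (rule dominated_convergence(2)[where h="\<lambda>x. pi"])
    show "?g k integrable_on {a..b}" for k using I by blast
    show "norm (?g k x) \<le> pi" if "x \<in> {a..b}" for k x
    proof -
      have "norm (of_real (?r k) * cis x) < 1" unfolding norm_mult norm_of_real by simp
      then have "1 - of_real (?r k) * cis x \<noteq> 0" by force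
      from Im_Ln_le_pi[OF this] mpi_less_Im_Ln[OF this] show ?thesis by simp
    qed
    show "(\<lambda>k. ?g k x) \<longlonglongrightarrow> (x - pi) / 2" if x: "x \<in> {a..b}" for x
    proof -
      have x': "0 < x" "x < 2 * pi" using x assms by auto
      have "(\<lambda>k. ?r k) \<longlonglongrightarrow> 1" by real_asymp
      then have "(\<lambda>k. complex_of_real (?r k)) \<longlonglongrightarrow> of_real 1" by (rule tendsto_of_real)
      then have "(\<lambda>k. 1 - of_real (?r k) * cis x) \<longlonglongrightarrow> 1 - of_real 1 * cis x"
        by (intro tendsto_diff tendsto_mult tendsto_const)
      moreover have "1 - cis x \<notin> \<real>\<^sub>\<le>\<^sub>0"
      proof -
        have False if "1 - cis x \<in> \<real>\<^sub>\<le>\<^sub>0"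
        proof -
          have "1 \<le> cos x" "sin x = 0" using that by (auto simp: complex_nonpos_Reals_iff)
          then have "cos x = 1" "sin x = 0" by (auto intro: order_antisym)
          then show False using Im_Ln_one_minus_cis(2)[OF x'] by (simp add: complex_eq_iff)
        qed
        then show ?thesis by blast
      qed
      ultimately have "(\<lambda>k. Ln (1 - of_real (?r k) * cis x)) \<longlonglongrightarrow> Ln (1 - cis x)"
        by (intro tendsto_Ln) auto
      from tendsto_Im[OF this] show ?thesis using Im_Ln_one_minus_cis(1)[OF x'] by simp
    qed
  qed auto
  have "((\<lambda>s. (s - pi) / 2) has_integral ((b - pi)\<^sup>2 / 4 - (a - pi)\<^sup>2 / 4)) {a..b}"
    using assms(2) by (intro fundamental_theorem_of_calculus)
      (auto intro!: derivative_eq_intros simp: has_real_derivative_iff_has_vector_derivative[symmetric])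
  then have "integral {a..b} (\<lambda>s. (s - pi) / 2) = (b - pi)\<^sup>2 / 4 - (a - pi)\<^sup>2 / 4" by (rule integral_unique)
  moreover have "(\<lambda>k. integral {a..b} (?g k)) \<longlonglongrightarrow> cosser b - cosser a"
    unfolding integral_unique[OF I] by (intro tendsto_diff cosser_abel_tendsto)
  ultimately show ?thesis using lim LIMSEQ_unique by fastforce
qed

text \<open>Constancy on the open interval extends to its closure by continuity, and negative
  arguments follow by evenness. The constant stays unspecified, as only differences of
  \<open>cosser\<close> are used later.\<close>

lemma cosser_formula: "\<exists>C. \<forall>t. \<bar>t\<bar> \<le> 2 * pi \<longrightarrow> cosser t = (\<bar>t\<bar> - pi)\<^sup>2 / 4 + C"
proof -
  let ?h = "\<lambda>t. cosser t - (t - pi)\<^sup>2 / 4"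
  have cc: "continuous_on A cosser" for A
    unfolding cosser_def
    by (rule continuous_on_suminf_bounded[OF _ _ summable_inverse_Suc_square])
       (auto intro!: continuous_intros divide_right_mono simp del: of_nat_Suc)
  have "?h t = ?h pi" if "t \<in> {0<..<2*pi}" for t
    using cosser_diff[of t pi] cosser_diff[of pi t] that by (cases "t \<le> pi") auto
  then have "?h constant_on {0<..<2*pi}" unfolding constant_on_def by blast
  then have "?h constant_on closure {0<..<2*pi}"
    by (rule constant_on_closureI) (auto intro!: continuous_intros cc)
  then obtain C where C: "\<And>t. t \<in> {0..2*pi} \<Longrightarrow> ?h t = C" unfolding constant_on_def by auto
  have "cosser t = (\<bar>t\<bar> - pi)\<^sup>2 / 4 + C" if "\<bar>t\<bar> \<le> 2 * pi" for t
  proof -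
    have "cosser t = cosser \<bar>t\<bar>" unfolding cosser_def by (cases "t \<ge> 0") auto
    then show ?thesis using C[of "\<bar>t\<bar>"] that by (simp add: algebra_simps)
  qed
  then show ?thesis by blast
qed

section \<open>The sine series on the rectangle and its holomorphic form\<close>

definition kap :: real where "kap = 2 * pi / 3"

text \<open>Sine coefficients on an interval of length 3/2, whose basic frequency pi / (3/2) is
  \<open>kap\<close>. They belong to what remains of the boundary values at x2 = 1 after subtracting
  the linear interpolation between the two corners.\<close>

definition cf :: "nat \<Rightarrow> real" where
  "cf n = 6 * sin (real (Suc n) * kap) / (pi\<^sup>2 * (real (Suc n))\<^sup>2)"

lemma abs_cf: "\<bar>cf n\<bar> \<le> (6 / pi\<^sup>2) * (1 / (real (Suc n))\<^sup>2)"
proof -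
  have "\<bar>cf n\<bar> = (6 / pi\<^sup>2) * (\<bar>sin (real (Suc n) * kap)\<bar> / (real (Suc n))\<^sup>2)"
    unfolding cf_def by (simp add: abs_mult)
  also have "\<dots> \<le> (6 / pi\<^sup>2) * (1 / (real (Suc n))\<^sup>2)"
    by (intro mult_left_mono divide_right_mono) auto
  finally show ?thesis .
qed

text \<open>Product-to-sum turns the sine series into a difference of \<open>cosser\<close> at kap x
  and kap (x + 2); the quadratic parts cancel, and the modulus of x leaves the kink at 0.\<close>

lemma tent_series:
  assumes "-1 \<le> x" "x \<le> 1/2"
  shows "(\<lambda>n. cf n * sin (real (Suc n) * kap * (x + 1))) sums (2/3 * (x + 1) - max 0 (2 * x))"
proof -
  obtain C where C: "\<And>t. \<bar>t\<bar> \<le> 2 * pi \<Longrightarrow> cosser t = (\<bar>t\<bar> - pi)\<^sup>2 / 4 + C" using cosser_formula by blast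
  have sums: "(\<lambda>n. cos (real (Suc n) * t) / (real (Suc n))\<^sup>2) sums cosser t" for t
    unfolding cosser_def
    by (intro summable_sums summable_comparison_test'[OF summable_inverse_Suc_square, of 0])
       (auto intro!: divide_right_mono simp del: of_nat_Suc)
  let ?u = "kap * x" and ?v = "kap * (x + 2)"
  have "(\<lambda>n. 3 / pi\<^sup>2 * (cos (real (Suc n) * ?u) / (real (Suc n))\<^sup>2 - cos (real (Suc n) * ?v) / (real (Suc n))\<^sup>2)) sums (3 / pi\<^sup>2 * (cosser ?u - cosser ?v))"
    by (intro sums_mult sums_diff sums)
  moreover have "3 / pi\<^sup>2 * (cos (real (Suc n) * ?u) / (real (Suc n))\<^sup>2 - cos (real (Suc n) * ?v) / (real (Suc n))\<^sup>2)
     = cf n * sin (real (Suc n) * kap * (x + 1))" for n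
  proof -
    let ?m = "real (Suc n)"
    have e: "?m * ?u = ?m * kap * (x + 1) - ?m * kap" "?m * ?v = ?m * kap * (x + 1) + ?m * kap" by algebra+
    have "cos (?m * ?u) - cos (?m * ?v) = 2 * sin (?m * kap) * sin (?m * kap * (x + 1))"
      unfolding e cos_add cos_diff by simp
    then show ?thesis unfolding cf_def by (simp add: diff_divide_distrib[symmetric] del: of_nat_Suc)
  qed
  moreover have "3 / pi\<^sup>2 * (cosser ?u - cosser ?v) = 2/3 * (x + 1) - max 0 (2 * x)"
  proof -
    have b: "\<bar>?u\<bar> \<le> 2 * pi" "\<bar>?v\<bar> \<le> 2 * pi" "?v \<ge> 0"
      using assms mult_left_mono[of "\<bar>x\<bar>" 1 pi] mult_left_mono[of "x + 2" "5/2" pi] by (auto simp: kap_def abs_mult)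
    have "cosser ?u - cosser ?v = (\<bar>?u\<bar> - pi)\<^sup>2 / 4 - (?v - pi)\<^sup>2 / 4" using C[OF b(1)] C[OF b(2)] b(3) by simp
    also have "\<bar>?u\<bar> = kap * \<bar>x\<bar>" by (simp add: kap_def abs_mult)
    also have "(kap * \<bar>x\<bar> - pi)\<^sup>2 / 4 - (?v - pi)\<^sup>2 / 4 = pi\<^sup>2 / 3 * (2/3 * (x + 1) - max 0 (2 * x))"
      by (cases "x \<ge> 0") (auto simp: kap_def power2_eq_square max_def field_simps)
    finally have e: "cosser ?u - cosser ?v = pi\<^sup>2 / 3 * (2/3 * (x + 1) - max 0 (2 * x))" .
    show ?thesis unfolding e by simp
  qed
  ultimately show ?thesis by simp
qed

definition mu :: "nat \<Rightarrow> real" where "mu n = real (Suc n) * kap"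

lemma kap_pos: "kap > 0" and kap_gt_2: "kap > 2"
  using pi_gt3 by (auto simp: kap_def)

lemma mu_pos: "mu n > 0" "mu n \<ge> kap"
proof -
  show "mu n > 0" by (simp add: mu_def kap_pos)
  have "1 * kap \<le> real (Suc n) * kap" by (intro mult_right_mono) (use kap_pos in auto)
  then show "mu n \<ge> kap" by (simp add: mu_def)
qed

lemma mu_nonzero [simp]: "mu n \<noteq> 0"
  using mu_pos(1)[of n] by simp

lemma sinh_mu_ge: "sinh (mu n) \<ge> exp (mu n) / 4" "sinh (mu n) > 0"
proof -
  have "mu n \<ge> 1" using mu_pos(2)[of n] kap_gt_2 by simp
  then have "exp (mu n) \<ge> 2" using exp_ge_add_one_self[of "mu n"] by linarith
  then have "exp (- mu n) \<le> 1 / 2" by (simp add: exp_minus field_simps)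
  with \<open>exp (mu n) \<ge> 2\<close> show *: "sinh (mu n) \<ge> exp (mu n) / 4" by (simp add: sinh_field_def)
  then show "sinh (mu n) > 0" by (rule less_le_trans[rotated]) simp
qed

lemma inverse_sinh_mu_le: "1 / sinh (mu n) \<le> 4 * exp (- mu n)"
proof -
  have "1 / sinh (mu n) \<le> 1 / (exp (mu n) / 4)" using sinh_mu_ge[of n] by (intro divide_left_mono) auto
  then show ?thesis by (simp add: exp_minus field_simps)
qed

lemma exp_mu: "exp (mu n * t) = exp (kap * t) ^ Suc n"
  by (simp add: mu_def exp_of_nat_mult[symmetric] mult.assoc del: power_Suc of_nat_Suc)

lemma summable_exp_mu: assumes "t > 0" shows "summable (\<lambda>n. exp (- mu n * t))"
proof -
  have "exp (- kap * t) < 1" using kap_pos assms by simp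
  then have "summable (\<lambda>n. exp (- kap * t) ^ Suc n)"
    using summable_Suc_iff[of "\<lambda>n. exp (- kap * t) ^ n"] by (simp add: summable_geometric del: power_Suc)
  moreover have "exp (- mu n * t) = exp (- kap * t) ^ Suc n" for n using exp_mu[of n "-t"] by simp
  ultimately show ?thesis by simp
qed

lemma norm_trig_mu:
  "norm (cos (of_real (mu n) * z)) / sinh (mu n) \<le> 4 * exp (- mu n * (1 - \<bar>Im z\<bar>))"
  "norm (sin (of_real (mu n) * z)) / sinh (mu n) \<le> 4 * exp (- mu n * (1 - \<bar>Im z\<bar>))"
proof -
  have e: "\<bar>Im (of_real (mu n) * z)\<bar> = mu n * \<bar>Im z\<bar>" using mu_pos(1)[of n] by (simp add: abs_mult)
  have c: "norm (cos (of_real (mu n) * z)) \<le> exp (mu n * \<bar>Im z\<bar>)" "norm (sin (of_real (mu n) * z)) \<le> exp (mu n * \<bar>Im z\<bar>)"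
    using cmod_cos_le_exp[of 1 "of_real (mu n) * z"] cmod_sin_le_exp[of 1 "of_real (mu n) * z"] unfolding e by simp_all
  have "x / sinh (mu n) \<le> 4 * exp (- mu n * (1 - \<bar>Im z\<bar>))" if "x \<le> exp (mu n * \<bar>Im z\<bar>)" "0 \<le> x" for x
  proof -
    have "x * (1 / sinh (mu n)) \<le> exp (mu n * \<bar>Im z\<bar>) * (4 * exp (- mu n))"
      using that inverse_sinh_mu_le[of n] sinh_mu_ge(2)[of n] by (intro mult_mono) auto
    also have "\<dots> = 4 * exp (- mu n * (1 - \<bar>Im z\<bar>))" by (simp add: exp_add[symmetric] algebra_simps)
    finally show ?thesis by simp
  qed
  then show "norm (cos (of_real (mu n) * z)) / sinh (mu n) \<le> 4 * exp (- mu n * (1 - \<bar>Im z\<bar>))"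
    "norm (sin (of_real (mu n) * z)) / sinh (mu n) \<le> 4 * exp (- mu n * (1 - \<bar>Im z\<bar>))" using c by auto
qed

definition Hterm :: "nat \<Rightarrow> complex \<Rightarrow> complex" where
  "Hterm n z = of_real (cf n / sinh (mu n)) * cos (of_real (mu n) * (z + 1))"

definition Tterm :: "nat \<Rightarrow> complex \<Rightarrow> complex" where
  "Tterm n z = of_real (sin (mu n) / (real (Suc n) * sinh (mu n))) * sin (of_real (mu n) * (z + 1))"

definition Tfun :: "complex \<Rightarrow> complex" where "Tfun z = (\<Sum>n. Tterm n z)"

text \<open>The real part of the quadratic term is - 2/3 (x1 + 1) x2, which is correct on both
  vertical sides. Each further term contributes a multiple of sin (mu (x1 + 1)) sinh (mu x2): it
  vanishes on the vertical sides, is odd in x2, and is normalised by its values at x2 = 1.\<close>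

definition Hfun :: "complex \<Rightarrow> complex" where
  "Hfun z = \<i> / 3 * (z + 1)\<^sup>2 + \<i> * (\<Sum>n. Hterm n z)"

definition Hder :: "complex \<Rightarrow> complex" where
  "Hder z = \<i> * (2 / 3 * (z + 1) - 4 / of_real pi * Tfun z)"

lemma norm_Hterm: assumes "\<bar>Im z\<bar> \<le> 1" shows "norm (Hterm n z) \<le> (24 / pi\<^sup>2) * (1 / (real (Suc n))\<^sup>2)"
proof -
  have "norm (Hterm n z) = \<bar>cf n\<bar> * (norm (cos (of_real (mu n) * (z + 1))) / sinh (mu n))"
    using sinh_mu_ge(2)[of n] by (simp add: Hterm_def norm_mult norm_divide)
  also have "\<dots> \<le> ((6 / pi\<^sup>2) * (1 / (real (Suc n))\<^sup>2)) * 4"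
  proof (intro mult_mono abs_cf)
    have "norm (cos (of_real (mu n) * (z + 1))) / sinh (mu n) \<le> 4 * exp (- mu n * (1 - \<bar>Im z\<bar>))"
      using norm_trig_mu(1)[of n "z + 1"] by simp
    also have "\<dots> \<le> 4 * 1" using mu_pos(1)[of n] assms by (intro mult_left_mono) auto
    finally show "norm (cos (of_real (mu n) * (z + 1))) / sinh (mu n) \<le> 4" by simp
  qed (use sinh_mu_ge(2)[of n] in auto)
  finally show ?thesis by simp
qed

lemma norm_Tterm: "norm (Tterm n z) \<le> 4 / real (Suc n) * exp (- mu n * (1 - \<bar>Im z\<bar>))"
proof -
  have "norm (Tterm n z) = \<bar>sin (mu n)\<bar> / real (Suc n) * (norm (sin (of_real (mu n) * (z + 1))) / sinh (mu n))"
    using sinh_mu_ge(2)[of n] by (simp add: Tterm_def norm_mult norm_divide del: of_nat_Suc)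
  also have "\<dots> \<le> 1 / real (Suc n) * (4 * exp (- mu n * (1 - \<bar>Im z\<bar>)))"
    using norm_trig_mu(2)[of n "z + 1"] sinh_mu_ge(2)[of n] by (intro mult_mono divide_right_mono) auto
  finally show ?thesis by simp
qed

lemma norm_Tterm': "norm (Tterm n z) \<le> 4 * exp (- mu n * (1 - \<bar>Im z\<bar>))"
proof -
  have "4 / real (Suc n) * exp (- mu n * (1 - \<bar>Im z\<bar>)) \<le> 4 / 1 * exp (- mu n * (1 - \<bar>Im z\<bar>))"
    by (intro mult_right_mono divide_left_mono) auto
  then show ?thesis using norm_Tterm[of n z] by simp
qed

lemma continuous_on_Hfun: "continuous_on {z. \<bar>Im z\<bar> \<le> 1} Hfun"
proof -
  have "continuous_on {z. \<bar>Im z\<bar> \<le> 1} (\<lambda>z. \<Sum>n. Hterm n z)"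
    by (rule continuous_on_suminf_bounded[OF _ norm_Hterm summable_mult[OF summable_inverse_Suc_square]])
       (auto simp: Hterm_def intro!: continuous_intros)
  then show ?thesis unfolding Hfun_def by (intro continuous_intros) auto
qed

lemma summable_Hterm: "\<bar>Im z\<bar> \<le> 1 \<Longrightarrow> summable (\<lambda>n. Hterm n z)"
  by (rule summable_comparison_test'[OF summable_mult[OF summable_inverse_Suc_square], of 0]) (rule norm_Hterm)

lemma summable_Tterm: "\<bar>Im z\<bar> < 1 \<Longrightarrow> summable (\<lambda>n. Tterm n z)"
  by (rule summable_comparison_test'[OF summable_mult[OF summable_exp_mu[of "1 - \<bar>Im z\<bar>"], of 4], of 0 "\<lambda>n. Tterm n z"]) (use norm_Tterm' in auto)

lemma convex_strip: "convex {z. \<bar>Im z\<bar> < d}" and open_strip: "open {z. \<bar>Im z\<bar> < d}"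
proof -
  have e: "{z. \<bar>Im z\<bar> < d} = {z. Im z < d} \<inter> {z. Im z > - d}" by (auto simp: abs_less_iff)
  show "convex {z. \<bar>Im z\<bar> < d}" unfolding e by (intro convex_Int convex_halfspace_Im_lt convex_halfspace_Im_gt)
  show "open {z. \<bar>Im z\<bar> < d}" unfolding e by (intro open_Int open_halfspace_Im_lt open_halfspace_Im_gt)
qed

lemma Hfun_deriv:
  assumes z: "\<bar>Im z\<bar> < 1"
  shows "(Hfun has_field_derivative Hder z) (at z)"
proof -
  \<comment> \<open>Half the distance to the edge of the strip: on the correspondingly narrower
    strip the differentiated terms decay exponentially, uniformly in the point.\<close>
  define d where "d = (1 - \<bar>Im z\<bar>) / 2"
  have d: "d > 0" "\<bar>Im z\<bar> < 1 - d" using z by (auto simp: d_def field_simps)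
  let ?f' = "\<lambda>n z. - (4 / of_real pi * Tterm n z)"
  have "((\<lambda>z. \<Sum>n. Hterm n z) has_field_derivative (\<Sum>n. ?f' n z)) (at z)"
  proof (rule suminf_has_field_derivative[OF convex_strip[of "1 - d"] open_strip[of "1 - d"]])
    fix n x assume x: "x \<in> {z. \<bar>Im z\<bar> < 1 - d}"
    \<comment> \<open>Differentiation gains one factor \<open>mu n\<close>, which leaves
      coefficients of order 1 / n; this identity is the origin of the factor 4 / pi in
      \<open>Hder\<close>.\<close>
    have e: "cf n * mu n = 4 / pi * (sin (mu n) / real (Suc n))"
      by (simp add: cf_def mu_def kap_def power2_eq_square divide_simps del: of_nat_Suc)
    have "(Hterm n has_field_derivative of_real (cf n / sinh (mu n)) * (- sin (of_real (mu n) * (x + 1)) * of_real (mu n))) (at x)"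
      unfolding Hterm_def by (auto intro!: derivative_eq_intros)
    also have "of_real (cf n / sinh (mu n)) * (- sin (of_real (mu n) * (x + 1)) * of_real (mu n)) =
      - (of_real (cf n * mu n) / of_real (sinh (mu n)) * sin (of_real (mu n) * (x + 1)))" by simp
    also have "\<dots> = ?f' n x" unfolding e by (simp add: Tterm_def mult.assoc del: of_nat_Suc)
    finally show "(Hterm n has_field_derivative ?f' n x) (at x)" .
    have "norm (?f' n x) = 4 / pi * norm (Tterm n x)" by (simp add: norm_mult norm_divide)
    also have "\<dots> \<le> 4 / pi * (4 * exp (- mu n * d))"
    proof (intro mult_left_mono order_trans[OF norm_Tterm'])
      have "mu n * d \<le> mu n * (1 - \<bar>Im x\<bar>)" using x mu_pos(1)[of n] by (intro mult_left_mono) auto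
      then show "exp (- mu n * (1 - \<bar>Im x\<bar>)) \<le> exp (- mu n * d)" by simp
    qed auto
    finally show "norm (?f' n x) \<le> 4 / pi * (4 * exp (- mu n * d))" .
  next
    show "summable (\<lambda>n. 4 / pi * (4 * exp (- mu n * d)))" by (intro summable_mult summable_exp_mu d)
  qed (use d summable_Hterm[of z] in auto)
  moreover have "(\<Sum>n. ?f' n z) = - (4 / of_real pi * Tfun z)"
    unfolding Tfun_def suminf_mult[OF summable_Tterm[OF z], symmetric]
    by (rule suminf_minus[OF summable_mult[OF summable_Tterm[OF z]]])
  ultimately have "((\<lambda>z. \<Sum>n. Hterm n z) has_field_derivative - (4 / of_real pi * Tfun z)) (at z)" by simp
  then have "((\<lambda>z. \<i> / 3 * (z + 1)\<^sup>2 + \<i> * (\<Sum>n. Hterm n z)) has_field_derivative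
      \<i> / 3 * (2 * (z + 1)) + \<i> * - (4 / of_real pi * Tfun z)) (at z)"
    by (auto intro!: derivative_eq_intros)
  moreover have "\<i> / 3 * (2 * (z + 1)) + \<i> * - (4 / of_real pi * Tfun z) = Hder z"
    by (simp add: Hder_def right_diff_distrib)
  ultimately show ?thesis unfolding Hfun_def[abs_def] by simp
qed

lemma Hder_holomorphic: "Hder holomorphic_on {z. \<bar>Im z\<bar> < 1}"
proof -
  have "Hfun holomorphic_on {z. \<bar>Im z\<bar> < 1}"
    using Hfun_deriv by (auto simp: holomorphic_on_open[OF open_strip])
  then have "deriv Hfun holomorphic_on {z. \<bar>Im z\<bar> < 1}" by (rule holomorphic_deriv[OF _ open_strip])
  then show ?thesis by (rule holomorphic_transform) (auto simp: DERIV_imp_deriv[OF Hfun_deriv])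
qed

lemma Re_Hfun_sums:
  assumes "\<bar>y\<bar> \<le> 1"
  shows "(\<lambda>n. cf n / sinh (mu n) * (sin (mu n * (x + 1)) * sinh (mu n * y))) sums (Re (Hfun (Complex x y)) + 2/3 * (x + 1) * y)"
proof -
  let ?z = "Complex x y"
  have "(\<lambda>n. Re (\<i> * Hterm n ?z)) sums Re (\<i> * (\<Sum>n. Hterm n ?z))"
    by (intro sums_Re sums_mult summable_sums summable_Hterm) (use assms in auto)
  moreover have "Re (\<i> * Hterm n ?z) = cf n / sinh (mu n) * (sin (mu n * (x + 1)) * sinh (mu n * y))" for n
  proof -
    have "Im (cos (of_real (mu n) * (?z + 1))) = - (sin (mu n * (x + 1)) * sinh (mu n * y))"
    proof -
      have "Re (of_real (mu n) * (?z + 1)) = mu n * (x + 1)" "Im (of_real (mu n) * (?z + 1)) = mu n * y" by simp_all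
      then show ?thesis unfolding Im_cos sinh_field_def by (simp only:) (simp add: field_simps)
    qed
    then show ?thesis by (simp add: Hterm_def)
  qed
  moreover have "Re (\<i> * (\<Sum>n. Hterm n ?z)) = Re (Hfun ?z) + 2/3 * (x + 1) * y"
    by (simp add: Hfun_def power2_eq_square)
  ultimately show ?thesis by simp
qed

definition Sigma0 :: "real^2 \<Rightarrow> real" where
  "Sigma0 x = Re (Hfun (Complex (x$1) (x$2)))"

lemma sin_nat_kap: "sin (mu n * (3/2)) = 0"
proof -
  have "mu n * (3/2) = real (Suc n) * pi" by (simp add: mu_def kap_def)
  then show ?thesis by (simp only: sin_npi)
qed

text \<open>At x1 = -1 and x1 = 1/2 all sines vanish and the quadratic term alone is left; at x2 = 1
  and x2 = -1 the hyperbolic quotient is 1 or -1, and the tent series supplies the rest.\<close>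

lemma Sigma0_boundary:
  assumes "x \<in> cbox (pt (-1) (-1)) (pt (1/2) 1)" "x \<notin> box (pt (-1) (-1)) (pt (1/2) 1)"
  shows "Sigma0 x = sigma0 x"
proof -
  let ?x = "x$1" and ?y = "x$2"
  have b: "-1 \<le> ?x" "?x \<le> 1/2" "\<bar>?y\<bar> \<le> 1" using assms(1) by (auto simp: mem_box2)
  have g: "sigma0 x = - ?y * max 0 (2 * ?x)" using b by (auto simp: sigma0_def max_def)
  have S: "Sigma0 x = s - 2/3 * (?x + 1) * ?y"
    if "(\<lambda>n. cf n / sinh (mu n) * (sin (mu n * (?x + 1)) * sinh (mu n * ?y))) sums s" for s
    using sums_unique2[OF that Re_Hfun_sums[OF b(3), of ?x]] by (simp add: Sigma0_def)
  consider "?x = -1" | "?x = 1/2" | "?y = 1" | "?y = -1" using assms by (auto simp: mem_box2)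
  then show ?thesis
  proof cases
    case 1
    then have "Sigma0 x = 0 - 2/3 * (?x + 1) * ?y" by (intro S) (simp add: sums_zero)
    then show ?thesis using 1 g by simp
  next
    case 2
    have "?x + 1 = 3/2" using 2 by simp
    then have "sin (mu n * (?x + 1)) = 0" for n by (simp only: sin_nat_kap)
    then have "Sigma0 x = 0 - 2/3 * (?x + 1) * ?y" by (intro S) (simp add: sums_zero)
    then show ?thesis using 2 g by simp
  next
    case 3
    have "Sigma0 x = (2/3 * (?x + 1) - max 0 (2 * ?x)) - 2/3 * (?x + 1) * ?y"
    proof (rule S)
      have "cf n / sinh (mu n) * (sin (mu n * (?x + 1)) * sinh (mu n * ?y)) = cf n * sin (real (Suc n) * kap * (?x + 1))" for n
        using sinh_mu_ge(2)[of n] 3 by (simp add: mu_def)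
      then show "(\<lambda>n. cf n / sinh (mu n) * (sin (mu n * (?x + 1)) * sinh (mu n * ?y))) sums (2/3 * (?x + 1) - max 0 (2 * ?x))"
        using tent_series[OF b(1,2)] by simp
    qed
    then show ?thesis using 3 g by simp
  next
    case 4
    have "Sigma0 x = - (2/3 * (?x + 1) - max 0 (2 * ?x)) - 2/3 * (?x + 1) * ?y"
    proof (rule S)
      have "cf n / sinh (mu n) * (sin (mu n * (?x + 1)) * sinh (mu n * ?y)) = - (cf n * sin (real (Suc n) * kap * (?x + 1)))" for n
        using sinh_mu_ge(2)[of n] 4 by (simp add: mu_def)
      then show "(\<lambda>n. cf n / sinh (mu n) * (sin (mu n * (?x + 1)) * sinh (mu n * ?y))) sums (- (2/3 * (?x + 1) - max 0 (2 * ?x)))"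
        using sums_minus[OF tent_series[OF b(1,2)]] by simp
    qed
    then show ?thesis using 4 g by simp
  qed
qed

lemma exp_minus_le_powr: "x > 0 \<Longrightarrow> exp (- x) \<le> x powr (-1/4)" for x :: real
proof -
  assume x: "x > 0"
  have "ln x \<le> 4 * x" using ln_le_minus_one[OF x] x by linarith
  then show ?thesis using x by (simp add: powr_def)
qed

text \<open>From exp (- x) <= x powr (-1/4), each term is at most a multiple of n powr (-5/4) times
  the weight. Any exponent strictly between 0 and 1/2 in place of 1/4 would do: positive for
  summability, below 1/2 for a square integrable weight. Partial sums are included to dominate a
  later passage to the limit.\<close>

lemma Tterm_powr_bound:
  "\<exists>C. \<forall>z N. \<bar>Im z\<bar> < 1 \<longrightarrow> norm (\<Sum>n<N. Tterm n z) \<le> C * (1 - \<bar>Im z\<bar>) powr (-1/4) \<and> norm (Tfun z) \<le> C * (1 - \<bar>Im z\<bar>) powr (-1/4)"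
proof -
  let ?M = "\<lambda>n. 4 * real (Suc n) powr (-5/4)"
  have sM: "summable ?M" by (intro summable_mult summable_powr_Suc) simp
  define C where "C = (\<Sum>n. ?M n)"
  have t: "norm (Tterm n z) \<le> ?M n * (1 - \<bar>Im z\<bar>) powr (-1/4)" if z: "\<bar>Im z\<bar> < 1" for n z
  proof -
    let ?t = "1 - \<bar>Im z\<bar>"
    have pos: "?t > 0" "real (Suc n) * ?t > 0" using z by auto
    have "exp (- mu n * ?t) \<le> exp (- (real (Suc n) * ?t))"
      using mult_right_mono[of 1 kap "real (Suc n) * ?t"] pos kap_gt_2 by (simp add: mu_def mult_ac del: of_nat_Suc)
    also have "\<dots> \<le> (real (Suc n) * ?t) powr (-1/4)" by (rule exp_minus_le_powr[OF pos(2)])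
    also have "\<dots> = real (Suc n) powr (-1/4) * ?t powr (-1/4)" using pos by (simp add: powr_mult)
    finally have "4 / real (Suc n) * exp (- mu n * ?t) \<le> 4 / real (Suc n) * (real (Suc n) powr (-1/4) * ?t powr (-1/4))"
      by (intro mult_left_mono) auto
    also have "\<dots> = 4 * (real (Suc n) powr (-1) * real (Suc n) powr (-1/4)) * ?t powr (-1/4)"
      by (simp add: powr_minus_divide del: of_nat_Suc)
    also have "real (Suc n) powr (-1) * real (Suc n) powr (-1/4) = real (Suc n) powr (-5/4)"
      unfolding powr_add[symmetric] by simp
    finally show ?thesis using norm_Tterm[of n z] by linarith
  qed
  have "norm (\<Sum>n<N. Tterm n z) \<le> C * (1 - \<bar>Im z\<bar>) powr (-1/4) \<and> norm (Tfun z) \<le> C * (1 - \<bar>Im z\<bar>) powr (-1/4)"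
    if z: "\<bar>Im z\<bar> < 1" for z N
  proof -
    have s: "norm (\<Sum>n<N. Tterm n z) \<le> C * (1 - \<bar>Im z\<bar>) powr (-1/4)" for N
    proof -
      have "norm (\<Sum>n<N. Tterm n z) \<le> (\<Sum>n<N. ?M n * (1 - \<bar>Im z\<bar>) powr (-1/4))"
        by (intro sum_norm_le t z)
      also have "\<dots> = (\<Sum>n<N. ?M n) * (1 - \<bar>Im z\<bar>) powr (-1/4)" by (simp add: sum_distrib_right)
      also have "\<dots> \<le> C * (1 - \<bar>Im z\<bar>) powr (-1/4)"
        unfolding C_def by (intro mult_right_mono sum_le_suminf sM) auto
      finally show ?thesis .
    qed
    have "(\<lambda>N. norm (\<Sum>n<N. Tterm n z)) \<longlonglongrightarrow> norm (Tfun z)"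
      unfolding Tfun_def by (intro tendsto_norm summable_LIMSEQ summable_Tterm z)
    then have "norm (Tfun z) \<le> C * (1 - \<bar>Im z\<bar>) powr (-1/4)" by (rule LIMSEQ_le_const2) (use s in auto)
    with s show ?thesis by auto
  qed
  then show ?thesis by blast
qed

subsection \<open>Positivity and holomorphic extension of the sine series\<close>

text \<open>With g (u) = - ln |1 - r cis u| the sum is (g (t - a) - g (t + a)) / 2, and |1 - r cis
  u|^2 = 1 + r^2 - 2 r cos u. The sign condition says that cos (t + a) <= cos (t - a), which orders
  the two moduli.\<close>

lemma log_kernel_nonneg:
  assumes r: "0 \<le> r" "r < 1" and s: "sin a * sin t \<ge> 0"
  shows "\<exists>N\<ge>0. (\<lambda>n. sin (real (Suc n) * a) * sin (real (Suc n) * t) / real (Suc n) * r ^ Suc n) sums N"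
proof -
  define g where "g u = - ln (norm (1 - of_real r * cis u))" for u
  have nz: "1 - of_real r * cis u \<noteq> 0" and lt: "norm (of_real r * cis u) < 1" for u
  proof -
    show "norm (of_real r * cis u) < 1" unfolding norm_mult norm_of_real using r by simp
    then show "1 - of_real r * cis u \<noteq> 0" by force
  qed
  have g: "(\<lambda>n. cos (real (Suc n) * u) / real (Suc n) * r ^ Suc n) sums g u" for u
  proof -
    have "(\<lambda>n. Re ((of_real r * cis u) ^ Suc n / of_nat (Suc n))) sums Re (- Ln (1 - of_real r * cis u))"
      by (intro sums_Re Ln_one_minus_sums lt)
    moreover have "Re ((of_real r * cis u) ^ Suc n / of_nat (Suc n)) = cos (real (Suc n) * u) / real (Suc n) * r ^ Suc n" for n
      unfolding power_mult_distrib Complex.DeMoivre of_real_power[symmetric]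
      by (simp del: of_real_power of_nat_Suc power_Suc)
    ultimately show ?thesis using nz by (simp add: g_def)
  qed
  have "(\<lambda>n. 1/2 * (cos (real (Suc n) * (t - a)) / real (Suc n) * r ^ Suc n - cos (real (Suc n) * (t + a)) / real (Suc n) * r ^ Suc n))
     sums (1/2 * (g (t - a) - g (t + a)))"
    by (intro sums_mult sums_diff g)
  moreover have e: "1/2 * (cos (real (Suc n) * (t - a)) / real (Suc n) * r ^ Suc n - cos (real (Suc n) * (t + a)) / real (Suc n) * r ^ Suc n)
    = sin (real (Suc n) * a) * sin (real (Suc n) * t) / real (Suc n) * r ^ Suc n" for n
  proof -
    have "cos (real (Suc n) * (t - a)) - cos (real (Suc n) * (t + a)) = 2 * (sin (real (Suc n) * a) * sin (real (Suc n) * t))"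
      unfolding right_diff_distrib distrib_left cos_diff cos_add by simp
    moreover have "1/2 * (C / m * R - D / m * R) = S / m * R" if "C - D = 2 * S" for C D S m R :: real
    proof -
      have "C = D + 2 * S" using that by simp
      then show ?thesis by (simp add: add_divide_distrib algebra_simps)
    qed
    ultimately show ?thesis by blast
  qed
  moreover have "g (t + a) \<le> g (t - a)"
  proof -
    have sq: "(norm (1 - of_real r * cis u))\<^sup>2 = 1 + r\<^sup>2 - 2 * r * cos u" for u
    proof -
      have "(norm (1 - of_real r * cis u))\<^sup>2 = (1 - r * cos u)\<^sup>2 + (r * sin u)\<^sup>2" by (simp add: cmod_power2)
      also have "\<dots> = 1 - 2 * r * cos u + r\<^sup>2 * ((sin u)\<^sup>2 + (cos u)\<^sup>2)"
      proof -
        have "(1 - r * c)\<^sup>2 + (r * s)\<^sup>2 = 1 - 2 * r * c + r\<^sup>2 * (s\<^sup>2 + c\<^sup>2)" for c s by (simp add: power2_eq_square algebra_simps)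
        then show ?thesis .
      qed
      finally show ?thesis by simp
    qed
    have "cos (t + a) \<le> cos (t - a)" using s by (simp add: cos_add cos_diff mult.commute)
    then have "r * cos (t + a) \<le> r * cos (t - a)" using r by (intro mult_left_mono) auto
    then have "(norm (1 - of_real r * cis (t - a)))\<^sup>2 \<le> (norm (1 - of_real r * cis (t + a)))\<^sup>2" unfolding sq by simp
    then have "norm (1 - of_real r * cis (t - a)) \<le> norm (1 - of_real r * cis (t + a))" by (rule power2_le_imp_le) simp
    then show ?thesis using nz[of "t - a"] nz[of "t + a"] by (simp add: g_def)
  qed
  ultimately show ?thesis unfolding e by (intro exI[of _ "1/2 * (g (t - a) - g (t + a))"] conjI) simp_all
qed

text \<open>Multiplying cosh / sinh by exp (- 2 K mu) gives the tail of its geometric expansion from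
  index \<open>K\<close> on. Consecutive tails differ by two logarithmic kernels, so the sums
  \<open>q\<close> decrease, and they tend to 0; hence \<open>q 0\<close> is nonnegative. No
  interchange of two infinite sums is required.\<close>

lemma Re_Tfun_nonneg:
  assumes x: "-1 < x" "x < 1/2" and y: "\<bar>y\<bar> < 1"
  shows "Re (Tfun (Complex x y)) \<ge> 0"
proof -
  define a where "a n = sin (mu n) * sin (mu n * (x + 1)) / real (Suc n)" for n
  define w where "w K n = a n * (cosh (mu n * y) / sinh (mu n)) * exp (- mu n * (2 * real K))" for K n
  have aN: "\<exists>N\<ge>0. (\<lambda>n. a n * exp (- mu n * t)) sums N" if t: "t > 0" for t
  proof -
    \<comment> \<open>Here the range of \<open>x\<close> enters: kap (x + 1) lies between 0 and
      pi.\<close>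
    have "sin kap \<ge> 0" by (intro sin_ge_zero) (auto simp: kap_def)
    moreover have "sin (kap * (x + 1)) \<ge> 0"
      using x mult_left_mono[of "x + 1" "3/2" kap] kap_pos by (intro sin_ge_zero) (auto simp: kap_def)
    ultimately have "sin kap * sin (kap * (x + 1)) \<ge> 0" by simp
    moreover have "exp (- kap * t) < 1" using kap_pos t by simp
    ultimately have "\<exists>N\<ge>0. (\<lambda>n. sin (real (Suc n) * kap) * sin (real (Suc n) * (kap * (x + 1))) / real (Suc n) * exp (- kap * t) ^ Suc n) sums N"
      by (intro log_kernel_nonneg) auto
    moreover have "exp (- kap * t) ^ Suc n = exp (- mu n * t)" for n using exp_mu[of n "-t"] by simp
    ultimately show ?thesis by (simp add: a_def mu_def mult.assoc del: of_nat_Suc power_Suc)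
  qed
  have ch: "\<bar>cosh (mu n * y) / sinh (mu n)\<bar> \<le> 4 * exp (- mu n * (1 - \<bar>y\<bar>))" for n
  proof -
    have "norm (cos (of_real (mu n) * (\<i> * of_real y))) = cosh (mu n * y)"
    proof -
      have "cos (of_real (mu n) * (\<i> * of_real y)) = of_real (cosh (mu n * y))"
        by (simp add: complex_eq_iff Re_cos Im_cos cosh_field_def)
      then show ?thesis by simp
    qed
    then show ?thesis using norm_trig_mu(1)[of n "\<i> * of_real y"] sinh_mu_ge(2)[of n] by simp
  qed
  have a1: "\<bar>a n\<bar> \<le> 1" for n
  proof -
    have "\<bar>sin (mu n) * sin (mu n * (x + 1))\<bar> \<le> 1" unfolding abs_mult by (intro mult_le_one) auto
    then show ?thesis unfolding a_def abs_divide by (auto simp: divide_le_eq)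
  qed
  have wb: "\<bar>w K n\<bar> \<le> exp (- kap * (2 * real K)) * (4 * exp (- mu n * (1 - \<bar>y\<bar>)))" for K n
  proof -
    have "\<bar>w K n\<bar> = \<bar>a n\<bar> * \<bar>cosh (mu n * y) / sinh (mu n)\<bar> * exp (- mu n * (2 * real K))" by (simp add: w_def abs_mult)
    also have "\<dots> \<le> 1 * (4 * exp (- mu n * (1 - \<bar>y\<bar>))) * exp (- kap * (2 * real K))"
      using a1[of n] ch[of n] mult_right_mono[OF mu_pos(2)[of n], of "2 * real K"] by (intro mult_mono) auto
    finally show ?thesis by (simp add: mult_ac)
  qed
  have s4: "summable (\<lambda>n. 4 * exp (- mu n * (1 - \<bar>y\<bar>)))" using y by (intro summable_mult summable_exp_mu) auto
  have sw: "summable (w K)" for K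
    by (rule summable_comparison_test'[OF summable_mult[OF s4], of 0 _ "exp (- kap * (2 * real K))"]) (use wb in auto)
  define q where "q K = (\<Sum>n. w K n)" for K
  have step: "q (Suc K) \<le> q K" for K
  proof -
    let ?t1 = "2 * real K + 1 - y" and ?t2 = "2 * real K + 1 + y"
    have "?t1 > 0" "?t2 > 0" using y by (auto simp: abs_less_iff)
    obtain N1 where N1: "N1 \<ge> 0" "(\<lambda>n. a n * exp (- mu n * ?t1)) sums N1" using aN[OF \<open>?t1 > 0\<close>] by blast
    obtain N2 where N2: "N2 \<ge> 0" "(\<lambda>n. a n * exp (- mu n * ?t2)) sums N2" using aN[OF \<open>?t2 > 0\<close>] by blast
    note N = N1(1) N2(1) N1(2) N2(2)
    have e: "w K n - w (Suc K) n = a n * exp (- mu n * ?t1) + a n * exp (- mu n * ?t2)" for n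
    proof -
      have "cosh (mu n * y) / sinh (mu n) * (1 - exp (- mu n * 2)) = exp (- mu n * (1 - y)) + exp (- mu n * (1 + y))"
      proof -
        have "exp (mu n) * exp (- mu n) = 1" "exp (- mu n) * exp (- mu n) = exp (- mu n * 2)"
          by (simp_all add: exp_add[symmetric])
        then have "1 - exp (- mu n * 2) = (exp (mu n) - exp (- mu n)) * exp (- mu n)"
          by (simp only: left_diff_distrib)
        then have "1 - exp (- mu n * 2) = 2 * sinh (mu n) * exp (- mu n)"
          by (simp add: sinh_field_def)
        then have "cosh (mu n * y) / sinh (mu n) * (1 - exp (- mu n * 2)) = 2 * cosh (mu n * y) * exp (- mu n)"
          using sinh_mu_ge(2)[of n] by (simp only:) simp
        also have "\<dots> = exp (- mu n * (1 - y)) + exp (- mu n * (1 + y))"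
          by (simp add: cosh_field_def distrib_right exp_add[symmetric] algebra_simps)
        finally show ?thesis .
      qed
      note f1 = this
      have f2: "exp (- mu n * (2 * real (Suc K))) = exp (- mu n * (2 * real K)) * exp (- mu n * 2)"
        by (simp add: exp_add[symmetric] algebra_simps)
      have f3: "exp (- mu n * ?t1) = exp (- mu n * (2 * real K)) * exp (- mu n * (1 - y))"
        "exp (- mu n * ?t2) = exp (- mu n * (2 * real K)) * exp (- mu n * (1 + y))"
        by (simp_all add: exp_add[symmetric] algebra_simps)
      have "b * c * E - b * c * (E * X) = b * (E * P) + b * (E * Q)" if "c * (1 - X) = P + Q" for b c E X P Q :: real
      proof -
        have "b * c * E - b * c * (E * X) = b * E * (c * (1 - X))" by (simp add: algebra_simps)
        then show ?thesis unfolding that by (simp add: algebra_simps)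
      qed
      from this[OF f1] show ?thesis unfolding w_def f2 f3 .
    qed
    have "(\<lambda>n. w K n - w (Suc K) n) sums (N1 + N2)" unfolding e by (intro sums_add N)
    moreover have "(\<lambda>n. w K n - w (Suc K) n) sums (q K - q (Suc K))"
      unfolding q_def by (intro sums_diff summable_sums sw)
    ultimately have "q K - q (Suc K) = N1 + N2" by (rule sums_unique2[symmetric])
    then show ?thesis using N by linarith
  qed
  have "(\<lambda>K. exp (- kap * (2 * real K)) * (\<Sum>n. 4 * exp (- mu n * (1 - \<bar>y\<bar>)))) \<longlonglongrightarrow> 0 * (\<Sum>n. 4 * exp (- mu n * (1 - \<bar>y\<bar>)))"
  proof (intro tendsto_mult tendsto_const)
    have "(\<lambda>K. exp (- (kap * 2)) ^ K) \<longlonglongrightarrow> 0" using kap_pos by (intro LIMSEQ_power_zero) simp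
    then show "(\<lambda>K. exp (- kap * (2 * real K))) \<longlonglongrightarrow> 0" by (simp add: exp_of_nat_mult[symmetric] mult_ac)
  qed
  moreover have "norm (q K) \<le> exp (- kap * (2 * real K)) * (\<Sum>n. 4 * exp (- mu n * (1 - \<bar>y\<bar>)))" for K
  proof -
    have "norm (q K) \<le> (\<Sum>n. exp (- kap * (2 * real K)) * (4 * exp (- mu n * (1 - \<bar>y\<bar>))))"
      unfolding q_def by (rule norm_suminf_le[OF _ summable_mult[OF s4]]) (use wb in auto)
    then show ?thesis by (simp only: suminf_mult[OF s4])
  qed
  ultimately have "q \<longlonglongrightarrow> 0" by (intro Lim_null_comparison[of q]) (auto intro: always_eventually)
  moreover have "decseq q" by (rule decseq_SucI) (rule step)
  ultimately have "q 0 \<ge> 0" using decseq_ge by blast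
  moreover have "Re (Tfun (Complex x y)) = q 0"
  proof -
    have "(\<lambda>n. Re (Tterm n (Complex x y))) sums Re (Tfun (Complex x y))"
      unfolding Tfun_def by (intro sums_Re summable_sums summable_Tterm) (use y in auto)
    moreover have "Re (Tterm n (Complex x y)) = w 0 n" for n
    proof -
      have "Re (of_real (mu n) * (Complex x y + 1)) = mu n * (x + 1)" "Im (of_real (mu n) * (Complex x y + 1)) = mu n * y" by simp_all
      then have "Re (sin (of_real (mu n) * (Complex x y + 1))) = sin (mu n * (x + 1)) * cosh (mu n * y)"
        unfolding Re_sin cosh_field_def by (simp only:)
      then show ?thesis by (simp add: Tterm_def w_def a_def del: of_nat_Suc)
    qed
    ultimately show ?thesis unfolding q_def by (simp add: sums_unique)
  qed
  ultimately show ?thesis by simp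
qed

section \<open>Analytic continuation near the segment\<close>

definition Aexp :: "complex \<Rightarrow> nat \<Rightarrow> complex \<Rightarrow> complex" where
  "Aexp s n z = exp (of_real (mu n) * (s * (z + 1) - 1))"

lemma norm_Aexp: "s = \<i> \<or> s = - \<i> \<Longrightarrow> norm (Aexp s n z) \<le> exp (- mu n * (1 - \<bar>Im z\<bar>))"
proof -
  assume s: "s = \<i> \<or> s = - \<i>"
  have "norm (Aexp s n z) = exp (mu n * (Re (s * (z + 1)) - 1))" by (simp add: Aexp_def norm_exp_eq_Re)
  also have "\<dots> \<le> exp (mu n * (\<bar>Im z\<bar> - 1))" using s mu_pos(1)[of n] by (auto intro!: mult_left_mono)
  finally show ?thesis by (simp add: algebra_simps)
qed

text \<open>The relative error of 2 exp (- mu) as an approximation of 1 / sinh mu. Being of order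
  exp (- 2 mu), it buys convergence on a wider strip.\<close>

definition rho :: "nat \<Rightarrow> real" where "rho n = exp (-2 * mu n) / (1 - exp (-2 * mu n))"

lemma rho_bounds: "0 \<le> rho n" "rho n \<le> 2 * exp (-2 * mu n)" "1 / sinh (mu n) = 2 * exp (- mu n) * (1 + rho n)"
proof -
  have "2 * mu n \<ge> 1" using mu_pos(2)[of n] kap_gt_2 by simp
  then have "exp (2 * mu n) \<ge> 2" using exp_ge_add_one_self[of "2 * mu n"] by linarith
  then have h: "1 - exp (-2 * mu n) \<ge> 1/2" by (simp add: exp_minus field_simps)
  then have "1 - exp (-2 * mu n) \<ge> 0" by linarith
  then show "0 \<le> rho n" unfolding rho_def by (intro divide_nonneg_nonneg exp_ge_zero)
  have "exp (-2 * mu n) / (1 - exp (-2 * mu n)) \<le> exp (-2 * mu n) / (1/2)" by (rule frac_le[OF exp_ge_zero order_refl _ h]) simp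
  then show "rho n \<le> 2 * exp (-2 * mu n)" by (simp add: rho_def)
  have "1 + rho n = 1 / (1 - exp (-2 * mu n))" using h mu_pos(1)[of n] by (simp add: rho_def field_simps)
  moreover have "sinh (mu n) * (2 * exp (- mu n)) = 1 - exp (-2 * mu n)"
  proof -
    have "exp (mu n) * exp (- mu n) = 1" "exp (- mu n) * exp (- mu n) = exp (-2 * mu n)"
      by (simp_all add: exp_add[symmetric])
    then have "1 - exp (-2 * mu n) = (exp (mu n) - exp (- mu n)) * exp (- mu n)" by (simp only: left_diff_distrib)
    then show ?thesis by (simp add: sinh_field_def)
  qed
  ultimately have "sinh (mu n) * (2 * exp (- mu n) * (1 + rho n)) = 1" using h by (simp add: mult.assoc[symmetric])
  then show "1 / sinh (mu n) = 2 * exp (- mu n) * (1 + rho n)" using sinh_mu_ge(2)[of n] by (simp add: field_simps)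
qed

text \<open>\<open>Aexp\<close> is one of the two exponentials of the sine, damped by exp (- mu).
  The part without \<open>rho\<close> is a power series that sums to logarithms; the part with
  \<open>rho\<close> converges beyond the edge of the unit strip.\<close>

lemma Tterm_split:
  "Tterm n z = - \<i> * of_real (sin (mu n) / real (Suc n)) * (Aexp \<i> n z - Aexp (- \<i>) n z)
     + - \<i> * of_real (sin (mu n) / real (Suc n) * rho n) * (Aexp \<i> n z - Aexp (- \<i>) n z)"
proof -
  have "Tterm n z = of_real (sin (mu n) / real (Suc n) * (1 / sinh (mu n))) * sin (of_real (mu n) * (z + 1))"
    by (simp add: Tterm_def)
  also have "\<dots> = of_real (sin (mu n) / real (Suc n) * (1 + rho n)) * (2 * of_real (exp (- mu n)) * sin (of_real (mu n) * (z + 1)))"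
    unfolding rho_bounds(3) by (simp del: of_nat_Suc)
  also have "2 * of_real (exp (- mu n)) * sin (of_real (mu n) * (z + 1)) = - \<i> * (Aexp \<i> n z - Aexp (- \<i>) n z)"
  proof -
    have "Aexp s n z = of_real (exp (- mu n)) * exp (s * (of_real (mu n) * (z + 1)))" for s
      unfolding Aexp_def exp_of_real[symmetric] exp_add[symmetric] by (simp add: algebra_simps)
    then show ?thesis by (simp add: sin_exp_eq field_simps)
  qed
  finally have "Tterm n z = of_real (sin (mu n) / real (Suc n) * (1 + rho n)) * (- \<i> * (Aexp \<i> n z - Aexp (- \<i>) n z))" .
  moreover have "of_real (s * (1 + r)) * (c * d) = c * of_real s * d + c * of_real (s * r) * d" for s r :: real and c d :: complex
    by (simp add: algebra_simps)
  ultimately show ?thesis by (simp only:)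
qed

definition Rfun :: "complex \<Rightarrow> complex" where
  "Rfun z = (\<Sum>n. - \<i> * of_real (sin (mu n) / real (Suc n) * rho n) * (Aexp \<i> n z - Aexp (- \<i>) n z))"

text \<open>For |Im z| < 2 the exponentials are at most exp (mu), while \<open>rho\<close> is at
  most 2 exp (- 2 mu); the terms and their derivatives thus decay like exp (- mu), uniformly on that
  strip.\<close>

lemma Rfun:
  shows Rfun_holomorphic: "Rfun holomorphic_on {z. \<bar>Im z\<bar> < 2}"
    and Rfun_summable: "\<bar>Im z\<bar> < 2 \<Longrightarrow> summable (\<lambda>n. - \<i> * of_real (sin (mu n) / real (Suc n) * rho n) * (Aexp \<i> n z - Aexp (- \<i>) n z))"
proof -
  let ?f = "\<lambda>n z. - \<i> * of_real (sin (mu n) / real (Suc n) * rho n) * (Aexp \<i> n z - Aexp (- \<i>) n z)"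
  let ?f' = "\<lambda>n z. of_real (sin (mu n) / real (Suc n) * rho n * mu n) * (Aexp \<i> n z + Aexp (- \<i>) n z)"
  have c: "\<bar>sin (mu n) / real (Suc n) * rho n * t\<bar> \<le> (t / real (Suc n)) * (2 * exp (-2 * mu n))" if "t \<ge> 0" for n t
  proof -
    have "\<bar>sin (mu n) / real (Suc n) * rho n * t\<bar> = (t / real (Suc n)) * (\<bar>sin (mu n)\<bar> * rho n)"
      using rho_bounds(1)[of n] that by (simp add: abs_mult)
    also have "\<dots> \<le> (t / real (Suc n)) * (1 * (2 * exp (-2 * mu n)))"
      using rho_bounds[of n] that by (intro mult_left_mono mult_mono) auto
    finally show ?thesis by simp
  qed
  have AB: "norm (Aexp \<i> n z) + norm (Aexp (- \<i>) n z) \<le> 2 * exp (mu n)" if "\<bar>Im z\<bar> < 2" for n z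
  proof -
    have "- mu n * (1 - \<bar>Im z\<bar>) \<le> mu n * 1" using that mu_pos(1)[of n] mult_left_mono[of "\<bar>Im z\<bar> - 1" 1 "mu n"] by (simp add: algebra_simps)
    then have "exp (- mu n * (1 - \<bar>Im z\<bar>)) \<le> exp (mu n)" by simp
    moreover have "norm (Aexp \<i> n z) \<le> exp (- mu n * (1 - \<bar>Im z\<bar>))" "norm (Aexp (- \<i>) n z) \<le> exp (- mu n * (1 - \<bar>Im z\<bar>))"
      by (intro norm_Aexp; simp)+
    ultimately show ?thesis by linarith
  qed
  have bound: "norm (of_real (sin (mu n) / real (Suc n) * rho n * t) * u) \<le> (t / real (Suc n)) * (4 * exp (- mu n * 1))"
    if "norm u \<le> 2 * exp (mu n)" "t \<ge> 0" for n t and u :: complex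
  proof -
    have "norm (of_real (sin (mu n) / real (Suc n) * rho n * t) * u) \<le> ((t / real (Suc n)) * (2 * exp (-2 * mu n))) * (2 * exp (mu n))"
      unfolding norm_mult norm_of_real using c[OF that(2), of n] that by (intro mult_mono) auto
    also have "\<dots> = (t / real (Suc n)) * (4 * (exp (-2 * mu n) * exp (mu n)))" by simp
    also have "exp (-2 * mu n) * exp (mu n) = exp (- mu n * 1)" by (simp add: exp_add[symmetric])
    finally show ?thesis .
  qed
  have sm: "summable (\<lambda>n. C * (4 * exp (- mu n * 1)))" for C :: real by (intro summable_mult summable_exp_mu) simp
  show sf: "summable (\<lambda>n. ?f n z)" if z: "\<bar>Im z\<bar> < 2" for z
  proof (rule summable_comparison_test'[OF sm[of 1], of 0])
    fix n
    have "norm (- \<i> * (Aexp \<i> n z - Aexp (- \<i>) n z)) \<le> 2 * exp (mu n)"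
      using AB[OF z, of n] norm_triangle_ineq4[of "Aexp \<i> n z" "Aexp (- \<i>) n z"] by (simp add: norm_mult)
    from bound[OF this, of 1] have "norm (?f n z) \<le> 1 / real (Suc n) * (4 * exp (- mu n * 1))" by (simp add: mult_ac norm_mult)
    also have "\<dots> \<le> 1 * (4 * exp (- mu n * 1))" by (intro mult_right_mono) auto
    finally show "norm (?f n z) \<le> 1 * (4 * exp (- mu n * 1))" .
  qed
  have "(Rfun has_field_derivative (\<Sum>n. ?f' n z)) (at z)" if z: "\<bar>Im z\<bar> < 2" for z
    unfolding Rfun_def
  proof (rule suminf_has_field_derivative[OF convex_strip[of 2] open_strip[of 2]])
    fix n x assume x: "x \<in> {z. \<bar>Im z\<bar> < 2}"
    have dA: "(Aexp s n has_field_derivative Aexp s n x * (of_real (mu n) * s)) (at x)" for s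
      unfolding Aexp_def by (auto intro!: derivative_eq_intros)
    have e: "- \<i> * c * (A * (m * \<i>) - B * (m * - \<i>)) = (c * m) * (A + B)" for A B c m :: complex by (simp add: algebra_simps)
    show "(?f n has_field_derivative ?f' n x) (at x)"
      by (rule DERIV_cong[OF DERIV_cmult[OF DERIV_diff[OF dA dA]]]) (simp only: e of_real_mult)
    have "norm (Aexp \<i> n x + Aexp (- \<i>) n x) \<le> 2 * exp (mu n)"
      using AB[of x n] x norm_triangle_ineq[of "Aexp \<i> n x" "Aexp (- \<i>) n x"] by simp
    from bound[OF this, of "mu n"] mu_pos(1)[of n] have "norm (?f' n x) \<le> mu n / real (Suc n) * (4 * exp (- mu n * 1))" by simp
    also have "mu n / real (Suc n) = kap" by (simp add: mu_def)
    finally show "norm (?f' n x) \<le> kap * (4 * exp (- mu n * 1))" .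
  qed (use z sm sf[of z] in auto)
  then show "Rfun holomorphic_on {z. \<bar>Im z\<bar> < 2}" by (auto simp: holomorphic_on_open[OF open_strip])
qed

lemma Aexp_power: "Aexp s n z = Aexp s 0 z ^ Suc n"
  by (simp add: Aexp_def mu_def exp_of_nat_mult[symmetric] algebra_simps del: power_Suc)

text \<open>Writing sin (mu) by cis (mu) and cis (- mu) gives two power series in
  \<open>Aexp s 0 z\<close>, each of them the Taylor series of a logarithm.\<close>

lemma log_part_sums:
  assumes "norm (Aexp s 0 z) < 1"
  shows "(\<lambda>n. of_real (sin (mu n) / real (Suc n)) * Aexp s n z) sums
    (- \<i> / 2 * (Ln (1 - cis (- kap) * Aexp s 0 z) - Ln (1 - cis kap * Aexp s 0 z)))"
proof -
  have n: "norm (cis u * Aexp s 0 z) < 1" for u using assms by (simp add: norm_mult)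
  have "(\<lambda>n. - \<i> / 2 * ((cis kap * Aexp s 0 z) ^ Suc n / of_nat (Suc n) - (cis (- kap) * Aexp s 0 z) ^ Suc n / of_nat (Suc n)))
     sums (- \<i> / 2 * (- Ln (1 - cis kap * Aexp s 0 z) - (- Ln (1 - cis (- kap) * Aexp s 0 z))))"
    by (intro sums_mult sums_diff Ln_one_minus_sums n)
  moreover have "- \<i> / 2 * ((cis kap * Aexp s 0 z) ^ Suc n / of_nat (Suc n) - (cis (- kap) * Aexp s 0 z) ^ Suc n / of_nat (Suc n))
     = of_real (sin (mu n) / real (Suc n)) * Aexp s n z" for n
  proof -
    have c: "cis (mu n) - cis (- mu n) = 2 * \<i> * of_real (sin (mu n))" by (simp add: complex_eq_iff)
    have "- \<i> / 2 * ((cis kap * Aexp s 0 z) ^ Suc n / of_nat (Suc n) - (cis (- kap) * Aexp s 0 z) ^ Suc n / of_nat (Suc n))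
      = - \<i> / 2 * ((cis (mu n) - cis (- mu n)) * Aexp s n z / of_nat (Suc n))"
      unfolding power_mult_distrib Complex.DeMoivre Aexp_power[of s n z, symmetric]
      by (simp add: mu_def left_diff_distrib diff_divide_distrib del: of_nat_Suc)
    also have "\<dots> = of_real (sin (mu n) / real (Suc n)) * Aexp s n z" unfolding c by (simp del: of_nat_Suc)
    finally show ?thesis .
  qed
  ultimately show ?thesis by (simp add: algebra_simps)
qed

text \<open>On the closure of \<open>Omega\<close> the arguments of the logarithms vanish only at i
  and -i, the kinks of the boundary values; restricting to Re z >= 1/4 stays away from them.
  \<open>W\<close> demands positive real parts, so that the principal branch is holomorphic.\<close>

lemma Tfun_extension:
  "\<exists>W G. open W \<and> {z. 1/4 \<le> Re z \<and> Re z \<le> 1/2 \<and> \<bar>Im z\<bar> \<le> 1} \<subseteq> W \<and> G holomorphic_on W \<and> (\<forall>z\<in>W. \<bar>Im z\<bar> < 1 \<longrightarrow> G z = Tfun z)"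
proof -
  define W where "W = {z. \<bar>Im z\<bar> < 2} \<inter> {z. Re (1 - cis kap * Aexp \<i> 0 z) > 0} \<inter> {z. Re (1 - cis (- kap) * Aexp \<i> 0 z) > 0}
    \<inter> {z. Re (1 - cis kap * Aexp (- \<i>) 0 z) > 0} \<inter> {z. Re (1 - cis (- kap) * Aexp (- \<i>) 0 z) > 0}"
  define lp where "lp s z = - \<i> / 2 * (Ln (1 - cis (- kap) * Aexp s 0 z) - Ln (1 - cis kap * Aexp s 0 z))" for s z
  define G where "G z = - \<i> * (lp \<i> z - lp (- \<i>) z) + Rfun z" for z
  have hA: "Aexp s n holomorphic_on A" for s n A unfolding Aexp_def by (intro holomorphic_intros)
  have cA: "continuous_on A (\<lambda>z. Re (1 - cis u * Aexp s 0 z))" for A u s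
    by (intro continuous_intros holomorphic_on_imp_continuous_on hA)
  have oW: "open W" unfolding W_def
    by (intro open_Int open_strip open_Collect_less cA continuous_intros)
  have hlp: "lp s holomorphic_on W" if "s = \<i> \<or> s = - \<i>" for s
    unfolding lp_def
    by (intro holomorphic_intros hA) (use that in \<open>auto simp: W_def complex_nonpos_Reals_iff\<close>)
  have hG: "G holomorphic_on W"
    unfolding G_def by (intro holomorphic_intros hlp holomorphic_on_subset[OF Rfun_holomorphic]) (auto simp: W_def)
  have eq: "G z = Tfun z" if z: "\<bar>Im z\<bar> < 1" for z
  proof -
    have "norm (Aexp s 0 z) < 1" if "s = \<i> \<or> s = - \<i>" for s
    proof -
      have "mu 0 * (1 - \<bar>Im z\<bar>) > 0" using z mu_pos(1)[of 0] by simp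
      then have "exp (- mu 0 * (1 - \<bar>Im z\<bar>)) < 1" by simp
      then show ?thesis using norm_Aexp[OF that, of 0 z] by linarith
    qed
    then have s: "(\<lambda>n. of_real (sin (mu n) / real (Suc n)) * Aexp \<i> n z) sums lp \<i> z"
      "(\<lambda>n. of_real (sin (mu n) / real (Suc n)) * Aexp (- \<i>) n z) sums lp (- \<i>) z"
      unfolding lp_def by (intro log_part_sums; simp)+
    have "(\<lambda>n. - \<i> * (of_real (sin (mu n) / real (Suc n)) * Aexp \<i> n z - of_real (sin (mu n) / real (Suc n)) * Aexp (- \<i>) n z)
       + - \<i> * of_real (sin (mu n) / real (Suc n) * rho n) * (Aexp \<i> n z - Aexp (- \<i>) n z)) sums G z"
      unfolding G_def Rfun_def using z by (intro sums_add sums_mult sums_diff s summable_sums Rfun_summable) auto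
    moreover have "- \<i> * (of_real (sin (mu n) / real (Suc n)) * Aexp \<i> n z - of_real (sin (mu n) / real (Suc n)) * Aexp (- \<i>) n z)
       + - \<i> * of_real (sin (mu n) / real (Suc n) * rho n) * (Aexp \<i> n z - Aexp (- \<i>) n z) = Tterm n z" for n
      unfolding Tterm_split by (simp only: right_diff_distrib mult.assoc)
    ultimately show ?thesis unfolding Tfun_def by (simp add: sums_unique)
  qed
  have sub: "{z. 1/4 \<le> Re z \<and> Re z \<le> 1/2 \<and> \<bar>Im z\<bar> \<le> 1} \<subseteq> W"
  proof
    fix z assume "z \<in> {z. 1/4 \<le> Re z \<and> Re z \<le> 1/2 \<and> \<bar>Im z\<bar> \<le> 1}"
    then have z: "1/4 \<le> Re z" "Re z \<le> 1/2" "\<bar>Im z\<bar> \<le> 1" by auto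
    let ?x = "Re z"
    \<comment> \<open>Up to sign, the phases of the four terms are kap x and kap (x + 2). They lie
      in [pi/6, pi/3] and [3 pi/2, 5 pi/3], hence are not multiples of 2 pi.\<close>
    have c1: "cos (kap * ?x) < 1"
    proof -
      have "cos (kap * ?x) < cos 0"
        by (rule cos_monotone_0_pi) (use z kap_pos mult_left_mono[of ?x "1/2" kap] in \<open>auto simp: kap_def\<close>)
      then show ?thesis by simp
    qed
    have c2: "cos (kap * (?x + 2)) < 1"
    proof -
      have "cos (kap * (?x + 2)) = cos (2 * pi - kap * (?x + 2))" by (simp add: cos_diff)
      also have "\<dots> < cos 0"
      proof (rule cos_monotone_0_pi)
        have "pi * (1/4) \<le> pi * ?x" "pi * ?x \<le> pi * (1/2)" using z by (auto intro!: mult_left_mono)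
        then show "0 < 2 * pi - kap * (?x + 2)" "2 * pi - kap * (?x + 2) \<le> pi" using pi_gt3
          by (auto simp: kap_def field_simps)
      qed auto
      finally show ?thesis by simp
    qed
    have key: "Re (1 - cis u * Aexp s 0 z) > 0" if s: "s = \<i> \<or> s = - \<i>" and c: "cos (u + Im s * (kap * (?x + 1))) < 1" for s u
    proof -
      have e: "cis u * Aexp s 0 z = of_real (exp (mu 0 * (Re (s * (z + 1)) - 1))) * cis (u + mu 0 * Im (s * (z + 1)))"
        unfolding Aexp_def exp_eq_polar[of "of_real (mu 0) * _"] by (simp add: cis_mult[symmetric])
      have i: "mu 0 * Im (s * (z + 1)) = Im s * (kap * (?x + 1))" using s by (auto simp: mu_def)
      let ?e = "exp (mu 0 * (Re (s * (z + 1)) - 1))"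
      have "Re (s * (z + 1)) \<le> 1" using s z by auto
      then have "mu 0 * (Re (s * (z + 1)) - 1) \<le> 0" using mu_pos(1)[of 0] by (simp add: mult_le_0_iff)
      then have e1: "?e \<le> 1" by simp
      have "?e * cos (u + Im s * (kap * (?x + 1))) < 1"
      proof (cases "cos (u + Im s * (kap * (?x + 1))) \<le> 0")
        case True
        then have "?e * cos (u + Im s * (kap * (?x + 1))) \<le> 0" by (simp add: mult_le_0_iff)
        then show ?thesis by simp
      next
        case False
        then have "?e * cos (u + Im s * (kap * (?x + 1))) \<le> 1 * cos (u + Im s * (kap * (?x + 1)))" using e1 by (intro mult_right_mono) auto
        then show ?thesis using c by simp
      qed
      then show ?thesis unfolding e i by simp
    qed
    have "cos (kap + kap * (?x + 1)) < 1" "cos (- kap + kap * (?x + 1)) < 1" "cos (kap - kap * (?x + 1)) < 1" "cos (- kap - kap * (?x + 1)) < 1"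
    proof -
      have a: "kap + kap * (?x + 1) = kap * (?x + 2)" "- kap + kap * (?x + 1) = kap * ?x" "kap - kap * (?x + 1) = - (kap * ?x)"
        "- kap - kap * (?x + 1) = - (kap * (?x + 2))" by (simp_all add: algebra_simps)
      show "cos (kap + kap * (?x + 1)) < 1" "cos (- kap + kap * (?x + 1)) < 1" "cos (kap - kap * (?x + 1)) < 1" "cos (- kap - kap * (?x + 1)) < 1"
        unfolding a cos_minus using c1 c2 by auto
    qed
    note c = this
    have "Re (1 - cis kap * Aexp \<i> 0 z) > 0" "Re (1 - cis (- kap) * Aexp \<i> 0 z) > 0"
      "Re (1 - cis kap * Aexp (- \<i>) 0 z) > 0" "Re (1 - cis (- kap) * Aexp (- \<i>) 0 z) > 0"
      by (rule key; use c in simp)+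
    then show "z \<in> W" unfolding W_def using z(3) by (intro IntI CollectI) linarith+
  qed
  show ?thesis using oW sub hG eq by blast
qed

subsection \<open>Real parts of holomorphic functions\<close>

abbreviation cx :: "real^2 \<Rightarrow> complex" where "cx x \<equiv> Complex (x$1) (x$2)"

lemma cx_has_derivative: "(cx has_derivative cx) (at x)"
proof -
  have "cx = (\<lambda>x. of_real (x$1) + \<i> * of_real (x$2))" by (simp add: complex_eq_iff fun_eq_iff)
  moreover have "((\<lambda>x. of_real (x$1) + \<i> * of_real (x$2)) has_derivative (\<lambda>x. of_real (x$1) + \<i> * of_real (x$2))) (at x)"
    by (intro has_derivative_add has_derivative_mult_right has_derivative_of_real bounded_linear_imp_has_derivative bounded_linear_vec_nth)
  ultimately show ?thesis by simp
qed

lemma continuous_on_cx: "continuous_on A cx"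
  by (intro has_derivative_continuous_on[OF has_derivative_at_withinI[OF cx_has_derivative]])

lemma Re_holomorphic_has_derivative:
  assumes "(H has_field_derivative d) (at (cx x))"
  shows "((\<lambda>x. Re (H (cx x))) has_derivative (\<lambda>h. pt (Re d) (- Im d) \<bullet> h)) (at x)"
proof -
  have "((\<lambda>x. H (cx x)) has_derivative (\<lambda>h. d * cx h)) (at x)"
    using has_derivative_compose[OF cx_has_derivative assms[unfolded has_field_derivative_def]] by simp
  from has_derivative_Re[OF this] show ?thesis
    by (simp add: inner_vec_def sum_2 algebra_simps)
qed

lemma partial_Re_holomorphic:
  assumes "(H has_field_derivative d) (at (cx x))"
  shows "partial 1 (\<lambda>x. Re (H (cx x))) x = Re d" "partial 2 (\<lambda>x. Re (H (cx x))) x = Re (\<i> * d)"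
  using partial_has_derivative[OF Re_holomorphic_has_derivative[OF assms]] by simp_all

lemma partial_cong:
  assumes "open U" "x \<in> U" "\<And>y. y \<in> U \<Longrightarrow> f y = g y"
  shows "partial i f x = partial i g x"
proof -
  have "(f has_derivative D) (at x) \<longleftrightarrow> (g has_derivative D) (at x)" for D
    using has_derivative_transform_within_open[OF _ assms(1,2), of f D UNIV g]
      has_derivative_transform_within_open[OF _ assms(1,2), of g D UNIV f] assms(3) by auto
  then show ?thesis unfolding partial_def frechet_derivative_def by simp
qed

lemma Ck_on_cong:
  assumes "open U" "\<And>y. y \<in> U \<Longrightarrow> f y = g y" "Ck_on k U f"
  shows "Ck_on k U g"
  using assms(2,3)
proof (induction k arbitrary: f g)
  case 0
  then show ?case using continuous_on_cong[of U U f g] by simp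
next
  case (Suc k)
  have "g differentiable (at x)" if "x \<in> U" for x
  proof -
    have "f differentiable (at x)" using Suc.prems(2) that by simp
    then obtain D where "(f has_derivative D) (at x)" unfolding differentiable_def by blast
    then have "(g has_derivative D) (at x)"
      by (rule has_derivative_transform_within_open[OF _ assms(1) that Suc.prems(1)])
    then show ?thesis unfolding differentiable_def by blast
  qed
  moreover have "Ck_on k U (partial i g)" for i
  proof (rule Suc.IH)
    show "partial i f y = partial i g y" if "y \<in> U" for y
      by (rule partial_cong[OF assms(1) that Suc.prems(1)])
    show "Ck_on k U (partial i f)" using Suc.prems(2) by simp
  qed
  ultimately show ?case by simp
qed

text \<open>The induction closes because both partial derivatives are again real parts of
  holomorphic functions, namely of H' and of i H'.\<close>

lemma Ck_on_Re_holomorphic: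
  assumes S: "open S" and H: "H holomorphic_on S" and U: "open U" "cx ` U \<subseteq> S"
  shows "Ck_on k U (\<lambda>x. Re (H (cx x)))"
  using H
proof (induction k arbitrary: H)
  case 0
  have "continuous_on U (\<lambda>x. H (cx x))"
    by (rule continuous_on_compose2[OF holomorphic_on_imp_continuous_on[OF 0] continuous_on_cx]) (use U in auto)
  then show ?case by (auto intro: continuous_intros)
next
  case (Suc k)
  have D: "(H has_field_derivative deriv H (cx x)) (at (cx x))" if "x \<in> U" for x
    using holomorphic_derivI[OF Suc.prems S] U that by blast
  have d: "deriv H holomorphic_on S" by (rule holomorphic_deriv[OF Suc.prems S])
  have "Ck_on k U (\<lambda>x. Re (deriv H (cx x)))" by (rule Suc.IH[OF d])
  then have 1: "Ck_on k U (partial 1 (\<lambda>x. Re (H (cx x))))"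
    by (rule Ck_on_cong[OF U(1), rotated]) (rule partial_Re_holomorphic(1)[OF D, symmetric])
  have "(\<lambda>z. \<i> * deriv H z) holomorphic_on S" by (intro holomorphic_intros d)
  from Suc.IH[OF this] have 2: "Ck_on k U (partial 2 (\<lambda>x. Re (H (cx x))))"
    by (rule Ck_on_cong[OF U(1), rotated]) (rule partial_Re_holomorphic(2)[OF D, symmetric])
  have "(\<lambda>x. Re (H (cx x))) differentiable (at x)" if "x \<in> U" for x
    using Re_holomorphic_has_derivative[OF D[OF that]] by (auto simp: differentiable_def)
  with 1 2 show ?case by (auto simp: forall_2)
qed

lemma harmonic_on_Re_holomorphic:
  assumes S: "open S" and H: "H holomorphic_on S" and U: "open U" "cx ` U \<subseteq> S"
  shows "harmonic_on U (\<lambda>x. Re (H (cx x)))"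
  unfolding harmonic_on_def
proof (intro conjI ballI)
  show "Ck_on 2 U (\<lambda>x. Re (H (cx x)))" by (rule Ck_on_Re_holomorphic[OF assms])
  fix x assume x: "x \<in> U"
  have D: "(H has_field_derivative deriv H (cx x)) (at (cx x))" if "x \<in> U" for x
    using holomorphic_derivI[OF H S] U that by blast
  have d: "deriv H holomorphic_on S" by (rule holomorphic_deriv[OF H S])
  have DD: "(deriv H has_field_derivative deriv (deriv H) (cx x)) (at (cx x))"
    using holomorphic_derivI[OF d S] U x by blast
  have "partial 1 (partial 1 (\<lambda>x. Re (H (cx x)))) x = partial 1 (\<lambda>x. Re (deriv H (cx x))) x"
    by (rule partial_cong[OF U(1) x]) (rule partial_Re_holomorphic(1)[OF D])
  also have "\<dots> = Re (deriv (deriv H) (cx x))" by (rule partial_Re_holomorphic(1)[OF DD])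
  finally have 1: "partial 1 (partial 1 (\<lambda>x. Re (H (cx x)))) x = Re (deriv (deriv H) (cx x))" .
  have "partial 2 (partial 2 (\<lambda>x. Re (H (cx x)))) x = partial 2 (\<lambda>x. Re (\<i> * deriv H (cx x))) x"
    by (rule partial_cong[OF U(1) x]) (rule partial_Re_holomorphic(2)[OF D])
  also have "\<dots> = Re (\<i> * (\<i> * deriv (deriv H) (cx x)))"
    by (rule partial_Re_holomorphic(2)[OF DERIV_cmult[OF DD]])
  finally show "(\<Sum>i\<in>UNIV. partial i (partial i (\<lambda>x. Re (H (cx x)))) x) = 0" using 1 by (simp add: sum_2)
qed

text \<open>The constant sequence serves as approximation, since \<open>f\<close> is itself
  continuous on the closure.\<close>

lemma has_trace_continuous:
  assumes f: "f \<in> W12 U" "continuous_on (closure U) f"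
    and B: "\<And>P R. (P, R) \<in> B \<Longrightarrow> closed_segment P R \<subseteq> closure U"
    and g: "\<And>P R x. (P, R) \<in> B \<Longrightarrow> x \<in> closed_segment P R \<Longrightarrow> f x = g x"
  shows "has_trace U B f g"
proof -
  have eq: "f (linepath P R t) = g (linepath P R t)" if "(P, R) \<in> B" "t \<in> {0..1}" for P R t
    using g[OF that(1), of "linepath P R t"] linepath_in_path[OF that(2)] by blast
  have m: "(\<lambda>t. g (linepath P R t)) \<in> borel_measurable (lebesgue_on {0..1})" if PR: "(P, R) \<in> B" for P R
  proof -
    have "(\<lambda>t. f (linepath P R t)) \<in> borel_measurable (lebesgue_on {0..1})"
      by (intro continuous_imp_measurable_on_sets_lebesgue continuous_on_linepath[OF f(2) B[OF PR]]) simp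
    then show ?thesis by (subst measurable_cong[of _ _ "\<lambda>t. f (linepath P R t)"]) (use eq[OF PR] in auto)
  qed
  have z: "(\<integral>\<^sup>+t. ennreal ((f (linepath P R t) - g (linepath P R t))\<^sup>2) \<partial>lebesgue_on {0..1}) = 0" if "(P, R) \<in> B" for P R
  proof -
    have "(\<integral>\<^sup>+t. ennreal ((f (linepath P R t) - g (linepath P R t))\<^sup>2) \<partial>lebesgue_on {0..1}) = (\<integral>\<^sup>+t. 0 \<partial>lebesgue_on {0..1::real})"
      by (rule nn_integral_cong) (use eq[OF that] in auto)
    then show ?thesis by simp
  qed
  show ?thesis
    unfolding has_trace_def
    by (intro conjI exI[of _ "\<lambda>n. f"]) (use f m z in \<open>auto simp: W12_tendsto_def L2_tendsto_def\<close>)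
qed

lemma W12_intro:
  assumes "L2_on U f" "has_weak_gradient U f G" "L2_on U G"
  shows "f \<in> W12 U"
  using assms unfolding W12_def by blast

lemma closure_box2: "a$1 < b$1 \<Longrightarrow> a$2 < b$2 \<Longrightarrow> closure (box a b) = cbox a (b::real^2)"
  by (rule closure_box) (auto simp: box_ne_empty Basis_vec2 inner_axis)

lemma L2_on_continuous_closure:
  fixes f :: "real^2 \<Rightarrow> 'b::euclidean_space"
  assumes f: "continuous_on (cbox a b) f"
  shows "L2_on (box a b) f"
proof -
  obtain B where B: "\<And>x. x \<in> cbox a b \<Longrightarrow> norm (f x) \<le> B"
    using compact_imp_bounded[OF compact_continuous_image[OF f compact_cbox]] unfolding bounded_iff by fastforce
  have "continuous_on (box a b) f" using f box_subset_cbox continuous_on_subset by blast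
  then have m: "(\<lambda>x. indicator (box a b) x *\<^sub>R f x) \<in> borel_measurable lebesgue"
    by (intro measurable_completion) (simp add: borel_measurable_continuous_on_indicator)
  show ?thesis by (rule L2_on_bounded[OF _ m, of B]) (use B box_subset_cbox[of a b] in auto)
qed

lemma L2_on_dominated:
  fixes f :: "real^2 \<Rightarrow> 'b::euclidean_space" and w :: "real^2 \<Rightarrow> real"
  assumes U: "open U" and f: "continuous_on U f" and w: "integrable lebesgue (\<lambda>x. indicator U x * w x)"
    and le: "\<And>x. x \<in> U \<Longrightarrow> (norm (f x))\<^sup>2 \<le> w x"
  shows "L2_on U f"
proof -
  have m: "(\<lambda>x. indicator U x *\<^sub>R f x) \<in> borel_measurable lebesgue"
    by (intro measurable_completion) (simp add: borel_measurable_continuous_on_indicator borel_open[OF U] f)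
  have m2: "(\<lambda>x. indicator U x *\<^sub>R (norm (f x))\<^sup>2) \<in> borel_measurable lebesgue"
    by (intro measurable_completion)
       (auto intro!: borel_measurable_continuous_on_indicator continuous_intros f borel_open[OF U] simp del: real_scaleR_def)
  have "integrable lebesgue (\<lambda>x. indicator U x *\<^sub>R (norm (f x))\<^sup>2)"
    by (rule Bochner_Integration.integrable_bound[OF w m2]) (use le in \<open>auto simp: indicator_def intro: order_trans[OF _ abs_ge_self]\<close>)
  with m show ?thesis using L2_on_iff[of U f] U by auto
qed

text \<open>Tonelli reduces this to the integrability of s powr (-1/2) at 0. The weight is the
  square of the one with exponent -1/4 in the gradient bound.\<close>

lemma integrable_inverse_sqrt_strip:
  "integrable lebesgue (\<lambda>x. indicator (box (pt a (-1)) (pt b 1)) x * (1 - \<bar>x$2\<bar>) powr (-1/2))"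
proof -
  let ?s = "\<lambda>s::real. indicator {0..2} s * s powr (-1/2)"
  have "set_integrable lebesgue {0..2} (\<lambda>s::real. s powr (-1/2))"
    using integrable_on_powr_from_0[of "-1/2" 2] by (intro nonnegative_absolutely_integrable_1) auto
  then have "integrable lebesgue ?s" unfolding set_integrable_def by simp
  then have s: "integrable lborel ?s" by (subst (asm) integrable_completion) auto
  have "integrable lborel (\<lambda>y. ?s (1 + (-1) * y) + ?s (1 + 1 * y))"
    by (intro Bochner_Integration.integrable_add lborel_integrable_real_affine s) auto
  note int = this
  define w where "w y = indicator {-1<..<1} y * (1 - \<bar>y\<bar>) powr (-1/2)" for y :: real
  have wm[measurable]: "w \<in> borel_measurable borel" unfolding w_def by measurable
  have w0: "0 \<le> w y" for y by (simp add: w_def)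
  have "integrable lborel w"
  proof (rule Bochner_Integration.integrable_bound[OF int])
    have "w y \<le> ?s (1 + (-1) * y) + ?s (1 + 1 * y)" for y
      by (cases "y \<ge> 0") (auto simp: w_def indicator_def)
    then show "AE y in lborel. norm (w y) \<le> norm (?s (1 + (-1) * y) + ?s (1 + 1 * y))"
      using w0 by (intro AE_I2) (auto intro: order_trans[OF _ abs_ge_self])
  qed simp
  then have fin: "(\<integral>\<^sup>+y. ennreal (w y) \<partial>lborel) < \<infinity>" using w0 unfolding integrable_iff_bounded by simp
  let ?k = "\<lambda>x::real^2. indicator {a<..<b} (x$1) * w (x$2)"
  have km[measurable]: "?k \<in> borel_measurable borel"
  proof -
    have [measurable]: "(\<lambda>x::real^2. x$i) \<in> borel_measurable borel" for i
      by (intro borel_measurable_continuous_onI continuous_intros)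
    show ?thesis by measurable
  qed
  have "(\<integral>\<^sup>+x. ennreal (?k x) \<partial>lborel) = (\<integral>\<^sup>+z. ennreal (?k (pt (fst z) (snd z))) \<partial>(lborel \<Otimes>\<^sub>M lborel))"
    unfolding distr_lborel_pt[symmetric] by (rule nn_integral_distr) auto
  also have "\<dots> = (\<integral>\<^sup>+z. ennreal (indicator {a<..<b} (fst z)) * ennreal (w (snd z)) \<partial>(lborel \<Otimes>\<^sub>M lborel))"
    by (intro nn_integral_cong) (simp add: ennreal_mult w0)
  also have "\<dots> = (\<integral>\<^sup>+x. \<integral>\<^sup>+y. ennreal (indicator {a<..<b} x) * ennreal (w y) \<partial>lborel \<partial>lborel)"
    by (subst lborel.nn_integral_fst[symmetric]) auto
  also have "\<dots> = (\<integral>\<^sup>+x. ennreal (indicator {a<..<b} x) * (\<integral>\<^sup>+y. ennreal (w y) \<partial>lborel) \<partial>lborel)"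
    by (intro nn_integral_cong nn_integral_cmult) simp
  also have "\<dots> = (\<integral>\<^sup>+x. indicator {a<..<b} x \<partial>lborel) * (\<integral>\<^sup>+y. ennreal (w y) \<partial>lborel)"
    by (subst nn_integral_multc) (auto simp: ennreal_indicator)
  also have "\<dots> < \<infinity>" using fin by (cases "a \<le> b") (auto simp: ennreal_mult_less_top)
  finally have "integrable lborel ?k"
    unfolding integrable_iff_bounded using w0 by (simp add: abs_mult)
  then have "integrable lebesgue ?k" by (subst integrable_completion) auto
  moreover have "?k = (\<lambda>x. indicator (box (pt a (-1)) (pt b 1)) x * (1 - \<bar>x$2\<bar>) powr (-1/2))"
    by (auto simp: fun_eq_iff indicator_def w_def mem_box2)
  ultimately show ?thesis by simp
qed

subsection \<open>The harmonic extension\<close>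

definition Sgrad :: "real^2 \<Rightarrow> real^2" where
  "Sgrad x = pt (Re (Hder (cx x))) (- Im (Hder (cx x)))"

lemma Omega_eq: "Omega = box (pt (-1) (-1)) (pt (1/2) 1)" by (simp add: Omega_def)

lemma Omega_iff: "x \<in> Omega \<longleftrightarrow> -1 < x$1 \<and> x$1 < 1/2 \<and> -1 < x$2 \<and> x$2 < 1"
  by (simp add: Omega_def mem_box2)

lemma Omega_strip: "x \<in> Omega \<Longrightarrow> \<bar>Im (cx x)\<bar> < 1"
  by (auto simp: Omega_iff)

lemma closure_Omega: "closure Omega = cbox (pt (-1) (-1)) (pt (1/2) 1)"
  unfolding Omega_eq by (rule closure_box2) auto

lemma open_Omega: "open Omega" unfolding Omega_eq by (rule open_box)

lemma Sigma0_has_derivative: "\<bar>x$2\<bar> < 1 \<Longrightarrow> (Sigma0 has_derivative (\<lambda>h. Sgrad x \<bullet> h)) (at x)"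
  unfolding Sigma0_def[abs_def] Sgrad_def by (rule Re_holomorphic_has_derivative) (simp add: Hfun_deriv)

lemma continuous_Sigma0: "continuous_on {x. \<bar>x$2\<bar> \<le> 1} Sigma0"
  unfolding Sigma0_def[abs_def]
  by (intro continuous_on_Re continuous_on_compose2[OF continuous_on_Hfun continuous_on_cx]) auto

lemma continuous_Sgrad: "continuous_on {x. \<bar>x$2\<bar> < 1} Sgrad"
proof -
  have c: "continuous_on {x. \<bar>x$2\<bar> < 1} (\<lambda>x. Hder (cx x))"
    by (rule continuous_on_compose2[OF holomorphic_on_imp_continuous_on[OF Hder_holomorphic] continuous_on_cx]) auto
  show ?thesis unfolding Sgrad_def[abs_def] by (intro continuous_intros c)
qed

lemma harmonic_Sigma0: "harmonic_on Omega Sigma0"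
proof -
  have "Hfun holomorphic_on {z. \<bar>Im z\<bar> < 1}"
    using Hfun_deriv by (auto simp: holomorphic_on_open[OF open_strip])
  from harmonic_on_Re_holomorphic[OF open_strip this open_Omega] show ?thesis
    unfolding Sigma0_def[abs_def] using Omega_strip by blast
qed

lemma norm_pt: "norm (pt a b) = sqrt (a\<^sup>2 + b\<^sup>2)"
  by (simp add: norm_vec_def L2_set_def sum_2)

lemma norm_Sgrad: "norm (Sgrad x) = norm (Hder (cx x))"
  by (simp add: Sgrad_def norm_pt cmod_def)

text \<open>Gradients of the partial sums. Unlike \<open>Sgrad\<close> they are finite combinations
  of gradients of separated functions, for which orthogonality can be computed directly.\<close>

definition SgradN :: "nat \<Rightarrow> real^2 \<Rightarrow> real^2" where
  "SgradN N x = (let d = \<i> * (2 / 3 * (cx x + 1) - 4 / of_real pi * (\<Sum>n<N. Tterm n (cx x))) in pt (Re d) (- Im d))"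

lemma Sgrad_bound:
  "\<exists>C. \<forall>x\<in>Omega. norm (Sgrad x) \<le> C * (1 - \<bar>x$2\<bar>) powr (-1/4) \<and> (\<forall>N. norm (SgradN N x) \<le> C * (1 - \<bar>x$2\<bar>) powr (-1/4))"
proof -
  obtain C where C: "\<And>z. \<bar>Im z\<bar> < 1 \<Longrightarrow> norm (Tfun z) \<le> C * (1 - \<bar>Im z\<bar>) powr (-1/4)"
    "\<And>z N. \<bar>Im z\<bar> < 1 \<Longrightarrow> norm (\<Sum>n<N. Tterm n z) \<le> C * (1 - \<bar>Im z\<bar>) powr (-1/4)"
    using Tterm_powr_bound by blast
  have key: "norm (\<i> * (2 / 3 * (cx x + 1) - 4 / of_real pi * T)) \<le> (2 + 4 / pi * C) * (1 - \<bar>x$2\<bar>) powr (-1/4)"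
    if x: "x \<in> Omega" and T: "norm T \<le> C * (1 - \<bar>x$2\<bar>) powr (-1/4)" for x T
  proof -
    let ?t = "(1 - \<bar>x$2\<bar>) powr (-1/4)"
    have y: "\<bar>x$2\<bar> < 1" using x by (auto simp: Omega_iff)
    \<comment> \<open>As the weight is at least 1, it also dominates the bounded polynomial
      part.\<close>
    have t1: "?t \<ge> 1"
    proof -
      have "(1 - \<bar>x$2\<bar>) powr (1/4) \<le> 1" using y by (intro powr_le1) auto
      then show ?thesis using y by (simp add: powr_minus_divide le_divide_eq)
    qed
    have "norm (cx x + 1) \<le> \<bar>x$1 + 1\<bar> + \<bar>x$2\<bar>" using cmod_le[of "cx x + 1"] by simp
    then have n: "norm (cx x + 1) \<le> 3" using x by (auto simp: Omega_iff)
    have "norm (\<i> * (2 / 3 * (cx x + 1) - 4 / of_real pi * T)) \<le> norm (2/3 * (cx x + 1)) + norm (4 / of_real pi * T)"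
      unfolding norm_mult[of \<i>] using norm_triangle_ineq4[of "2/3 * (cx x + 1)" "4 / of_real pi * T"] by simp
    also have "\<dots> = 2/3 * norm (cx x + 1) + 4 / pi * norm T" unfolding norm_mult norm_divide by simp
    also have "\<dots> \<le> 2/3 * 3 + 4 / pi * (C * ?t)"
      using n T by (intro add_mono mult_left_mono) auto
    also have "\<dots> \<le> 2 * ?t + 4 / pi * (C * ?t)" using t1 by simp
    finally show ?thesis by (simp add: algebra_simps)
  qed
  have "norm (Sgrad x) \<le> (2 + 4 / pi * C) * (1 - \<bar>x$2\<bar>) powr (-1/4)"
    "norm (SgradN N x) \<le> (2 + 4 / pi * C) * (1 - \<bar>x$2\<bar>) powr (-1/4)" if x: "x \<in> Omega" for x N
  proof -
    have y: "\<bar>Im (cx x)\<bar> < 1" "\<bar>Im (cx x)\<bar> = \<bar>x$2\<bar>" using Omega_strip[OF x] by auto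
    show "norm (Sgrad x) \<le> (2 + 4 / pi * C) * (1 - \<bar>x$2\<bar>) powr (-1/4)"
      unfolding norm_Sgrad Hder_def by (rule key[OF x C(1)[OF y(1), unfolded y(2)]])
    have "norm (SgradN N x) = norm (\<i> * (2 / 3 * (cx x + 1) - 4 / of_real pi * (\<Sum>n<N. Tterm n (cx x))))"
      unfolding SgradN_def Let_def norm_pt cmod_def power2_minus ..
    also have "\<dots> \<le> (2 + 4 / pi * C) * (1 - \<bar>x$2\<bar>) powr (-1/4)"
      by (rule key[OF x C(2)[OF y(1), unfolded y(2)]])
    finally show "norm (SgradN N x) \<le> (2 + 4 / pi * C) * (1 - \<bar>x$2\<bar>) powr (-1/4)" .
  qed
  then show ?thesis by blast
qed

lemma L2_from_quarter_bound:
  fixes f :: "real^2 \<Rightarrow> 'b::euclidean_space"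
  assumes f: "continuous_on Omega f" and C: "\<And>x. x \<in> Omega \<Longrightarrow> norm (f x) \<le> C * (1 - \<bar>x$2\<bar>) powr (-1/4)"
  shows "L2_on Omega f"
proof (rule L2_on_dominated[OF open_Omega f, of "\<lambda>x. C\<^sup>2 * (1 - \<bar>x$2\<bar>) powr (-1/2)"])
  have "integrable lebesgue (\<lambda>x. C\<^sup>2 * (indicator Omega x * (1 - \<bar>x$2\<bar>) powr (-1/2)))"
    unfolding Omega_eq by (intro integrable_mult_right integrable_inverse_sqrt_strip)
  then show "integrable lebesgue (\<lambda>x. indicator Omega x * (C\<^sup>2 * (1 - \<bar>x$2\<bar>) powr (-1/2)))"
    by (simp add: mult.left_commute)
  fix x assume x: "x \<in> Omega"
  have "(norm (f x))\<^sup>2 \<le> (C * (1 - \<bar>x$2\<bar>) powr (-1/4))\<^sup>2" using C[OF x] by (intro power_mono) auto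
  also have "\<dots> = C\<^sup>2 * ((1 - \<bar>x$2\<bar>) powr (-1/4) * (1 - \<bar>x$2\<bar>) powr (-1/4))" by (simp add: power2_eq_square)
  also have "(1 - \<bar>x$2\<bar>) powr (-1/4) * (1 - \<bar>x$2\<bar>) powr (-1/4) = (1 - \<bar>x$2\<bar>) powr (-1/2)"
    unfolding powr_add[symmetric] by simp
  finally show "(norm (f x))\<^sup>2 \<le> C\<^sup>2 * (1 - \<bar>x$2\<bar>) powr (-1/2)" .
qed

lemma Sgrad_L2: "L2_on Omega Sgrad"
  using Sgrad_bound continuous_on_subset[OF continuous_Sgrad, of Omega] L2_from_quarter_bound
  by (metis (no_types, lifting) Omega_iff abs_less_iff mem_Collect_eq minus_less_iff subsetI)

lemma Omega_weak_gradient: "has_weak_gradient Omega Sigma0 Sgrad"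
proof (rule classical_weak_gradient[OF open_Omega, of "{}"])
  have sub: "Omega \<subseteq> {x. \<bar>x$2\<bar> < 1}" by (auto simp: Omega_iff)
  show "continuous_on Omega Sigma0" by (rule continuous_on_subset[OF continuous_Sigma0]) (use sub in auto)
  have c: "continuous_on Omega Sgrad" by (rule continuous_on_subset[OF continuous_Sgrad sub])
  then show "continuous_on (Omega \<inter> {x. x$1 \<notin> {}}) Sgrad" by simp
  show "set_integrable lebesgue C Sgrad" if "compact C" "C \<subseteq> Omega" for C
    by (rule continuous_compact_integrable[OF c that])
  show "(Sigma0 has_derivative (\<lambda>h. Sgrad x \<bullet> h)) (at x)" if "x \<in> Omega" for x
    using that sub by (intro Sigma0_has_derivative) auto
qed simp

lemma continuous_Sigma0_closure: "continuous_on (cbox (pt (-1) (-1)) (pt (1/2) 1)) Sigma0"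
  by (rule continuous_on_subset[OF continuous_Sigma0]) (auto simp: mem_box2)

lemma Sigma0_W12: "Sigma0 \<in> W12 Omega"
  by (rule W12_intro[OF _ Omega_weak_gradient Sgrad_L2])
     (unfold Omega_eq, rule L2_on_continuous_closure[OF continuous_Sigma0_closure])

lemma rect_sides_segments:
  assumes "(P, R) \<in> rect_sides a b" "x \<in> closed_segment P R" "a$1 < b$1" "a$2 < b$2"
  shows "x \<in> cbox a b" "x \<notin> box a b"
proof -
  have "P \<in> cbox a b" "R \<in> cbox a b" using assms(1,3,4) by (auto simp: rect_sides_def mem_box2)
  then show "x \<in> cbox a b" using assms(2) closed_segment_subset[of P "cbox a b" R] by (auto simp: convex_box)
  obtain u where u: "x = (1 - u) *\<^sub>R P + u *\<^sub>R R" using assms(2) by (auto simp: closed_segment_def)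
  have e: "x$1 = (1 - u) * P$1 + u * R$1" "x$2 = (1 - u) * P$2 + u * R$2" by (simp_all add: u)
  have "(P$1 = a$1 \<and> R$1 = a$1) \<or> (P$1 = b$1 \<and> R$1 = b$1) \<or> (P$2 = a$2 \<and> R$2 = a$2) \<or> (P$2 = b$2 \<and> R$2 = b$2)"
    using assms(1) by (auto simp: rect_sides_def)
  then have "x$1 = a$1 \<or> x$1 = b$1 \<or> x$2 = a$2 \<or> x$2 = b$2" unfolding e by (auto simp: algebra_simps)
  then show "x \<notin> box a b" by (auto simp: mem_box2)
qed

lemma harmonic_extension_Sigma0: "harmonic_extension Sigma0"
  unfolding harmonic_extension_def
proof (intro conjI harmonic_Sigma0)
  show "has_trace Omega sides_Omega Sigma0 sigma0"
  proof (rule has_trace_continuous[OF Sigma0_W12])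
    show "continuous_on (closure Omega) Sigma0" unfolding closure_Omega by (rule continuous_Sigma0_closure)
    fix P R assume PR: "(P, R) \<in> sides_Omega"
    show "closed_segment P R \<subseteq> closure Omega"
      unfolding closure_Omega using rect_sides_segments(1)[OF PR[unfolded sides_Omega_def]] by auto
    fix x assume x: "x \<in> closed_segment P R"
    show "Sigma0 x = sigma0 x"
      by (rule Sigma0_boundary) (use rect_sides_segments[OF PR[unfolded sides_Omega_def] x] in auto)
  qed
qed

text \<open>Multiplying an eigenfunction by the cut-off and letting the cut-off tend to 1 only costs the
  layer term, where the eigenfunction vanishes linearly while the derivative of the cut-off
  is of order \<open>k\<close> on a set of width \<open>1 / k\<close>.\<close>

lemma cutoff_deriv_vanishing:
  assumes ab: "a < b" and p: "smooth p" "p a = 0" "p b = 0"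
  shows "\<exists>C. \<forall>k. \<forall>s\<in>{a..b}. \<bar>deriv (cutoff a b k) s * p s\<bar> \<le> C"
proof -
  obtain M where M: "M > 0" "\<And>x. \<bar>deriv step x\<bar> \<le> M" using deriv_step_bounded by blast
  have "bounded (deriv p ` {a..b})"
    by (intro compact_imp_bounded compact_continuous_image smooth_continuous smooth_deriv p) auto
  then obtain L where L: "\<And>s. s \<in> {a..b} \<Longrightarrow> \<bar>deriv p s\<bar> \<le> L" unfolding bounded_iff by fastforce
  have lip: "\<bar>p s - p t\<bar> \<le> L * \<bar>s - t\<bar>" if "s \<in> {a..b}" "t \<in> {a..b}" for s t
  proof -
    have "norm (p s - p t) \<le> L * norm (s - t)"
      by (rule field_differentiable_bound[of "{a..b}" p "deriv p"])
         (use L that smooth_DERIV[OF p(1)] in \<open>auto intro: has_field_derivative_at_within\<close>)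
    then show ?thesis by simp
  qed
  have L0: "L \<ge> 0" using L[of a] ab by auto
  have one: "\<bar>real k * deriv step (real k * d) * p s\<bar> \<le> M * (2 * L)" if "\<bar>p s\<bar> \<le> L * d" "d \<ge> 0" for k d s
  proof (cases "real k * d \<ge> 2 \<or> real k * d \<le> 1")
    case True
    then have "deriv step (real k * d) = 0" using deriv_step_0 by auto
    then show ?thesis using M(1) L0 by simp
  next
    case False
    have "\<bar>real k * deriv step (real k * d) * p s\<bar> = \<bar>deriv step (real k * d)\<bar> * (real k * \<bar>p s\<bar>)" by (simp add: abs_mult)
    also have "\<dots> \<le> M * (2 * L)"
    proof (rule mult_mono[OF M(2)])
      have "real k * \<bar>p s\<bar> \<le> real k * (L * d)" using that by (intro mult_left_mono) auto
      also have "\<dots> = (real k * d) * L" by simp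
      also have "\<dots> \<le> 2 * L" using False L0 by (intro mult_right_mono) auto
      finally show "real k * \<bar>p s\<bar> \<le> 2 * L" .
    qed (use M(1) in auto)
    finally show ?thesis .
  qed
  have "\<bar>deriv (cutoff a b k) s * p s\<bar> \<le> M * (2 * L) + M * (2 * L)" if s: "s \<in> {a..b}" for k s
  proof -
    have "\<bar>p s\<bar> \<le> L * (s - a)" "\<bar>p s\<bar> \<le> L * (b - s)" using lip[OF s, of a] lip[OF s, of b] s ab p by auto
    then have "\<bar>real k * deriv step (real k * (s - a)) * p s\<bar> \<le> M * (2 * L)" "\<bar>real k * deriv step (real k * (b - s)) * p s\<bar> \<le> M * (2 * L)"
      using s by (auto intro!: one)
    moreover have "deriv (cutoff a b k) s * p s = real k * deriv step (real k * (s - a)) * p s - real k * deriv step (real k * (b - s)) * p s"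
      by (simp add: deriv_cutoff algebra_simps)
    ultimately show ?thesis by linarith
  qed
  then show ?thesis by blast
qed

text \<open>For a merely integrable \<open>E\<close> the layer term has no boundary limit to pass
  to. If the differentiated factor vanishes at both ends, however, the gradients of the cut-off
  products stay uniformly bounded and converge pointwise, so dominated convergence suffices.\<close>

lemma tendsto_cutoff_gradient:
  fixes E :: "real^2 \<Rightarrow> real"
  assumes ab: "a$1 < b$1" "a$2 < b$2" and E: "set_integrable lebesgue (box a b) E"
    and pq: "smooth p" "smooth q"
  shows "p (a$1) = 0 \<Longrightarrow> p (b$1) = 0 \<Longrightarrow> (\<lambda>k. LINT x:box a b|lebesgue. E x * partial 1 (cut2 a b k p q) x) \<longlonglongrightarrow> (LINT x:box a b|lebesgue. E x * (deriv p (x$1) * q (x$2)))"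
    and "q (a$2) = 0 \<Longrightarrow> q (b$2) = 0 \<Longrightarrow> (\<lambda>k. LINT x:box a b|lebesgue. E x * partial 2 (cut2 a b k p q) x) \<longlonglongrightarrow> (LINT x:box a b|lebesgue. E x * (p (x$1) * deriv q (x$2)))"
proof -
  obtain K where K: "\<And>k. k \<ge> K \<Longrightarrow> 4 \<le> real k * (b$1 - a$1)" "\<And>k. k \<ge> K \<Longrightarrow> 4 \<le> real k * (b$2 - a$2)"
    using eventually_box_large[OF ab] unfolding eventually_at_top_linorder by auto
  have bd: "\<exists>B\<ge>0. \<forall>s\<in>{c..d}. \<bar>f s\<bar> \<le> B" if "smooth f" for f :: "real \<Rightarrow> real" and c d
  proof -
    have "bounded (f ` {c..d})" by (intro compact_imp_bounded compact_continuous_image smooth_continuous that) auto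
    then obtain B where "\<forall>s\<in>{c..d}. \<bar>f s\<bar> \<le> B" unfolding bounded_iff by fastforce
    then show ?thesis by (intro exI[of _ "max B 0"]) (auto simp: le_max_iff_disj)
  qed
  obtain Bp where Bp: "Bp \<ge> 0" "\<And>s. s \<in> {a$1..b$1} \<Longrightarrow> \<bar>p s\<bar> \<le> Bp" using bd[OF pq(1)] by blast
  obtain Bp' where Bp': "Bp' \<ge> 0" "\<And>s. s \<in> {a$1..b$1} \<Longrightarrow> \<bar>deriv p s\<bar> \<le> Bp'" using bd[OF smooth_deriv[OF pq(1)]] by blast
  obtain Bq where Bq: "Bq \<ge> 0" "\<And>s. s \<in> {a$2..b$2} \<Longrightarrow> \<bar>q s\<bar> \<le> Bq" using bd[OF pq(2)] by blast
  obtain Bq' where Bq': "Bq' \<ge> 0" "\<And>s. s \<in> {a$2..b$2} \<Longrightarrow> \<bar>deriv q s\<bar> \<le> Bq'" using bd[OF smooth_deriv[OF pq(2)]] by blast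
  have Ei: "integrable lebesgue (\<lambda>x. indicator (box a b) x *\<^sub>R E x)" using E unfolding set_integrable_def .
  have cb: "\<bar>cutoff (a$i) (b$i) (k+K) s\<bar> \<le> 1" for k s and i :: 2
  proof -
    have "i = 1 \<or> i = 2" using exhaust_2 by auto
    then have "4 \<le> real (k+K) * (b$i - a$i)" using K(1)[of "k+K"] K(2)[of "k+K"] by auto
    from cutoff_bounds[OF this, of s] show ?thesis by auto
  qed
  have main: "(\<lambda>k. LINT x:box a b|lebesgue. E x * F k x) \<longlonglongrightarrow> (LINT x:box a b|lebesgue. E x * F0 x)"
    if F: "\<And>k. continuous_on UNIV (F k)" "continuous_on UNIV F0"
      and lim: "\<And>x. x \<in> box a b \<Longrightarrow> (\<lambda>k. F k x) \<longlonglongrightarrow> F0 x" and B: "\<And>k x. x \<in> box a b \<Longrightarrow> \<bar>F (k+K) x\<bar> \<le> B" for F F0 B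
  proof -
    have "(\<lambda>k. \<integral>x. indicator (box a b) x *\<^sub>R E x * F (k+K) x \<partial>lebesgue) \<longlonglongrightarrow> (\<integral>x. indicator (box a b) x *\<^sub>R E x * F0 x \<partial>lebesgue)"
    proof (rule integral_dominated_convergence[where w="\<lambda>x. norm (indicator (box a b) x *\<^sub>R E x) * B"])
      show "AE x in lebesgue. (\<lambda>k. indicator (box a b) x *\<^sub>R E x * F (k+K) x) \<longlonglongrightarrow> indicator (box a b) x *\<^sub>R E x * F0 x"
      proof (rule AE_I2)
        fix x
        show "(\<lambda>k. indicator (box a b) x *\<^sub>R E x * F (k+K) x) \<longlonglongrightarrow> indicator (box a b) x *\<^sub>R E x * F0 x"
        proof (cases "x \<in> box a b")
          case True
          show ?thesis by (intro tendsto_mult tendsto_const LIMSEQ_ignore_initial_segment lim True)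
        qed simp
      qed
      show "AE x in lebesgue. norm (indicator (box a b) x *\<^sub>R E x * F (k+K) x) \<le> norm (indicator (box a b) x *\<^sub>R E x) * B" for k
        using B by (intro AE_I2) (auto simp: indicator_def abs_mult intro!: mult_left_mono)
      show "integrable lebesgue (\<lambda>x. norm (indicator (box a b) x *\<^sub>R E x) * B)" using Ei by (intro integrable_mult_left integrable_norm)
    qed (rule borel_measurable_times[OF borel_measurable_integrable[OF Ei] borel_measurable_lebesgue_continuous], rule F)+
    from LIMSEQ_offset[OF this] show ?thesis unfolding set_lebesgue_integral_def by (simp add: mult.assoc)
  qed
  have cp: "continuous_on UNIV (\<lambda>x::real^2. p (x$1))" "continuous_on UNIV (\<lambda>x::real^2. deriv p (x$1))"
    "continuous_on UNIV (\<lambda>x::real^2. q (x$2))" "continuous_on UNIV (\<lambda>x::real^2. deriv q (x$2))"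
    using continuous_on_compose2[OF smooth_continuous[OF pq(1), of UNIV], of UNIV "\<lambda>x::real^2. x$1"]
      continuous_on_compose2[OF smooth_continuous[OF smooth_deriv[OF pq(1)], of UNIV], of UNIV "\<lambda>x::real^2. x$1"]
      continuous_on_compose2[OF smooth_continuous[OF pq(2), of UNIV], of UNIV "\<lambda>x::real^2. x$2"]
      continuous_on_compose2[OF smooth_continuous[OF smooth_deriv[OF pq(2)], of UNIV], of UNIV "\<lambda>x::real^2. x$2"]
    by (auto simp: continuous_intros)
  have lc: "(\<lambda>k. cutoff (a$i) (b$i) k (x$i)) \<longlonglongrightarrow> 1" "(\<lambda>k. deriv (cutoff (a$i) (b$i) k) (x$i)) \<longlonglongrightarrow> 0" if "x \<in> box a b" for x i
  proof -
    have "a$i < x$i" "x$i < b$i" using that exhaust_2[of i] by (auto simp: mem_box2)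
    from cutoff_eventually[OF this] show "(\<lambda>k. cutoff (a$i) (b$i) k (x$i)) \<longlonglongrightarrow> 1" "(\<lambda>k. deriv (cutoff (a$i) (b$i) k) (x$i)) \<longlonglongrightarrow> 0"
      by (auto intro!: tendsto_eventually elim: eventually_mono)
  qed
  {
    assume z: "p (a$1) = 0" "p (b$1) = 0"
    obtain C where C: "\<And>k s. s \<in> {a$1..b$1} \<Longrightarrow> \<bar>deriv (cutoff (a$1) (b$1) k) s * p s\<bar> \<le> C"
      using cutoff_deriv_vanishing[OF ab(1) pq(1) z] by blast
    show "(\<lambda>k. LINT x:box a b|lebesgue. E x * partial 1 (cut2 a b k p q) x) \<longlonglongrightarrow> (LINT x:box a b|lebesgue. E x * (deriv p (x$1) * q (x$2)))"
      unfolding partial_cut2[OF pq]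
    proof (rule main[where B = "(C + 1 * Bp') * (1 * Bq)"])
      fix x k assume x: "x \<in> box a b"
      have m: "x$1 \<in> {a$1..b$1}" "x$2 \<in> {a$2..b$2}" using x by (auto simp: mem_box2)
      show "(\<lambda>k. (deriv (cutoff (a$1) (b$1) k) (x$1) * p (x$1) + cutoff (a$1) (b$1) k (x$1) * deriv p (x$1)) * (cutoff (a$2) (b$2) k (x$2) * q (x$2))) \<longlonglongrightarrow> deriv p (x$1) * q (x$2)"
        by (rule tendsto_eq_intros lc x refl)+ simp
      have "\<bar>deriv (cutoff (a$1) (b$1) (k+K)) (x$1) * p (x$1) + cutoff (a$1) (b$1) (k+K) (x$1) * deriv p (x$1)\<bar> \<le> C + 1 * Bp'"
      proof (intro order_trans[OF abs_triangle_ineq] add_mono C m)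
        show "\<bar>cutoff (a$1) (b$1) (k+K) (x$1) * deriv p (x$1)\<bar> \<le> 1 * Bp'"
          unfolding abs_mult by (intro mult_mono cb Bp' m) auto
      qed
      moreover have "\<bar>cutoff (a$2) (b$2) (k+K) (x$2) * q (x$2)\<bar> \<le> 1 * Bq"
        unfolding abs_mult by (intro mult_mono cb Bq m) auto
      ultimately show "\<bar>(deriv (cutoff (a$1) (b$1) (k+K)) (x$1) * p (x$1) + cutoff (a$1) (b$1) (k+K) (x$1) * deriv p (x$1)) * (cutoff (a$2) (b$2) (k+K) (x$2) * q (x$2))\<bar> \<le> (C + 1 * Bp') * (1 * Bq)"
        unfolding abs_mult[of "_ + _"] by (intro mult_mono) (auto intro: order_trans[OF abs_ge_zero])
    qed (intro continuous_intros continuous_cutoff cp)+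
  }
  {
    assume z: "q (a$2) = 0" "q (b$2) = 0"
    obtain C where C: "\<And>k s. s \<in> {a$2..b$2} \<Longrightarrow> \<bar>deriv (cutoff (a$2) (b$2) k) s * q s\<bar> \<le> C"
      using cutoff_deriv_vanishing[OF ab(2) pq(2) z] by blast
    show "(\<lambda>k. LINT x:box a b|lebesgue. E x * partial 2 (cut2 a b k p q) x) \<longlonglongrightarrow> (LINT x:box a b|lebesgue. E x * (p (x$1) * deriv q (x$2)))"
      unfolding partial_cut2[OF pq]
    proof (rule main[where B = "(1 * Bp) * (C + 1 * Bq')"])
      fix x k assume x: "x \<in> box a b"
      have m: "x$1 \<in> {a$1..b$1}" "x$2 \<in> {a$2..b$2}" using x by (auto simp: mem_box2)
      show "(\<lambda>k. cutoff (a$1) (b$1) k (x$1) * p (x$1) * (deriv (cutoff (a$2) (b$2) k) (x$2) * q (x$2) + cutoff (a$2) (b$2) k (x$2) * deriv q (x$2))) \<longlonglongrightarrow> p (x$1) * deriv q (x$2)"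
        by (rule tendsto_eq_intros lc x refl)+ simp
      have "\<bar>deriv (cutoff (a$2) (b$2) (k+K)) (x$2) * q (x$2) + cutoff (a$2) (b$2) (k+K) (x$2) * deriv q (x$2)\<bar> \<le> C + 1 * Bq'"
      proof (intro order_trans[OF abs_triangle_ineq] add_mono C m)
        show "\<bar>cutoff (a$2) (b$2) (k+K) (x$2) * deriv q (x$2)\<bar> \<le> 1 * Bq'"
          unfolding abs_mult by (intro mult_mono cb Bq' m) auto
      qed
      moreover have "\<bar>cutoff (a$1) (b$1) (k+K) (x$1) * p (x$1)\<bar> \<le> 1 * Bp"
        unfolding abs_mult by (intro mult_mono cb Bp m) auto
      ultimately show "\<bar>cutoff (a$1) (b$1) (k+K) (x$1) * p (x$1) * (deriv (cutoff (a$2) (b$2) (k+K)) (x$2) * q (x$2) + cutoff (a$2) (b$2) (k+K) (x$2) * deriv q (x$2))\<bar> \<le> (1 * Bp) * (C + 1 * Bq')"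
        unfolding abs_mult[of _ "_ + _"] by (intro mult_mono) (auto simp: Bp)
    qed (intro continuous_intros continuous_cutoff cp)+
  }
qed

subsection \<open>Uniqueness of the harmonic extension\<close>

lemma differentiable_gradient:
  fixes f :: "real^2 \<Rightarrow> real"
  assumes "f differentiable (at x)"
  shows "(f has_derivative (\<lambda>h. (\<chi> j. partial j f x) \<bullet> h)) (at x)"
proof -
  have "(f has_derivative frechet_derivative f (at x)) (at x)"
    using assms frechet_derivative_works by blast
  then show ?thesis
  proof (rule has_derivative_eq_rhs)
    have lin: "linear (frechet_derivative f (at x))" using assms linear_frechet_derivative by blast
    show "frechet_derivative f (at x) = (\<lambda>h. (\<chi> j. partial j f x) \<bullet> h)"
    proof
      fix h :: "real^2"
      have "h = h$1 *\<^sub>R axis 1 1 + h$2 *\<^sub>R axis 2 1" by (simp add: vec_eq_iff forall_2 axis_def)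
      then have "frechet_derivative f (at x) h = frechet_derivative f (at x) (h$1 *\<^sub>R axis 1 1 + h$2 *\<^sub>R axis 2 1)" by simp
      also have "\<dots> = h$1 * partial 1 f x + h$2 * partial 2 f x"
        by (simp add: linear_add[OF lin] linear_scale[OF lin] partial_def)
      finally show "frechet_derivative f (at x) h = (\<chi> j. partial j f x) \<bullet> h"
        by (simp add: inner_vec_def sum_2 mult.commute)
    qed
  qed
qed

lemma C1_weak_gradient:
  assumes U: "open U" and f: "\<And>x. x \<in> U \<Longrightarrow> f differentiable (at x)" "\<And>i. continuous_on U (partial i f)"
  shows "has_weak_gradient U f (\<lambda>x. \<chi> j. partial j f x)"
proof (rule classical_weak_gradient[OF U, of "{}"])
  have c: "continuous_on U (\<lambda>x. \<chi> j. partial j f x)" by (intro continuous_on_vec_lambda f)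
  then show "continuous_on (U \<inter> {x. x$1 \<notin> {}}) (\<lambda>x. \<chi> j. partial j f x)" by simp
  show "set_integrable lebesgue C (\<lambda>x. \<chi> j. partial j f x)" if "compact C" "C \<subseteq> U" for C
    by (rule continuous_compact_integrable[OF c that])
  show "continuous_on U f"
    using f(1) by (intro continuous_at_imp_continuous_on ballI differentiable_imp_continuous_within) auto
qed (use f differentiable_gradient in auto)

lemma set_integral_AE_cong:
  fixes f g :: "real^2 \<Rightarrow> real"
  assumes "set_integrable lebesgue U f" "AE x in lebesgue. x \<in> U \<longrightarrow> f x = g x"
  shows "(LINT x:U|lebesgue. f x) = (LINT x:U|lebesgue. g x)" "set_integrable lebesgue U g"
proof -
  have ae: "AE x in lebesgue. indicator U x *\<^sub>R f x = indicator U x *\<^sub>R g x"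
    using assms(2) by (auto elim!: eventually_mono simp: indicator_def)
  have m: "(\<lambda>x. indicator U x *\<^sub>R f x) \<in> borel_measurable lebesgue" using assms(1) unfolding set_integrable_def by simp
  have m': "(\<lambda>x. indicator U x *\<^sub>R g x) \<in> borel_measurable lebesgue" by (rule borel_measurable_AE[OF m ae])
  show "(LINT x:U|lebesgue. f x) = (LINT x:U|lebesgue. g x)"
    unfolding set_lebesgue_integral_def by (rule integral_cong_AE[OF m m' ae])
  show "set_integrable lebesgue U g"
    using assms(1) unfolding set_integrable_def by (rule integrable_cong_AE_imp[OF _ m']) (use ae in \<open>auto elim: eventually_mono\<close>)
qed

text \<open>Integrates by parts once, using that the partial derivatives of \<open>S\<close> have
  classical weak gradients in the interior; the Laplacian then appears under the integral.\<close>

lemma harmonic_weakly_harmonic: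
  assumes U: "open U" and h: "harmonic_on U S" and t: "test_function U \<phi>"
  shows "(LINT x:U|lebesgue. weak_gradient U S x $ 1 * partial 1 \<phi> x) + (LINT x:U|lebesgue. weak_gradient U S x $ 2 * partial 2 \<phi> x) = 0"
proof -
  have Ck: "Ck_on (Suc (Suc 0)) U S" using h unfolding harmonic_on_def by (simp add: numeral_2_eq_2)
  have d1: "S differentiable (at x)" if "x \<in> U" for x using Ck that by simp
  have d2: "partial i S differentiable (at x)" if "x \<in> U" for i x using Ck that by simp
  have c2: "continuous_on U (partial j (partial i S))" for i j using Ck by simp
  have c1: "continuous_on U (partial i S)" for i
    using d2 by (intro continuous_at_imp_continuous_on ballI differentiable_imp_continuous_within) auto
  have w1: "has_weak_gradient U S (\<lambda>x. \<chi> j. partial j S x)" by (rule C1_weak_gradient[OF U d1 c1])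
  have w2: "has_weak_gradient U (partial i S) (\<lambda>x. \<chi> j. partial j (partial i S) x)" for i by (rule C1_weak_gradient[OF U d2 c2])
  obtain C where C: "compact C" "C \<subseteq> U" "\<And>x. x \<notin> C \<Longrightarrow> \<phi> x = 0" "\<And>x i. x \<notin> C \<Longrightarrow> partial i \<phi> x = 0"
    using test_function_support[OF t] by metis
  note cphi = test_function_continuous[OF t]
  have A: "(LINT x:U|lebesgue. weak_gradient U S x $ i * partial i \<phi> x) = - (LINT x:U|lebesgue. partial i (partial i S) x * \<phi> x)" for i
  proof -
    have "(LINT x:U|lebesgue. weak_gradient U S x $ i * partial i \<phi> x) = (LINT x:U|lebesgue. partial i S x * partial i \<phi> x)"
    proof (rule set_integral_AE_cong(1)[symmetric])
      show "set_integrable lebesgue U (\<lambda>x. partial i S x * partial i \<phi> x)"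
        by (rule set_integrable_test[OF continuous_compact_integrable[OF c1] C(1,2,4) cphi(2)])
      show "AE x in lebesgue. x \<in> U \<longrightarrow> partial i S x * partial i \<phi> x = weak_gradient U S x $ i * partial i \<phi> x"
        using weak_gradient_AE_eq[OF U w1] by (auto elim!: eventually_mono)
    qed
    also have "\<dots> = - (LINT x:U|lebesgue. (\<chi> j. partial j (partial i S) x) $ i * \<phi> x)"
      using w2[of i] t unfolding has_weak_gradient_def by blast
    finally show ?thesis by simp
  qed
  have i: "set_integrable lebesgue U (\<lambda>x. partial i (partial i S) x * \<phi> x)" for i
    by (rule set_integrable_test[OF continuous_compact_integrable[OF c2] C(1,2,3) cphi(1)])
  have "(LINT x:U|lebesgue. partial 1 (partial 1 S) x * \<phi> x) + (LINT x:U|lebesgue. partial 2 (partial 2 S) x * \<phi> x)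
    = (LINT x:U|lebesgue. partial 1 (partial 1 S) x * \<phi> x + partial 2 (partial 2 S) x * \<phi> x)"
    by (rule set_integral_add(2)[symmetric, OF i i])
  also have "\<dots> = (LINT x:U|lebesgue. 0)"
  proof (rule set_lebesgue_integral_cong)
    show "\<forall>x. x \<in> U \<longrightarrow> partial 1 (partial 1 S) x * \<phi> x + partial 2 (partial 2 S) x * \<phi> x = 0"
    proof (intro allI impI)
      fix x assume "x \<in> U"
      then have "partial 1 (partial 1 S) x + partial 2 (partial 2 S) x = 0" using h unfolding harmonic_on_def by (simp add: sum_2)
      then show "partial 1 (partial 1 S) x * \<phi> x + partial 2 (partial 2 S) x * \<phi> x = 0" by (simp add: distrib_right[symmetric])
    qed
  qed (use U in auto)
  finally show ?thesis unfolding A by simp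
qed

lemma continuous_AE_zero:
  fixes f :: "real^2 \<Rightarrow> 'b::euclidean_space"
  assumes U: "open U" and f: "continuous_on U f" and ae: "AE x in lebesgue. x \<in> U \<longrightarrow> f x = 0" and x: "x \<in> U"
  shows "f x = 0"
proof (rule ccontr)
  assume n: "f x \<noteq> 0"
  have "open (U \<inter> f -` (- {0}))" by (rule continuous_open_preimage[OF f U]) auto
  moreover have "AE x in lebesgue. x \<notin> U \<inter> f -` (- {0})" using ae by eventually_elim auto
  then have "negligible (U \<inter> f -` (- {0}))"
    using AE_iff_null_sets[of "U \<inter> f -` (- {0})" lebesgue] \<open>open (U \<inter> f -` (- {0}))\<close>
    by (simp add: negligible_iff_null_sets)
  ultimately show False using open_not_negligible[of "U \<inter> f -` (- {0})"] x n by auto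
qed

text \<open>The product p q is an eigenfunction of the Laplacian that vanishes on all sides. Weak
  harmonicity, extended from test functions to p q by cut-offs, kills the integral of the two
  gradients; equality of the traces moves the other derivative to p q, and the eigenvalue factors
  out. Integer indices allow shifts in both directions later.\<close>

lemma sine_product_orthogonal:
  fixes m n :: int
  assumes S: "harmonic_extension S" "harmonic_extension S'"
  shows "(LINT x:Omega|lebesgue. (S x - S' x) * (sin (real_of_int m * (kap * (x$1 + 1))) * sin (real_of_int n * (pi / 2 * (x$2 + 1))))) = 0"
proof -
  define a b where "a = real_of_int m * kap" and "b = real_of_int n * (pi / 2)"
  define p where "p s = sin (a * s + a)" for s
  define q where "q s = sin (b * s + b)" for s
  have sp: "smooth p" "smooth q" unfolding p_def q_def by (rule smooth_sin)+
  have dp: "deriv p = (\<lambda>s. a * cos (a * s + a))" "deriv q = (\<lambda>s. b * cos (b * s + b))"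
    unfolding p_def q_def by (rule ext, rule DERIV_imp_deriv, auto intro!: derivative_eq_intros)+
  have ddp: "deriv (deriv p) = (\<lambda>s. - a\<^sup>2 * p s)" "deriv (deriv q) = (\<lambda>s. - b\<^sup>2 * q s)"
    unfolding dp p_def q_def by (rule ext, rule DERIV_imp_deriv, auto intro!: derivative_eq_intros simp: power2_eq_square)+
  have z: "p (-1) = 0" "p (1/2) = 0" "q (-1) = 0" "q 1 = 0"
  proof -
    have "a * (1/2) + a = of_int m * pi" by (simp add: a_def kap_def)
    then show "p (1/2) = 0" unfolding p_def by (simp only: sin_int_times_real) (simp add: sin_integer_2pi sin_zero_iff_int2)
    have "b * 1 + b = of_int n * pi" by (simp add: b_def)
    then show "q 1 = 0" unfolding q_def by (simp add: sin_zero_iff_int2)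
  qed (auto simp: p_def q_def)
  let ?a = "pt (-1) (-1)" and ?b = "pt (1/2) 1"
  let ?U = "box ?a ?b"
  define E where "E i x = weak_gradient ?U S x $ i - weak_gradient ?U S' x $ i" for i x
  have tr: "has_trace ?U (rect_sides ?a ?b) S sigma0" "has_trace ?U (rect_sides ?a ?b) S' sigma0"
    using S unfolding harmonic_extension_def Omega_eq sides_Omega_def by auto
  have har: "harmonic_on ?U S" "harmonic_on ?U S'" using S unfolding harmonic_extension_def Omega_eq by auto
  have W: "S \<in> W12 ?U" "S' \<in> W12 ?U" using tr unfolding has_trace_def by auto
  have Gi: "set_integrable lebesgue ?U (\<lambda>x. weak_gradient ?U S x $ i)" "set_integrable lebesgue ?U (\<lambda>x. weak_gradient ?U S' x $ i)" for i
    using W12_weak_gradient(3)[OF open_box W(1)] W12_weak_gradient(3)[OF open_box W(2)]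
    by (auto intro!: set_integrable_nth L2_on_integrable)
  have Ei: "set_integrable lebesgue ?U (E i)" for i unfolding E_def[abs_def] by (intro set_integral_diff Gi)
  have weak: "(LINT x:?U|lebesgue. E 1 x * partial 1 \<phi> x) + (LINT x:?U|lebesgue. E 2 x * partial 2 \<phi> x) = 0" if t: "test_function ?U \<phi>" for \<phi>
  proof -
    have i: "set_integrable lebesgue ?U (\<lambda>x. g x * partial i \<phi> x)" if "set_integrable lebesgue ?U g" for g i
      by (rule set_integrable_mult_continuous[OF that]) (rule continuous_on_subset[OF test_function_continuous(2)[OF t]], simp)
    have "(LINT x:?U|lebesgue. E i x * partial i \<phi> x) = (LINT x:?U|lebesgue. weak_gradient ?U S x $ i * partial i \<phi> x) - (LINT x:?U|lebesgue. weak_gradient ?U S' x $ i * partial i \<phi> x)" for i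
      unfolding E_def left_diff_distrib by (rule set_integral_diff(2)[OF i[OF Gi(1)] i[OF Gi(2)]])
    then show ?thesis
      using harmonic_weakly_harmonic[OF open_box har(1) t] harmonic_weakly_harmonic[OF open_box har(2) t] by simp
  qed
  have ab: "?a$1 < ?b$1" "?a$2 < ?b$2" by auto
  have "(\<lambda>k. (LINT x:?U|lebesgue. E 1 x * partial 1 (cut2 ?a ?b k p q) x) + (LINT x:?U|lebesgue. E 2 x * partial 2 (cut2 ?a ?b k p q) x))
     \<longlonglongrightarrow> (LINT x:?U|lebesgue. E 1 x * (deriv p (x$1) * q (x$2))) + (LINT x:?U|lebesgue. E 2 x * (p (x$1) * deriv q (x$2)))"
    using tendsto_add[OF tendsto_cutoff_gradient(1)[OF ab Ei[of 1] sp] tendsto_cutoff_gradient(2)[OF ab Ei[of 2] sp]] z by simp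
  moreover have "eventually (\<lambda>k. (LINT x:?U|lebesgue. E 1 x * partial 1 (cut2 ?a ?b k p q) x) + (LINT x:?U|lebesgue. E 2 x * partial 2 (cut2 ?a ?b k p q) x) = 0) sequentially"
    using eventually_box_large[OF ab] by eventually_elim (intro weak test_function_cut2 sp; simp)
  ultimately have s0: "(LINT x:?U|lebesgue. E 1 x * (deriv p (x$1) * q (x$2))) + (LINT x:?U|lebesgue. E 2 x * (p (x$1) * deriv q (x$2))) = 0"
    by (rule LIMSEQ_unique[OF _ tendsto_eventually])
  have L2: "L2_on ?U S" "L2_on ?U S'" using W12_weak_gradient(1)[OF open_box] W by auto
  have Di: "set_integrable lebesgue ?U (\<lambda>x. S x - S' x)"
    by (intro set_integral_diff L2_on_integrable L2) auto
  have cpq: "continuous_on A (\<lambda>x::real^2. f (x$1) * g (x$2))" if "smooth f" "smooth g" for f g A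
    using continuous_tensor[OF that, of A] unfolding tensor_def[abs_def] .
  have i1: "set_integrable lebesgue ?U (\<lambda>x. (S x - S' x) * (f (x$1) * g (x$2)))" if "smooth f" "smooth g" for f g
    by (rule set_integrable_mult_continuous[OF Di cpq[OF that]])
  have i2: "set_integrable lebesgue ?U (\<lambda>x. E i x * (f (x$1) * g (x$2)))" if "smooth f" "smooth g" for f g i
    by (rule set_integrable_mult_continuous[OF Ei cpq[OF that]])
  let ?J = "LINT x:?U|lebesgue. (S x - S' x) * (p (x$1) * q (x$2))"
  have "(LINT x:?U|lebesgue. (S x - S' x) * (deriv (deriv p) (x$1) * q (x$2))) + (LINT x:?U|lebesgue. E 1 x * (deriv p (x$1) * q (x$2))) = 0"
    using trace_green(1)[OF ab tr smooth_deriv[OF sp(1)] sp(2)] i1[OF smooth_deriv[OF smooth_deriv[OF sp(1)]] sp(2)] i2[OF smooth_deriv[OF sp(1)] sp(2), of 1]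
    by (simp add: set_integral_add(2) E_def[symmetric])
  moreover have "(LINT x:?U|lebesgue. (S x - S' x) * (p (x$1) * deriv (deriv q) (x$2))) + (LINT x:?U|lebesgue. E 2 x * (p (x$1) * deriv q (x$2))) = 0"
    using trace_green(2)[OF ab tr sp(1) smooth_deriv[OF sp(2)]] i1[OF sp(1) smooth_deriv[OF smooth_deriv[OF sp(2)]]] i2[OF sp(1) smooth_deriv[OF sp(2)], of 2]
    by (simp add: set_integral_add(2) E_def[symmetric])
  moreover have "(LINT x:?U|lebesgue. (S x - S' x) * (deriv (deriv p) (x$1) * q (x$2))) = - a\<^sup>2 * ?J"
    unfolding ddp set_integral_mult_right[symmetric] by (simp only: mult_ac)
  moreover have "(LINT x:?U|lebesgue. (S x - S' x) * (p (x$1) * deriv (deriv q) (x$2))) = - b\<^sup>2 * ?J"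
    unfolding ddp set_integral_mult_right[symmetric] by (simp only: mult_ac)
  ultimately have "(a\<^sup>2 + b\<^sup>2) * ?J = 0" using s0 by (simp add: distrib_right)
  \<comment> \<open>A vanishing eigenvalue forces \<open>a\<close> = 0, where the first sine factor
    is identically 0.\<close>
  moreover have "?J = 0" if "a\<^sup>2 + b\<^sup>2 = 0"
  proof -
    have "a = 0" using that by (simp add: sum_power2_eq_zero_iff)
    then show ?thesis by (simp add: p_def set_lebesgue_integral_def)
  qed
  ultimately have "?J = 0" by auto
  then show ?thesis unfolding Omega_eq p_def q_def a_def b_def by (simp add: distrib_left mult.assoc)
qed

text \<open>Completeness of the sines by Stone-Weierstrass: multiplying by a cosine shifts the
  indices of the sines, so orthogonality to all sine products persists after multiplication by
  polynomials in the two cosines, and these are dense. A test function is then divided by the first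
  sine product, which is positive on \<open>Omega\<close>.\<close>

lemma harmonic_extension_difference_AE:
  assumes S: "harmonic_extension S" "harmonic_extension S'"
  shows "AE x in lebesgue. x \<in> Omega \<longrightarrow> S x - S' x = 0"
proof -
  let ?K = "cbox (pt (-1) (-1)) (pt (1/2) 1)"
  let ?s = "\<lambda>x::real^2. kap * (x$1 + 1)" and ?t = "\<lambda>x::real^2. pi / 2 * (x$2 + 1)"
  define D where "D x = S x - S' x" for x
  have W: "S \<in> W12 Omega" "S' \<in> W12 Omega" using S unfolding harmonic_extension_def has_trace_def by auto
  have lm: "Omega \<in> lmeasurable" unfolding Omega_eq by simp
  have Di: "set_integrable lebesgue Omega D"
    unfolding D_def[abs_def]
    using W12_weak_gradient(1)[OF open_Omega W(1)] W12_weak_gradient(1)[OF open_Omega W(2)]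
    by (intro set_integral_diff L2_on_integrable lm) auto
  have int: "set_integrable lebesgue Omega (\<lambda>x. D x * f x)" if "continuous_on ?K f" for f
    using set_integrable_mult_continuous[OF Di[unfolded Omega_eq] that] unfolding Omega_eq .
  define e where "e m n x = sin (real_of_int m * ?s x) * sin (real_of_int n * ?t x)" for m n :: int and x
  have ce: "continuous_on A (e m n)" for A m n unfolding e_def[abs_def] by (intro continuous_intros)
  define P where "P r \<longleftrightarrow> continuous_on ?K r \<and> (\<forall>m n. (LINT x:Omega|lebesgue. D x * (e m n x * r x)) = 0)" for r
  \<comment> \<open>The multipliers that preserve \<open>P\<close> are closed under products by
    construction, which is not visible for \<open>P\<close> itself.\<close>
  define R where "R = {r. continuous_on ?K r \<and> (\<forall>r'. P r' \<longrightarrow> P (\<lambda>x. r x * r' x))}"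
  have P1: "P (\<lambda>x. 1)"
    unfolding P_def using sine_product_orthogonal[OF S] by (simp add: D_def e_def)
  have PR: "P r" if "r \<in> R" for r using that P1 unfolding R_def by fastforce
  have lin: "(LINT x:Omega|lebesgue. D x * (c * f x + d * g x)) = c * (LINT x:Omega|lebesgue. D x * f x) + d * (LINT x:Omega|lebesgue. D x * g x)"
    if f: "continuous_on ?K f" "continuous_on ?K g" for c d f g
  proof -
    have "(LINT x:Omega|lebesgue. D x * (c * f x + d * g x)) = (LINT x:Omega|lebesgue. c * (D x * f x) + d * (D x * g x))"
      by (simp only: distrib_left mult.left_commute)
    also have "\<dots> = (LINT x:Omega|lebesgue. c * (D x * f x)) + (LINT x:Omega|lebesgue. d * (D x * g x))"
      by (rule set_integral_add(2)) (use int[OF f(1)] int[OF f(2)] in auto)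
    finally show ?thesis by simp
  qed
  have Rlin: "P (\<lambda>x. c * f x + d * g x)" if "P f" "P g" for c d f g
    unfolding P_def
  proof (intro conjI allI)
    have cf: "continuous_on ?K f" "continuous_on ?K g" using that unfolding P_def by auto
    then show "continuous_on ?K (\<lambda>x. c * f x + d * g x)" by (intro continuous_intros)
    fix m n
    have "(LINT x:Omega|lebesgue. D x * (e m n x * (c * f x + d * g x))) = (LINT x:Omega|lebesgue. D x * (c * (e m n x * f x) + d * (e m n x * g x)))"
      by (simp only: distrib_left mult.left_commute)
    also have "\<dots> = c * (LINT x:Omega|lebesgue. D x * (e m n x * f x)) + d * (LINT x:Omega|lebesgue. D x * (e m n x * g x))"
      by (intro lin continuous_intros ce cf)
    also have "\<dots> = 0" using that unfolding P_def by simp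
    finally show "(LINT x:Omega|lebesgue. D x * (e m n x * (c * f x + d * g x))) = 0" .
  qed
  have shift: "P (\<lambda>x. u x * r x)"
    if r: "P r" and u: "continuous_on ?K u" "\<And>m n x. u x * e m n x = 1/2 * e (m + i) (n + j) x + 1/2 * e (m - i) (n - j) x" for u r i j
    unfolding P_def
  proof (intro conjI allI)
    have cr: "continuous_on ?K r" using r unfolding P_def by auto
    show "continuous_on ?K (\<lambda>x. u x * r x)" by (intro continuous_intros u cr)
    fix m n
    have "e m n x * (u x * r x) = 1/2 * (e (m + i) (n + j) x * r x) + 1/2 * (e (m - i) (n - j) x * r x)" for x
    proof -
      have "e m n x * (u x * r x) = (u x * e m n x) * r x" by simp
      then show ?thesis unfolding u(2) by (simp add: algebra_simps)
    qed
    then have "(LINT x:Omega|lebesgue. D x * (e m n x * (u x * r x))) = (LINT x:Omega|lebesgue. D x * (1/2 * (e (m + i) (n + j) x * r x) + 1/2 * (e (m - i) (n - j) x * r x)))"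
      by (simp only:)
    also have "\<dots> = 1/2 * (LINT x:Omega|lebesgue. D x * (e (m + i) (n + j) x * r x)) + 1/2 * (LINT x:Omega|lebesgue. D x * (e (m - i) (n - j) x * r x))"
      by (intro lin continuous_intros ce cr)
    also have "\<dots> = 0" using r unfolding P_def by simp
    finally show "(LINT x:Omega|lebesgue. D x * (e m n x * (u x * r x))) = 0" .
  qed
  have trig: "cos s * sin (real_of_int m * s) = 1/2 * sin (real_of_int (m + 1) * s) + 1/2 * sin (real_of_int (m - 1) * s)" for s m
    by (simp add: distrib_right left_diff_distrib sin_add sin_diff add_divide_distrib diff_divide_distrib)
  have c1: "(\<lambda>x. cos (?s x)) \<in> R"
  proof -
    have "P (\<lambda>x. cos (?s x) * r x)" if "P r" for r
    proof (rule shift[OF that, of _ 1 0])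
      fix m n x
      have "cos (?s x) * e m n x = (cos (?s x) * sin (real_of_int m * ?s x)) * sin (real_of_int n * ?t x)" by (simp add: e_def)
      then show "cos (?s x) * e m n x = 1/2 * e (m + 1) (n + 0) x + 1/2 * e (m - 1) (n - 0) x"
        unfolding trig by (simp add: e_def distrib_right)
    qed (intro continuous_intros)
    then show ?thesis unfolding R_def by (auto intro!: continuous_intros)
  qed
  have c2: "(\<lambda>x. cos (?t x)) \<in> R"
  proof -
    have "P (\<lambda>x. cos (?t x) * r x)" if "P r" for r
    proof (rule shift[OF that, of _ 0 1])
      fix m n x
      have "cos (?t x) * e m n x = sin (real_of_int m * ?s x) * (cos (?t x) * sin (real_of_int n * ?t x))" by (simp add: e_def)
      then show "cos (?t x) * e m n x = 1/2 * e (m + 0) (n + 1) x + 1/2 * e (m - 0) (n - 1) x"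
        unfolding trig by (simp add: e_def distrib_left)
    qed (intro continuous_intros)
    then show ?thesis unfolding R_def by (auto intro!: continuous_intros)
  qed
  have FR: "function_ring_on R ?K"
  proof
    show "compact ?K" by simp
    show "continuous_on ?K f" if "f \<in> R" for f using that unfolding R_def by auto
    show "(\<lambda>x. f x + g x) \<in> R" if "f \<in> R" "g \<in> R" for f g
    proof -
      have "P (\<lambda>x. (f x + g x) * r x)" if "P r" for r
        using Rlin[of "\<lambda>x. f x * r x" "\<lambda>x. g x * r x" 1 1] \<open>f \<in> R\<close> \<open>g \<in> R\<close> that unfolding R_def by (simp add: distrib_right)
      then show ?thesis using that unfolding R_def by (auto intro!: continuous_intros)
    qed
    show "(\<lambda>x. f x * g x) \<in> R" if "f \<in> R" "g \<in> R" for f g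
      using that unfolding R_def by (auto intro!: continuous_intros simp: mult.assoc)
    show "(\<lambda>_. c) \<in> R" for c
      unfolding R_def using Rlin[of _ _ c 0] by auto
    fix x y assume xy: "x \<in> ?K" "y \<in> ?K" "x \<noteq> y"
    \<comment> \<open>On the closed rectangle both arguments range over [0, pi], where the cosine is
      injective; hence the two cosines separate points.\<close>
    have inj: "cos u = cos v \<longleftrightarrow> u = v" if "0 \<le> u" "u \<le> pi" "0 \<le> v" "v \<le> pi" for u v :: real
      using that cos_inj_pi by blast
    have b: "0 \<le> ?s z" "?s z \<le> pi" "0 \<le> ?t z" "?t z \<le> pi" if "z \<in> ?K" for z
      using that mult_left_mono[of "z$1 + 1" "3/2" pi] by (auto simp: mem_box2 kap_def)
    show "\<exists>f\<in>R. f x \<noteq> f y"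
    proof (cases "x$1 = y$1")
      case True
      then have "x$2 \<noteq> y$2" using xy(3) by (auto simp: vec_eq_iff forall_2)
      then have "cos (?t x) \<noteq> cos (?t y)" using inj[OF b(3)[OF xy(1)] b(4)[OF xy(1)] b(3)[OF xy(2)] b(4)[OF xy(2)]] by auto
      then show ?thesis using c2 by (intro bexI[OF _ c2]) auto
    next
      case False
      then have "cos (?s x) \<noteq> cos (?s y)" using inj[OF b(1)[OF xy(1)] b(2)[OF xy(1)] b(1)[OF xy(2)] b(2)[OF xy(2)]] kap_pos by auto
      then show ?thesis using c1 by (intro bexI[OF _ c1]) auto
    qed
  qed
  have zero: "(LINT x:Omega|lebesgue. D x * (e 1 1 x * f x)) = 0" if f: "continuous_on ?K f" for f
  proof -
    let ?M = "LINT x:Omega|lebesgue. \<bar>D x\<bar>"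
    have M0: "?M \<ge> 0" unfolding set_lebesgue_integral_def by (intro Bochner_Integration.integral_nonneg) auto
    have "\<bar>LINT x:Omega|lebesgue. D x * (e 1 1 x * f x)\<bar> \<le> 0 + d" if d: "d > 0" for d
    proof -
      \<comment> \<open>The summand 1 guards against a vanishing L1 norm of
        \<open>D\<close>.\<close>
      define eps where "eps = d / (?M + 1)"
      have eps: "eps > 0" using d M0 by (simp add: eps_def)
      obtain g where g: "g \<in> R" "\<And>x. x \<in> ?K \<Longrightarrow> \<bar>f x - g x\<bar> < eps"
        using function_ring_on.Stone_Weierstrass_basic[OF FR f eps] by blast
      have cg: "continuous_on ?K g" and g0: "(LINT x:Omega|lebesgue. D x * (e 1 1 x * g x)) = 0"
        using PR[OF g(1)] unfolding P_def by auto
      have "(LINT x:Omega|lebesgue. D x * (e 1 1 x * f x)) = (LINT x:Omega|lebesgue. D x * (e 1 1 x * f x)) - (LINT x:Omega|lebesgue. D x * (e 1 1 x * g x))"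
        using g0 by simp
      also have "\<dots> = (LINT x:Omega|lebesgue. D x * (e 1 1 x * f x) - D x * (e 1 1 x * g x))"
        by (rule set_integral_diff(2)[symmetric]) (intro int continuous_intros ce f cg)+
      finally have e: "(LINT x:Omega|lebesgue. D x * (e 1 1 x * f x)) = (LINT x:Omega|lebesgue. D x * (e 1 1 x * f x) - D x * (e 1 1 x * g x))" .
      have "norm (LINT x:Omega|lebesgue. D x * (e 1 1 x * f x) - D x * (e 1 1 x * g x)) \<le> (LINT x:Omega|lebesgue. eps * \<bar>D x\<bar>)"
        unfolding set_lebesgue_integral_def
      proof (rule order_trans[OF Bochner_Integration.integral_norm_bound integral_mono])
        show "integrable lebesgue (\<lambda>x. norm (indicator Omega x *\<^sub>R (D x * (e 1 1 x * f x) - D x * (e 1 1 x * g x))))"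
          using set_integral_diff(1)[OF int int, of "\<lambda>x. e 1 1 x * f x" "\<lambda>x. e 1 1 x * g x"]
          unfolding set_integrable_def by (intro integrable_norm) (auto intro!: continuous_intros ce f cg)
        have "set_integrable lebesgue Omega (\<lambda>x. eps * \<bar>D x\<bar>)" using set_integrable_abs[OF Di] by simp
        then show "integrable lebesgue (\<lambda>x. indicator Omega x *\<^sub>R (eps * \<bar>D x\<bar>))" unfolding set_integrable_def .
        fix x
        show "norm (indicator Omega x *\<^sub>R (D x * (e 1 1 x * f x) - D x * (e 1 1 x * g x))) \<le> indicator Omega x *\<^sub>R (eps * \<bar>D x\<bar>)"
        proof (cases "x \<in> Omega")
          case True
          then have xK: "x \<in> ?K" unfolding Omega_eq using box_subset_cbox by blast
          have "\<bar>e 1 1 x\<bar> \<le> 1" unfolding e_def abs_mult by (intro mult_le_one) auto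
          then have "\<bar>e 1 1 x\<bar> * \<bar>f x - g x\<bar> \<le> 1 * eps" using g(2)[OF xK] by (intro mult_mono) auto
          then have "\<bar>D x\<bar> * (\<bar>e 1 1 x\<bar> * \<bar>f x - g x\<bar>) \<le> \<bar>D x\<bar> * eps" by (intro mult_left_mono) auto
          moreover have "D x * (e 1 1 x * f x) - D x * (e 1 1 x * g x) = D x * (e 1 1 x * (f x - g x))" by (simp add: algebra_simps)
          ultimately show ?thesis using True by (simp add: abs_mult mult.commute)
        qed simp
      qed
      also have "\<dots> = eps * ?M" by simp
      also have "\<dots> \<le> d"
      proof -
        have "eps * ?M \<le> eps * (?M + 1)" using eps by (intro mult_left_mono) auto
        also have "\<dots> = d" using M0 by (simp add: eps_def)
        finally show ?thesis .
      qed
      finally show ?thesis unfolding e by simp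
    qed
    then have "\<bar>LINT x:Omega|lebesgue. D x * (e 1 1 x * f x)\<bar> \<le> 0" by (rule field_le_epsilon)
    then show ?thesis by simp
  qed
  have "AE x in lebesgue. x \<in> Omega \<longrightarrow> D x = 0"
  proof (rule fundamental_lemma[OF _ open_Omega])
    show "set_integrable lebesgue C D" if "compact C" "C \<subseteq> Omega" for C
      by (rule set_integrable_subset[OF Di]) (use that in \<open>auto intro: fmeasurableD lmeasurable_compact\<close>)
    fix p q assume t: "test_function Omega (tensor p q)"
    obtain C where C: "compact C" "C \<subseteq> Omega" "\<And>x. x \<notin> C \<Longrightarrow> tensor p q x = 0"
      using t unfolding test_function_def by blast
    note ct = test_function_continuous(1)[OF t]
    have epos: "e 1 1 x > 0" if "x \<in> Omega" for x
    proof -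
      have "0 < ?s x" "?s x < pi" "0 < ?t x" "?t x < pi"
        using that mult_strict_left_mono[of "x$1 + 1" "3/2" pi] by (auto simp: Omega_iff kap_def)
      then show ?thesis unfolding e_def by (auto intro!: mult_pos_pos[OF sin_gt_zero sin_gt_zero] simp del: zero_less_mult_iff)
    qed
    \<comment> \<open>The quotient extends continuously by 0, because the support of the test
      function is compact in \<open>Omega\<close> and thus away from the zeros of
      \<open>e 1 1\<close> on the boundary.\<close>
    define f where "f x = (if x \<in> Omega then tensor p q x / e 1 1 x else 0)" for x
    have "continuous_on (Omega \<union> - C) f"
    proof (rule continuous_on_open_Un[OF open_Omega])
      show "open (- C)" using C(1) by (simp add: compact_imp_closed open_Compl)
      have "continuous_on Omega (\<lambda>x. tensor p q x / e 1 1 x)"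
        by (intro continuous_intros ce continuous_on_subset[OF ct]) (use epos in \<open>auto simp: less_imp_neq[symmetric]\<close>)
      then show "continuous_on Omega f" by (rule continuous_on_eq) (simp add: f_def)
      show "continuous_on (- C) f" by (rule continuous_on_eq[of _ "\<lambda>x. 0"]) (use C in \<open>auto simp: f_def\<close>)
    qed
    moreover have "Omega \<union> - C = UNIV" using C(2) by blast
    ultimately have "continuous_on ?K f" using continuous_on_subset by fastforce
    from zero[OF this] have "(LINT x:Omega|lebesgue. D x * (e 1 1 x * f x)) = 0" .
    moreover have "(LINT x:Omega|lebesgue. D x * (e 1 1 x * f x)) = (LINT x:Omega|lebesgue. D x * tensor p q x)"
    proof (rule set_lebesgue_integral_cong)
      show "Omega \<in> sets lebesgue" using lm by blast
      show "\<forall>x. x \<in> Omega \<longrightarrow> D x * (e 1 1 x * f x) = D x * tensor p q x"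
        using epos by (auto simp: f_def less_imp_neq[symmetric])
    qed
    ultimately show "(LINT x:Omega|lebesgue. D x * tensor p q x) = 0" by simp
  qed
  then show ?thesis by (simp add: D_def)
qed

lemma harmonic_extension_unique:
  assumes S: "harmonic_extension S" "harmonic_extension S'" and x: "x \<in> Omega"
  shows "S x = S' x"
proof -
  have c: "continuous_on Omega f" if "harmonic_extension f" for f
  proof -
    have "Ck_on (Suc (Suc 0)) Omega f" using that unfolding harmonic_extension_def harmonic_on_def by (simp add: numeral_2_eq_2)
    then show ?thesis by (intro continuous_at_imp_continuous_on ballI differentiable_imp_continuous_within) auto
  qed
  have "S x - S' x = 0"
    by (rule continuous_AE_zero[OF open_Omega _ harmonic_extension_difference_AE[OF S] x])
       (intro continuous_intros c S)
  then show ?thesis by simp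
qed

subsection \<open>The glued function\<close>

abbreviation Qi :: "(real^2) set" where "Qi \<equiv> box (pt (-1) (-1)) (pt 1 1)"

lemma interior_Q: "interior square_Q = Qi"
  unfolding square_Q_def by (rule interior_cbox)

lemma Omega_sub_Qi: "Omega \<subseteq> Qi"
  by (auto simp: Omega_iff mem_box2)

definition sig :: "real^2 \<Rightarrow> real" where "sig = glued Sigma0"

lemma sig_Omega: "x \<in> cbox (pt (-1) (-1)) (pt (1/2) 1) \<Longrightarrow> sig x = Sigma0 x"
proof -
  assume x: "x \<in> cbox (pt (-1) (-1)) (pt (1/2) 1)"
  show ?thesis
  proof (cases "x \<in> Omega")
    case True then show ?thesis by (simp add: sig_def glued_def)
  next
    case False
    have b: "Sigma0 x = sigma0 x" by (rule Sigma0_boundary[OF x]) (use False in \<open>simp add: Omega_eq\<close>)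
    have "x$1 = 1/2" if "x \<in> strip_P" using that x by (auto simp: strip_P_def mem_box2)
    then show ?thesis using False b by (auto simp: sig_def glued_def sigma0_def)
  qed
qed

lemma sig_P: "x \<in> cbox (pt (1/2) (-1)) (pt 1 1) \<Longrightarrow> sig x = - x$2"
  by (auto simp: sig_def glued_def Omega_iff strip_P_def square_Q_def mem_box2 sigma0_def)

lemma square_Q_split: "square_Q = cbox (pt (-1) (-1)) (pt (1/2) 1) \<union> cbox (pt (1/2) (-1)) (pt 1 1)"
  by (auto simp: square_Q_def mem_box2)

lemma continuous_sig: "continuous_on (cbox (pt (-1) (-1)) (pt 1 1)) sig"
proof -
  have "continuous_on (cbox (pt (-1) (-1)) (pt (1/2) 1) \<union> cbox (pt (1/2) (-1)) (pt 1 1)) sig"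
  proof (rule continuous_on_closed_Un)
    show "continuous_on (cbox (pt (-1) (-1)) (pt (1/2) 1)) sig"
      by (rule continuous_on_eq[OF continuous_Sigma0_closure]) (simp add: sig_Omega)
    show "continuous_on (cbox (pt (1/2) (-1)) (pt 1 1)) sig"
      by (rule continuous_on_eq[of _ "\<lambda>x. - x$2"]) (auto intro!: continuous_intros simp: sig_P)
  qed auto
  then show ?thesis using square_Q_split unfolding square_Q_def by simp
qed

lemma sig_sides:
  assumes "x \<in> cbox (pt (-1) (-1)) (pt 1 1)" "x \<notin> Qi"
  shows "sig x = sigma0 x"
proof (cases "x$1 < 1/2")
  case True
  then have x: "x \<in> cbox (pt (-1) (-1)) (pt (1/2) 1)" "x \<notin> box (pt (-1) (-1)) (pt (1/2) 1)" using assms by (auto simp: mem_box2)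
  show ?thesis using sig_Omega[OF x(1)] Sigma0_boundary[OF x] by simp
next
  case False
  then have "x \<in> cbox (pt (1/2) (-1)) (pt 1 1)" using assms by (auto simp: mem_box2)
  from sig_P[OF this] show ?thesis using False by (simp add: sigma0_def)
qed

definition siggrad :: "real^2 \<Rightarrow> real^2" where
  "siggrad x = (if x \<in> Omega then Sgrad x else pt 0 (-1))"

lemma L2_siggrad: "L2_on Qi siggrad"
proof -
  have OM: "Omega \<in> lmeasurable" unfolding Omega_eq by simp
  have O: "Omega \<in> sets lebesgue" "Qi \<in> sets lebesgue" using open_Omega by auto
  note S = Sgrad_L2[unfolded L2_on_iff[OF O(1)]]
  have c: "integrable lebesgue (\<lambda>x. indicator (Qi - Omega) x *\<^sub>R (1::real))"
    using fmeasurable.Diff[OF lmeasurable_box OM] by (simp add: lmeasurable_iff_integrable[symmetric])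
  have [measurable]: "Qi - Omega \<in> sets lebesgue" using O by auto
  have m: "(\<lambda>x. indicator Omega x *\<^sub>R Sgrad x + indicator (Qi - Omega) x *\<^sub>R pt 0 (-1)) \<in> borel_measurable lebesgue"
    using S by (intro borel_measurable_add) auto
  have "(\<lambda>x. indicator Omega x *\<^sub>R Sgrad x + indicator (Qi - Omega) x *\<^sub>R pt 0 (-1)) = (\<lambda>x. indicator Qi x *\<^sub>R siggrad x)"
    using Omega_sub_Qi by (auto simp: fun_eq_iff siggrad_def indicator_def)
  moreover have "(\<lambda>x. indicator Omega x *\<^sub>R (norm (Sgrad x))\<^sup>2 + indicator (Qi - Omega) x *\<^sub>R 1) = (\<lambda>x. indicator Qi x *\<^sub>R (norm (siggrad x))\<^sup>2)"
    using Omega_sub_Qi by (auto simp: fun_eq_iff siggrad_def indicator_def norm_pt)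
  moreover have "integrable lebesgue (\<lambda>x. indicator Omega x *\<^sub>R (norm (Sgrad x))\<^sup>2 + indicator (Qi - Omega) x *\<^sub>R (1::real))"
    using S c by (intro Bochner_Integration.integrable_add) auto
  ultimately show ?thesis unfolding L2_on_iff[OF O(2)] using m by simp
qed

lemma open_right_half: "open {x \<in> Qi. x$1 > 1/2}"
proof -
  have "{x \<in> Qi. x$1 > 1/2} = box (pt (1/2) (-1)) (pt 1 1)" by (auto simp: mem_box2)
  then show ?thesis by (simp only: open_box)
qed

lemma sig_has_derivative:
  assumes "x \<in> Qi" "x$1 \<noteq> 1/2"
  shows "(sig has_derivative (\<lambda>h. siggrad x \<bullet> h)) (at x)"
proof (cases "x$1 < 1/2")
  case True
  then have x: "x \<in> Omega" using assms by (auto simp: Omega_iff mem_box2)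
  have "(Sigma0 has_derivative (\<lambda>h. siggrad x \<bullet> h)) (at x)"
    using Sigma0_has_derivative[of x] x by (auto simp: siggrad_def Omega_iff)
  then show ?thesis
    by (rule has_derivative_transform_within_open[OF _ open_Omega x]) (simp add: sig_def glued_def)
next
  case False
  then have x: "x \<in> {x \<in> Qi. x$1 > 1/2}" "x \<notin> Omega" using assms by (auto simp: Omega_iff)
  have "((\<lambda>x::real^2. - x$2) has_derivative (\<lambda>h. - h$2)) (at x)"
    by (intro has_derivative_minus bounded_linear_imp_has_derivative bounded_linear_vec_nth)
  then have "((\<lambda>x::real^2. - x$2) has_derivative (\<lambda>h. siggrad x \<bullet> h)) (at x)"
    using x by (simp add: siggrad_def inner_vec_def sum_2)
  then show ?thesis
    by (rule has_derivative_transform_within_open[OF _ open_right_half x(1)])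
       (rule sig_P[symmetric], auto simp: mem_box2)
qed

lemma sig_weak_gradient: "has_weak_gradient Qi sig siggrad"
proof (rule classical_weak_gradient[OF open_box, of "{1/2}"])
  show "continuous_on Qi sig" by (rule continuous_on_subset[OF continuous_sig]) (rule box_subset_cbox)
  show "(sig has_derivative (\<lambda>h. siggrad x \<bullet> h)) (at x)" if "x \<in> Qi" "x$1 \<notin> {1/2}" for x
    using that by (intro sig_has_derivative) auto
  have "continuous_on (Omega \<union> {x \<in> Qi. x$1 > 1/2}) siggrad"
  proof (rule continuous_on_open_Un[OF open_Omega open_right_half])
    have "continuous_on Omega Sgrad" by (rule continuous_on_subset[OF continuous_Sgrad]) (auto simp: Omega_iff)
    then show "continuous_on Omega siggrad" by (rule continuous_on_eq) (simp add: siggrad_def)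
    show "continuous_on {x \<in> Qi. x$1 > 1/2} siggrad"
      by (rule continuous_on_eq[of _ "\<lambda>x. pt 0 (-1)"]) (auto simp: siggrad_def Omega_iff)
  qed
  then show "continuous_on (Qi \<inter> {x. x$1 \<notin> {1/2}}) siggrad"
    by (rule continuous_on_subset) (auto simp: Omega_iff mem_box2)
  show "set_integrable lebesgue C siggrad" if "compact C" "C \<subseteq> Qi" for C
    by (rule set_integrable_subset[OF L2_on_integrable[OF _ L2_siggrad]]) (use that in \<open>auto intro: fmeasurableD lmeasurable_compact\<close>)
qed simp

lemma shear_nth: "shear v x $ 1 = x$1" "shear v x $ 2 = 1 * x$2 + 1 * v x"
  by (simp_all add: shear_def axis_def)

lemma coord_weak_gradient: "has_weak_gradient Qi (\<lambda>x. x$i) (\<lambda>x. axis i 1)"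
proof (rule classical_weak_gradient[OF open_box, of "{}"])
  show "((\<lambda>x. x$i) has_derivative (\<lambda>h. axis i 1 \<bullet> h)) (at x)" for x :: "real^2"
    by (simp add: inner_axis' bounded_linear_imp_has_derivative bounded_linear_vec_nth)
  show "set_integrable lebesgue C (\<lambda>x. axis i 1 :: real^2)" if "compact C" "C \<subseteq> Qi" for C
    by (rule continuous_compact_integrable[of UNIV]) (use that in \<open>auto intro!: continuous_intros\<close>)
qed (auto intro!: continuous_intros)

lemma closure_Qi: "closure Qi = cbox (pt (-1) (-1)) (pt 1 1)"
  by (rule closure_box2) auto

lemma coord_W12: "(\<lambda>x. x$i) \<in> W12 Qi"
  by (rule W12_intro[OF L2_on_continuous_closure coord_weak_gradient L2_on_continuous_closure]) (intro continuous_intros)+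

lemma sides_Q_eq: "sides_Q = rect_sides (pt (-1) (-1)) (pt 1 1)"
  by (simp add: sides_Q_def)

text \<open>The constraint, the boundary condition and the energy are all stated for the shear, so
  the argument works with the gradient of x2 + v rather than that of \<open>v\<close>.\<close>

definition Gam :: "(real^2 \<Rightarrow> real) \<Rightarrow> real^2 \<Rightarrow> real^2" where
  "Gam v = weak_gradient Qi (\<lambda>x. shear v x $ 2)"

lemma shear_row_1: "AE x in lebesgue. x \<in> Qi \<longrightarrow> weak_gradient Qi (\<lambda>x. shear v x $ 1) x = axis 1 1"
  unfolding shear_nth by (rule weak_gradient_AE_eq[OF open_box coord_weak_gradient])

text \<open>The first row of the Jacobian is the constant e1. Hence the determinant is linear in the
  gradient of the second component, which makes the constraint a sign condition on one derivative,
  and the energy is a Dirichlet integral up to a constant.\<close>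

lemma weak_jacobian_AE:
  "AE x in lebesgue. x \<in> Qi \<longrightarrow> det (weak_jacobian Qi (shear v) x) = Gam v x $ 2 \<and>
     (norm (weak_jacobian Qi (shear v) x))\<^sup>2 = 1 + (norm (Gam v x))\<^sup>2"
  using shear_row_1[of v]
proof eventually_elim
  case (elim x)
  show ?case
  proof
    assume x: "x \<in> Qi"
    let ?J = "weak_jacobian Qi (shear v) x"
    have 1: "?J $ 1 = axis 1 1" using elim x by (simp add: weak_jacobian_def)
    have 2: "?J $ 2 = Gam v x" by (simp add: weak_jacobian_def Gam_def)
    have "det ?J = Gam v x $ 2" using 1 2 by (simp add: det_2 axis_def)
    moreover have "(norm ?J)\<^sup>2 = (norm (?J $ 1))\<^sup>2 + (norm (?J $ 2))\<^sup>2"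
      by (simp add: norm_vec_def[where 'a = "real^2"] L2_set_def sum_2)
    ultimately show "det ?J = Gam v x $ 2 \<and> (norm ?J)\<^sup>2 = 1 + (norm (Gam v x))\<^sup>2" unfolding 1 2 by simp
  qed
qed

lemma sig_shear_W12: "(\<lambda>x. shear sig x $ 2) \<in> W12 Qi"
  and Gam_sig: "AE x in lebesgue. x \<in> Qi \<longrightarrow> Gam sig x = pt 0 1 + siggrad x"
proof -
  have w: "has_weak_gradient Qi (\<lambda>x. shear sig x $ 2) (\<lambda>x. 1 *\<^sub>R axis 2 1 + 1 *\<^sub>R siggrad x)"
    unfolding shear_nth by (rule has_weak_gradient_lincomb[OF coord_weak_gradient sig_weak_gradient])
  have "L2_on Qi (\<lambda>x. 1 *\<^sub>R axis 2 1 + 1 *\<^sub>R siggrad x)"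
    by (intro L2_on_lincomb L2_siggrad L2_on_continuous_closure continuous_intros) auto
  moreover have "L2_on Qi (\<lambda>x. shear sig x $ 2)"
    unfolding shear_nth by (intro L2_on_continuous_closure continuous_intros continuous_sig)
  ultimately show "(\<lambda>x. shear sig x $ 2) \<in> W12 Qi" using w by (intro W12_intro) auto
  have e: "pt 0 1 = axis 2 1" by (simp add: vec_eq_iff forall_2 axis_def)
  show "AE x in lebesgue. x \<in> Qi \<longrightarrow> Gam sig x = pt 0 1 + siggrad x"
    unfolding Gam_def e using weak_gradient_AE_eq[OF open_box w] by simp
qed

lemma det_positive: "x \<in> Omega \<Longrightarrow> 1 + Sgrad x $ 2 > 0"
proof -
  assume x: "x \<in> Omega"
  have "Re (Tfun (Complex (x$1) (x$2))) \<ge> 0" by (rule Re_Tfun_nonneg) (use x in \<open>auto simp: Omega_iff\<close>)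
  then have "4 / pi * Re (Tfun (cx x)) \<ge> 0" by simp
  moreover have "1 + Sgrad x $ 2 = 1 - 2/3 * (x$1 + 1) + 4 / pi * Re (Tfun (cx x))"
    by (simp add: Sgrad_def Hder_def)
  moreover have "2/3 * (x$1 + 1) < 1" using x by (simp add: Omega_iff)
  ultimately show ?thesis by linarith
qed

lemma sig_admissible: "sig \<in> admissible"
proof -
  have W: "sig \<in> W12 Qi"
    by (rule W12_intro[OF L2_on_continuous_closure[OF continuous_sig] sig_weak_gradient L2_siggrad])
  have tr: "has_trace Qi sides_Q (\<lambda>x. shear sig x $ i) (\<lambda>x. shear sigma0 x $ i)" for i
  proof (rule has_trace_continuous)
    have i: "i = 1 \<or> i = 2" using exhaust_2 by auto
    then show "(\<lambda>x. shear sig x $ i) \<in> W12 Qi" using sig_shear_W12 coord_W12[of 1] by (auto simp: shear_nth(1))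
    show "continuous_on (closure Qi) (\<lambda>x. shear sig x $ i)"
      unfolding closure_Qi using i
    proof
      show "i = 1 \<Longrightarrow> continuous_on (cbox (pt (-1) (-1)) (pt 1 1)) (\<lambda>x. shear sig x $ i)"
        by (simp only: shear_nth) (intro continuous_intros)
      show "i = 2 \<Longrightarrow> continuous_on (cbox (pt (-1) (-1)) (pt 1 1)) (\<lambda>x. shear sig x $ i)"
        by (simp only: shear_nth) (intro continuous_intros continuous_sig)
    qed
    fix P R assume PR: "(P, R) \<in> sides_Q"
    show "closed_segment P R \<subseteq> closure Qi"
      unfolding closure_Qi using rect_sides_segments(1)[OF PR[unfolded sides_Q_eq]] by auto
    fix x assume x: "x \<in> closed_segment P R"
    have "sig x = sigma0 x" by (rule sig_sides) (use rect_sides_segments[OF PR[unfolded sides_Q_eq] x] in auto)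
    then show "shear sig x $ i = shear sigma0 x $ i" by (simp add: shear_def)
  qed
  have "AE x in lebesgue. x \<notin> cbox (pt (-1) (-1)) (pt 1 1) - Qi"
    using AE_frontier_box[of "pt (-1) (-1)" "pt 1 1"] by (rule AE_completion)
  then have "AE x in lebesgue. x \<in> square_Q \<longrightarrow> 0 \<le> det (weak_jacobian Qi (shear sig) x)"
    using weak_jacobian_AE[of sig] Gam_sig
  proof eventually_elim
    case (elim x)
    show ?case
    proof
      assume "x \<in> square_Q"
      then have x: "x \<in> Qi" using elim(1) unfolding square_Q_def by blast
      show "0 \<le> det (weak_jacobian Qi (shear sig) x)"
        using elim(2,3) x det_positive[of x] by (auto simp: siggrad_def)
    qed
  qed
  then show ?thesis unfolding admissible_def interior_Q using W tr by simp
qed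

lemma energy_eq:
  assumes "(\<lambda>x. shear v x $ 2) \<in> W12 Qi"
  shows "energy v = measure lebesgue Qi + (LINT x:Qi|lebesgue. Gam v x \<bullet> Gam v x)"
proof -
  have L: "L2_on Qi (Gam v)" unfolding Gam_def by (rule W12_weak_gradient(3)[OF open_box assms])
  have i1: "set_integrable lebesgue Qi (\<lambda>x. 1::real)" unfolding set_integrable_def by (simp add: lmeasurable_iff_integrable[symmetric])
  have i2: "set_integrable lebesgue Qi (\<lambda>x. Gam v x \<bullet> Gam v x)" by (rule L2_on_integrable_product[OF _ L L]) simp
  have i: "set_integrable lebesgue Qi (\<lambda>x. 1 + Gam v x \<bullet> Gam v x)" by (rule set_integral_add(1)[OF i1 i2])
  let ?N = "\<lambda>x. (norm (weak_jacobian Qi (shear v) x))\<^sup>2"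
  have ae: "AE x in lebesgue. x \<notin> cbox (pt (-1) (-1)) (pt 1 1) - Qi"
    using AE_frontier_box[of "pt (-1) (-1)" "pt 1 1"] by (rule AE_completion)
  have j: "AE x in lebesgue. x \<in> Qi \<longrightarrow> 1 + Gam v x \<bullet> Gam v x = ?N x"
    using weak_jacobian_AE[of v] by eventually_elim (simp add: power2_norm_eq_inner)
  have "(LINT x:Qi|lebesgue. 1 + Gam v x \<bullet> Gam v x) = (LINT x:Qi|lebesgue. ?N x)" and iN: "set_integrable lebesgue Qi ?N"
    by (rule set_integral_AE_cong[OF i j])+
  moreover have "energy v = (LINT x:Qi|lebesgue. ?N x)"
    unfolding energy_def interior_Q set_lebesgue_integral_def
  proof (rule integral_cong_AE)
    have m: "(\<lambda>x. indicator Qi x *\<^sub>R ?N x) \<in> borel_measurable lebesgue" using iN unfolding set_integrable_def by simp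
    have e: "AE x in lebesgue. indicator Qi x *\<^sub>R ?N x = indicator square_Q x *\<^sub>R ?N x"
      using ae by eventually_elim (use box_subset_cbox[of "pt (-1) (-1)" "pt 1 1"] in \<open>auto simp: indicator_def square_Q_def\<close>)
    show "(\<lambda>x. indicator square_Q x *\<^sub>R ?N x) \<in> borel_measurable lebesgue" by (rule borel_measurable_AE[OF m e])
    show "AE x in lebesgue. indicator square_Q x *\<^sub>R ?N x = indicator Qi x *\<^sub>R ?N x" using e by eventually_elim (rule sym)
    show "(\<lambda>x. indicator Qi x *\<^sub>R ?N x) \<in> borel_measurable lebesgue" by (rule m)
  qed
  moreover have "(LINT x:Qi|lebesgue. 1 + Gam v x \<bullet> Gam v x) = (LINT x:Qi|lebesgue. 1) + (LINT x:Qi|lebesgue. Gam v x \<bullet> Gam v x)"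
    by (rule set_integral_add(2)[OF i1 i2])
  moreover have "(LINT x:Qi|lebesgue. (1::real)) = measure lebesgue Qi"
    unfolding set_lebesgue_integral_def by simp
  ultimately show ?thesis by simp
qed

text \<open>Presents an arbitrary factor as a derivative, so that Green's identity in x2 yields
  integrals of v - sig itself.\<close>

lemma smooth_antiderivative:
  assumes f: "smooth f"
  shows "\<exists>F. smooth F \<and> deriv F = f"
proof -
  define F where "F u = (LBINT y=0..ereal u. f y)" for u :: real
  have D: "(F has_real_derivative f x) (at x)" for x
  proof -
    have "((\<lambda>u. LBINT y=0..u. f y) has_vector_derivative f x) (at x within {-\<bar>x\<bar>-1..\<bar>x\<bar>+1})"
      using interval_integral_FTC2[of "-\<bar>x\<bar>-1" 0 "\<bar>x\<bar>+1" f x] smooth_continuous[OF f] by (auto simp: zero_ereal_def)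
    moreover have "at x within {-\<bar>x\<bar>-1..\<bar>x\<bar>+1} = at x" by (rule at_within_interior) (auto simp: abs_if)
    ultimately show ?thesis by (simp add: F_def[abs_def] has_real_derivative_iff_has_vector_derivative)
  qed
  have "C1k k F" for k
  proof (cases k)
    case 0
    then show ?thesis using D by (auto intro!: DERIV_isCont simp: continuous_on_eq_continuous_at)
  next
    case (Suc j)
    have "C1k j f" using f by (simp add: smooth_def)
    then show ?thesis using D Suc by (auto intro!: exI[of _ f])
  qed
  moreover have "deriv F = f" by (rule ext, rule DERIV_imp_deriv[OF D])
  ultimately show ?thesis unfolding smooth_def by blast
qed

subsection \<open>Minimality\<close>

definition Edif :: "(real^2 \<Rightarrow> real) \<Rightarrow> real^2 \<Rightarrow> real^2" where
  "Edif v x = Gam v x - Gam sig x"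

lemma admissible_shear:
  assumes "v \<in> admissible"
  shows "has_trace Qi (rect_sides (pt (-1) (-1)) (pt 1 1)) (\<lambda>x. shear v x $ 2) (\<lambda>x. shear sigma0 x $ 2)"
    and "(\<lambda>x. shear v x $ 2) \<in> W12 Qi"
    and "L2_on Qi v"
    and "AE x in lebesgue. x \<in> Qi \<longrightarrow> 0 \<le> Gam v x $ 2"
proof -
  show t: "has_trace Qi (rect_sides (pt (-1) (-1)) (pt 1 1)) (\<lambda>x. shear v x $ 2) (\<lambda>x. shear sigma0 x $ 2)"
    using assms unfolding admissible_def interior_Q sides_Q_eq by blast
  then show "(\<lambda>x. shear v x $ 2) \<in> W12 Qi" unfolding has_trace_def by (rule conjunct1)
  have "v \<in> W12 Qi" using assms unfolding admissible_def interior_Q by blast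
  then show "L2_on Qi v" by (rule W12_weak_gradient(1)[OF open_box])
  have "AE x in lebesgue. x \<in> square_Q \<longrightarrow> 0 \<le> det (weak_jacobian Qi (shear v) x)"
    using assms unfolding admissible_def interior_Q by blast
  then show "AE x in lebesgue. x \<in> Qi \<longrightarrow> 0 \<le> Gam v x $ 2"
    using weak_jacobian_AE[of v]
  proof eventually_elim
    case (elim x)
    then show ?case using box_subset_cbox unfolding square_Q_def by fastforce
  qed
qed

lemma L2_Gam: "v \<in> admissible \<Longrightarrow> L2_on Qi (Gam v)"
  unfolding Gam_def by (rule W12_weak_gradient(3)[OF open_box admissible_shear(2)])

lemma L2_Edif: "v \<in> admissible \<Longrightarrow> L2_on Qi (Edif v)"
  using L2_on_lincomb[of Qi "Gam v" "Gam sig" 1 "-1"] L2_Gam sig_admissible by (simp add: Edif_def[abs_def])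

lemma L2_dif: "v \<in> admissible \<Longrightarrow> L2_on Qi (\<lambda>x. v x - sig x)"
  using L2_on_lincomb[of Qi v sig 1 "-1"] admissible_shear(3) sig_admissible by simp

lemma smooth_proj_continuous:
  assumes "smooth p" "smooth q"
  shows "continuous_on A (\<lambda>x::real^2. p (x$1) * q (x$2))"
  using continuous_tensor[OF assms] by (simp add: tensor_def[abs_def])

text \<open>\<open>p\<close> and \<open>q\<close> are free of boundary conditions, since
  \<open>v\<close> and \<open>sig\<close> have the same trace on the whole boundary of the
  square.\<close>

lemma Edif_green:
  assumes v: "v \<in> admissible" and pq: "smooth p" "smooth q"
  shows "(LINT x:Qi|lebesgue. (v x - sig x) * (deriv p (x$1) * q (x$2))) = - (LINT x:Qi|lebesgue. Edif v x $ 1 * (p (x$1) * q (x$2)))"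
    and "(LINT x:Qi|lebesgue. (v x - sig x) * (p (x$1) * deriv q (x$2))) = - (LINT x:Qi|lebesgue. Edif v x $ 2 * (p (x$1) * q (x$2)))"
proof -
  have s: "shear v x $ 2 - shear sig x $ 2 = v x - sig x" for x by (simp add: shear_nth)
  have e: "Gam v x $ i - Gam sig x $ i = Edif v x $ i" for x i by (simp add: Edif_def)
  have ab: "pt (-1) (-1) $ 1 < pt 1 1 $ 1" "pt (-1) (-1) $ 2 < pt 1 1 $ 2" by auto
  note g = trace_green[OF ab admissible_shear(1)[OF v] admissible_shear(1)[OF sig_admissible] pq, unfolded s, folded Gam_def, unfolded e]
  have i: "set_integrable lebesgue Qi (\<lambda>x. (v x - sig x) * (p (x$1) * q (x$2)))" "set_integrable lebesgue Qi (\<lambda>x. Edif v x $ i * (p (x$1) * q (x$2)))"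
    if "smooth p" "smooth q" for p q i
    by (intro set_integrable_mult_continuous_L2 L2_dif v L2_on_nth L2_Edif smooth_proj_continuous that; simp)+
  show "(LINT x:Qi|lebesgue. (v x - sig x) * (deriv p (x$1) * q (x$2))) = - (LINT x:Qi|lebesgue. Edif v x $ 1 * (p (x$1) * q (x$2)))"
    using g(1) unfolding set_integral_add(2)[OF i(1)[OF smooth_deriv[OF pq(1)] pq(2)] i(2)[OF pq]] by simp
  show "(LINT x:Qi|lebesgue. (v x - sig x) * (p (x$1) * deriv q (x$2))) = - (LINT x:Qi|lebesgue. Edif v x $ 2 * (p (x$1) * q (x$2)))"
    using g(2) unfolding set_integral_add(2)[OF i(1)[OF pq(1) smooth_deriv[OF pq(2)]] i(2)[OF pq]] by simp
qed

lemma set_integral_subset_eq: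
  fixes f :: "real^2 \<Rightarrow> real"
  assumes "U \<subseteq> V" "\<And>x. x \<in> V \<Longrightarrow> x \<notin> U \<Longrightarrow> f x = 0"
  shows "(LINT x:V|lebesgue. f x) = (LINT x:U|lebesgue. f x)"
proof -
  have e: "indicator V x *\<^sub>R f x = indicator U x *\<^sub>R f x" for x
    using assms by (cases "x \<in> U"; cases "x \<in> V") auto
  show ?thesis unfolding set_lebesgue_integral_def e ..
qed

text \<open>A function with zero boundary values whose x2 derivative vanishes on a strip must vanish
  there. In weak form: an antiderivative in x2 of a test function is still allowed in Green's
  identity, although it need not vanish at the top and bottom. Applied with c = 1/2 on the strip and
  with c = -1 for uniqueness of the minimizer.\<close>

lemma dif_zero:
  assumes v: "v \<in> admissible" and c: "-1 \<le> c" "c < 1"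
    and E2: "AE x in lebesgue. x \<in> Qi \<and> x$1 > c \<longrightarrow> Edif v x $ 2 = 0"
  shows "AE x in lebesgue. x \<in> box (pt c (-1)) (pt 1 1) \<longrightarrow> v x - sig x = 0"
    and "AE x in lebesgue. x \<in> box (pt c (-1)) (pt 1 1) \<longrightarrow> Edif v x $ 1 = 0"
proof -
  let ?R = "box (pt c (-1)) (pt 1 1)"
  have RQ: "?R \<subseteq> Qi" using c by (auto simp: mem_box2)
  have iQ: "set_integrable lebesgue C f" if "L2_on Qi f" "compact C" "C \<subseteq> ?R" for C and f :: "real^2 \<Rightarrow> real"
    by (rule set_integrable_subset[OF L2_on_integrable[OF _ that(1)]]) (use that(2,3) RQ in \<open>auto intro: fmeasurableD lmeasurable_compact\<close>)
  have zero: "tensor p q x = 0" if "test_function ?R (tensor p q)" "x \<notin> ?R" for p q x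
    using that unfolding test_function_def by blast
  show d: "AE x in lebesgue. x \<in> ?R \<longrightarrow> v x - sig x = 0"
  proof (rule fundamental_lemma[OF iQ[OF L2_dif[OF v]] open_box])
    fix p q assume pq: "smooth p" "smooth q" and t: "test_function ?R (tensor p q)"
    obtain q' where q': "smooth q'" "deriv q' = q" using smooth_antiderivative[OF pq(2)] by blast
    show "(LINT x:?R|lebesgue. (v x - sig x) * tensor p q x) = 0"
    proof (cases "\<exists>y. q y \<noteq> 0")
      case False
      then show ?thesis by (simp add: tensor_def set_lebesgue_integral_def)
    next
      case True
      then obtain y where y: "q y \<noteq> 0" by blast
      \<comment> \<open>The product vanishes off the strip and \<open>q\<close> is nonzero at
        \<open>y\<close>, so \<open>p\<close> itself vanishes there; this keeps the test in the
        strip after \<open>q\<close> is replaced by its antiderivative.\<close>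
      have p0: "p s = 0" if "s \<le> c" for s
        using zero[OF t, of "pt s y"] y that by (auto simp: tensor_def mem_box2)
      have "(LINT x:?R|lebesgue. (v x - sig x) * tensor p q x) = (LINT x:Qi|lebesgue. (v x - sig x) * tensor p q x)"
        by (rule set_integral_subset_eq[symmetric, OF RQ]) (simp add: zero[OF t])
      also have "\<dots> = - (LINT x:Qi|lebesgue. Edif v x $ 2 * (p (x$1) * q' (x$2)))"
        using Edif_green(2)[OF v pq(1) q'(1)] by (simp add: q'(2) tensor_def)
      also have "(LINT x:Qi|lebesgue. Edif v x $ 2 * (p (x$1) * q' (x$2))) = (LINT x:Qi|lebesgue. 0)"
      proof (rule set_integral_AE_cong(1))
        show "set_integrable lebesgue Qi (\<lambda>x. Edif v x $ 2 * (p (x$1) * q' (x$2)))"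
          by (intro set_integrable_mult_continuous_L2 L2_on_nth L2_Edif v smooth_proj_continuous pq q') simp
        show "AE x in lebesgue. x \<in> Qi \<longrightarrow> Edif v x $ 2 * (p (x$1) * q' (x$2)) = 0"
          using E2
        proof eventually_elim
          case (elim x)
          then show ?case using p0[of "x$1"] by (cases "x$1 > c") auto
        qed
      qed
      finally show ?thesis by simp
    qed
  qed
  show "AE x in lebesgue. x \<in> ?R \<longrightarrow> Edif v x $ 1 = 0"
  proof (rule fundamental_lemma[OF iQ[OF L2_on_nth[OF _ L2_Edif[OF v]]] open_box])
    fix p q assume pq: "smooth p" "smooth q" and t: "test_function ?R (tensor p q)"
    obtain C where C: "C \<subseteq> ?R" "\<And>x i. x \<notin> C \<Longrightarrow> partial i (tensor p q) x = 0"
      using test_function_support[OF t] by metis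
    have z: "deriv p (x$1) * q (x$2) = 0" if "x \<notin> ?R" for x
      using C(2)[of x 1] C(1) that partial_tensor(1)[OF pq] by (auto simp: tensor_def)
    have "(LINT x:?R|lebesgue. Edif v x $ 1 * tensor p q x) = (LINT x:Qi|lebesgue. Edif v x $ 1 * tensor p q x)"
      by (rule set_integral_subset_eq[symmetric, OF RQ]) (simp add: zero[OF t])
    also have "\<dots> = - (LINT x:Qi|lebesgue. (v x - sig x) * (deriv p (x$1) * q (x$2)))"
      using Edif_green(1)[OF v pq] by (simp add: tensor_def)
    also have "(LINT x:Qi|lebesgue. (v x - sig x) * (deriv p (x$1) * q (x$2))) = (LINT x:Qi|lebesgue. 0)"
    proof (rule set_integral_AE_cong(1))
      show "set_integrable lebesgue Qi (\<lambda>x. (v x - sig x) * (deriv p (x$1) * q (x$2)))"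
        by (intro set_integrable_mult_continuous_L2 L2_dif v smooth_proj_continuous smooth_deriv pq)
      show "AE x in lebesgue. x \<in> Qi \<longrightarrow> (v x - sig x) * (deriv p (x$1) * q (x$2)) = 0"
        using d
      proof eventually_elim
        case (elim x)
        then show ?case using z[of x] by (cases "x \<in> ?R") auto
      qed
    qed
    finally show "(LINT x:?R|lebesgue. Edif v x $ 1 * tensor p q x) = 0" by simp
  qed simp_all
qed

text \<open>On the strip the constraint is active: since the boundary values of \<open>v\<close> and \<open>sig\<close> agree,
  \<open>Edif v $ 2\<close> integrates to zero against functions of \<open>x$1\<close>, while on the strip it equals
  the nonnegative determinant of \<open>v\<close>.\<close>

lemma Edif_strip:
  assumes v: "v \<in> admissible"
  shows "AE x in lebesgue. x \<in> Qi \<and> x$1 > 1/2 \<longrightarrow> Edif v x $ 2 = 0"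
proof -
  \<comment> \<open>A smooth weight that is positive exactly for x1 > 1/2, to be paired with the
    constant 1 in x2, whose derivative is 0.\<close>
  define p where "p s = flat_exp 0 (1 * s + - 1/2)" for s
  have p: "smooth p" unfolding p_def using smooth_affine[OF smooth_flat_exp, of 0 1 "-1/2"] by simp
  have p0: "p s = 0" if "s \<le> 1/2" for s using that by (simp add: p_def flat_exp_def)
  have p1: "p s > 0" if "s > 1/2" for s using that by (simp add: p_def flat_exp_def)
  have d: "deriv (\<lambda>x. 1::real) = (\<lambda>x. 0)" by (rule ext) simp
  have z: "(LINT x:Qi|lebesgue. Edif v x $ 2 * (p (x$1) * 1)) = 0"
    using Edif_green(2)[OF v p smooth_const[of 1]] by (simp add: d)
  have i: "integrable lebesgue (\<lambda>x. indicator Qi x *\<^sub>R (Edif v x $ 2 * (p (x$1) * 1)))"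
    using set_integrable_mult_continuous_L2[OF L2_on_nth[OF _ L2_Edif[OF v]] smooth_proj_continuous[OF p smooth_const[of 1]]]
    unfolding set_integrable_def by simp
  have nn: "AE x in lebesgue. 0 \<le> indicator Qi x *\<^sub>R (Edif v x $ 2 * (p (x$1) * 1))"
    using admissible_shear(4)[OF v] Gam_sig
  proof eventually_elim
    case (elim x)
    show ?case
    proof (cases "x \<in> Qi \<and> x$1 > 1/2")
      case True
      then have "Edif v x $ 2 \<ge> 0" using elim by (auto simp: Edif_def siggrad_def Omega_iff)
      then show ?thesis using p1[of "x$1"] True by simp
    next
      case False
      then show ?thesis using p0[of "x$1"] by (auto simp: indicator_def)
    qed
  qed
  have "AE x in lebesgue. indicator Qi x *\<^sub>R (Edif v x $ 2 * (p (x$1) * 1)) = 0"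
    using integral_nonneg_eq_0_iff_AE[OF i nn] z unfolding set_lebesgue_integral_def by simp
  then show ?thesis
  proof eventually_elim
    case (elim x)
    then show ?case using p1[of "x$1"] by auto
  qed
qed

lemma Edif_zero_P:
  assumes v: "v \<in> admissible"
  shows "AE x in lebesgue. x \<in> Qi \<and> x \<notin> Omega \<longrightarrow> Edif v x = 0"
proof -
  have a: "AE x in lebesgue. x \<in> box (pt (1/2) (-1)) (pt 1 1) \<longrightarrow> Edif v x $ 1 = 0"
    by (rule dif_zero(2)[OF v _ _ Edif_strip[OF v]]) auto
  have b: "AE x in lebesgue. (x::real^2) $ 1 \<notin> {1/2}" by (rule AE_line) simp
  show ?thesis using a b Edif_strip[OF v]
  proof eventually_elim
    case (elim x)
    then show ?case by (auto simp: Omega_iff mem_box2 vec_eq_iff forall_2)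
  qed
qed

text \<open>Integrability is part of the notion, because a non-integrable function has integral 0 by
  default and sums of orthogonal fields could then not be controlled.\<close>

definition orth :: "(real^2 \<Rightarrow> real) \<Rightarrow> (real^2 \<Rightarrow> real^2) \<Rightarrow> bool" where
  "orth v w \<longleftrightarrow> set_integrable lebesgue Omega (\<lambda>x. Edif v x \<bullet> w x) \<and> (LINT x:Omega|lebesgue. Edif v x \<bullet> w x) = 0"

lemma orth_lincomb:
  assumes "orth v w" "orth v u"
  shows "orth v (\<lambda>x. w x + c *\<^sub>R u x)"
proof -
  have i: "set_integrable lebesgue Omega (\<lambda>x. Edif v x \<bullet> w x)" "set_integrable lebesgue Omega (\<lambda>x. c * (Edif v x \<bullet> u x))"
    using assms by (auto simp: orth_def)
  have e: "Edif v x \<bullet> (w x + c *\<^sub>R u x) = Edif v x \<bullet> w x + c * (Edif v x \<bullet> u x)" for x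
    by (simp add: inner_add_right)
  show ?thesis unfolding orth_def e set_integral_add(2)[OF i]
    using set_integral_add(1)[OF i] assms by (simp add: orth_def)
qed

lemma integral_Edif_Omega:
  assumes v: "v \<in> admissible" and i: "set_integrable lebesgue Qi (\<lambda>x. Edif v x \<bullet> w x)"
  shows "set_integrable lebesgue Omega (\<lambda>x. Edif v x \<bullet> w x)"
    and "(LINT x:Omega|lebesgue. Edif v x \<bullet> w x) = (LINT x:Qi|lebesgue. Edif v x \<bullet> w x)"
proof -
  have "Omega \<in> sets lebesgue" using open_Omega by auto
  then show s: "set_integrable lebesgue Omega (\<lambda>x. Edif v x \<bullet> w x)"
    by (rule set_integrable_subset[OF i]) (rule Omega_sub_Qi)
  show "(LINT x:Omega|lebesgue. Edif v x \<bullet> w x) = (LINT x:Qi|lebesgue. Edif v x \<bullet> w x)"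
    unfolding set_lebesgue_integral_def
  proof (rule integral_cong_AE)
    show "AE x in lebesgue. indicator Omega x *\<^sub>R (Edif v x \<bullet> w x) = indicator Qi x *\<^sub>R (Edif v x \<bullet> w x)"
      using Edif_zero_P[OF v]
    proof eventually_elim
      case (elim x)
      then show ?case using Omega_sub_Qi by (cases "x \<in> Omega"; cases "x \<in> Qi") auto
    qed
  qed (use i s in \<open>simp_all add: set_integrable_def\<close>)
qed

text \<open>Green's identity is applied on the whole square, where the trace of \<open>v\<close> is
  prescribed, and not on \<open>Omega\<close>, where its values on the segment are not. This is
  possible because the separated harmonic function is smooth on the whole plane and
  \<open>Edif\<close> vanishes almost everywhere off \<open>Omega\<close>.\<close>

lemma mode_orth:
  assumes v: "v \<in> admissible" and pq: "smooth p" "smooth q"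
    and h: "\<And>s t. deriv (deriv p) s * q t + p s * deriv (deriv q) t = 0"
  shows "orth v (\<lambda>x. pt (deriv p (x$1) * q (x$2)) (p (x$1) * deriv q (x$2)))"
proof -
  note pq' = smooth_deriv[OF pq(1)] smooth_deriv[OF pq(2)]
  have i: "set_integrable lebesgue Qi (\<lambda>x. (v x - sig x) * (p (x$1) * q (x$2)))" "set_integrable lebesgue Qi (\<lambda>x. Edif v x $ i * (p (x$1) * q (x$2)))"
    if "smooth p" "smooth q" for p q i
    by (intro set_integrable_mult_continuous_L2 L2_dif v L2_on_nth L2_Edif smooth_proj_continuous that; simp)+
  have e: "Edif v x \<bullet> pt a b = Edif v x $ 1 * a + Edif v x $ 2 * b" for x a b by (simp add: inner_vec_def sum_2)
  note I = i(2)[OF pq'(1) pq(2), of 1] i(2)[OF pq(1) pq'(2), of 2]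
  have s: "set_integrable lebesgue Qi (\<lambda>x. Edif v x \<bullet> pt (deriv p (x$1) * q (x$2)) (p (x$1) * deriv q (x$2)))"
    unfolding e by (rule set_integral_add(1)[OF I])
  have "(LINT x:Qi|lebesgue. Edif v x \<bullet> pt (deriv p (x$1) * q (x$2)) (p (x$1) * deriv q (x$2)))
    = - ((LINT x:Qi|lebesgue. (v x - sig x) * (deriv (deriv p) (x$1) * q (x$2))) + (LINT x:Qi|lebesgue. (v x - sig x) * (p (x$1) * deriv (deriv q) (x$2))))"
    unfolding e set_integral_add(2)[OF I] using Edif_green(1)[OF v pq'(1) pq(2)] Edif_green(2)[OF v pq(1) pq'(2)] by simp
  also have "\<dots> = - (LINT x:Qi|lebesgue. (v x - sig x) * (deriv (deriv p) (x$1) * q (x$2)) + (v x - sig x) * (p (x$1) * deriv (deriv q) (x$2)))"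
    by (subst set_integral_add(2)[OF i(1) i(1)]) (intro pq pq' smooth_deriv refl)+
  also have "\<dots> = 0"
    unfolding distrib_left[symmetric] h by simp
  finally show ?thesis unfolding orth_def using integral_Edif_Omega[OF v s] by simp
qed

text \<open>The field is a combination of gradients of separated harmonic functions: x2, then (x1 +
  1) x2, and sin (mu (x1 + 1)) sinh (mu x2) for each further term.\<close>

lemma orth_SgradN:
  assumes v: "v \<in> admissible"
  shows "orth v (\<lambda>x. pt 0 1 + SgradN N x)"
proof (induction N)
  case 0
  have d: "deriv (\<lambda>x. c::real) = (\<lambda>x. 0)" "deriv (\<lambda>x::real. x + c) = (\<lambda>x. 1)" "deriv (\<lambda>x::real. x) = (\<lambda>x. 1)" for c
    by (rule ext, rule DERIV_imp_deriv, auto intro!: derivative_eq_intros)+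
  have 1: "orth v (\<lambda>x. pt (0 * x$2) (1 * 1))"
    using mode_orth[OF v smooth_const[of 1] smooth_id] by (simp add: d)
  have 2: "orth v (\<lambda>x. pt (1 * x$2) ((x$1 + 1) * 1))"
    using mode_orth[OF v smooth_add[OF smooth_id smooth_const[of 1]] smooth_id] by (simp add: d)
  have "(\<lambda>x. pt 0 1 + SgradN 0 x) = (\<lambda>x. pt (0 * x$2) (1 * 1) + (-2/3) *\<^sub>R pt (1 * x$2) ((x$1 + 1) * 1))"
    by (simp add: fun_eq_iff vec_eq_iff forall_2 SgradN_def Let_def)
  then show ?case using orth_lincomb[OF 1 2, of "-2/3"] by simp
next
  case (Suc N)
  let ?m = "mu N"
  define p where "p s = sin (?m * s + ?m)" for s
  define q where "q s = sinh (?m * s + 0)" for s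
  have pq: "smooth p" "smooth q" unfolding p_def[abs_def] q_def[abs_def] by (rule smooth_sin smooth_sinh)+
  have d: "deriv p = (\<lambda>s. ?m * cos (?m * s + ?m))" "deriv q = (\<lambda>s. ?m * cosh (?m * s))"
    unfolding p_def q_def by (rule ext, rule DERIV_imp_deriv, auto intro!: derivative_eq_intros)+
  have dd: "deriv (deriv p) = (\<lambda>s. - ?m\<^sup>2 * p s)" "deriv (deriv q) = (\<lambda>s. ?m\<^sup>2 * q s)"
    unfolding d by (rule ext, rule DERIV_imp_deriv, auto intro!: derivative_eq_intros simp: p_def q_def power2_eq_square)+
  have o: "orth v (\<lambda>x. pt (deriv p (x$1) * q (x$2)) (p (x$1) * deriv q (x$2)))"
    by (rule mode_orth[OF v pq]) (simp add: dd)
  have mz: "?m \<noteq> 0" by (simp add: mu_def kap_def)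
  \<comment> \<open>The coefficient of \<open>Tterm\<close>. The factor 1 / mu in the combination
    below compensates the derivative of the mode.\<close>
  define c where "c = sin ?m / (real (Suc N) * sinh ?m)"
  have T: "Tterm N (cx x) = Complex (c * (sin (?m * (x$1 + 1)) * cosh (?m * x$2))) (c * (cos (?m * (x$1 + 1)) * sinh (?m * x$2)))" for x
  proof -
    have "of_real ?m * (cx x + 1) = Complex (?m * (x$1 + 1)) (?m * x$2)" by (simp add: complex_eq_iff)
    then show ?thesis unfolding Tterm_def c_def[symmetric]
      by (simp add: complex_eq_iff Re_sin Im_sin cosh_field_def sinh_field_def exp_minus)
  qed
  have "(\<lambda>x. pt 0 1 + SgradN (Suc N) x) = (\<lambda>x. (pt 0 1 + SgradN N x) + (4 / pi * c / ?m) *\<^sub>R pt (deriv p (x$1) * q (x$2)) (p (x$1) * deriv q (x$2)))"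
    using mz by (simp add: fun_eq_iff vec_eq_iff forall_2 SgradN_def Let_def T d p_def q_def algebra_simps)
  then show ?case using orth_lincomb[OF Suc o, of "4 / pi * c / ?m"] by simp
qed


lemma SgradN_tendsto:
  assumes "x \<in> Omega"
  shows "(\<lambda>N. SgradN N x) \<longlonglongrightarrow> Sgrad x"
proof -
  have "(\<lambda>n. Tterm n (cx x)) sums Tfun (cx x)"
    unfolding Tfun_def by (rule summable_sums[OF summable_Tterm[OF Omega_strip[OF assms]]])
  then have T: "(\<lambda>N. \<Sum>n<N. Tterm n (cx x)) \<longlonglongrightarrow> Tfun (cx x)" unfolding sums_def .
  let ?f = "\<lambda>T. pt (Re (\<i> * (2 / 3 * (cx x + 1) - 4 / of_real pi * T))) (- Im (\<i> * (2 / 3 * (cx x + 1) - 4 / of_real pi * T)))"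
  have "continuous_on UNIV ?f" by (intro continuous_intros)
  then have "(\<lambda>N. ?f (\<Sum>n<N. Tterm n (cx x))) \<longlonglongrightarrow> ?f (Tfun (cx x))"
    by (rule continuous_on_tendsto_compose[OF _ T]) auto
  then show ?thesis unfolding SgradN_def Sgrad_def Hder_def Let_def .
qed

text \<open>Passes to the limit in the partial sums. The dominating function is |Edif|^2 + h^2,
  where \<open>h\<close> collects the constant field and the bound with exponent -1/4, which is
  uniform in the number of terms.\<close>

lemma Sgrad_orth:
  assumes v: "v \<in> admissible"
  shows "(LINT x:Omega|lebesgue. Edif v x \<bullet> (pt 0 1 + Sgrad x)) = 0"
proof -
  obtain C where C: "\<And>x. x \<in> Omega \<Longrightarrow> norm (Sgrad x) \<le> C * (1 - \<bar>x$2\<bar>) powr (-1/4)"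
    "\<And>x N. x \<in> Omega \<Longrightarrow> norm (SgradN N x) \<le> C * (1 - \<bar>x$2\<bar>) powr (-1/4)"
    using Sgrad_bound by metis
  have OM: "Omega \<in> lmeasurable" unfolding Omega_eq by simp
  then have OS: "Omega \<in> sets lebesgue" by (rule fmeasurableD)
  have E: "L2_on Omega (Edif v)"
  proof -
    note Q = L2_Edif[OF v, unfolded L2_on_iff[OF fmeasurableD[OF lmeasurable_box]]]
    have e: "indicator Omega x *\<^sub>R (indicator Qi x *\<^sub>R Edif v x) = indicator Omega x *\<^sub>R Edif v x" for x
      using Omega_sub_Qi by (auto simp: indicator_def)
    have "(\<lambda>x. indicator Omega x *\<^sub>R (indicator Qi x *\<^sub>R Edif v x)) \<in> borel_measurable lebesgue"
      by (rule borel_measurable_scaleR[OF borel_measurable_indicator[OF OS] conjunct1[OF Q]])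
    moreover have "set_integrable lebesgue Omega (\<lambda>x. (norm (Edif v x))\<^sup>2)"
      by (rule set_integrable_subset[OF _ OS Omega_sub_Qi]) (use Q in \<open>simp add: set_integrable_def\<close>)
    ultimately show ?thesis unfolding L2_on_iff[OF OS] set_integrable_def e by blast
  qed
  define h where "h x = 1 *\<^sub>R (1::real) + C *\<^sub>R ((1 - \<bar>x$2\<bar>) powr (-1/4))" for x :: "real^2"
  have h: "L2_on Omega h"
    unfolding h_def[abs_def]
  proof (rule L2_on_lincomb[OF OS])
    show "L2_on Omega (\<lambda>x. 1::real)" by (rule L2_on_bounded[OF OM, of _ 1]) (use OS in auto)
    show "L2_on Omega (\<lambda>x. (1 - \<bar>x$2\<bar>) powr (-1/4))"
    proof (rule L2_from_quarter_bound[of _ 1])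
      show "continuous_on Omega (\<lambda>x. (1 - \<bar>x$2\<bar>) powr (-1/4))"
        by (intro continuous_intros) (auto simp: Omega_iff)
    qed simp
  qed
  let ?s = "\<lambda>N x. indicator Omega x *\<^sub>R (Edif v x \<bullet> (pt 0 1 + SgradN N x))"
  let ?w = "\<lambda>x. indicator Omega x *\<^sub>R (norm (Edif v x))\<^sup>2 + indicator Omega x *\<^sub>R (norm (h x))\<^sup>2"
  have o: "integrable lebesgue (?s N)" "integral\<^sup>L lebesgue (?s N) = 0" for N
    using orth_SgradN[OF v, of N] unfolding orth_def set_integrable_def set_lebesgue_integral_def by auto
  have S: "L2_on Omega (\<lambda>x. 1 *\<^sub>R pt 0 1 + 1 *\<^sub>R Sgrad x)"
    by (intro L2_on_lincomb OS Sgrad_L2) (rule L2_on_bounded[OF OM, of _ "norm (pt 0 1)"]; use OS in auto)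
  have "(\<lambda>N. integral\<^sup>L lebesgue (?s N)) \<longlonglongrightarrow> integral\<^sup>L lebesgue (\<lambda>x. indicator Omega x *\<^sub>R (Edif v x \<bullet> (pt 0 1 + Sgrad x)))"
  proof (rule integral_dominated_convergence[where w = ?w])
    show "(\<lambda>x. indicator Omega x *\<^sub>R (Edif v x \<bullet> (pt 0 1 + Sgrad x))) \<in> borel_measurable lebesgue"
      using L2_on_integrable_product[OF OS E S] unfolding set_integrable_def by simp
    show "integrable lebesgue ?w"
      using E[unfolded L2_on_iff[OF OS]] h[unfolded L2_on_iff[OF OS]] by (intro Bochner_Integration.integrable_add) auto
    show "?s N \<in> borel_measurable lebesgue" for N using o(1) by simp
    show "AE x in lebesgue. (\<lambda>N. ?s N x) \<longlonglongrightarrow> indicator Omega x *\<^sub>R (Edif v x \<bullet> (pt 0 1 + Sgrad x))"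
    proof (rule AE_I2)
      fix x
      show "(\<lambda>N. ?s N x) \<longlonglongrightarrow> indicator Omega x *\<^sub>R (Edif v x \<bullet> (pt 0 1 + Sgrad x))"
      proof (cases "x \<in> Omega")
        case True
        then show ?thesis by (intro tendsto_intros SgradN_tendsto)
      qed simp
    qed
    show "AE x in lebesgue. norm (?s N x) \<le> ?w x" for N
    proof (rule AE_I2)
      fix x
      show "norm (?s N x) \<le> ?w x"
      proof (cases "x \<in> Omega")
        case True
        have "norm (pt 0 1 + SgradN N x) \<le> norm (pt 0 1) + norm (SgradN N x)" by (rule norm_triangle_ineq)
        also have "\<dots> \<le> h x" using C(2)[OF True, of N] by (simp add: h_def norm_pt)
        finally have b: "norm (pt 0 1 + SgradN N x) \<le> norm (h x)" by simp
        have "\<bar>Edif v x \<bullet> (pt 0 1 + SgradN N x)\<bar> \<le> norm (Edif v x) * norm (h x)"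
          by (rule order_trans[OF Cauchy_Schwarz_ineq2]) (intro mult_left_mono b; simp)
        also have "\<dots> \<le> (norm (Edif v x))\<^sup>2 + (norm (h x))\<^sup>2"
          using zero_le_power2[of "norm (Edif v x) - norm (h x)"] zero_le_power2[of "norm (Edif v x)"] zero_le_power2[of "norm (h x)"]
          unfolding power2_diff by linarith
        finally show ?thesis using True by simp
      qed simp
    qed
  qed
  then show ?thesis unfolding o(2) set_lebesgue_integral_def by (simp add: LIMSEQ_const_iff)
qed

lemma energy_split:
  assumes v: "v \<in> admissible"
  shows "energy v = energy sig + (LINT x:Qi|lebesgue. Edif v x \<bullet> Edif v x)"
proof -
  let ?s = "Gam sig" and ?E = "Edif v"
  note L = L2_Gam[OF sig_admissible] L2_Edif[OF v]
  have Q: "Qi \<in> sets lebesgue" by simp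
  note i = L2_on_integrable_product[OF Q L(1) L(1)] L2_on_integrable_product[OF Q L(2) L(1)] L2_on_integrable_product[OF Q L(2) L(2)]
  have z: "(LINT x:Qi|lebesgue. ?E x \<bullet> ?s x) = 0"
  proof -
    have "(LINT x:Qi|lebesgue. ?E x \<bullet> ?s x) = (LINT x:Omega|lebesgue. ?E x \<bullet> ?s x)"
      by (rule integral_Edif_Omega(2)[OF v i(2), symmetric])
    also have "\<dots> = (LINT x:Omega|lebesgue. ?E x \<bullet> (pt 0 1 + Sgrad x))"
    proof (rule set_integral_AE_cong(1)[OF integral_Edif_Omega(1)[OF v i(2)]])
      show "AE x in lebesgue. x \<in> Omega \<longrightarrow> ?E x \<bullet> ?s x = ?E x \<bullet> (pt 0 1 + Sgrad x)"
        using Gam_sig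
      proof eventually_elim
        case (elim x)
        then show ?case using Omega_sub_Qi by (auto simp: siggrad_def)
      qed
    qed
    also have "\<dots> = 0" by (rule Sgrad_orth[OF v])
    finally show ?thesis .
  qed
  have e: "Gam v x \<bullet> Gam v x = ?s x \<bullet> ?s x + (2 * (?E x \<bullet> ?s x) + ?E x \<bullet> ?E x)" for x
    by (simp add: Edif_def inner_diff_left inner_diff_right inner_commute)
  have i2: "set_integrable lebesgue Qi (\<lambda>x. 2 * (?E x \<bullet> ?s x))" using i(2) by simp
  have "(LINT x:Qi|lebesgue. Gam v x \<bullet> Gam v x) = (LINT x:Qi|lebesgue. ?s x \<bullet> ?s x) + (LINT x:Qi|lebesgue. ?E x \<bullet> ?E x)"
    unfolding e set_integral_add(2)[OF i(1) set_integral_add(1)[OF i2 i(3)]] set_integral_add(2)[OF i2 i(3)]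
    using z by simp
  then show ?thesis using energy_eq[OF admissible_shear(2)[OF v]] energy_eq[OF admissible_shear(2)[OF sig_admissible]] by simp
qed

lemma Edif_square_nonneg: "(LINT x:Qi|lebesgue. Edif v x \<bullet> Edif v x) \<ge> 0"
  unfolding set_lebesgue_integral_def by (intro Bochner_Integration.integral_nonneg) auto

lemma sig_minimizer: "global_minimizer sig"
  unfolding global_minimizer_def
proof (intro conjI ballI sig_admissible)
  show "energy sig \<le> energy v" if "v \<in> admissible" for v
    using energy_split[OF that] Edif_square_nonneg[of v] by linarith
qed

lemma minimizer_unique:
  assumes "global_minimizer v"
  shows "AE x in lebesgue. x \<in> square_Q \<longrightarrow> v x = sig x"
proof -
  have v: "v \<in> admissible" and le: "energy v \<le> energy sig"
    using assms sig_admissible unfolding global_minimizer_def by auto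
  have Q: "Qi \<in> sets lebesgue" by simp
  have i: "integrable lebesgue (\<lambda>x. indicator Qi x *\<^sub>R (Edif v x \<bullet> Edif v x))"
    using L2_on_integrable_product[OF Q L2_Edif[OF v] L2_Edif[OF v]] unfolding set_integrable_def .
  have z: "(LINT x:Qi|lebesgue. Edif v x \<bullet> Edif v x) = 0"
    using energy_split[OF v] le Edif_square_nonneg[of v] by linarith
  have "AE x in lebesgue. indicator Qi x *\<^sub>R (Edif v x \<bullet> Edif v x) = 0"
    using integral_nonneg_eq_0_iff_AE[OF i] z unfolding set_lebesgue_integral_def by simp
  then have E2: "AE x in lebesgue. x \<in> Qi \<and> x$1 > -1 \<longrightarrow> Edif v x $ 2 = 0"
  proof eventually_elim
    case (elim x)
    then show ?case by auto
  qed
  \<comment> \<open>With c = -1 the strip of \<open>dif_zero\<close> is the whole open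
    square.\<close>
  have "AE x in lebesgue. x \<in> Qi \<longrightarrow> v x - sig x = 0" by (rule dif_zero(1)[OF v _ _ E2]) auto
  moreover have "AE x in lebesgue. x \<notin> cbox (pt (-1) (-1)) (pt 1 1) - Qi"
    using AE_frontier_box[of "pt (-1) (-1)" "pt 1 1"] by (rule AE_completion)
  ultimately show ?thesis
  proof eventually_elim
    case (elim x)
    then show ?case unfolding square_Q_def by auto
  qed
qed

subsection \<open>The normal derivative along the segment\<close>

lemma Re_Hder_nonzero_on_K: "\<exists>y. \<bar>y\<bar> < 1 \<and> Re (Hder (Complex (1/2) y)) \<noteq> 0"
proof (rule ccontr)
  assume "\<not> ?thesis"
  then have R: "Re (Hder (Complex (1/2) y)) = 0" if "\<bar>y\<bar> < 1" for y using that by blast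
  let ?S = "{z::complex. \<bar>Im z\<bar> < 1}" and ?U = "{z::complex. \<bar>Im z\<bar> < 1 \<and> Re z = 1/2}"
  have H: "Hder z - \<i> = 0" if z: "z \<in> ?U" for z
  proof -
    obtain y where y: "z = Complex (1/2) y" "\<bar>y\<bar> < 1" using z by (metis (mono_tags, lifting) complex_surj mem_Collect_eq)
    \<comment> \<open>On the line Re z = 1/2 each term is purely imaginary, as sin (3/2 mu) = 0;
      this gives Im H' = 1 there.\<close>
    have "Re (Tterm n z) = 0" for n
    proof -
      have "of_real (mu n) * (z + 1) = Complex (mu n * (3/2)) (mu n * y)" by (simp add: complex_eq_iff y)
      then show ?thesis unfolding Tterm_def using sin_nat_kap[of n] by (simp add: Re_sin del: times_divide_eq_right)
    qed
    moreover have "(\<lambda>n. Re (Tterm n z)) sums Re (Tfun z)"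
      unfolding Tfun_def by (intro sums_Re summable_sums summable_Tterm) (use z in auto)
    ultimately have "Re (Tfun z) = 0" using sums_unique2[OF _ sums_zero, of "Re (Tfun z)"] by simp
    then have "Im (Hder z) = 1" by (simp add: Hder_def y(1))
    then show ?thesis using R[OF y(2)] by (simp add: complex_eq_iff y(1))
  qed
  have lim: "of_real (1/2) islimpt ?U"
    unfolding islimpt_approachable
  proof (intro allI impI)
    fix e :: real assume e: "e > 0"
    show "\<exists>x'\<in>?U. x' \<noteq> of_real (1/2) \<and> dist x' (of_real (1/2)) < e"
    proof (rule bexI[of _ "Complex (1/2) (min (e/2) (1/2))"])
      have "Complex (1/2) (min (e/2) (1/2)) - of_real (1/2) = \<i> * of_real (min (e/2) (1/2))" by (simp add: complex_eq_iff)
      then have "dist (Complex (1/2) (min (e/2) (1/2))) (of_real (1/2)) = \<bar>min (e/2) (1/2)\<bar>"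
        by (simp only: dist_norm norm_mult norm_ii norm_of_real mult_1)
      then show "Complex (1/2) (min (e/2) (1/2)) \<noteq> of_real (1/2) \<and> dist (Complex (1/2) (min (e/2) (1/2))) (of_real (1/2)) < e"
        using e by (auto simp: complex_eq_iff min_def)
    qed (use e in auto)
  qed
  have "Hder 0 - \<i> = 0"
    by (rule analytic_continuation[of "\<lambda>z. Hder z - \<i>" ?S ?U "of_real (1/2)", OF _ open_strip convex_connected[OF convex_strip] _ _ lim H])
       (auto intro!: holomorphic_intros Hder_holomorphic)
  \<comment> \<open>The origin lies in \<open>Omega\<close>, and H' = i there would make the
    determinant 0.\<close>
  then have "Sgrad (pt 0 0) $ 2 = -1" by (simp add: Sgrad_def Complex_eq)
  then show False using det_positive[of "pt 0 0"] by (simp add: Omega_iff)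
qed

lemma has_trace_cong:
  assumes f: "has_trace U B f g" and U: "open U" and eq: "\<And>x. x \<in> U \<Longrightarrow> f x = f' x"
  shows "has_trace U B f' g"
proof -
  have wg: "has_weak_gradient U f = has_weak_gradient U f'"
  proof (rule ext, rule iffI)
    show "has_weak_gradient U f' G" if "has_weak_gradient U f G" for G
      by (rule has_weak_gradient_cong[OF that]) (simp_all add: eq)
    show "has_weak_gradient U f G" if "has_weak_gradient U f' G" for G
      by (rule has_weak_gradient_cong[OF that]) (simp_all add: eq)
  qed
  then have wge: "weak_gradient U f = weak_gradient U f'" unfolding weak_gradient_def by simp
  have "L2_on U f \<Longrightarrow> L2_on U f'" using L2_on_AE_cong[of U f f'] U eq by auto
  then have "f \<in> W12 U \<Longrightarrow> f' \<in> W12 U" by (simp add: W12_def wg)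
  moreover have "L2_tendsto U F f \<longleftrightarrow> L2_tendsto U F f'" for F
    unfolding L2_tendsto_def
    by (rule arg_cong[of _ _ "\<lambda>s. s \<longlonglongrightarrow> 0"], rule ext, rule nn_integral_cong) (simp add: eq)
  ultimately show ?thesis using f unfolding has_trace_def W12_tendsto_def wge by simp
qed

lemma partial_sig: "x \<in> Omega \<Longrightarrow> partial 1 sig x = Re (Hder (cx x))"
  using partial_has_derivative[OF sig_has_derivative[of x], of 1] Omega_sub_Qi
  by (auto simp: siggrad_def Sgrad_def Omega_iff mem_box2)

lemma Re_holomorphic_weak_gradient:
  assumes W: "open W" "H holomorphic_on W" and U: "open U" "cx ` U \<subseteq> W"
  shows "has_weak_gradient U (\<lambda>x. Re (H (cx x))) (\<lambda>x. pt (Re (deriv H (cx x))) (- Im (deriv H (cx x))))"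
    and "S \<subseteq> cx -` W \<Longrightarrow> continuous_on S (\<lambda>x. pt (Re (deriv H (cx x))) (- Im (deriv H (cx x))))"
    and "S \<subseteq> cx -` W \<Longrightarrow> continuous_on S (\<lambda>x. Re (H (cx x)))"
proof -
  have c0: "continuous_on S (\<lambda>x. k (cx x))" if "S \<subseteq> cx -` W" "k holomorphic_on W" for S k
    by (rule continuous_on_compose2[OF holomorphic_on_imp_continuous_on[OF that(2)] continuous_on_cx]) (use that(1) in auto)
  note cH = c0[OF _ W(2)] c0[OF _ holomorphic_deriv[OF W(2,1)]]
  show c: "continuous_on S (\<lambda>x. pt (Re (deriv H (cx x))) (- Im (deriv H (cx x))))" if "S \<subseteq> cx -` W" for S
    by (intro continuous_intros cH that)
  show c': "continuous_on S (\<lambda>x. Re (H (cx x)))" if "S \<subseteq> cx -` W" for S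
    by (intro continuous_intros cH that)
  have sub: "U \<subseteq> cx -` W" using U by blast
  show "has_weak_gradient U (\<lambda>x. Re (H (cx x))) (\<lambda>x. pt (Re (deriv H (cx x))) (- Im (deriv H (cx x))))"
  proof (rule classical_weak_gradient[OF U(1), of "{}"])
    show "continuous_on U (\<lambda>x. Re (H (cx x)))" by (rule c'[OF sub])
    show "continuous_on (U \<inter> {x. x$1 \<notin> {}}) (\<lambda>x. pt (Re (deriv H (cx x))) (- Im (deriv H (cx x))))" using c[OF sub] by simp
    show "set_integrable lebesgue C (\<lambda>x. pt (Re (deriv H (cx x))) (- Im (deriv H (cx x))))" if "compact C" "C \<subseteq> U" for C
      by (rule continuous_compact_integrable[OF c[OF sub] that])
    fix x assume "x \<in> U"
    then have "(H has_field_derivative deriv H (cx x)) (at (cx x))"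
      using holomorphic_derivI[OF W(2,1)] U by blast
    then show "((\<lambda>x. Re (H (cx x))) has_derivative (\<lambda>h. pt (Re (deriv H (cx x))) (- Im (deriv H (cx x))) \<bullet> h)) (at x)"
      by (rule Re_holomorphic_has_derivative)
  qed simp
qed

text \<open>The left edge 1/4 keeps the closed box away from the kinks at (0, 1) and (0, -1). On the
  box the derivative is the real part of a function that is holomorphic beyond the closed box, so
  its own boundary values form the trace.\<close>

lemma trace_exists: "\<exists>h. trace_d1_on_K sig h"
proof -
  obtain W G where W: "open W" "{z. 1/4 \<le> Re z \<and> Re z \<le> 1/2 \<and> \<bar>Im z\<bar> \<le> 1} \<subseteq> W" "G holomorphic_on W"
    and G: "\<And>z. z \<in> W \<Longrightarrow> \<bar>Im z\<bar> < 1 \<Longrightarrow> G z = Tfun z"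
    using Tfun_extension by blast
  define H where "H z = \<i> * (2 / 3 * (z + 1) - 4 / of_real pi * G z)" for z
  have H: "H holomorphic_on W" unfolding H_def[abs_def] by (intro holomorphic_intros W(3)) auto
  let ?U = "box (pt (1/4) (-1)) (pt (1/2) 1)" and ?C = "cbox (pt (1/4) (-1)) (pt (1/2) 1)"
  have C: "?C \<subseteq> cx -` W"
  proof
    fix x assume "x \<in> ?C"
    then have "cx x \<in> {z. 1/4 \<le> Re z \<and> Re z \<le> 1/2 \<and> \<bar>Im z\<bar> \<le> 1}" by (auto simp: mem_box2)
    then show "x \<in> cx -` W" using W(2) by blast
  qed
  then have U: "cx ` ?U \<subseteq> W" using box_subset_cbox by blast
  have cl: "closure ?U = ?C" by (rule closure_box2) auto
  note h = Re_holomorphic_weak_gradient[OF W(1) H open_box U]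
  let ?f = "\<lambda>x. Re (H (cx x))"
  have "has_trace ?U {(pt (1/2) (-1), pt (1/2) 1)} ?f ?f"
  proof (rule has_trace_continuous)
    show "?f \<in> W12 ?U"
      by (rule W12_intro[OF L2_on_continuous_closure[OF h(3)[OF C]] h(1) L2_on_continuous_closure[OF h(2)[OF C]]])
    show "continuous_on (closure ?U) ?f" unfolding cl by (rule h(3)[OF C])
    show "closed_segment P R \<subseteq> closure ?U" if "(P, R) \<in> {(pt (1/2) (-1), pt (1/2) 1)}" for P R
      unfolding cl by (rule closed_segment_subset) (use that in \<open>auto simp: mem_box2 convex_box\<close>)
  qed simp
  then have "has_trace ?U {(pt (1/2) (-1), pt (1/2) 1)} (partial 1 sig) ?f"
  proof (rule has_trace_cong[OF _ open_box])
    fix x assume x: "x \<in> ?U"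
    then have o: "x \<in> Omega" by (auto simp: Omega_iff mem_box2)
    have "G (cx x) = Tfun (cx x)" using x U by (intro G) (auto simp: mem_box2)
    then show "?f x = partial 1 sig x" unfolding partial_sig[OF o] H_def Hder_def by simp
  qed
  then show ?thesis unfolding trace_d1_on_K_def by (intro exI[of _ ?f] exI[of _ "1/4"]) auto
qed

text \<open>Each covering set is replaced by an interval around the height of one of its points. The
  heights in the set differ from it by at most the diameter d, which gives length 2 d, and the
  parametrisation of a segment of length 2 halves this to d.\<close>

lemma hausdorff1_null_negligible:
  assumes "hausdorff1 {y \<in> seg_K. h y \<noteq> 0} = 0"
  shows "negligible {t \<in> {0..1}. h (linepath (pt (1/2) (-1)) (pt (1/2) 1) t) \<noteq> 0}"
  unfolding negligible_outer
proof (intro allI impI)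
  let ?A = "{y \<in> seg_K. h y \<noteq> 0}" and ?l = "linepath (pt (1/2) (-1)) (pt (1/2) 1)"
  fix e :: real assume e: "e > 0"
  \<comment> \<open>Any single scale would serve, as the Hausdorff measure is a supremum over scales
    and is assumed to be 0.\<close>
  let ?CC = "{C :: nat \<Rightarrow> (real^2) set. ?A \<subseteq> (\<Union>n. C n) \<and> (\<forall>n. bounded (C n) \<and> diameter (C n) \<le> 1)}"
  have "(INF C\<in>?CC. (\<Sum>n. ennreal (diameter (C n)))) \<le> hausdorff1 ?A"
    unfolding hausdorff1_def by (rule SUP_upper) simp
  then have "(INF C\<in>?CC. (\<Sum>n. ennreal (diameter (C n)))) < ennreal e"
    unfolding assms using e by (simp add: le_zero_eq)
  then obtain C where C: "?A \<subseteq> (\<Union>n. C n)" "\<And>n. bounded (C n)" and s: "(\<Sum>n. ennreal (diameter (C n))) < ennreal e"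
    unfolding INF_less_iff by blast
  define d where "d n = diameter (C n)" for n
  have d0: "d n \<ge> 0" for n unfolding d_def by (rule diameter_ge_0[OF C(2)])
  \<comment> \<open>For an empty covering set the chosen point is arbitrary, which merely adds one
    point to the union of the intervals.\<close>
  define y where "y n = (SOME z. z \<in> C n) $ 2" for n
  define I where "I n = {(y n + 1 - d n) / 2 .. (y n + 1 + d n) / 2}" for n
  have em: "emeasure lebesgue (I n) = ennreal (d n)" for n unfolding I_def using d0[of n] by (simp add: field_simps)
  have "emeasure lebesgue (\<Union>n. I n) \<le> (\<Sum>n. emeasure lebesgue (I n))"
    by (rule emeasure_subadditive_countably) (auto simp: I_def)
  also have "\<dots> < ennreal e" using s unfolding em d_def .
  finally have lt: "emeasure lebesgue (\<Union>n. I n) < ennreal e" .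
  have lm: "(\<Union>n. I n) \<in> lmeasurable"
    by (rule fmeasurableI) (use lt in \<open>auto simp: I_def intro: order_less_trans\<close>)
  have "measure lebesgue (\<Union>n. I n) < e"
    using lt unfolding emeasure_eq_measure2[OF lm] by (simp add: ennreal_less_iff)
  moreover have "{t \<in> {0..1}. h (?l t) \<noteq> 0} \<subseteq> (\<Union>n. I n)"
  proof
    fix t assume t: "t \<in> {t \<in> {0..1}. h (?l t) \<noteq> 0}"
    have l: "?l t = pt (1/2) (-1 + 2 * t)" by (simp add: linepath_pt)
    have "h (?l t) \<noteq> 0" "t \<in> {0..1}" using t by auto
    then have "?l t \<in> ?A" unfolding l by (auto simp: seg_K_def square_Q_def mem_box2)
    then obtain n where n: "?l t \<in> C n" using C(1) by blast
    define z where "z = (SOME z. z \<in> C n)"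
    have z: "z \<in> C n" unfolding z_def using n by (rule someI)
    have "\<bar>(?l t - z) $ 2\<bar> \<le> norm (?l t - z)" by (rule component_le_norm_cart)
    also have "\<dots> \<le> d n" using diameter_bounded_bound[OF C(2) n z] by (simp add: d_def dist_norm)
    finally have "\<bar>-1 + 2 * t - y n\<bar> \<le> d n" by (simp add: l y_def z_def)
    then have "t \<in> I n" by (auto simp: I_def abs_le_iff)
    then show "t \<in> (\<Union>n. I n)" by blast
  qed
  ultimately show "\<exists>T. {t \<in> {0..1}. h (?l t) \<noteq> 0} \<subseteq> T \<and> T \<in> lmeasurable \<and> measure lebesgue T < e" using lm by blast
qed

text \<open>One volume integral is evaluated twice, with a factor \<open>p\<close> that is 1 on the
  segment and 0 at the left edge. Through the approximating sequence it is a limit of line integrals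
  that tends to the one for \<open>h\<close>, which is 0. As \<open>q\<close> vanishes outside (c,
  d), Green's formula for the holomorphic derivative on a smaller box gives the claimed
  integral.\<close>

lemma null_trace_integral:
  assumes tr: "trace_d1_on_K sig h" and h0: "hausdorff1 {y \<in> seg_K. h y \<noteq> 0} = 0"
    and cd: "-1 < c" "c < d" "d < 1" and q: "smooth q" "\<And>y. y \<le> c \<or> y \<ge> d \<Longrightarrow> q y = 0"
  shows "(\<integral>y. indicator {c..d} y * (q y * Re (Hder (Complex (1/2) y))) \<partial>lborel) = 0"
proof -
  obtain a where a: "-1 \<le> a" "a < 1/2" and T: "has_trace (box (pt a (-1)) (pt (1/2) 1)) {(pt (1/2) (-1), pt (1/2) 1)} (partial 1 sig) h"
    using tr unfolding trace_d1_on_K_def by blast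
  let ?U = "box (pt a (-1)) (pt (1/2) 1)" and ?f = "partial 1 sig"
  let ?l = "linepath (pt (1/2) (-1)) (pt (1/2) 1)"
  have cl: "closure ?U = cbox (pt a (-1)) (pt (1/2) 1)" by (rule closure_box2) (use a in auto)
  have sub: "?U \<subseteq> Omega" using a by (auto simp: Omega_iff mem_box2)
  obtain F where F: "\<And>n. F n \<in> W12 ?U" "\<And>n. continuous_on (cbox (pt a (-1)) (pt (1/2) 1)) (F n)" "W12_tendsto ?U F ?f"
    and Fh: "\<And>P R. (P, R) \<in> {(pt (1/2) (-1), pt (1/2) 1)} \<Longrightarrow> (\<lambda>n. \<integral>\<^sup>+t. ennreal ((F n (linepath P R t) - h (linepath P R t))\<^sup>2) \<partial>lebesgue_on {0..1}) \<longlonglongrightarrow> 0"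
    by (rule has_traceE[OF T, unfolded cl]) (rule that; assumption)
  have fW: "?f \<in> W12 ?U" using T unfolding has_trace_def by (rule conjunct1)
  have sn: "seg_null F (pt (1/2) (-1)) (pt (1/2) 1)"
  proof -
    have "AE t in lebesgue. t \<notin> {t \<in> {0..1}. h (?l t) \<noteq> 0}"
      by (rule AE_not_in) (rule hausdorff1_null_negligible[OF h0, unfolded negligible_iff_null_sets])
    then have ae: "AE t in lebesgue_on {0..1}. h (?l t) = 0"
      by (subst AE_restrict_space_iff) (auto elim!: eventually_mono)
    have "(\<integral>\<^sup>+t. ennreal ((F n (?l t) - h (?l t))\<^sup>2) \<partial>lebesgue_on {0..1}) = (\<integral>\<^sup>+t. ennreal ((F n (?l t))\<^sup>2) \<partial>lebesgue_on {0..1})" for n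
      by (rule nn_integral_cong_AE) (use ae in eventually_elim, simp)
    then show ?thesis unfolding seg_null_def using Fh by simp
  qed
  define b where "b = max a (1/4)"
  have b: "a \<le> b" "1/4 \<le> b" "b < 1/2" using a by (auto simp: b_def)
  \<comment> \<open>Scaled so that the argument of \<open>step\<close> runs from 0 at
    \<open>b\<close> to 2 at 1/2, where \<open>step\<close> has reached the value 1.\<close>
  define k where "k = 2 / (1/2 - b)"
  have k: "k > 0" "k * (1/2 - b) = 2"
    using b nonzero_eq_divide_eq[of "1/2 - b" k 2] by (simp_all add: k_def)
  define p where "p s = step (k * s + - (k * b))" for s
  have p: "smooth p" unfolding p_def[abs_def] by (rule smooth_affine[OF smooth_step])
  have arg: "k * s + - (k * b) \<le> 1" if "s \<le> b" for s
    using mult_left_mono[OF that less_imp_le[OF k(1)]] by linarith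
  have p0: "p s = 0" if "s \<le> b" for s using step_0[OF arg[OF that]] by (simp add: p_def)
  have dp0: "deriv p s = 0" if "s \<le> b" for s
  proof -
    have "(p has_real_derivative deriv step (k * s + - (k * b)) * k) (at s)"
      unfolding p_def[abs_def] by (auto intro!: derivative_eq_intros DERIV_chain2[OF smooth_DERIV[OF smooth_step]])
    then show ?thesis using deriv_step_0[of "k * s + - (k * b)"] arg[OF that] by (simp add: DERIV_imp_deriv)
  qed
  have p1: "p (1/2) = 1" unfolding p_def using k by (intro step_1) (simp add: algebra_simps)
  let ?V = "\<lambda>x::real^2. p (x$1) * q (x$2)" and ?W = "\<lambda>x::real^2. deriv p (x$1) * q (x$2)"
  let ?T = "\<lambda>f. LINT x:?U|lebesgue. f x * ?W x + weak_gradient ?U f x $ 1 * ?V x"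
  have cVW: "continuous_on A ?V" "continuous_on A ?W" for A
    by (intro smooth_proj_continuous smooth_deriv p q)+
  have "(\<lambda>n. ?T (F n)) \<longlonglongrightarrow> ?T ?f"
    by (intro W12_tendsto_green_limit F fW cVW)
  moreover have "?T (F n) = (\<integral>y. indicator {-1..1} y * (q y * F n (pt (1/2) y)) \<partial>lborel)" for n
    using green_1[OF _ _ W12_weak_gradient(2)[OF open_box F(1)] L2_on_integrable[OF _ W12_weak_gradient(3)[OF open_box F(1)]] F(2) p q(1)] a
    by (simp add: p1 p0[OF b(1)])
  moreover have "(\<lambda>n. \<integral>y. indicator {-1..1} y * (q y * F n (pt (1/2) y)) \<partial>lborel) \<longlonglongrightarrow> 0"
    using side_null_1[OF F(2) _ _ smooth_continuous[OF q(1)], of "1/2"] a sn by simp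
  ultimately have T0: "?T ?f = 0" using LIMSEQ_unique by simp
  have Im: "cx ` ?U \<subseteq> {z. \<bar>Im z\<bar> < 1}" by (auto simp: mem_box2)
  note hd = Re_holomorphic_weak_gradient[OF open_strip Hder_holomorphic open_box Im]
  let ?g = "\<lambda>x. Re (Hder (cx x))" and ?D = "\<lambda>x. pt (Re (deriv Hder (cx x))) (- Im (deriv Hder (cx x)))"
  have wf: "has_weak_gradient ?U ?f ?D"
    by (rule has_weak_gradient_cong[OF hd(1)]) (use sub partial_sig in auto)
  let ?U' = "box (pt b c) (pt (1/2) d)" and ?C' = "cbox (pt b c) (pt (1/2) d)"
  have C': "?C' \<subseteq> cx -` {z. \<bar>Im z\<bar> < 1}" using cd by (auto simp: mem_box2)
  have U': "?U' \<subseteq> ?U" using b cd by (auto simp: mem_box2)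
  have Im': "cx ` ?U' \<subseteq> {z. \<bar>Im z\<bar> < 1}" using U' Im by blast
  have "?T ?f = (LINT x:?U|lebesgue. ?g x * ?W x + ?D x $ 1 * ?V x)"
  proof (rule set_integral_AE_cong(1))
    have L: "L2_on ?U ?f" "L2_on ?U (\<lambda>x. weak_gradient ?U ?f x $ 1)"
      using W12_weak_gradient[OF open_box fW] by (auto intro: L2_on_nth)
    show "set_integrable lebesgue ?U (\<lambda>x. ?f x * ?W x + weak_gradient ?U ?f x $ 1 * ?V x)"
      by (intro set_integral_add set_integrable_mult_continuous_L2 L cVW)
    show "AE x in lebesgue. x \<in> ?U \<longrightarrow> ?f x * ?W x + weak_gradient ?U ?f x $ 1 * ?V x = ?g x * ?W x + ?D x $ 1 * ?V x"
      using weak_gradient_AE_eq[OF open_box wf]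
    proof eventually_elim
      case (elim x)
      show ?case
      proof
        assume x: "x \<in> ?U"
        then have "x \<in> Omega" using sub by blast
        then show "?f x * ?W x + weak_gradient ?U ?f x $ 1 * ?V x = ?g x * ?W x + ?D x $ 1 * ?V x"
          using elim x partial_sig by simp
      qed
    qed
  qed
  also have "\<dots> = (LINT x:?U'|lebesgue. ?g x * ?W x + ?D x $ 1 * ?V x)"
  proof (rule set_integral_subset_eq[OF U'])
    fix x assume "x \<in> ?U" "x \<notin> ?U'"
    then consider "x$1 \<le> b" | "x$2 \<le> c \<or> x$2 \<ge> d" by (auto simp: mem_box2 not_less)
    then show "?g x * ?W x + ?D x $ 1 * ?V x = 0"
      by cases (simp_all add: p0 dp0 q(2))
  qed
  also have "\<dots> = (\<integral>y. indicator {c..d} y * (q y * Re (Hder (Complex (1/2) y))) \<partial>lborel)"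
    using green_1[OF _ _ Re_holomorphic_weak_gradient(1)[OF open_strip Hder_holomorphic open_box Im']
      set_integrable_continuous_box[OF hd(2)[OF C']] hd(3)[OF C'] p q(1)] b cd
    by (simp add: p1 p0)
  finally show ?thesis using T0 by simp
qed

text \<open>By continuity Re H' keeps its sign on an interval around a point where it is nonzero;
  the cut-off of that interval, taken as \<open>q\<close>, contradicts the vanishing integral of
  \<open>null_trace_integral\<close>.\<close>

lemma trace_not_null:
  assumes tr: "trace_d1_on_K sig h"
  shows "hausdorff1 {y \<in> seg_K. h y \<noteq> 0} \<noteq> 0"
proof
  assume h0: "hausdorff1 {y \<in> seg_K. h y \<noteq> 0} = 0"
  define f where "f y = Re (Hder (Complex (1/2) y))" for y
  obtain y0 where y0: "\<bar>y0\<bar> < 1" "f y0 \<noteq> 0" using Re_Hder_nonzero_on_K unfolding f_def by blast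
  have cf: "continuous_on {-1<..<1} f"
    unfolding f_def
    by (intro continuous_on_Re continuous_on_compose2[OF holomorphic_on_imp_continuous_on[OF Hder_holomorphic]])
       (auto simp: Complex_eq intro!: continuous_intros)
  define s where "s = sgn (f y0)"
  have "continuous_on {-1<..<1} (\<lambda>y. s * f y)" by (intro continuous_intros cf)
  then have "open ({-1<..<1} \<inter> (\<lambda>y. s * f y) -` {0<..})" by (rule continuous_open_preimage) auto
  moreover have "y0 \<in> {-1<..<1} \<inter> (\<lambda>y. s * f y) -` {0<..}" using y0 by (auto simp: s_def abs_sgn[symmetric] mult.commute[of "sgn _"])
  ultimately obtain e where e: "e > 0" "cball y0 e \<subseteq> {-1<..<1} \<inter> (\<lambda>y. s * f y) -` {0<..}"
    using open_contains_cball by meson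
  define c d where "c = y0 - e" and "d = y0 + e"
  have cb: "cball y0 e = {c..d}" by (auto simp: c_def d_def dist_real_def abs_le_iff)
  have pos: "s * f y > 0" "-1 < y" "y < 1" if "y \<in> {c..d}" for y using e(2) that unfolding cb by auto
  have cd: "-1 < c" "c < y0" "y0 < d" "d < 1" using e(1) pos(2)[of c] pos(3)[of d] by (auto simp: c_def d_def)
  have "eventually (\<lambda>k. 4 \<le> real k * (d - c) \<and> (cutoff c d k y0 = 1 \<and> deriv (cutoff c d k) y0 = 0)) sequentially"
    by (intro eventually_conj eventually_ge_mult cutoff_eventually) (use cd in auto)
  then obtain k where k: "4 \<le> real k * (d - c)" "cutoff c d k y0 = 1"
    using eventually_happens'[OF sequentially_bot] by blast
  let ?q = "cutoff c d k"
  have kp: "1 / real k > 0" using k(1) by (cases k) auto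
  have q0: "?q y = 0" if "y \<le> c \<or> y \<ge> d" for y
    using cutoff_0[OF k(1), of y] that kp by linarith
  have z: "(\<integral>y. indicator {c..d} y * (?q y * f y) \<partial>lborel) = 0"
    using null_trace_integral[OF tr h0 _ _ _ smooth_cutoff q0] cd unfolding f_def by simp
  have cg: "continuous_on {c..d} (\<lambda>y. ?q y * (s * f y))"
    by (intro continuous_intros smooth_continuous smooth_cutoff continuous_on_subset[OF cf]) (use pos in auto)
  have "((\<lambda>y. ?q y * (s * f y)) has_integral (LINT y:{c..d}|lborel. ?q y * (s * f y))) {c..d}"
    using set_borel_integral_eq_integral[OF borel_integrable_atLeastAtMost'[OF cg]] by (simp add: has_integral_integrable_integral)
  moreover have "(LINT y:{c..d}|lborel. ?q y * (s * f y)) = s * (\<integral>y. indicator {c..d} y * (?q y * f y) \<partial>lborel)"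
    unfolding set_lebesgue_integral_def by (simp add: mult_ac flip: integral_mult_right_zero)
  ultimately have hi: "((\<lambda>y. ?q y * (s * f y)) has_integral 0) (cbox c d)" using z by simp
  have "?q y0 * (s * f y0) = 0"
  proof (rule has_integral_0_cbox_imp_0[OF _ _ hi])
    show "continuous_on (cbox c d) (\<lambda>y. ?q y * (s * f y))" using cg by simp
    show "0 \<le> ?q y * (s * f y)" if "y \<in> box c d" for y
      by (intro mult_nonneg_nonneg cutoff_bounds k less_imp_le pos) (use that in auto)
  qed (use cd in auto)
  then have "s * f y0 = 0" unfolding k(2) by (simp only: mult_1)
  moreover have "s * f y0 > 0" by (rule pos(1)) (use cd in auto)
  ultimately show False by linarith
qed

text \<open>A C1 representative agrees with \<open>sig\<close> on the open square, so approaching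
  the segment from the right makes its gradient (0, -1) there. Approach from the left gives the
  gradient of \<open>Sigma0\<close>, hence Re H' = 0 along the segment.\<close>

lemma sig_not_C1:
  assumes v: "C1_closed square_Q v" and ae: "AE x in lebesgue. x \<in> square_Q \<longrightarrow> v x = sig x"
  shows False
proof -
  obtain G where cG: "continuous_on square_Q G" and G: "\<And>x. x \<in> square_Q \<Longrightarrow> (v has_derivative (\<lambda>h. G x \<bullet> h)) (at x within square_Q)"
    using v unfolding C1_closed_def by blast
  have QQ: "Qi \<subseteq> square_Q" unfolding square_Q_def by (rule box_subset_cbox)
  have cv: "continuous_on square_Q v" by (rule has_derivative_continuous_on[OF G])
  have ae0: "AE x in lebesgue. x \<in> Qi \<longrightarrow> v x - sig x = 0"
    using ae by eventually_elim (use QQ in auto)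
  have cd: "continuous_on Qi (\<lambda>x. v x - sig x)"
    by (intro continuous_on_diff continuous_on_subset[OF cv QQ] continuous_on_subset[OF continuous_sig] box_subset_cbox)
  have eq: "sig x = v x" if "x \<in> Qi" for x
    using continuous_AE_zero[OF open_box cd ae0 that] by simp
  have Gs: "G x = siggrad x" if x: "x \<in> Qi" "x$1 \<noteq> 1/2" for x
  proof -
    have "at x within square_Q = at x" using x(1) interior_Q by (intro at_within_interior) simp
    then have 1: "(v has_derivative (\<lambda>h. G x \<bullet> h)) (at x)" using G[of x] x QQ by auto
    have 2: "(v has_derivative (\<lambda>h. siggrad x \<bullet> h)) (at x)"
      by (rule has_derivative_transform_within_open[OF sig_has_derivative[OF x] open_box x(1)]) (rule eq)
    have "(\<lambda>h. G x \<bullet> h) = (\<lambda>h. siggrad x \<bullet> h)" by (rule has_derivative_unique[OF 1 2])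
    then show ?thesis by (metis vector_eq_rdot)
  qed
  have "Re (Hder (Complex (1/2) y)) = 0" if y: "\<bar>y\<bar> < 1" for y
  proof -
    \<comment> \<open>The values 1 and -1 of \<open>r\<close> are the two sides of approach; the
      offset in n + 3 keeps the points inside the square.\<close>
    have lim: "(\<lambda>n. G (pt (1/2 + r * inverse (real (n + 3))) y)) \<longlonglongrightarrow> G (pt (1/2) y)" if r: "\<bar>r\<bar> = 1" for r
    proof (rule continuous_on_tendsto_compose[OF cG])
      have "(\<lambda>n. inverse (real (n + 3))) \<longlonglongrightarrow> 0" by (rule LIMSEQ_ignore_initial_segment[OF lim_inverse_n])
      then have t: "(\<lambda>n. 1/2 + r * inverse (real (n + 3))) \<longlonglongrightarrow> 1/2 + r * 0" by (intro tendsto_intros)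
      have "continuous_on UNIV (\<lambda>s. pt s y)" by (intro continuous_intros)
      from continuous_on_tendsto_compose[OF this t] show "(\<lambda>n. pt (1/2 + r * inverse (real (n + 3))) y) \<longlonglongrightarrow> pt (1/2) y" by simp
      show "pt (1/2) y \<in> square_Q" using y by (auto simp: square_Q_def mem_box2)
      have "\<bar>r * inverse (real (n + 3))\<bar> \<le> 1/3" for n
      proof -
        have "inverse (real (n + 3)) \<le> inverse 3" by (rule le_imp_inverse_le) auto
        then show ?thesis using r by (simp add: abs_mult)
      qed
      then have "\<bar>r * inverse (real (n + 3))\<bar> < 1/2" for n by (rule order_le_less_trans) simp
      then have "pt (1/2 + r * inverse (real (n + 3))) y \<in> square_Q" for n
        using y by (simp add: square_Q_def mem_box2 abs_less_iff) (smt (verit) field_sum_of_halves)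
      then show "eventually (\<lambda>n. pt (1/2 + r * inverse (real (n + 3))) y \<in> square_Q) sequentially" by simp
    qed
    have r3: "0 < inverse (real (n + 3))" "inverse (real (n + 3)) \<le> 1/3" for n
      using le_imp_inverse_le[of 3 "real (n + 3)"] by auto
    have "G (pt (1/2 + 1 * s) y) = pt 0 (-1)" if "0 < s" "s \<le> 1/3" for s
      using that y by (subst Gs) (auto simp: mem_box2 siggrad_def Omega_iff)
    from this[OF r3] have "G (pt (1/2 + 1 * inverse (real (n + 3))) y) = pt 0 (-1)" for n .
    then have "(\<lambda>n. pt 0 (-1)) \<longlonglongrightarrow> G (pt (1/2) y)" using lim[of 1] by (simp del: of_nat_add)
    then have g1: "G (pt (1/2) y) = pt 0 (-1)" by (simp add: LIMSEQ_const_iff)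
    let ?x = "\<lambda>n. pt (1/2 + (-1) * inverse (real (n + 3))) y"
    have "G (pt (1/2 + (-1) * s) y) = Sgrad (pt (1/2 + (-1) * s) y)" if "0 < s" "s \<le> 1/3" for s
      using that y by (subst Gs) (auto simp: mem_box2 siggrad_def Omega_iff)
    from this[OF r3] have "G (?x n) = Sgrad (?x n)" for n .
    then have l1: "(\<lambda>n. Sgrad (?x n)) \<longlonglongrightarrow> G (pt (1/2) y)" using lim[of "-1"] by (simp del: of_nat_add)
    have l2: "(\<lambda>n. Sgrad (?x n)) \<longlonglongrightarrow> Sgrad (pt (1/2) y)"
    proof (rule continuous_on_tendsto_compose[OF continuous_Sgrad])
      have "(\<lambda>n. inverse (real (n + 3))) \<longlonglongrightarrow> 0" by (rule LIMSEQ_ignore_initial_segment[OF lim_inverse_n])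
      then have t: "(\<lambda>n. 1/2 + (-1) * inverse (real (n + 3))) \<longlonglongrightarrow> 1/2 + (-1) * 0" by (intro tendsto_intros)
      have "continuous_on UNIV (\<lambda>s. pt s y)" by (intro continuous_intros)
      from continuous_on_tendsto_compose[OF this t] show "?x \<longlonglongrightarrow> pt (1/2) y" by simp
    qed (use y in auto)
    have "Sgrad (pt (1/2) y) = pt 0 (-1)" using LIMSEQ_unique[OF l2 l1] g1 by simp
    then have "Sgrad (pt (1/2) y) $ 1 = 0" by simp
    then show ?thesis by (simp add: Sgrad_def)
  qed
  then show False using Re_Hder_nonzero_on_K by blast
qed

lemma det_jacobian_sig:
  assumes x: "x \<in> Omega"
  shows "det (jacobian (shear sig) (at x)) = 1 + Sgrad x $ 2"
proof -
  have "(sig has_derivative (\<lambda>h. Sgrad x \<bullet> h)) (at x)"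
    using sig_has_derivative[of x] x Omega_sub_Qi by (auto simp: siggrad_def Omega_iff mem_box2)
  then have "(shear sig has_derivative (\<lambda>h. h + (Sgrad x \<bullet> h) *\<^sub>R axis 2 1)) (at x)"
    unfolding shear_def[abs_def] by (auto intro!: derivative_eq_intros)
  from frechet_derivative_at[OF this] have "jacobian (shear sig) (at x) = matrix (\<lambda>h. h + (Sgrad x \<bullet> h) *\<^sub>R axis 2 1)"
    by (simp add: jacobian_def)
  then show ?thesis by (simp add: det_2 matrix_def axis_def inner_vec_def sum_2)
qed

theorem proposition14:
  shows "(\<exists>S. harmonic_extension S) \<and>
    (\<forall>S S'. harmonic_extension S \<longrightarrow> harmonic_extension S' \<longrightarrow> (\<forall>x\<in>Omega. S x = S' x)) \<and>
    (\<forall>S \<sigma>. harmonic_extension S \<longrightarrow> \<sigma> = glued S \<longrightarrow>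
       global_minimizer \<sigma> \<and>
       (\<forall>v. global_minimizer v \<longrightarrow> (AE x in lebesgue. x \<in> square_Q \<longrightarrow> v x = \<sigma> x)) \<and>
       (\<forall>x\<in>Omega. det (jacobian (shear \<sigma>) (at x)) > 0) \<and>
       (\<exists>h. trace_d1_on_K \<sigma> h) \<and>
       (\<forall>h. trace_d1_on_K \<sigma> h \<longrightarrow> hausdorff1 {y \<in> seg_K. h y \<noteq> 0} \<noteq> 0) \<and>
       \<not> (\<exists>v. C1_closed square_Q v \<and> (AE x in lebesgue. x \<in> square_Q \<longrightarrow> v x = \<sigma> x)))"
proof (intro conjI allI impI ballI)
  show "\<exists>S. harmonic_extension S" using harmonic_extension_Sigma0 by blast
  show "S x = S' x" if "harmonic_extension S" "harmonic_extension S'" "x \<in> Omega" for S S' x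
    by (rule harmonic_extension_unique[OF that])
  fix S \<sigma> assume S: "harmonic_extension S" and "\<sigma> = glued S"
  moreover have "S x = Sigma0 x" if "x \<in> Omega" for x
    by (rule harmonic_extension_unique[OF S harmonic_extension_Sigma0 that])
  \<comment> \<open>\<open>glued\<close> evaluates \<open>S\<close> only on \<open>Omega\<close>,
    where the extension is unique, so every extension yields the same candidate.\<close>
  then have "glued S = sig" unfolding sig_def by (auto simp: fun_eq_iff glued_def)
  ultimately have \<sigma>: "\<sigma> = sig" by simp
  show "global_minimizer \<sigma>" unfolding \<sigma> by (rule sig_minimizer)
  show "AE x in lebesgue. x \<in> square_Q \<longrightarrow> v x = \<sigma> x" if "global_minimizer v" for v
    unfolding \<sigma> by (rule minimizer_unique[OF that])
  show "det (jacobian (shear \<sigma>) (at x)) > 0" if "x \<in> Omega" for x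
    unfolding \<sigma> det_jacobian_sig[OF that] by (rule det_positive[OF that])
  show "\<exists>h. trace_d1_on_K \<sigma> h" unfolding \<sigma> by (rule trace_exists)
  show "hausdorff1 {y \<in> seg_K. h y \<noteq> 0} \<noteq> 0" if "trace_d1_on_K \<sigma> h" for h
    using that unfolding \<sigma> by (rule trace_not_null)
  show "\<not> (\<exists>v. C1_closed square_Q v \<and> (AE x in lebesgue. x \<in> square_Q \<longrightarrow> v x = \<sigma> x))"
    unfolding \<sigma> using sig_not_C1 by blast
qed

end
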